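(* Let $C$ be a submanifold of a manifold $M$, and consider a tubular neighborhood of $C$ identified with the normal bundle $\nu C$. There is an $L_\infty[1]$-algebra structure on $\chi^{\bullet}_{fp}(\nu C)[2]\oplus\Gamma(\wedge\nu C)[1]$ given by the following multibrackets (all others vanish): $$d(X[1])=PX,\qquad \{X[1],Y[1]\}=(-1)^{|X|}[X,Y][1],\qquad \{X[1],a_1,\dots,a_n\}=P[\dots[X,a_1],\dots,a_n]\ \text{ for all } n\ge1,$$ where $X,Y\in\chi^{\bullet}_{fp}(\nu C)[1]$, $a_1,\dots,a_n\in\Gamma(\wedge\nu C)[1]$, $[\cdot,\cdot]$ is the Schouten bracket on $\chi^\bullet_{fp}(\nu C)[1]$. For all $\tilde\pi\in\chi^2_{fp}(\nu C)$ and $\tilde\Phi\in\Gamma(\nu C)$: $$\Big(\tilde\pi\text{ is a Poisson structure and } \mathrm{graph}(-\tilde\Phi)\text{ is a coisotropic submanifold of }(\nu C,\tilde\pi)\Big)\iff (\tilde\pi[2],\tilde\Phi[1])\text{ is a Maurer-Cartan element of this }L_\infty[1]\text{-algebra}.$$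
   Context: An $L_\infty[1]$-algebra is a $\mathbb{Z}$-graded vector space $W$ with graded symmetric degree $1$ multilinear maps $m_k=\{\cdots\}$, $k\ge1$ ($d:=m_1$), satisfying $\sum_{i+j=n+1,\,i,j\ge1}\sum_{\sigma\in S_{(i,n-i)}}\epsilon(\sigma)m_j(m_i(v_{\sigma(1)},\dots,v_{\sigma(i)}),v_{\sigma(i+1)},\dots,v_{\sigma(n)})=0$ for all $n\ge1$ ($\epsilon$ Koszul sign, $S_{(i,n-i)}$ unshuffles). A Maurer-Cartan element is a degree $0$ element $\alpha$ with $\sum_{n\ge1}\frac1{n!}\{\alpha,\dots,\alpha\}=0$. Notation: $V[n]_i=V_{i+n}$; $v[1]\in V[1]$ is the element corresponding to $v\in V$. "All others vanish" is understood up to permutation of the entries. Setting: $\nu C=TM|_C/TC$ is identified with a neighborhood of $C$ in $M$ via a fixed embedding which, together with its derivative, is the identity on $C$. A vector field on $\nu C$ is fiberwise polynomial if it preserves the fiberwise polynomial functions on the vector bundle $\nu C$. $\chi^\bullet_{fp}(\nu C)$ is the space of multivector fields on the total space $\nu C$ that are sums of products of fiberwise polynomial vector fields (and fiberwise polynomial functions in degree $0$). $\chi^\bullet_{fp}(\nu C)[1]$ is a graded Lie algebra under the Schouten bracket ($[X,\cdot]$ is the Lie derivative for a vector field $X$); a $k$-vector field has degree $|X|=k-1$ there. Elements of $\Gamma(\wedge\nu C)$ are regarded as vertical, fiberwise constant multivector fields on $\nu C$. $P:\chi^\bullet_{fp}(\nu C)[1]\to\Gamma(\wedge\nu C)[1]$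 is restriction to $C$ followed by the projection $\wedge T(\nu C)|_C\to\wedge\nu C$ (along $T(\nu C)|_C=TC\oplus\nu C\to\nu C$). A Poisson structure is a bivector field $\pi$ with $[\pi,\pi]=0$; a submanifold $N$ is coisotropic if $\pi^\sharp(TN^\circ)\subset TN$, where $TN^\circ$ is the annihilator of $TN$ and $\pi^\sharp:T^*\to T$ is contraction with $\pi$. $\mathrm{graph}(-\tilde\Phi)\subset\nu C$ is the image of the section $-\tilde\Phi$. *)

theory Defs
  imports "HOL-Analysis.Analysis" "HOL-Library.Function_Algebras"
begin

section \<open>Preliminaries\<close>

instantiation "fun" :: (type, real_vector) real_vector
begin

definition scaleR_fun :: "real \<Rightarrow> ('a \<Rightarrow> 'b) \<Rightarrow> 'a \<Rightarrow> 'b"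
  where "scaleR_fun c f = (\<lambda>x. c *\<^sub>R f x)"

instance
  by standard (simp_all add: scaleR_fun_def fun_eq_iff scaleR_add_right scaleR_add_left)

end

text \<open>Model spaces of manifolds. Unlike \<open>euclidean_space\<close>, this class does not
  exclude dimension 0, so points and open subsets are allowed as submanifolds.\<close>

class finite_dim_inner = real_inner +
  assumes finite_dim: "\<exists>B. finite B \<and> (\<forall>x. \<exists>c. x = (\<Sum>b\<in>B. c b *\<^sub>R b))"

instance euclidean_space \<subseteq> finite_dim_inner
proof
  show "\<exists>B :: 'a set. finite B \<and> (\<forall>x. \<exists>c. x = (\<Sum>b\<in>B. c b *\<^sub>R b))"
    using euclidean_representation[symmetric] finite_Basis by blast
qed

instance prod :: (finite_dim_inner, finite_dim_inner) finite_dim_inner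
proof
  obtain B1 :: "'a set" where B1: "finite B1" "\<And>x. \<exists>c. x = (\<Sum>b\<in>B1. c b *\<^sub>R b)"
    using finite_dim by blast
  obtain B2 :: "'b set" where B2: "finite B2" "\<And>x. \<exists>c. x = (\<Sum>b\<in>B2. c b *\<^sub>R b)"
    using finite_dim by blast
  define B where "B = (\<lambda>b. (b, 0 :: 'b)) ` B1 \<union> (\<lambda>b. (0 :: 'a, b)) ` (B2 - {0})"
  have "\<exists>c. z = (\<Sum>b\<in>B. c b *\<^sub>R b)" for z
  proof -
    obtain c1 where c1: "fst z = (\<Sum>b\<in>B1. c1 b *\<^sub>R b)" using B1(2) by blast
    obtain c2 where c2: "snd z = (\<Sum>b\<in>B2. c2 b *\<^sub>R b)" using B2(2) by blast
    define c where "c = (\<lambda>b. if snd b = 0 then c1 (fst b) else c2 (snd b))"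
    have "(\<Sum>b\<in>B. c b *\<^sub>R b) =
        (\<Sum>b\<in>B1. c (b, 0) *\<^sub>R (b, 0)) + (\<Sum>b\<in>B2 - {0}. c (0, b) *\<^sub>R (0, b))"
      unfolding B_def using B1(1) B2(1)
      by (subst sum.union_disjoint) (auto simp: sum.reindex inj_on_def)
    also have "\<dots> = (fst z, \<Sum>b\<in>B2 - {0}. c2 b *\<^sub>R b)"
      by (simp add: c_def c1 prod_eq_iff fst_sum snd_sum)
    also have "(\<Sum>b\<in>B2 - {0}. c2 b *\<^sub>R b) = snd z"
      unfolding c2 using B2(1) by (intro sum.mono_neutral_left) auto
    finally show ?thesis by (metis prod.collapse)
  qed
  moreover have "finite B" using B1(1) B2(1) by (simp add: B_def)
  ultimately show "\<exists>B :: ('a \<times> 'b) set. finite B \<and> (\<forall>x. \<exists>c. x = (\<Sum>b\<in>B. c b *\<^sub>R b))"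
    by blast
qed

fun Ck_on :: "nat \<Rightarrow> 'a::real_normed_vector set \<Rightarrow> ('a \<Rightarrow> 'b::real_normed_vector) \<Rightarrow> bool" where
  "Ck_on 0 S f \<longleftrightarrow> continuous_on S f"
| "Ck_on (Suc k) S f \<longleftrightarrow> (\<forall>x\<in>S. f differentiable (at x)) \<and>
     (\<forall>v. Ck_on k S (\<lambda>x. frechet_derivative f (at x) v))"

definition smooth_on :: "'a::real_normed_vector set \<Rightarrow> ('a \<Rightarrow> 'b::real_normed_vector) \<Rightarrow> bool"
  where "smooth_on S f \<longleftrightarrow> (\<forall>k. Ck_on k S f)"


section \<open>Smooth manifolds\<close>

text \<open>A manifold is given by an atlas of charts \<open>(U, \<phi>)\<close>; its underlying set is the
  union of the chart domains. The values of \<open>\<phi>\<close> outside \<open>U\<close> are irrelevant.\<close>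

type_synonym ('a, 'e) atlas = "('a set \<times> ('a \<Rightarrow> 'e)) set"

definition carrier_of :: "('a, 'e) atlas \<Rightarrow> 'a set"
  where "carrier_of A = \<Union> (fst ` A)"

definition compatible :: "'a set \<times> ('a \<Rightarrow> 'e::real_normed_vector) \<Rightarrow> 'a set \<times> ('a \<Rightarrow> 'e) \<Rightarrow> bool"
  where "compatible = (\<lambda>(U, \<phi>) (V, \<theta>).
    open (\<phi> ` (U \<inter> V)) \<and> open (\<theta> ` (U \<inter> V)) \<and>
    smooth_on (\<phi> ` (U \<inter> V)) (\<theta> \<circ> the_inv_into U \<phi>) \<and>
    smooth_on (\<theta> ` (U \<inter> V)) (\<phi> \<circ> the_inv_into V \<theta>))"

definition mopen :: "('a, 'e::real_normed_vector) atlas \<Rightarrow> 'a set \<Rightarrow> bool"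
  where "mopen A W \<longleftrightarrow> W \<subseteq> carrier_of A \<and> (\<forall>(U, \<phi>)\<in>A. open (\<phi> ` (U \<inter> W)))"

definition smooth_manifold :: "('a, 'e::finite_dim_inner) atlas \<Rightarrow> bool"
  where "smooth_manifold A \<longleftrightarrow>
    (\<forall>(U, \<phi>)\<in>A. inj_on \<phi> U \<and> open (\<phi> ` U)) \<and>
    (\<forall>a\<in>A. \<forall>b\<in>A. compatible a b) \<and>
    Hausdorff_space (topology (mopen A)) \<and> second_countable (topology (mopen A))"

definition maximal_atlas :: "('a, 'e::real_normed_vector) atlas \<Rightarrow> ('a, 'e) atlas"
  where "maximal_atlas A = {(U, \<phi>). U \<subseteq> carrier_of A \<and> inj_on \<phi> U \<and> open (\<phi> ` U) \<and>
    (\<forall>b\<in>A. compatible (U, \<phi>) b)}"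

definition restrict_atlas :: "('a, 'e) atlas \<Rightarrow> 'a set \<Rightarrow> ('a, 'e) atlas"
  where "restrict_atlas A W = {(U \<inter> W, \<phi>) | U \<phi>. (U, \<phi>) \<in> A}"

definition smooth_map ::
  "('a, 'd::real_normed_vector) atlas \<Rightarrow> ('b, 'e::real_normed_vector) atlas \<Rightarrow> ('a \<Rightarrow> 'b) \<Rightarrow> bool"
  where "smooth_map A B f \<longleftrightarrow> f ` carrier_of A \<subseteq> carrier_of B \<and>
    (\<forall>(U, \<phi>)\<in>A. \<forall>(V, \<theta>)\<in>B. open (\<phi> ` (U \<inter> f -` V)) \<and>
       smooth_on (\<phi> ` (U \<inter> f -` V)) (\<theta> \<circ> f \<circ> the_inv_into U \<phi>))"

definition smooth_fun :: "('a, 'e::real_normed_vector) atlas \<Rightarrow> ('a \<Rightarrow> real) \<Rightarrow> bool"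
  where "smooth_fun A f \<longleftrightarrow> (\<forall>(U, \<phi>)\<in>A. smooth_on (\<phi> ` U) (f \<circ> the_inv_into U \<phi>))"

text \<open>Functions on the manifold are represented by their extension by 0.\<close>

definition smooth_functions :: "('a, 'e::real_normed_vector) atlas \<Rightarrow> ('a \<Rightarrow> real) set"
  where "smooth_functions A = {f. smooth_fun A f \<and> (\<forall>x. x \<notin> carrier_of A \<longrightarrow> f x = 0)}"

definition smooth_near :: "('a, 'e::real_normed_vector) atlas \<Rightarrow> 'a \<Rightarrow> ('a \<Rightarrow> real) \<Rightarrow> bool"
  where "smooth_near A p f \<longleftrightarrow> (\<exists>W. mopen A W \<and> p \<in> W \<and> smooth_fun (restrict_atlas A W) f)"

text \<open>Tangent vectors are point derivations on functions that are smooth near \<open>p\<close>.\<close>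

definition tangent_space :: "('a, 'e::real_normed_vector) atlas \<Rightarrow> 'a \<Rightarrow> (('a \<Rightarrow> real) \<Rightarrow> real) set"
  where "tangent_space A p = {v.
    (\<forall>f. \<not> smooth_near A p f \<longrightarrow> v f = 0) \<and>
    (\<forall>f g c. smooth_near A p f \<and> smooth_near A p g \<longrightarrow>
       v (f + c *\<^sub>R g) = v f + c * v g \<and>
       v (f * g) = f p * v g + g p * v f)}"

definition cotangent_space ::
  "('a, 'e::real_normed_vector) atlas \<Rightarrow> 'a \<Rightarrow> ((('a \<Rightarrow> real) \<Rightarrow> real) \<Rightarrow> real) set"
  where "cotangent_space A p = {\<alpha>.
    (\<forall>v. v \<notin> tangent_space A p \<longrightarrow> \<alpha> v = 0) \<and>
    (\<forall>v\<in>tangent_space A p. \<forall>w\<in>tangent_space A p. \<forall>c. \<alpha> (v + c *\<^sub>R w) = \<alpha> v + c * \<alpha> w)}"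


section \<open>Embedded submanifolds\<close>

text \<open>The model space is split as \<open>'c \<times> 'f\<close>, where \<open>'c\<close> is the model space of the submanifold.\<close>

definition slice_charts :: "('a, 'c::real_normed_vector \<times> 'f::real_normed_vector) atlas \<Rightarrow> 'a set \<Rightarrow> ('a, 'c \<times> 'f) atlas"
  where "slice_charts A C = {(U, \<phi>) \<in> maximal_atlas A. U \<inter> C = {q \<in> U. snd (\<phi> q) = 0}}"

definition embedded_submanifold :: "('a, 'c::real_normed_vector \<times> 'f::real_normed_vector) atlas \<Rightarrow> 'a set \<Rightarrow> bool"
  where "embedded_submanifold A C \<longleftrightarrow> C \<subseteq> carrier_of (slice_charts A C)"

definition sub_atlas :: "('a, 'c::real_normed_vector \<times> 'f::real_normed_vector) atlas \<Rightarrow> 'a set \<Rightarrow> ('a, 'c) atlas"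
  where "sub_atlas A C = {(U \<inter> C, fst \<circ> \<phi>) | U \<phi>. (U, \<phi>) \<in> slice_charts A C}"

text \<open>\<open>T\<^sub>pC\<close> as a subspace of \<open>T\<^sub>pM\<close>: the image under the differential of the inclusion.\<close>

definition tangent_sub ::
  "('a, 'c::real_normed_vector \<times> 'f::real_normed_vector) atlas \<Rightarrow> 'a set \<Rightarrow> 'a \<Rightarrow> (('a \<Rightarrow> real) \<Rightarrow> real) set"
  where "tangent_sub A C p = {v \<in> tangent_space A p.
    \<exists>u\<in>tangent_space (sub_atlas A C) p. \<forall>f. smooth_near A p f \<longrightarrow> v f = u f}"


section \<open>The normal bundle \<open>TM|\<^sub>C / TC\<close>\<close>

text \<open>A point of the total space is a pair of a base point \<open>p\<close> and a coset of \<open>T\<^sub>pC\<close> in \<open>T\<^sub>pM\<close>.\<close>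

type_synonym 'm coset = "(('m \<Rightarrow> real) \<Rightarrow> real) set"

type_synonym 'm normal = "'m \<times> 'm coset"

definition normal_space :: "('m, 'c::real_normed_vector \<times> 'f::real_normed_vector) atlas \<Rightarrow> 'm set \<Rightarrow> 'm \<Rightarrow> 'm coset set"
  where "normal_space A C p = {{v + u | u. u \<in> tangent_sub A C p} | v. v \<in> tangent_space A p}"

definition normal_zero :: "('m, 'c::real_normed_vector \<times> 'f::real_normed_vector) atlas \<Rightarrow> 'm set \<Rightarrow> 'm \<Rightarrow> 'm coset"
  where "normal_zero A C p = tangent_sub A C p"

definition normal_add :: "'m coset \<Rightarrow> 'm coset \<Rightarrow> 'm coset"
  where "normal_add \<xi> \<eta> = {v + w | v w. v \<in> \<xi> \<and> w \<in> \<eta>}"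

text \<open>The summand \<open>u\<close> makes the result a full coset also for \<open>t = 0\<close>.\<close>

definition normal_scale ::
  "('m, 'c::real_normed_vector \<times> 'f::real_normed_vector) atlas \<Rightarrow> 'm set \<Rightarrow> 'm \<Rightarrow> real \<Rightarrow> 'm coset \<Rightarrow> 'm coset"
  where "normal_scale A C p t \<xi> = {t *\<^sub>R v + u | v u. v \<in> \<xi> \<and> u \<in> tangent_sub A C p}"

definition normal_total :: "('m, 'c::real_normed_vector \<times> 'f::real_normed_vector) atlas \<Rightarrow> 'm set \<Rightarrow> 'm normal set"
  where "normal_total A C = (SIGMA p:C. normal_space A C p)"

text \<open>A slice chart \<open>\<phi> = (x, y)\<close> induces the bundle chart \<open>(p, [v]) \<mapsto> (x p, dy\<^sub>p v)\<close>.
  The vector \<open>dy\<^sub>p v\<close> is characterized by its inner products, since tangent vectors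
  act on real-valued functions only.\<close>

definition normal_chart :: "('m \<Rightarrow> 'c \<times> 'f::real_inner) \<Rightarrow> 'm normal \<Rightarrow> 'c \<times> 'f"
  where "normal_chart \<phi> = (\<lambda>(p, \<xi>).
    (fst (\<phi> p), THE y. \<exists>v\<in>\<xi>. \<forall>w. inner w y = v (\<lambda>q. inner w (snd (\<phi> q)))))"

definition normal_atlas :: "('m, 'c::real_inner \<times> 'f::real_inner) atlas \<Rightarrow> 'm set \<Rightarrow> ('m normal, 'c \<times> 'f) atlas"
  where "normal_atlas A C =
    {((SIGMA p:U \<inter> C. normal_space A C p), normal_chart \<phi>) | U \<phi>. (U, \<phi>) \<in> slice_charts A C}"

text \<open>A diffeomorphism \<open>\<psi>\<close> of the normal bundle onto an open set that is the identity on \<open>C\<close>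
  and whose derivative along \<open>C\<close> in fibre direction induces the identity of the normal
  bundle. (In directions tangent to \<open>C\<close> the derivative is automatically the identity.)\<close>

definition tubular_embedding ::
  "('m, 'c::real_inner \<times> 'f::real_inner) atlas \<Rightarrow> 'm set \<Rightarrow> ('m normal \<Rightarrow> 'm) \<Rightarrow> bool"
  where "tubular_embedding A C \<psi> \<longleftrightarrow>
    inj_on \<psi> (normal_total A C) \<and>
    mopen A (\<psi> ` normal_total A C) \<and>
    smooth_map (normal_atlas A C) A \<psi> \<and>
    smooth_map (restrict_atlas A (\<psi> ` normal_total A C)) (normal_atlas A C)
      (the_inv_into (normal_total A C) \<psi>) \<and>
    (\<forall>p\<in>C. \<psi> (p, normal_zero A C p) = p) \<and>
    (\<forall>p\<in>C. \<forall>\<xi>\<in>normal_space A C p.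
      (\<lambda>f. if smooth_near A p f then deriv (\<lambda>t. f (\<psi> (p, normal_scale A C p t \<xi>))) 0 else 0) \<in> \<xi>)"

definition normal_dual ::
  "('m, 'c::real_normed_vector \<times> 'f::real_normed_vector) atlas \<Rightarrow> 'm set \<Rightarrow> 'm \<Rightarrow> ('m coset \<Rightarrow> real) set"
  where "normal_dual A C p = {l.
    (\<forall>\<eta>. \<eta> \<notin> normal_space A C p \<longrightarrow> l \<eta> = 0) \<and>
    (\<forall>\<eta>\<in>normal_space A C p. \<forall>\<zeta>\<in>normal_space A C p. \<forall>c.
       l (normal_add \<eta> (normal_scale A C p c \<zeta>)) = l \<eta> + c * l \<zeta>)}"

definition normal_section ::
  "('m, 'c::real_inner \<times> 'f::real_inner) atlas \<Rightarrow> 'm set \<Rightarrow> ('m \<Rightarrow> 'm coset) \<Rightarrow> bool"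
  where "normal_section A C s \<longleftrightarrow> (\<forall>p\<in>C. s p \<in> normal_space A C p) \<and>
    smooth_map (sub_atlas A C) (normal_atlas A C) (\<lambda>p. (p, s p))"

definition graph_neg ::
  "('m, 'c::real_normed_vector \<times> 'f::real_normed_vector) atlas \<Rightarrow> 'm set \<Rightarrow> ('m \<Rightarrow> 'm coset) \<Rightarrow> 'm normal set"
  where "graph_neg A C s = (\<lambda>p. (p, normal_scale A C p (-1) (s p))) ` C"


section \<open>Multivector fields\<close>

text \<open>A \<open>k\<close>-vector field is represented as an alternating \<open>k\<close>-derivation of the algebra of
  smooth functions, \<open>(X\<^sub>1 \<and> \<dots> \<and> X\<^sub>k) (f\<^sub>1, \<dots>, f\<^sub>k) = det (X\<^sub>i f\<^sub>j)\<close>, extended by 0 to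
  all argument lists. Thus multivector fields of different degrees live in one type and
  have disjoint supports, so that inhomogeneous elements are just sums.\<close>

type_synonym 'a mvf = "('a \<Rightarrow> real) list \<Rightarrow> 'a \<Rightarrow> real"

definition multivector_fields :: "nat \<Rightarrow> ('a, 'e::real_normed_vector) atlas \<Rightarrow> 'a mvf set"
  where "multivector_fields k A = {X.
    (\<forall>fs. \<not> (length fs = k \<and> set fs \<subseteq> smooth_functions A) \<longrightarrow> X fs = 0) \<and>
    (\<forall>fs. X fs \<in> smooth_functions A) \<and>
    (\<forall>us f g c ws. length us + length ws + 1 = k \<and>
       set us \<union> {f, g} \<union> set ws \<subseteq> smooth_functions A \<longrightarrow>
       X (us @ (f + c *\<^sub>R g) # ws) = X (us @ f # ws) + c *\<^sub>R X (us @ g # ws) \<and>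
       X (us @ (f * g) # ws) = f * X (us @ g # ws) + g * X (us @ f # ws)) \<and>
    (\<forall>us f g ws. X (us @ f # g # ws) = - X (us @ g # f # ws))}"

text \<open>A subset \<open>I\<close> of \<open>{..<n}\<close> encodes the unshuffle that lists \<open>I\<close> increasingly, followed
  by its complement; this is the sign of that permutation.\<close>

definition unshuffle_sign :: "nat set \<Rightarrow> real"
  where "unshuffle_sign I = (-1) ^ card {(i, j). i \<in> I \<and> j \<notin> I \<and> j < i}"

text \<open>For \<open>X\<close> of degree \<open>p\<close> and \<open>Y\<close> of degree \<open>q\<close>,
  \<open>[X, Y] = (-1)\<^bsup>(p-1)(q-1)\<^esup> X \<circ> Y - Y \<circ> X\<close>, where \<open>\<circ>\<close> inserts the second multiderivation
  into the first slot of the first one and sums over unshuffles with sign. This is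
  the normalization with \<open>[X, Y \<and> Z] = [X, Y] \<and> Z + (-1)\<^bsup>(p-1)q\<^esup> Y \<and> [X, Z]\<close> and with
  \<open>[X, _]\<close> the Lie derivative for \<open>p = 1\<close>. Below \<open>n = p + q - 1\<close>; in the first
  term \<open>card I = q\<close>, in the second one \<open>card I = p\<close>, other \<open>I\<close> contribute 0.\<close>

definition schouten :: "'a mvf \<Rightarrow> 'a mvf \<Rightarrow> 'a mvf"
  where "schouten X Y fs = (let n = length fs in
    \<Sum>I\<in>Pow {..<n}. unshuffle_sign I *\<^sub>R
      ((-1) ^ ((n - card I) * (card I + 1)) *\<^sub>R X (Y (nths fs I) # nths fs (- I))
       - Y (X (nths fs I) # nths fs (- I))))"

definition wedge_vf :: "('a, 'e::real_normed_vector) atlas \<Rightarrow> 'a mvf list \<Rightarrow> 'a mvf"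
  where "wedge_vf A Xs fs x =
    (if length fs = length Xs \<and> set fs \<subseteq> smooth_functions A
     then \<Sum>\<sigma> | \<sigma> permutes {..<length Xs}. of_int (sign \<sigma>) * (\<Prod>i<length Xs. (Xs ! i) [fs ! \<sigma> i] x)
     else 0)"


section \<open>Poisson structures and coisotropic submanifolds\<close>

definition poisson :: "('a, 'e::real_normed_vector) atlas \<Rightarrow> 'a mvf \<Rightarrow> bool"
  where "poisson A \<pi> \<longleftrightarrow> \<pi> \<in> multivector_fields 2 A \<and> schouten \<pi> \<pi> = 0"

text \<open>\<open>\<pi>\<^sup>\<sharp> \<alpha> = \<pi> (\<alpha>, _)\<close>, where \<open>\<pi> (df, dg) = \<pi> (f, g)\<close>.\<close>

definition sharp ::
  "('a, 'e::real_normed_vector) atlas \<Rightarrow> 'a mvf \<Rightarrow> 'a \<Rightarrow> ((('a \<Rightarrow> real) \<Rightarrow> real) \<Rightarrow> real) \<Rightarrow> ('a \<Rightarrow> real) \<Rightarrow> real"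
  where "sharp A \<pi> x \<alpha> = (THE v. v \<in> tangent_space A x \<and>
    (\<forall>f\<in>smooth_functions A. \<forall>g\<in>smooth_functions A.
       (\<forall>w\<in>tangent_space A x. w f = \<alpha> w) \<longrightarrow> v g = \<pi> [f, g] x))"

definition annihilator ::
  "('a, 'c::real_normed_vector \<times> 'f::real_normed_vector) atlas \<Rightarrow> 'a set \<Rightarrow> 'a \<Rightarrow> ((('a \<Rightarrow> real) \<Rightarrow> real) \<Rightarrow> real) set"
  where "annihilator A N x = {\<alpha> \<in> cotangent_space A x. \<forall>v\<in>tangent_sub A N x. \<alpha> v = 0}"

definition coisotropic_submanifold ::
  "('a, 'c::real_normed_vector \<times> 'f::real_normed_vector) atlas \<Rightarrow> 'a mvf \<Rightarrow> 'a set \<Rightarrow> bool"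
  where "coisotropic_submanifold A \<pi> N \<longleftrightarrow> embedded_submanifold A N \<and>
    (\<forall>x\<in>N. sharp A \<pi> x ` annihilator A N x \<subseteq> tangent_sub A N x)"


section \<open>Fiberwise polynomial multivector fields\<close>

text \<open>Polynomial functions on the vector space \<open>\<nu>\<^sub>pC\<close>: the algebra generated by constants
  and linear functionals.\<close>

inductive_set fibre_polynomials ::
  "('m, 'c::real_normed_vector \<times> 'f::real_normed_vector) atlas \<Rightarrow> 'm set \<Rightarrow> 'm \<Rightarrow> ('m coset \<Rightarrow> real) set"
  for A C p where
  const: "(\<lambda>\<eta>. if \<eta> \<in> normal_space A C p then c else 0) \<in> fibre_polynomials A C p"
| linear: "l \<in> normal_dual A C p \<Longrightarrow> l \<in> fibre_polynomials A C p"
| add: "f \<in> fibre_polynomials A C p \<Longrightarrow> g \<in> fibre_polynomials A C p \<Longrightarrow> f + g \<in> fibre_polynomials A C p"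
| mult: "f \<in> fibre_polynomials A C p \<Longrightarrow> g \<in> fibre_polynomials A C p \<Longrightarrow> f * g \<in> fibre_polynomials A C p"

definition fp_functions ::
  "('m, 'c::real_inner \<times> 'f::real_inner) atlas \<Rightarrow> 'm set \<Rightarrow> ('m normal \<Rightarrow> real) set"
  where "fp_functions A C = {f \<in> smooth_functions (normal_atlas A C).
    \<forall>p\<in>C. (\<lambda>\<eta>. f (p, \<eta>)) \<in> fibre_polynomials A C p}"

definition fp_vector_fields ::
  "('m, 'c::real_inner \<times> 'f::real_inner) atlas \<Rightarrow> 'm set \<Rightarrow> 'm normal mvf set"
  where "fp_vector_fields A C = {X \<in> multivector_fields 1 (normal_atlas A C).
    \<forall>f\<in>fp_functions A C. X [f] \<in> fp_functions A C}"

definition chi_fp ::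
  "nat \<Rightarrow> ('m, 'c::real_inner \<times> 'f::real_inner) atlas \<Rightarrow> 'm set \<Rightarrow> 'm normal mvf set"
  where "chi_fp k A C =
    (if k = 0 then {(\<lambda>fs. if fs = [] then f else 0) | f. f \<in> fp_functions A C}
     else span {wedge_vf (normal_atlas A C) Xs | Xs. length Xs = k \<and> set Xs \<subseteq> fp_vector_fields A C})"


section \<open>Sections of \<open>\<and>\<nu>C\<close>\<close>

text \<open>An element of \<open>\<and>\<^sup>k\<nu>\<^sub>pC\<close> is an alternating \<open>k\<close>-linear form on the dual of \<open>\<nu>\<^sub>pC\<close>, extended
  by 0. A section is smooth if its contractions with smooth sections of the dual bundle,
  i.e. smooth fiberwise linear functions on the total space, are smooth.\<close>

type_synonym 'm wsec = "'m \<Rightarrow> ('m coset \<Rightarrow> real) list \<Rightarrow> real"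

definition fibrewise_linear ::
  "('m, 'c::real_inner \<times> 'f::real_inner) atlas \<Rightarrow> 'm set \<Rightarrow> ('m normal \<Rightarrow> real) set"
  where "fibrewise_linear A C = {F \<in> smooth_functions (normal_atlas A C).
    \<forall>p\<in>C. (\<lambda>\<eta>. F (p, \<eta>)) \<in> normal_dual A C p}"

definition wedge_sections ::
  "nat \<Rightarrow> ('m, 'c::real_inner \<times> 'f::real_inner) atlas \<Rightarrow> 'm set \<Rightarrow> 'm wsec set"
  where "wedge_sections k A C = {a.
    (\<forall>p ls. \<not> (p \<in> C \<and> length ls = k \<and> set ls \<subseteq> normal_dual A C p) \<longrightarrow> a p ls = 0) \<and>
    (\<forall>p\<in>C. \<forall>us l l' c ws. length us + length ws + 1 = k \<and>
       set us \<union> {l, l'} \<union> set ws \<subseteq> normal_dual A C p \<longrightarrow>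
       a p (us @ (l + c *\<^sub>R l') # ws) = a p (us @ l # ws) + c * a p (us @ l' # ws)) \<and>
    (\<forall>p us l l' ws. a p (us @ l # l' # ws) = - a p (us @ l' # l # ws)) \<and>
    (\<forall>Fs. length Fs = k \<and> set Fs \<subseteq> fibrewise_linear A C \<longrightarrow>
       (\<lambda>p. a p (map (\<lambda>F \<eta>. F (p, \<eta>)) Fs)) \<in> smooth_functions (sub_atlas A C))}"

text \<open>A section of \<open>\<nu>C\<close> as an element of degree 1.\<close>

definition wedge1 ::
  "('m, 'c::real_inner \<times> 'f::real_inner) atlas \<Rightarrow> 'm set \<Rightarrow> ('m \<Rightarrow> 'm coset) \<Rightarrow> 'm wsec"
  where "wedge1 A C s p ls =
    (if p \<in> C \<and> length ls = 1 \<and> set ls \<subseteq> normal_dual A C p then hd ls (s p) else 0)"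

definition vertical_derivative ::
  "('m, 'c::real_inner \<times> 'f::real_inner) atlas \<Rightarrow> 'm set \<Rightarrow> 'm \<Rightarrow> 'm coset \<Rightarrow> ('m normal \<Rightarrow> real) \<Rightarrow> 'm coset \<Rightarrow> real"
  where "vertical_derivative A C p \<xi> F = (\<lambda>\<eta>. if \<eta> \<in> normal_space A C p
    then deriv (\<lambda>t. F (p, normal_add \<xi> (normal_scale A C p t \<eta>))) 0 else 0)"

text \<open>The vertical, fiberwise constant multivector field on the total space given by a
  section of \<open>\<and>\<nu>C\<close>.\<close>

definition vert ::
  "('m, 'c::real_inner \<times> 'f::real_inner) atlas \<Rightarrow> 'm set \<Rightarrow> 'm wsec \<Rightarrow> 'm normal mvf"
  where "vert A C a Fs = (\<lambda>(p, \<xi>).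
    if set Fs \<subseteq> smooth_functions (normal_atlas A C) \<and> (p, \<xi>) \<in> normal_total A C
    then a p (map (vertical_derivative A C p \<xi>) Fs) else 0)"

text \<open>Restriction to \<open>C\<close> followed by the projection along \<open>TC\<close>. By duality, the projected
  multivector is evaluated on a covector \<open>l\<close> of \<open>\<nu>\<^sub>pC\<close> by pulling \<open>l\<close> back to the covector at
  \<open>0\<^sub>p\<close> that vanishes on \<open>TC\<close>; this is the differential at \<open>0\<^sub>p\<close> of any function that
  vanishes on the zero section and has vertical derivative \<open>l\<close> at \<open>0\<^sub>p\<close>.\<close>

definition conormal_extension ::
  "('m, 'c::real_inner \<times> 'f::real_inner) atlas \<Rightarrow> 'm set \<Rightarrow> 'm \<Rightarrow> ('m coset \<Rightarrow> real) \<Rightarrow> 'm normal \<Rightarrow> real"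
  where "conormal_extension A C p l = (SOME F. F \<in> smooth_functions (normal_atlas A C) \<and>
    (\<forall>q\<in>C. F (q, normal_zero A C q) = 0) \<and>
    vertical_derivative A C p (normal_zero A C p) F = l)"

definition Proj ::
  "('m, 'c::real_inner \<times> 'f::real_inner) atlas \<Rightarrow> 'm set \<Rightarrow> 'm normal mvf \<Rightarrow> 'm wsec"
  where "Proj A C X p ls = (if p \<in> C \<and> set ls \<subseteq> normal_dual A C p
    then X (map (conormal_extension A C p) ls) (p, normal_zero A C p) else 0)"


section \<open>\<open>L\<^sub>\<infinity>[1]\<close>-algebras\<close>

text \<open>A graded vector space is a family of independent subspaces of an ambient space.\<close>

definition graded_space :: "(int \<Rightarrow> 'w::real_vector set) \<Rightarrow> bool"
  where "graded_space W \<longleftrightarrow> (\<forall>i. subspace (W i)) \<and>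
    (\<forall>w. (\<forall>i. w i \<in> W i) \<and> finite {i. w i \<noteq> 0} \<and> (\<Sum>i | w i \<noteq> 0. w i) = 0 \<longrightarrow> (\<forall>i. w i = 0))"

definition total_space :: "(int \<Rightarrow> 'w::real_vector set) \<Rightarrow> 'w set"
  where "total_space W = span (\<Union>i. W i)"

text \<open>Koszul sign of the unshuffle encoded by \<open>I\<close>, for homogeneous elements of degrees \<open>ds\<close>.\<close>

definition koszul_sign :: "int list \<Rightarrow> nat set \<Rightarrow> real"
  where "koszul_sign ds I = (-1) ^ card {(i, j). i \<in> I \<and> j \<notin> I \<and> j < i \<and> odd (ds ! i * ds ! j)}"

text \<open>\<open>m [v\<^sub>1, \<dots>, v\<^sub>k]\<close> is the \<open>k\<close>-ary bracket, \<open>k \<ge> 1\<close>. Graded symmetry is expressed through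
  adjacent transpositions.\<close>

definition Linfty1_algebra :: "(int \<Rightarrow> 'w::real_vector set) \<Rightarrow> ('w list \<Rightarrow> 'w) \<Rightarrow> bool"
  where "Linfty1_algebra W m \<longleftrightarrow> graded_space W \<and>
    (\<forall>us x y c ws. set us \<union> {x, y} \<union> set ws \<subseteq> total_space W \<longrightarrow>
       m (us @ (x + c *\<^sub>R y) # ws) = m (us @ x # ws) + c *\<^sub>R m (us @ y # ws)) \<and>
    (\<forall>ds vs. vs \<noteq> [] \<and> list_all2 (\<lambda>d v. v \<in> W d) ds vs \<longrightarrow> m vs \<in> W (sum_list ds + 1)) \<and>
    (\<forall>us x y ws i j. set us \<union> set ws \<subseteq> total_space W \<and> x \<in> W i \<and> y \<in> W j \<longrightarrow>
       m (us @ x # y # ws) = (if odd (i * j) then -1 else 1) *\<^sub>R m (us @ y # x # ws)) \<and>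
    (\<forall>ds vs. vs \<noteq> [] \<and> list_all2 (\<lambda>d v. v \<in> W d) ds vs \<longrightarrow>
       (\<Sum>I\<in>Pow {..<length vs} - {{}}. koszul_sign ds I *\<^sub>R m (m (nths vs I) # nths vs (- I))) = 0)"

text \<open>The Maurer-Cartan series is summed in the topology of the ambient space; for the spaces
  of functions used here, this is pointwise convergence.\<close>

definition maurer_cartan ::
  "(int \<Rightarrow> 'w::{real_vector, topological_space} set) \<Rightarrow> ('w list \<Rightarrow> 'w) \<Rightarrow> 'w \<Rightarrow> bool"
  where "maurer_cartan W m \<alpha> \<longleftrightarrow> \<alpha> \<in> W 0 \<and>
    (\<lambda>n. (1 / fact (Suc n)) *\<^sub>R m (replicate (Suc n) \<alpha>)) sums 0"


section \<open>The graded space and brackets on \<open>\<chi>\<^sub>f\<^sub>p(\<nu>C)[2] \<oplus> \<Gamma>(\<and>\<nu>C)[1]\<close>\<close>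

definition defo_space ::
  "('m, 'c::real_inner \<times> 'f::real_inner) atlas \<Rightarrow> 'm set \<Rightarrow> int \<Rightarrow> ('m normal mvf \<times> 'm wsec) set"
  where "defo_space A C i =
    (if i + 2 \<ge> 0 then chi_fp (nat (i + 2)) A C else {0}) \<times>
    (if i + 1 \<ge> 0 then wedge_sections (nat (i + 1)) A C else {0})"

text \<open>\<open>(X, 0)\<close> and \<open>(0, a)\<close> stand for \<open>X[1]\<close> and \<open>a\<close>. For \<open>X\<close> of degree \<open>k\<close> as a multivector
  field, \<open>|X| = k - 1\<close>, whence the sign \<open>(-1)\<^bsup>k+1\<^esup>\<close>. The last clause says that brackets of
  homogeneous entries of any other type vanish; there the entries may be assumed
  sorted by graded symmetry.\<close>

definition defo_algebra ::
  "('m, 'c::real_inner \<times> 'f::real_inner) atlas \<Rightarrow> 'm set \<Rightarrow>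
   (('m normal mvf \<times> 'm wsec) list \<Rightarrow> 'm normal mvf \<times> 'm wsec) \<Rightarrow> bool"
  where "defo_algebra A C m \<longleftrightarrow> Linfty1_algebra (defo_space A C) m \<and>
    (\<forall>k. \<forall>X\<in>chi_fp k A C. m [(X, 0)] = (0, Proj A C X)) \<and>
    (\<forall>k l. \<forall>X\<in>chi_fp k A C. \<forall>Y\<in>chi_fp l A C.
       m [(X, 0), (Y, 0)] = ((-1) ^ (k + 1) *\<^sub>R schouten X Y, 0)) \<and>
    (\<forall>k. \<forall>X\<in>chi_fp k A C. \<forall>as. as \<noteq> [] \<and> set as \<subseteq> (\<Union>l. wedge_sections l A C) \<longrightarrow>
       m ((X, 0) # map (\<lambda>a. (0, a)) as) = (0, Proj A C (foldl schouten X (map (vert A C) as)))) \<and>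
    (\<forall>Xs as. set Xs \<subseteq> (\<Union>k. chi_fp k A C) \<and> set as \<subseteq> (\<Union>l. wedge_sections l A C) \<and>
       (Xs \<noteq> [] \<or> as \<noteq> []) \<and> length Xs \<noteq> 1 \<and> \<not> (length Xs = 2 \<and> as = []) \<longrightarrow>
       m (map (\<lambda>X. (X, 0)) Xs @ map (\<lambda>a. (0, a)) as) = 0)"

end

theory Submission
  imports Defs
begin

text \<open>Vertical, fibrewise constant multivector fields form an abelian subalgebra complementary to
  \<open>ker P\<close>, which is closed under the Schouten bracket: a multivector field is in \<open>ker P\<close> iff it
  preserves the functions that vanish on the zero section. So the brackets are higher derived brackets
  in the sense of Voronov. Their second component is \<open>P\<close> of \<open>D (v # vs) = [\<dots>[X, a\<^sub>1], \<dots>, a\<^sub>n] \<plusminus> [a, D vs]\<close>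
  with \<open>v = (X, a)\<close> and \<open>vs = v\<^sub>1, \<dots>, v\<^sub>n\<close>, \<open>v\<^sub>i = (_, a\<^sub>i)\<close>; the generalized Jacobi identities
  follow from the Leibniz rule, the Jacobi identity and \<open>P [X, Y] = P [P X, Y] + P [X, P Y]\<close>.

  By symmetry and multilinearity the Maurer-Cartan series of \<open>(\<pi>, \<Phi>)\<close> has the components
  \<open>- [\<pi>, \<pi>] / 2\<close> and \<open>\<Sum>\<^sub>n P [\<dots>[\<pi>, \<Phi>], \<dots>, \<Phi>] / n!\<close>. Evaluated on fibrewise linear functions \<open>F\<close>, \<open>G\<close>,
  the latter is the Taylor series at \<open>0\<close> of the polynomial \<open>t \<mapsto> \<pi> (F + t F', G + t G') (- t \<Phi>)\<close>, where
  \<open>F'\<close>, \<open>G'\<close> are the fibrewise constant extensions of \<open>F \<circ> \<Phi>\<close>, \<open>G \<circ> \<Phi>\<close>. Its sum is the value at \<open>t = 1\<close>,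
  and the functions \<open>F + F'\<close> locally define the graph of \<open>- \<Phi>\<close>, so that these values vanish iff the
  graph is coisotropic.\<close>

section \<open>Sums over unshuffles\<close>

text \<open>Unshuffles are never handled as permutations. A sum over them satisfies a recursion on
  the first entry of the list; for multiderivations this recursion says that contraction with a
  function is a graded derivation of wedge product and bracket. Hence the identities of the Schouten
  calculus are inductions on the total degree, whose base case is evaluation at the empty list.
  Multiderivations take global functions as arguments, but P, the vertical lift and coisotropy are
  pointwise. The bridge is a cut-off argument on the normal bundle, where the Hausdorff property of
  M enters: the value of a multiderivation at a point depends only on the differentials of its
  arguments. So the choice in \<open>conormal_extension\<close> is immaterial, and brackets of
  vertical lifts may be computed on functions that are affine along the fibres. Polynomiality along
  the fibres is what lets the Maurer-Cartan series speak about the graph: its terms are Taylor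
  coefficients at the zero section, which do not determine a general smooth function away from
  it.\<close>

definition par :: "int \<Rightarrow> real"
  where "par k = (if even k then 1 else - 1)"

lemma par_mult_self [simp]: "par k * par k = 1"
  by (simp add: par_def)

lemma par_add: "par (j + k) = par j * par k"
  by (auto simp: par_def)

text \<open>Splitting by whether position 0 is selected mirrors \<open>Cons\<close> on lists: the
  head goes to the left or to the right block, and all other positions shift by one.\<close>

lemma sum_Pow_lessThan_Suc:
  fixes g :: "nat set \<Rightarrow> 'b::comm_monoid_add"
  shows "(\<Sum>I\<in>Pow {..<Suc n}. g I) = (\<Sum>I\<in>Pow {..<n}. g (insert 0 (Suc ` I)) + g (Suc ` I))"
proof -
  have inj: "inj ((`) Suc)" by (rule injI) (auto simp: inj_image_eq_iff)
  have inj': "inj (\<lambda>I. insert 0 (Suc ` I))"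
  proof (rule injI)
    fix I J assume "insert 0 (Suc ` I) = insert 0 (Suc ` J)"
    then have "insert 0 (Suc ` I) - {0} = insert 0 (Suc ` J) - {0}" by simp
    then have "Suc ` I = Suc ` J" by auto
    then show "I = J" by (simp add: inj_image_eq_iff)
  qed
  have P: "Pow {..<Suc n} = (\<lambda>I. insert 0 (Suc ` I)) ` Pow {..<n} \<union> (`) Suc ` Pow {..<n}"
    by (simp add: lessThan_Suc_eq_insert_0 Pow_insert image_Pow_surj[OF refl, symmetric] image_image Un_commute)
  have "(\<lambda>I. insert 0 (Suc ` I)) ` Pow {..<n} \<inter> (`) Suc ` Pow {..<n} = {}" by auto
  then show ?thesis unfolding P by (subst sum.union_disjoint)
       (auto simp: sum.reindex inj_on_subset[OF inj] inj_on_subset[OF inj'] sum.distrib)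
qed

lemma nths_shift [simp]:
  "nths (x # xs) (insert 0 (Suc ` I)) = x # nths xs I"
  "nths (x # xs) (Suc ` I) = nths xs I"
  "nths (x # xs) (- insert 0 (Suc ` I)) = nths xs (- I)"
  "nths (x # xs) (- (Suc ` I)) = x # nths xs (- I)"
  by (auto simp: nths_Cons Compl_eq image_iff intro!: arg_cong[where f = "nths xs"])

text \<open>Entries carry their degrees, so that the sublists passed to \<open>G\<close> still know
  which signs they cause; the sums in the generalized Jacobi identities have this shape.\<close>

definition koszul_sum :: "((int \<times> 'b) list \<Rightarrow> (int \<times> 'b) list \<Rightarrow> 'c::real_vector) \<Rightarrow> (int \<times> 'b) list \<Rightarrow> 'c"
  where "koszul_sum G ps =
    (\<Sum>I\<in>Pow {..<length ps}. koszul_sign (map fst ps) I *\<^sub>R G (nths ps I) (nths ps (- I)))"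

definition deg :: "(int \<times> 'b) list \<Rightarrow> int"
  where "deg ps = sum_list (map fst ps)"

lemma deg_simps [simp]: "deg [] = 0" "deg (p # ps) = fst p + deg ps" "deg (ps @ qs) = deg ps + deg qs"
  by (simp_all add: deg_def)

text \<open>A head in the left block stays in front, is overtaken by no entry and causes no
  sign.\<close>

lemma koszul_sign_insert:
  "koszul_sign (d # ds) (insert 0 (Suc ` I)) = koszul_sign ds I"
proof -
  have "{(i, j). i \<in> insert 0 (Suc ` I) \<and> j \<notin> insert 0 (Suc ` I) \<and> j < i \<and>
      odd ((d # ds) ! i * (d # ds) ! j)} =
    map_prod Suc Suc ` {(i, j). i \<in> I \<and> j \<notin> I \<and> j < i \<and> odd (ds ! i * ds ! j)}"
    (is "?L = ?f ` ?R")
  proof (intro set_eqI iffI)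
    fix x assume "x \<in> ?L"
    then show "x \<in> ?f ` ?R" by (cases x; cases "fst x"; cases "snd x")
         (auto simp: image_iff inj_image_mem_iff)
  qed (auto simp: inj_image_mem_iff)
  moreover have "inj_on ?f ?R" by (intro inj_on_subset[OF prod.inj_map]) auto
  ultimately show ?thesis by (simp add: koszul_sign_def card_image)
qed

text \<open>Only odd entries contribute to the parity of a total degree, so counting them computes
  the sign of a block.\<close>

lemma deg_nths:
  assumes "I \<subseteq> {..<length ps}"
  shows "(- 1 :: real) ^ card {i \<in> I. odd (map fst ps ! i)} = par (deg (nths ps I))"
  using assms
proof (induction ps arbitrary: I)
  case (Cons p ps)
  define J where "J = {j. Suc j \<in> I}"
  have J: "J \<subseteq> {..<length ps}" using Cons.prems by (auto simp: J_def)
  have fin: "finite J" using J finite_subset by blast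
  have mem: "i \<in> I \<longleftrightarrow> (i = 0 \<and> 0 \<in> I) \<or> i \<in> Suc ` J" for i
    by (cases i) (auto simp: J_def)
  have "{i \<in> Suc ` J. odd (map fst (p # ps) ! i)} = Suc ` {i \<in> J. odd (map fst ps ! i)}" by auto
  then have 1: "card {i \<in> Suc ` J. odd (map fst (p # ps) ! i)} = card {i \<in> J. odd (map fst ps ! i)}"
    by (simp add: card_image)
  show ?case
  proof (cases "0 \<in> I")
    case True
    then have "{i \<in> I. odd (map fst (p # ps) ! i)} =
      (if odd (fst p) then insert 0 {i \<in> Suc ` J. odd (map fst (p # ps) ! i)}
       else {i \<in> Suc ` J. odd (map fst (p # ps) ! i)})"
    proof (intro set_eqI)
      fix i
      have "i \<in> I \<longleftrightarrow> i = 0 \<or> i \<in> Suc ` J" using mem[of i] True by blast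
      then show "i \<in> {i \<in> I. odd (map fst (p # ps) ! i)} \<longleftrightarrow> i \<in> (if odd (fst p)
        then insert 0 {i \<in> Suc ` J. odd (map fst (p # ps) ! i)}
        else {i \<in> Suc ` J. odd (map fst (p # ps) ! i)})" by auto
    qed
    then have "card {i \<in> I. odd (map fst (p # ps) ! i)} =
      (if odd (fst p) then 1 else 0) + card {i \<in> J. odd (map fst ps ! i)}"
      using 1 fin by (auto simp: card_insert_if)
    moreover have "nths (p # ps) I = p # nths ps J" using True by (simp add: nths_Cons J_def)
    ultimately show ?thesis using Cons.IH[OF J] by (auto simp: par_add par_def power_add)
  next
    case False
    then have "I = Suc ` J" using mem by blast
    with 1 Cons.IH[OF J] show ?thesis by simp
  qed
qed (simp add: par_def)

text \<open>A head in the right block is overtaken by the whole left block: besides the old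
  inversions \<open>R\<close> there are the new ones \<open>Q\<close> between the head and the
  selected entries.\<close>

lemma koszul_sign_image_Suc:
  assumes "I \<subseteq> {..<length ps}"
  shows "koszul_sign (d # map fst ps) (Suc ` I) = par (d * deg (nths ps I)) * koszul_sign (map fst ps) I"
proof -
  let ?ds = "map fst ps"
  have fin: "finite I" using assms finite_subset by blast
  define R where "R = {(i, j). i \<in> I \<and> j \<notin> I \<and> j < i \<and> odd (?ds ! i * ?ds ! j)}"
  define Q where "Q = {i \<in> I. odd (?ds ! i * d)}"
  have "{(i, j). i \<in> Suc ` I \<and> j \<notin> Suc ` I \<and> j < i \<and> odd ((d # ?ds) ! i * (d # ?ds) ! j)} =
    map_prod Suc Suc ` R \<union> (\<lambda>i. (Suc i, 0)) ` Q" (is "?L = _")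
  proof (intro set_eqI iffI)
    fix x assume "x \<in> ?L"
    then show "x \<in> map_prod Suc Suc ` R \<union> (\<lambda>i. (Suc i, 0)) ` Q" by (cases x; cases "snd x")
         (auto simp: image_iff inj_image_mem_iff R_def Q_def)
  qed (auto simp: R_def Q_def inj_image_mem_iff)
  moreover have "finite R"
  proof (rule finite_subset)
    show "R \<subseteq> Sigma I (\<lambda>i. {..<i})" by (auto simp: R_def)
  qed (use fin in auto)
  moreover have "finite Q" using fin by (simp add: Q_def)
  moreover have "map_prod Suc Suc ` R \<inter> (\<lambda>i. (Suc i, 0)) ` Q = {}" by auto
  moreover have "inj_on (map_prod Suc Suc) R" by (intro inj_on_subset[OF prod.inj_map]) auto
  moreover have "inj_on (\<lambda>i. (Suc i, 0::nat)) Q" by (auto simp: inj_on_def)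
  ultimately have "koszul_sign (d # ?ds) (Suc ` I) = (- 1) ^ card R * (- 1) ^ card Q"
    by (simp add: koszul_sign_def card_Un_disjoint card_image power_add)
  moreover have "(- 1 :: real) ^ card Q = par (d * deg (nths ps I))"
  proof (cases "odd d")
    case True
    then have "Q = {i \<in> I. odd (?ds ! i)}" by (auto simp: Q_def)
    with deg_nths[OF assms] True show ?thesis by (simp add: par_def)
  next
    case False
    then have "Q = {}" by (auto simp: Q_def)
    with False show ?thesis by (simp add: par_def)
  qed
  ultimately show ?thesis by (simp add: koszul_sign_def R_def)
qed

lemma koszul_sum_Nil [simp]: "koszul_sum G [] = G [] []"
  by (simp add: koszul_sum_def koszul_sign_def)

text \<open>The recursion that replaces subsets of positions in the later sign computations: a head
  of degree d goes left for free and goes right at the cost of (-1)^(d deg L).\<close>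

lemma koszul_sum_Cons:
  "koszul_sum G (p # ps) = koszul_sum (\<lambda>L R. G (p # L) R + par (fst p * deg L) *\<^sub>R G L (p # R)) ps"
  unfolding koszul_sum_def
  by (subst list.size, simp only: add_Suc_right add_0_right sum_Pow_lessThan_Suc, rule sum.cong[OF refl])
     (simp add: koszul_sign_insert koszul_sign_image_Suc scaleR_add_right mult.commute)

text \<open>The two blocks are known to exhaust the list as a multiset, which is enough for them to
  inherit homogeneity of all entries.\<close>

lemma koszul_sum_cong:
  assumes "\<And>L R. mset L + mset R = mset ps \<Longrightarrow> G L R = H L R"
  shows "koszul_sum G ps = koszul_sum H ps"
  using assms
proof (induction ps arbitrary: G H)
  case (Cons p ps)
  show ?case unfolding koszul_sum_Cons by (rule Cons.IH) (simp add: Cons.prems)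
qed simp

lemma koszul_sum_add: "koszul_sum (\<lambda>L R. G L R + H L R) ps = koszul_sum G ps + koszul_sum H ps"
  by (simp add: koszul_sum_def scaleR_add_right sum.distrib)

lemma koszul_sum_scaleR: "koszul_sum (\<lambda>L R. c *\<^sub>R G L R) ps = c *\<^sub>R koszul_sum G ps"
  by (simp add: koszul_sum_def scaleR_sum_right mult.commute)

lemma koszul_sum_minus: "koszul_sum (\<lambda>L R. - G L R) ps = - koszul_sum G ps"
  using koszul_sum_scaleR[of "- 1" G ps] by simp

lemma koszul_sum_0: "koszul_sum (\<lambda>L R. 0) ps = 0"
  by (simp add: koszul_sum_def)

definition unshuffle_sum :: "('b list \<Rightarrow> 'b list \<Rightarrow> 'c::real_vector) \<Rightarrow> 'b list \<Rightarrow> 'c"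
  where "unshuffle_sum G fs = (\<Sum>I\<in>Pow {..<length fs}. unshuffle_sign I *\<^sub>R G (nths fs I) (nths fs (- I)))"

text \<open>Function arguments carry the plain sign of the unshuffle, which is the Koszul sign for
  entries that all have degree 1.\<close>

lemma unshuffle_sum_eq_koszul_sum: "unshuffle_sum G fs = koszul_sum (\<lambda>L R. G (map snd L) (map snd R)) (map (Pair 1) fs)"
proof -
  have "unshuffle_sign I = koszul_sign (map fst (map (Pair (1::int)) fs)) I" if "I \<subseteq> {..<length fs}" for I
  proof -
    have "{(i, j). i \<in> I \<and> j \<notin> I \<and> j < i} = {(i, j). i \<in> I \<and> j \<notin> I \<and> j < i \<and>
        odd (map fst (map (Pair (1::int)) fs) ! i * map fst (map (Pair (1::int)) fs) ! j)}" using that by fastforce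
    then show ?thesis by (simp add: unshuffle_sign_def koszul_sign_def)
  qed
  then show ?thesis by (auto simp: unshuffle_sum_def koszul_sum_def nths_map o_def intro!: sum.cong)
qed

lemma unshuffle_sum_Nil [simp]: "unshuffle_sum G [] = G [] []"
  by (simp add: unshuffle_sum_eq_koszul_sum)

lemma unshuffle_sum_Cons:
  "unshuffle_sum G (f # fs) = unshuffle_sum (\<lambda>L R. G (f # L) R + (- 1) ^ length L *\<^sub>R G L (f # R)) fs"
proof -
  have "par (deg L) = (- 1) ^ length L"
    if "mset L + mset R = mset (map (Pair 1) fs)" for L R
  proof -
    have "set L \<subseteq> Pair 1 ` set fs" using that by (metis set_mset_mset set_mset_union Un_upper1 set_map)
    then have "deg L = int (length L)" by (induction L) auto
    then show ?thesis by (simp add: par_def minus_one_power_iff)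
  qed
  then show ?thesis unfolding unshuffle_sum_eq_koszul_sum list.map koszul_sum_Cons by (intro koszul_sum_cong) simp
qed

lemma unshuffle_sum_cong:
  assumes "\<And>L R. length L + length R = length fs \<Longrightarrow> G L R = H L R"
  shows "unshuffle_sum G fs = unshuffle_sum H fs"
  using assms
proof (induction fs arbitrary: G H)
  case (Cons f fs)
  show ?case unfolding unshuffle_sum_Cons by (rule Cons.IH) (simp add: Cons.prems)
qed simp

lemma unshuffle_sum_add: "unshuffle_sum (\<lambda>L R. G L R + H L R) fs = unshuffle_sum G fs + unshuffle_sum H fs"
  by (simp add: unshuffle_sum_def scaleR_add_right sum.distrib)

lemma unshuffle_sum_scaleR: "unshuffle_sum (\<lambda>L R. c *\<^sub>R G L R) fs = c *\<^sub>R unshuffle_sum G fs"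
  by (simp add: unshuffle_sum_def scaleR_sum_right mult.commute)

lemma unshuffle_sum_minus: "unshuffle_sum (\<lambda>L R. - G L R) fs = - unshuffle_sum G fs"
  using unshuffle_sum_scaleR[of "- 1" G fs] by simp

lemma unshuffle_sum_0 [simp]: "unshuffle_sum (\<lambda>L R. 0) fs = 0"
  by (simp add: unshuffle_sum_def)

section \<open>The Schouten bracket of alternating multiderivations\<close>

instance "fun" :: (type, real_algebra) real_algebra by standard (simp_all add: scaleR_fun_def fun_eq_iff)

lemma scaleR_fun_apply: "(c *\<^sub>R f) x = c *\<^sub>R f x"
  by (simp add: scaleR_fun_def)

text \<open>The algebraic content of \<open>multivector_fields\<close>: only a subset
  \<open>S\<close> of a commutative algebra remains, so that the following calculus does not see the
  manifold.\<close>

definition multiderivations :: "nat \<Rightarrow> 'r::{real_algebra, comm_ring} set \<Rightarrow> ('r list \<Rightarrow> 'r) set"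
  where "multiderivations k S = {X.
    (\<forall>fs. \<not> (length fs = k \<and> set fs \<subseteq> S) \<longrightarrow> X fs = 0) \<and>
    (\<forall>fs. X fs \<in> S) \<and>
    (\<forall>us f g c ws. length us + length ws + 1 = k \<and> set us \<union> {f, g} \<union> set ws \<subseteq> S \<longrightarrow>
       X (us @ (f + c *\<^sub>R g) # ws) = X (us @ f # ws) + c *\<^sub>R X (us @ g # ws) \<and>
       X (us @ (f * g) # ws) = f * X (us @ g # ws) + g * X (us @ f # ws)) \<and>
    (\<forall>us f g ws. X (us @ f # g # ws) = - X (us @ g # f # ws))}"

lemma multivector_fields_eq: "multivector_fields k A = multiderivations k (smooth_functions A)"
  by (simp add: multivector_fields_def multiderivations_def)

definition contract :: "'r \<Rightarrow> ('r list \<Rightarrow> 'r) \<Rightarrow> 'r list \<Rightarrow> 'r"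
  where "contract f X fs = X (f # fs)"

definition wedge :: "('r list \<Rightarrow> 'r) \<Rightarrow> ('r list \<Rightarrow> 'r) \<Rightarrow> 'r list \<Rightarrow> 'r::{real_algebra, comm_ring}"
  where "wedge X Y = unshuffle_sum (\<lambda>L R. X L * Y R)"

text \<open>In the summand that survives, \<open>L\<close> has length q and \<open>R\<close> has
  length p - 1, so this is the sign (-1)^((p-1)(q-1)); q + 1 stands for q - 1 to avoid truncated
  subtraction.\<close>

abbreviation bsgn :: "'a list \<Rightarrow> 'a list \<Rightarrow> real"
  where "bsgn L R \<equiv> (- 1) ^ (length R * (length L + 1))"

definition bracket :: "('r list \<Rightarrow> 'r) \<Rightarrow> ('r list \<Rightarrow> 'r) \<Rightarrow> 'r list \<Rightarrow> 'r::{real_algebra, comm_ring}"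
  where "bracket X Y = unshuffle_sum (\<lambda>L R.
    bsgn L R *\<^sub>R X (Y L # R) - Y (X L # R))"

lemma schouten_eq_bracket: "schouten = bracket"
proof (intro ext[where 'a = "'a mvf"] ext[where 'a = "('a \<Rightarrow> real) list"])
  fix X Y :: "'a mvf" and fs :: "('a \<Rightarrow> real) list"
  have "card I = length (nths fs I)" "length fs - card I = length (nths fs (- I))"
    if "I \<subseteq> {..<length fs}" for I
  proof -
    show *: "card I = length (nths fs I)" using that by (auto simp: length_nths intro!: arg_cong[where f = card])
    have "length (nths fs (- I)) = card ({..<length fs} - I)"
      by (auto simp: length_nths intro!: arg_cong[where f = card])
    also have "\<dots> = length fs - card I" using that by (subst card_Diff_subset) (auto intro: finite_subset)
    finally show "length fs - card I = length (nths fs (- I))" by simp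
  qed
  then show "schouten X Y fs = bracket X Y fs"
    by (auto simp: schouten_def bracket_def unshuffle_sum_def Let_def intro!: sum.cong)
qed

lemma bracket_Nil: "bracket X Y [] = X [Y []] - Y [X []]"
  by (simp add: bracket_def)

lemma wedge_Nil: "wedge X Y [] = X [] * Y []"
  by (simp add: wedge_def)

section \<open>Calculus of alternating multiderivations of a function algebra\<close>

locale function_algebra =
  fixes S :: "'a::{real_algebra, comm_ring} set"
  assumes subspace_S: "subspace S"
    and mult_S: "f \<in> S \<Longrightarrow> g \<in> S \<Longrightarrow> f * g \<in> S"
begin

abbreviation "MD k \<equiv> multiderivations k S"

lemma zero_S [simp]: "0 \<in> S"
  and add_S: "f \<in> S \<Longrightarrow> g \<in> S \<Longrightarrow> f + g \<in> S"
  and scale_S: "f \<in> S \<Longrightarrow> c *\<^sub>R f \<in> S"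
  and diff_S: "f \<in> S \<Longrightarrow> g \<in> S \<Longrightarrow> f - g \<in> S"
  and minus_S: "f \<in> S \<Longrightarrow> - f \<in> S"
  using subspace_S by (auto simp: subspace_0 subspace_add subspace_scale subspace_diff subspace_neg)

lemma MD_outside: "X \<in> MD k \<Longrightarrow> \<not> (length fs = k \<and> set fs \<subseteq> S) \<Longrightarrow> X fs = 0"
  by (simp add: multiderivations_def)

lemma MD_length: "X \<in> MD k \<Longrightarrow> length fs \<noteq> k \<Longrightarrow> X fs = 0"
  by (rule MD_outside) auto

lemma MD_in_S: "X \<in> MD k \<Longrightarrow> X fs \<in> S"
  by (simp add: multiderivations_def)

lemma MD_alt: "X \<in> MD k \<Longrightarrow> X (us @ f # g # ws) = - X (us @ g # f # ws)"
  unfolding multiderivations_def by blast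

lemma MD_alt0: "X \<in> MD k \<Longrightarrow> X (f # g # ws) = - X (g # f # ws)"
  using MD_alt[of X k "[]" f g ws] by simp

text \<open>If a remaining argument is outside \<open>S\<close> or their number is wrong, all three
  terms vanish; hence conditions are imposed on \<open>f\<close> and \<open>g\<close> alone.\<close>

lemma MD_linear:
  assumes "X \<in> MD k" "f \<in> S" "g \<in> S"
  shows "X (us @ (f + c *\<^sub>R g) # ws) = X (us @ f # ws) + c *\<^sub>R X (us @ g # ws)"
proof (cases "length us + length ws + 1 = k \<and> set us \<union> {f, g} \<union> set ws \<subseteq> S")
  case True
  with assms(1) show ?thesis unfolding multiderivations_def by blast
next
  case False
  then have "\<not> (length us + length ws + 1 = k \<and> set us \<union> set ws \<subseteq> S)" using assms by auto
  then have "X (us @ h # ws) = 0" for h by (intro MD_outside[OF assms(1)]) auto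
  then show ?thesis by simp
qed

lemma MD_deriv:
  assumes "X \<in> MD k" "f \<in> S" "g \<in> S"
  shows "X (us @ (f * g) # ws) = f * X (us @ g # ws) + g * X (us @ f # ws)"
proof (cases "length us + length ws + 1 = k \<and> set us \<union> {f, g} \<union> set ws \<subseteq> S")
  case True
  with assms(1) show ?thesis unfolding multiderivations_def by blast
next
  case False
  then have "\<not> (length us + length ws + 1 = k \<and> set us \<union> set ws \<subseteq> S)" using assms by auto
  then have "X (us @ h # ws) = 0" for h by (intro MD_outside[OF assms(1)]) auto
  then show ?thesis by simp
qed

lemmas MD_linear0 = MD_linear[where us = "[]", simplified]
lemmas MD_deriv0 = MD_deriv[where us = "[]", simplified]

lemma MD_zero_arg [simp]: "X \<in> MD k \<Longrightarrow> X (us @ 0 # ws) = 0"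
  using MD_linear[of X k 0 0 us 1 ws] by simp

lemma MD_zero_arg0 [simp]: "X \<in> MD k \<Longrightarrow> X (0 # ws) = 0"
  using MD_zero_arg[of X k "[]"] by simp

lemma MD_add_arg0: "X \<in> MD k \<Longrightarrow> f \<in> S \<Longrightarrow> g \<in> S \<Longrightarrow> X ((f + g) # ws) = X (f # ws) + X (g # ws)"
  using MD_linear0[of X k f g 1] by simp

lemma MD_scale_arg0: "X \<in> MD k \<Longrightarrow> g \<in> S \<Longrightarrow> X ((c *\<^sub>R g) # ws) = c *\<^sub>R X (g # ws)"
  using MD_linear0[of X k 0 g c ws] by (simp add: MD_zero_arg0)

lemma MD_minus_arg0: "X \<in> MD k \<Longrightarrow> g \<in> S \<Longrightarrow> X ((- g) # ws) = - X (g # ws)"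
  using MD_scale_arg0[of X k g "- 1"] by simp

lemma MD_diff_arg0: "X \<in> MD k \<Longrightarrow> f \<in> S \<Longrightarrow> g \<in> S \<Longrightarrow> X ((f - g) # ws) = X (f # ws) - X (g # ws)"
  using MD_linear0[of X k f g "-1"] by simp

lemma MD_I:
  assumes "\<And>fs. \<not> (length fs = k \<and> set fs \<subseteq> S) \<Longrightarrow> X fs = 0" "\<And>fs. X fs \<in> S"
    "\<And>us f g c ws. length us + length ws + 1 = k \<Longrightarrow> set us \<union> {f, g} \<union> set ws \<subseteq> S \<Longrightarrow>
       X (us @ (f + c *\<^sub>R g) # ws) = X (us @ f # ws) + c *\<^sub>R X (us @ g # ws) \<and>
       X (us @ (f * g) # ws) = f * X (us @ g # ws) + g * X (us @ f # ws)"
    "\<And>us f g ws. X (us @ f # g # ws) = - X (us @ g # f # ws)"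
  shows "X \<in> MD k"
proof -
  have "\<forall>fs. \<not> (length fs = k \<and> set fs \<subseteq> S) \<longrightarrow> X fs = 0" using assms(1) by blast
  moreover have "\<forall>fs. X fs \<in> S" using assms(2) by blast
  moreover have "\<forall>us f g c ws. length us + length ws + 1 = k \<and> set us \<union> {f, g} \<union> set ws \<subseteq> S \<longrightarrow>
       X (us @ (f + c *\<^sub>R g) # ws) = X (us @ f # ws) + c *\<^sub>R X (us @ g # ws) \<and>
       X (us @ (f * g) # ws) = f * X (us @ g # ws) + g * X (us @ f # ws)" by (intro allI impI assms(3)) auto
  moreover have "\<forall>us f g ws. X (us @ f # g # ws) = - X (us @ g # f # ws)" by (intro allI assms(4))
  ultimately show ?thesis unfolding multiderivations_def by (intro CollectI conjI)
qed

lemma subspace_MD: "subspace (MD k)"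
proof (rule subspaceI)
  show "0 \<in> MD k" by (simp add: multiderivations_def)
next
  fix X Y assume X: "X \<in> MD k" and Y: "Y \<in> MD k"
  show "X + Y \<in> MD k"
  proof (rule MD_I)
    fix us f g ws
    show "(X + Y) (us @ f # g # ws) = - (X + Y) (us @ g # f # ws)"
      using MD_alt[OF X, of us f g ws] MD_alt[OF Y, of us f g ws] by simp
  qed (simp_all add: MD_outside[OF X] MD_outside[OF Y] add_S MD_in_S[OF X] MD_in_S[OF Y]
        MD_linear[OF X] MD_linear[OF Y] MD_deriv[OF X] MD_deriv[OF Y] algebra_simps)
next
  fix c X assume X: "X \<in> MD k"
  have c: "(c *\<^sub>R X) fs = c *\<^sub>R X fs" for fs by (simp add: scaleR_fun_def)
  show "c *\<^sub>R X \<in> MD k"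
  proof (rule MD_I)
    fix us f g ws
    show "(c *\<^sub>R X) (us @ f # g # ws) = - (c *\<^sub>R X) (us @ g # f # ws)"
      using MD_alt[OF X, of us f g ws] by (simp add: c)
  qed (simp_all add: c MD_outside[OF X] scale_S MD_in_S[OF X] MD_linear[OF X] MD_deriv[OF X] scaleR_add_right mult.commute)
qed

lemma MD_0 [simp]: "0 \<in> MD k"
  by (rule subspace_0[OF subspace_MD])

lemma contract_MD:
  assumes "X \<in> MD (Suc k)"
  shows "contract f X \<in> MD k"
proof (cases "f \<in> S")
  case True
  show ?thesis
  proof (rule MD_I)
    fix us g h ws
    show "contract f X (us @ g # h # ws) = - contract f X (us @ h # g # ws)"
      unfolding contract_def by (rule MD_alt[OF assms, of "f # us" g h ws, unfolded append_Cons])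
  next
    fix us g h c ws assume "set us \<union> {g, h} \<union> set ws \<subseteq> S"
    then have "g \<in> S" "h \<in> S" by auto
    then show "contract f X (us @ (g + c *\<^sub>R h) # ws) = contract f X (us @ g # ws) + c *\<^sub>R contract f X (us @ h # ws) \<and>
      contract f X (us @ (g * h) # ws) = g * contract f X (us @ h # ws) + h * contract f X (us @ g # ws)"
      unfolding contract_def by (intro conjI MD_linear[OF assms, of g h "f # us" c ws, unfolded append_Cons]
          MD_deriv[OF assms, of g h "f # us" ws, unfolded append_Cons])
  qed (use True in \<open>auto simp: contract_def MD_outside[OF assms] MD_in_S[OF assms]\<close>)
next
  case False
  then have "contract f X = 0" by (auto simp: contract_def fun_eq_iff MD_outside[OF assms])
  then show ?thesis by simp
qed

lemma contract_MD_0: "X \<in> MD 0 \<Longrightarrow> contract f X = 0"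
  by (auto simp: contract_def fun_eq_iff MD_outside)

lemma contract_MD_diff: "X \<in> MD k \<Longrightarrow> contract f X \<in> MD (k - 1)"
  by (cases k) (auto simp: contract_MD contract_MD_0)

lemma MD_0_iff: "X \<in> MD 0 \<longleftrightarrow> X [] \<in> S \<and> (\<forall>fs. fs \<noteq> [] \<longrightarrow> X fs = 0)"
proof
  assume X: "X [] \<in> S \<and> (\<forall>fs. fs \<noteq> [] \<longrightarrow> X fs = 0)"
  then have "X fs \<in> S" for fs by (cases "fs = []") auto
  with X show "X \<in> MD 0" by (simp add: multiderivations_def)
qed (auto simp: MD_in_S MD_length)

lemma MD_1_iff:
  "X \<in> MD 1 \<longleftrightarrow> (\<forall>fs. length fs \<noteq> 1 \<longrightarrow> X fs = 0) \<and> (\<forall>f. f \<notin> S \<longrightarrow> X [f] = 0) \<and>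
    (\<forall>f\<in>S. X [f] \<in> S) \<and> (\<forall>f\<in>S. \<forall>g\<in>S. \<forall>c. X [f + c *\<^sub>R g] = X [f] + c *\<^sub>R X [g]) \<and>
    (\<forall>f\<in>S. \<forall>g\<in>S. X [f * g] = f * X [g] + g * X [f])" (is "?l \<longleftrightarrow> ?r")
proof
  assume X: ?r
  have "X fs \<in> S" for fs
  proof (cases "length fs = 1")
    case True
    then obtain f where "fs = [f]" by (auto simp: length_Suc_conv)
    with X show ?thesis by (cases "f \<in> S") auto
  qed (use X in auto)
  moreover have "X fs = 0" if "length fs = 1 \<longrightarrow> \<not> set fs \<subseteq> S" for fs
    using X that by (cases "length fs = 1") (auto simp: length_Suc_conv)
  ultimately show ?l using X by (simp add: multiderivations_def)
qed (auto simp: MD_in_S MD_outside MD_linear0 MD_deriv0)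

text \<open>By antisymmetry it suffices to test derivations in the last slot, which is reached by contractions.\<close>

lemma MD_Suc_SucI:
  assumes "X [] = 0" "\<And>f ws. f \<notin> S \<Longrightarrow> X (f # ws) = 0" "\<And>f. f \<in> S \<Longrightarrow> contract f X \<in> MD (Suc k)"
    and alt: "\<And>f g ws. X (f # g # ws) = - X (g # f # ws)"
  shows "X \<in> MD (Suc (Suc k))"
proof -
  have 1: "X fs = 0" if "\<not> (length fs = Suc (Suc k) \<and> set fs \<subseteq> S)" for fs
  proof (cases fs)
    case (Cons f ws)
    then show ?thesis
      using that assms(2)[of f ws] MD_outside[OF assms(3), of f ws] by (cases "f \<in> S") (auto simp: contract_def)
  qed (use assms in simp)
  have 2: "X fs \<in> S" for fs
  proof (cases fs)
    case (Cons f ws)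
    then show ?thesis
      using assms(2)[of f ws] MD_in_S[OF assms(3), of f ws] by (cases "f \<in> S") (auto simp: contract_def)
  qed (use assms in simp)
  have C: "X (u # us @ (f + c *\<^sub>R g) # ws) = X (u # us @ f # ws) + c *\<^sub>R X (u # us @ g # ws) \<and>
      X (u # us @ (f * g) # ws) = f * X (u # us @ g # ws) + g * X (u # us @ f # ws)"
    if "u \<in> S" "f \<in> S" "g \<in> S" for us f g c ws u
    using MD_linear[OF assms(3), of u f g us c ws] MD_deriv[OF assms(3), of u f g us ws] that
    unfolding contract_def by blast
  have 3: "X (us @ (f + c *\<^sub>R g) # ws) = X (us @ f # ws) + c *\<^sub>R X (us @ g # ws) \<and>
      X (us @ (f * g) # ws) = f * X (us @ g # ws) + g * X (us @ f # ws)"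
    if len: "length us + length ws + 1 = Suc (Suc k)" and sub: "set us \<union> {f, g} \<union> set ws \<subseteq> S" for us f g c ws
  proof (cases us)
    case (Cons u us')
    with C[of u f g us' c ws] sub Cons show ?thesis by auto
  next
    case Nil
    then obtain w ws' where ws: "ws = w # ws'" using len Nil by (cases ws) auto
    then have "X (h # ws) = - X (w # h # ws')" for h using alt[of h w ws'] by simp
    then show ?thesis using C[of w f g "[]" c ws'] sub Nil ws by (simp add: algebra_simps)
  qed
  have 4: "X (us @ f # g # ws) = - X (us @ g # f # ws)" for us f g ws
  proof (cases us)
    case (Cons u us')
    then show ?thesis
      using assms(2)[of u] MD_alt[OF assms(3), of u us' f g ws] by (cases "u \<in> S") (auto simp: contract_def)
  qed (use alt[of f g ws] in simp)
  show ?thesis by (rule MD_I; fact 1 2 3 4)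
qed

text \<open>The head \<open>f\<close> joins either the block that is inserted or the remaining one.
  In the latter case it stands behind the inserted value, and one transposition brings it to the
  front. The outcome is that interior products are graded derivations of the bracket.\<close>

lemma contract_bracket:
  assumes X: "X \<in> MD p" and Y: "Y \<in> MD q"
  shows "contract f (bracket X Y) = bracket (contract f X) Y + (- 1) ^ (p + 1) *\<^sub>R bracket X (contract f Y)"
proof
  fix fs
  have "contract f (bracket X Y) fs = unshuffle_sum (\<lambda>L R.
    bsgn L R *\<^sub>R contract f X (Y L # R) - Y (contract f X L # R) +
    (- 1) ^ (p + 1) *\<^sub>R (bsgn L R *\<^sub>R X (contract f Y L # R) - contract f Y (X L # R))) fs"
    unfolding contract_def bracket_def unshuffle_sum_Cons
  proof (rule unshuffle_sum_cong)
    fix L R :: "'a list"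
    have X1: "X (Y L # f # R) = - X (f # Y L # R)" and Y1: "Y (X L # f # R) = - Y (f # X L # R)"
      by (rule MD_alt0[OF X] MD_alt0[OF Y])+
    \<comment> \<open>The sign varies with the length of \<open>R\<close>, but the term vanishes
      unless \<open>X\<close> receives exactly \<open>p\<close> arguments, which fixes this
      length.\<close>
    have 2: "(- 1) ^ length R *\<^sub>R X (Y (f # L) # R) = (- 1) ^ (p + 1) *\<^sub>R X (Y (f # L) # R)"
    proof (cases "p = Suc (length R)")
      case False
      then show ?thesis by (simp add: MD_length[OF X])
    qed simp
    have 3: "(- 1) ^ length L *\<^sub>R Y (f # X L # R) = (- 1) ^ p *\<^sub>R Y (f # X L # R)"
    proof (cases "p = length L")
      case False
      then have "Y (f # X L # R) = 0" using MD_zero_arg[OF Y, of "[f]"] MD_length[OF X, of L] by simp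
      then show ?thesis by simp
    qed simp
    have "(- 1) ^ (length R * (length (f # L) + 1)) *\<^sub>R X (Y (f # L) # R) =
      bsgn L R *\<^sub>R ((- 1) ^ length R *\<^sub>R X (Y (f # L) # R))"
      by (simp flip: power_add add: algebra_simps)
    also note 2
    finally have 4: "(- 1) ^ (length R * (length (f # L) + 1)) *\<^sub>R X (Y (f # L) # R) =
      (- 1) ^ (p + 1) *\<^sub>R (bsgn L R *\<^sub>R X (Y (f # L) # R))"
      by (simp only: scaleR_scaleR mult.commute)
    have 5: "(- 1 :: real) ^ length L * (- 1) ^ (length (f # R) * (length L + 1)) = - (bsgn L R)"
      by (auto simp: minus_one_power_iff)
    show "(- 1) ^ (length R * (length (f # L) + 1)) *\<^sub>R X (Y (f # L) # R) - Y (X (f # L) # R) +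
      (- 1) ^ length L *\<^sub>R ((- 1) ^ (length (f # R) * (length L + 1)) *\<^sub>R X (Y L # f # R) - Y (X L # f # R)) =
      bsgn L R *\<^sub>R X (f # Y L # R) - Y (X (f # L) # R) +
      (- 1) ^ (p + 1) *\<^sub>R (bsgn L R *\<^sub>R X (Y (f # L) # R) - Y (f # X L # R))"
      unfolding X1 Y1 scaleR_diff_right scaleR_minus_right 4
      scaleR_scaleR 5 scaleR_minus_left 3 power_add by (simp only: minus_minus) (simp add: algebra_simps)
  qed
  then show "contract f (bracket X Y) fs = (bracket (contract f X) Y + (- 1) ^ (p + 1) *\<^sub>R bracket X (contract f Y)) fs"
    by (simp only: bracket_def unshuffle_sum_add unshuffle_sum_scaleR plus_fun_apply scaleR_fun_apply)
qed

lemma contract_wedge: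
  assumes X: "X \<in> MD p"
  shows "contract f (wedge X Y) = wedge (contract f X) Y + (- 1) ^ p *\<^sub>R wedge X (contract f Y)"
proof
  fix fs
  have "contract f (wedge X Y) fs = unshuffle_sum (\<lambda>L R.
    contract f X L * Y R + (- 1) ^ p *\<^sub>R (X L * contract f Y R)) fs"
    unfolding contract_def wedge_def unshuffle_sum_Cons
  proof (rule unshuffle_sum_cong)
    fix L R :: "'a list"
    show "X (f # L) * Y R + (- 1) ^ length L *\<^sub>R (X L * Y (f # R)) =
      X (f # L) * Y R + (- 1) ^ p *\<^sub>R (X L * Y (f # R))"
      by (cases "p = length L") (simp_all add: MD_length[OF X])
  qed
  then show "contract f (wedge X Y) fs = (wedge (contract f X) Y + (- 1) ^ p *\<^sub>R wedge X (contract f Y)) fs"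
    by (simp only: wedge_def unshuffle_sum_add unshuffle_sum_scaleR plus_fun_apply scaleR_fun_apply)
qed

text \<open>Insertion into the first slot is all that the bracket uses, so this weak condition gives
  bilinearity. Unlike \<open>MD k\<close> it is stable under sums of different degrees.\<close>

definition slot_linear :: "('a list \<Rightarrow> 'a) set"
  where "slot_linear = {X. (\<forall>fs. X fs \<in> S) \<and>
    (\<forall>f\<in>S. \<forall>g\<in>S. \<forall>c ws. X ((f + c *\<^sub>R g) # ws) = X (f # ws) + c *\<^sub>R X (g # ws))}"

lemma MD_slot_linear: "X \<in> MD k \<Longrightarrow> X \<in> slot_linear"
  by (simp add: slot_linear_def MD_in_S MD_linear0)

lemma subspace_slot_linear: "subspace slot_linear"
proof (rule subspaceI)
  fix X Y assume "X \<in> slot_linear" "Y \<in> slot_linear"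
  then show "X + Y \<in> slot_linear" by (simp add: slot_linear_def add_S algebra_simps)
next
  fix c X assume "X \<in> slot_linear"
  then show "c *\<^sub>R X \<in> slot_linear" by (simp add: slot_linear_def scale_S scaleR_fun_apply algebra_simps)
qed (simp add: slot_linear_def)

lemma span_MD_slot_linear: "span (\<Union>k. MD k) \<subseteq> slot_linear"
  by (intro span_minimal subspace_slot_linear) (auto intro: MD_slot_linear)

lemma bracket_linear1:
  assumes "X \<in> slot_linear" "Y \<in> slot_linear" "Z \<in> slot_linear"
  shows "bracket (X + c *\<^sub>R Y) Z = bracket X Z + c *\<^sub>R bracket Y Z"
proof
  fix fs
  show "bracket (X + c *\<^sub>R Y) Z fs = (bracket X Z + c *\<^sub>R bracket Y Z) fs"
    unfolding bracket_def plus_fun_apply scaleR_fun_apply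
      unshuffle_sum_scaleR[symmetric] unshuffle_sum_add[symmetric] using assms
    by (intro unshuffle_sum_cong) (simp add: slot_linear_def algebra_simps)
qed

lemma bracket_linear2:
  assumes "X \<in> slot_linear" "Y \<in> slot_linear" "Z \<in> slot_linear"
  shows "bracket Z (X + c *\<^sub>R Y) = bracket Z X + c *\<^sub>R bracket Z Y"
proof
  fix fs
  show "bracket Z (X + c *\<^sub>R Y) fs = (bracket Z X + c *\<^sub>R bracket Z Y) fs"
    unfolding bracket_def plus_fun_apply scaleR_fun_apply
      unshuffle_sum_scaleR[symmetric] unshuffle_sum_add[symmetric] using assms
    by (intro unshuffle_sum_cong) (simp add: slot_linear_def algebra_simps)
qed

lemma bracket_zero:
  assumes "X \<in> slot_linear"
  shows "bracket 0 X = 0" "bracket X 0 = 0"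
  using bracket_linear1[of 0 0 X 1] bracket_linear2[of 0 0 X 1] assms
  by (simp_all add: subspace_0[OF subspace_slot_linear])

lemmas bracket_zeroM = bracket_zero[OF MD_slot_linear]

lemma bracket_scale1: "X \<in> MD p \<Longrightarrow> Z \<in> MD r \<Longrightarrow> bracket (c *\<^sub>R X) Z = c *\<^sub>R bracket X Z"
  using bracket_linear1[of 0 X Z c] by (simp add: MD_slot_linear bracket_zeroM subspace_0[OF subspace_slot_linear])

lemma bracket_scale2: "X \<in> MD p \<Longrightarrow> Z \<in> MD r \<Longrightarrow> bracket Z (c *\<^sub>R X) = c *\<^sub>R bracket Z X"
  using bracket_linear2[of 0 X Z c] by (simp add: MD_slot_linear bracket_zeroM subspace_0[OF subspace_slot_linear])

lemma bracket_minus1: "X \<in> MD p \<Longrightarrow> Z \<in> MD r \<Longrightarrow> bracket (- X) Z = - bracket X Z"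
  using bracket_scale1[of X p Z r "- 1"] by simp

lemma bracket_minus2: "X \<in> MD p \<Longrightarrow> Z \<in> MD r \<Longrightarrow> bracket Z (- X) = - bracket Z X"
  using bracket_scale2[of X p Z r "- 1"] by simp

lemma wedge_linear1: "wedge (X + c *\<^sub>R Y) Z = wedge X Z + c *\<^sub>R wedge Y Z"
  unfolding wedge_def fun_eq_iff plus_fun_apply scaleR_fun_apply
    unshuffle_sum_scaleR[symmetric] unshuffle_sum_add[symmetric]
  by (simp add: unshuffle_sum_def scaleR_fun_apply algebra_simps)

lemma wedge_linear2: "wedge Z (X + c *\<^sub>R Y) = wedge Z X + c *\<^sub>R wedge Z Y"
  unfolding wedge_def fun_eq_iff plus_fun_apply scaleR_fun_apply
    unshuffle_sum_scaleR[symmetric] unshuffle_sum_add[symmetric]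
  by (simp add: unshuffle_sum_def scaleR_fun_apply algebra_simps)

lemma wedge_zero [simp]: "wedge 0 X = 0" "wedge X 0 = 0"
  using wedge_linear1[of 0 1 0 X] wedge_linear2[of X 0 1 0] by simp_all

lemma wedge_add1: "wedge (X + Y) Z = wedge X Z + wedge Y Z"
  using wedge_linear1[of X 1 Y Z] by simp

lemma wedge_add2: "wedge Z (X + Y) = wedge Z X + wedge Z Y"
  using wedge_linear2[of Z X 1 Y] by simp

lemma wedge_scale1: "wedge (c *\<^sub>R X) Z = c *\<^sub>R wedge X Z"
  using wedge_linear1[of 0 c X Z] by simp

lemma wedge_scale2: "wedge Z (c *\<^sub>R X) = c *\<^sub>R wedge Z X"
  using wedge_linear2[of Z 0 c X] by simp

lemma wedge_minus1: "wedge (- X) Z = - wedge X Z"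
  using wedge_scale1[of "- 1"] by simp

lemma wedge_minus2: "wedge Z (- X) = - wedge Z X"
  using wedge_scale2[of Z "- 1"] by simp

lemma bracket_length:
  assumes "X \<in> MD p" "Y \<in> MD q" "length fs + 1 \<noteq> p + q"
  shows "bracket X Y fs = 0"
proof -
  have "bracket X Y fs = unshuffle_sum (\<lambda>L R. 0) fs" unfolding bracket_def
  proof (rule unshuffle_sum_cong)
    fix L R :: "'a list" assume "length L + length R = length fs"
    then have "(length L \<noteq> q \<or> length R + 1 \<noteq> p) \<and> (length L \<noteq> p \<or> length R + 1 \<noteq> q)"
      using assms(3) by auto
    then have "X (Y L # R) = 0" "Y (X L # R) = 0"
      using MD_length[OF assms(1)] MD_length[OF assms(2)] MD_zero_arg0[OF assms(1)] MD_zero_arg0[OF assms(2)]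
      by (metis Suc_eq_plus1 length_Cons)+
    then show "bsgn L R *\<^sub>R X (Y L # R) - Y (X L # R) = 0" by simp
  qed
  then show ?thesis by simp
qed

lemma bracket_0_0: "X \<in> MD 0 \<Longrightarrow> Y \<in> MD 0 \<Longrightarrow> bracket X Y = 0"
  by (rule ext) (simp add: bracket_length)

text \<open>Exchanging \<open>X\<close> and \<open>Y\<close> exchanges the two kinds of summands.
  Each is nonzero for one pair of block lengths only, and there \<open>bsgn\<close> has the parity
  of (p + 1)(q + 1).\<close>

lemma bracket_antisym:
  assumes "X \<in> MD p" "Y \<in> MD q"
  shows "bracket X Y = - ((- 1) ^ ((p + 1) * (q + 1)) *\<^sub>R bracket Y X)"
proof
  fix fs
  have "bracket X Y fs = unshuffle_sum (\<lambda>L R. (- ((- 1) ^ ((p + 1) * (q + 1)))) *\<^sub>R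
    (bsgn L R *\<^sub>R Y (X L # R) - X (Y L # R))) fs" unfolding bracket_def
  proof (rule unshuffle_sum_cong)
    fix L R :: "'a list"
    have 1: "bsgn L R *\<^sub>R X (Y L # R) = (- 1) ^ ((p + 1) * (q + 1)) *\<^sub>R X (Y L # R)"
    proof (cases "length L = q \<and> Suc (length R) = p")
      case True
      then show ?thesis by (auto simp: minus_one_power_iff)
    next
      case False
      then have "X (Y L # R) = 0" using MD_length[OF assms(1)] MD_length[OF assms(2)] MD_zero_arg0[OF assms(1)]
        by (metis length_Cons)
      then show ?thesis by simp
    qed
    have 2: "Y (X L # R) = (- 1) ^ ((p + 1) * (q + 1)) *\<^sub>R bsgn L R *\<^sub>R Y (X L # R)"
    proof (cases "length L = p \<and> Suc (length R) = q")
      case True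
      then show ?thesis by (auto simp: minus_one_power_iff)
    next
      case False
      then have "Y (X L # R) = 0" using MD_length[OF assms(1)] MD_length[OF assms(2)] MD_zero_arg0[OF assms(2)]
        by (metis length_Cons)
      then show ?thesis by simp
    qed
    show "bsgn L R *\<^sub>R X (Y L # R) - Y (X L # R) =
      (- ((- 1) ^ ((p + 1) * (q + 1)))) *\<^sub>R (bsgn L R *\<^sub>R Y (X L # R) - X (Y L # R))"
      unfolding 1 scaleR_diff_right scaleR_minus_left 2[symmetric] by simp
  qed
  then show "bracket X Y fs = (- ((- 1) ^ ((p + 1) * (q + 1)) *\<^sub>R bracket Y X)) fs"
    by (simp only: bracket_def unshuffle_sum_scaleR unshuffle_sum_minus uminus_apply scaleR_fun_apply scaleR_minus_left)
qed

lemma contract_contract: "X \<in> MD k \<Longrightarrow> contract f (contract g X) = - contract g (contract f X)"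
proof
  fix fs assume "X \<in> MD k"
  then show "contract f (contract g X) fs = (- contract g (contract f X)) fs"
    unfolding contract_def uminus_apply by (rule MD_alt0)
qed

lemma contract_zero [simp]: "contract f 0 = 0"
  by (simp add: contract_def fun_eq_iff)

lemma contract_outside: "X \<in> MD k \<Longrightarrow> f \<notin> S \<Longrightarrow> contract f X = 0"
  by (rule ext) (simp add: contract_def MD_outside)

lemma contract_add: "contract f (X + Y) = contract f X + contract f Y"
  and contract_scale: "contract f (c *\<^sub>R X) = c *\<^sub>R contract f X"
  by (simp_all add: contract_def fun_eq_iff scaleR_fun_apply)

lemma contract_bracket1:
  assumes X: "X \<in> MD p" and Y: "Y \<in> MD q"
  shows "contract f (bracket (contract g X) Y) =
    bracket (contract f (contract g X)) Y + (- 1) ^ p *\<^sub>R bracket (contract g X) (contract f Y)"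
proof (cases p)
  case 0
  then show ?thesis using X Y
    by (simp add: contract_MD_0 bracket_zeroM[OF Y] bracket_zeroM[OF contract_MD_diff[OF Y]] contract_zero)
next
  case (Suc p')
  with contract_bracket[OF contract_MD Y] X show ?thesis by simp
qed

text \<open>The mixed terms change sign when \<open>f\<close> and \<open>g\<close> are exchanged;
  this makes the bracket alternating in its first two arguments.\<close>

lemma contract_contract_bracket:
  assumes X: "X \<in> MD p" and Y: "Y \<in> MD q"
  shows "contract g (contract f (bracket X Y)) =
    bracket (contract g (contract f X)) Y + bracket X (contract g (contract f Y)) +
    (- 1) ^ p *\<^sub>R (bracket (contract f X) (contract g Y) - bracket (contract g X) (contract f Y))"
  unfolding contract_bracket[OF X Y] contract_add contract_scale contract_bracket1[OF X Y]
    contract_bracket[OF X contract_MD_diff[OF Y]]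
  by (simp add: algebra_simps scaleR_scaleR[symmetric] del: scaleR_scaleR) (simp add: power_add[symmetric])

lemma bracket_at_one:
  assumes X: "X \<in> MD p" and Y: "Y \<in> MD q"
  shows "bracket X Y [f] = X [f, Y []] - Y [X [f]] + (- 1) ^ (p + 1) *\<^sub>R (X [Y [f]] - Y [f, X []])"
proof -
  have "bracket X Y [f] = contract f (bracket X Y) []" by (simp add: contract_def)
  then show ?thesis unfolding contract_bracket[OF X Y]
    by (simp only: plus_fun_apply scaleR_fun_apply bracket_Nil) (simp add: contract_def)
qed

text \<open>For a result of degree 1 a contraction leaves no slot in which to test the derivation
  property, so it is checked directly; for two vector fields the second-order terms cancel as in a
  commutator.\<close>

lemma bracket_MD_2:
  assumes X: "X \<in> MD p" and Y: "Y \<in> MD q" and pq: "p + q = 2"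
  shows "bracket X Y \<in> MD 1"
proof -
  note S = MD_in_S[OF X] MD_in_S[OF Y]
  have out: "X [f] = 0" "Y [f] = 0" "X [f, g] = 0" "Y [f, g] = 0" if "f \<notin> S" for f g
    using that by (auto intro!: MD_outside[OF X] MD_outside[OF Y])
  consider "p = 2" "q = 0" | "p = 1" "q = 1" | "p = 0" "q = 2" using pq by linarith
  then have D: "bracket X Y [f * g] = f * bracket X Y [g] + g * bracket X Y [f]" if "f \<in> S" "g \<in> S" for f g
  proof cases
    case 1
    have "Y h = 0" if "h \<noteq> []" for h using MD_length[OF Y] that 1 by simp
    then show ?thesis using that 1
      by (simp add: bracket_at_one[OF X Y] MD_zero_arg0[OF X] MD_zero_arg0[OF Y] MD_deriv0[OF X])
  next
    case 2
    have "X [] = 0" "Y [] = 0" "X [h, k] = 0" "Y [h, k] = 0" for h k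
      using MD_length[OF X] MD_length[OF Y] 2 by simp_all
    then show ?thesis using that 2
      by (simp add: bracket_at_one[OF X Y] MD_add_arg0[OF X] MD_add_arg0[OF Y] MD_deriv0[OF X] MD_deriv0[OF Y]
          S mult_S algebra_simps)
  next
    case 3
    have "X h = 0" if "h \<noteq> []" for h using MD_length[OF X] that 3 by simp
    then show ?thesis using that 3
      by (simp add: bracket_at_one[OF X Y] MD_zero_arg0[OF X] MD_zero_arg0[OF Y] MD_deriv0[OF Y])
  qed
  show ?thesis unfolding MD_1_iff
  proof (intro conjI allI impI ballI)
    fix fs :: "'a list" assume "length fs \<noteq> 1"
    then show "bracket X Y fs = 0" using pq by (intro bracket_length[OF X Y]) auto
  next
    fix f assume f: "f \<notin> S"
    show "bracket X Y [f] = 0" by (simp add: bracket_at_one[OF X Y] out[OF f] MD_zero_arg0[OF X] MD_zero_arg0[OF Y])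
  next
    fix f g c assume "f \<in> S" "g \<in> S"
    then show "bracket X Y [f + c *\<^sub>R g] = bracket X Y [f] + c *\<^sub>R bracket X Y [g]"
      by (simp add: bracket_at_one[OF X Y] MD_linear0[OF X] MD_linear0[OF Y] S algebra_simps)
  next
    fix f g assume "f \<in> S" "g \<in> S"
    then show "bracket X Y [f * g] = f * bracket X Y [g] + g * bracket X Y [f]" by (rule D)
  qed (simp add: bracket_at_one[OF X Y] S diff_S add_S scale_S minus_S)
qed

text \<open>By induction on p + q: a bracket of degree at least 2 is tested on its contractions,
  which are brackets of smaller total degree. For p = q = 0 the truncated degree 0 does no harm
  because the bracket vanishes.\<close>

lemma bracket_MD:
  assumes "X \<in> MD p" "Y \<in> MD q"
  shows "bracket X Y \<in> MD (p + q - 1)"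
  using assms
proof (induction "p + q" arbitrary: p q X Y rule: less_induct)
  case less
  note X = less.prems(1) and Y = less.prems(2)
  consider "p + q = 0" | "p + q = 1" | "p + q = 2" | k where "p + q = Suc (Suc (Suc k))"
    by (metis One_nat_def Suc_1 not0_implies_Suc)
  then show ?case
  proof cases
    case 1
    with X Y bracket_0_0 show ?thesis by simp
  next
    case 2
    then show ?thesis by (simp add: MD_0_iff bracket_Nil diff_S MD_in_S[OF X] MD_in_S[OF Y] bracket_length[OF X Y])
  next
    case 3
    with bracket_MD_2[OF X Y] show ?thesis by simp
  next
    case 4
    have "bracket X Y \<in> MD (Suc (Suc k))"
    proof (rule MD_Suc_SucI)
      show "bracket X Y [] = 0" by (rule bracket_length[OF X Y]) (simp add: 4)
    next
      fix f ws assume "f \<notin> S"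
      then have "contract f X = 0" "contract f Y = 0" using contract_outside X Y by blast+
      then have "contract f (bracket X Y) = 0"
        by (simp add: contract_bracket[OF X Y] bracket_zeroM[OF X] bracket_zeroM[OF Y])
      then show "bracket X Y (f # ws) = 0" by (simp add: contract_def fun_eq_iff)
    next
      fix f
      have "bracket (contract f X) Y \<in> MD (Suc k)"
      proof (cases p)
        case 0
        with X show ?thesis by (simp add: contract_MD_0 bracket_zeroM[OF Y])
      next
        case (Suc p')
        with less.hyps[OF _ contract_MD Y, of p' X f] X 4 show ?thesis by simp
      qed
      moreover have "bracket X (contract f Y) \<in> MD (Suc k)"
      proof (cases q)
        case 0
        with Y show ?thesis by (simp add: contract_MD_0 bracket_zeroM[OF X])
      next
        case (Suc q')
        with less.hyps[OF _ X contract_MD, of q' Y f] Y 4 show ?thesis by simp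
      qed
      ultimately show "contract f (bracket X Y) \<in> MD (Suc k)"
        unfolding contract_bracket[OF X Y] by (intro subspace_add subspace_scale subspace_MD)
    next
      fix f g ws
      have "contract g (contract f (bracket X Y)) = - contract f (contract g (bracket X Y))"
        unfolding contract_contract_bracket[OF X Y]
          contract_contract[OF X, of g f] contract_contract[OF Y, of g f]
          bracket_minus1[OF contract_MD_diff[OF contract_MD_diff[OF X]] Y]
          bracket_minus2[OF contract_MD_diff[OF contract_MD_diff[OF Y]] X] by (simp add: algebra_simps)
      then show "bracket X Y (f # g # ws) = - bracket X Y (g # f # ws)" by (simp add: contract_def fun_eq_iff)
    qed
    with 4 show ?thesis by simp
  qed
qed

lemma contract_bracket2:
  assumes X: "X \<in> MD p" and Y: "Y \<in> MD q" and Z: "Z \<in> MD r"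
  shows "contract f (bracket (bracket X Y) Z) =
    bracket (contract f (bracket X Y)) Z + (- 1) ^ (p + q) *\<^sub>R bracket (bracket X Y) (contract f Z)"
proof (cases "p + q = 0")
  case True
  then show ?thesis using X Y by (simp add: bracket_0_0 bracket_zeroM[OF Z] bracket_zeroM[OF contract_MD_diff[OF Z]])
next
  case False
  then show ?thesis using contract_bracket[OF bracket_MD[OF X Y] Z] by simp
qed

text \<open>Turns identities between expressions in brackets and wedge products into inductions on
  the total degree.\<close>

lemma eq_by_contraction:
  fixes A B :: "'a list \<Rightarrow> 'a"
  assumes "A [] = B []" "\<And>f. contract f A = contract f B"
  shows "A = B"
proof
  fix fs
  show "A fs = B fs"
  proof (cases fs)
    case (Cons f ws)
    with fun_cong[OF assms(2)[of f], of ws] show ?thesis by (simp add: contract_def)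
  qed (use assms in simp)
qed

lemma contract_MD_cases:
  assumes "X \<in> MD k"
  obtains "contract f X = 0" "k = 0" | j where "k = Suc j" "contract f X \<in> MD j"
  using assms contract_MD contract_MD_0 by (cases k) auto

text \<open>Without arguments only terms of total degree 2 survive, which leaves six distributions
  of the degrees and the case where every term vanishes.\<close>

lemma bracket_jacobi_Nil:
  assumes X: "X \<in> MD p" and Y: "Y \<in> MD q" and Z: "Z \<in> MD r"
  shows "bracket X (bracket Y Z) [] =
    bracket (bracket X Y) Z [] + (- 1) ^ ((p + 1) * (q + 1)) *\<^sub>R bracket Y (bracket X Z) []"
proof -
  note S = MD_in_S[OF X] MD_in_S[OF Y] MD_in_S[OF Z]
  note D = MD_diff_arg0[OF X] MD_diff_arg0[OF Y] MD_diff_arg0[OF Z]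
  have len: "X fs = 0" if "length fs \<noteq> p" for fs using that by (rule MD_length[OF X])
  have len': "Y fs = 0" if "length fs \<noteq> q" for fs using that by (rule MD_length[OF Y])
  have len'': "Z fs = 0" if "length fs \<noteq> r" for fs using that by (rule MD_length[OF Z])
  note sw = MD_alt0[OF X, of "Z []" "Y []" "[]"] MD_alt0[OF Y, of "Z []" "X []" "[]"]
    MD_alt0[OF Z, of "Y []" "X []" "[]"]
  have E: "X [Y [Z []] - Z [Y []]] - (Y [X [], Z []] - Z [Y [X []]] + (- 1) ^ (q + 1) *\<^sub>R (Y [Z [X []]] - Z [X [], Y []])) =
    X [Z [], Y []] - Y [X [Z []]] + (- 1) ^ (p + 1) *\<^sub>R (X [Y [Z []]] - Y [Z [], X []]) - Z [X [Y []] - Y [X []]] +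
    (- 1) ^ ((p + 1) * (q + 1)) *\<^sub>R (Y [X [Z []] - Z [X []]] -
      (X [Y [], Z []] - Z [X [Y []]] + (- 1) ^ (p + 1) *\<^sub>R (X [Z [Y []]] - Z [Y [], X []])))"
  proof -
    consider "p = 2" "q = 0" "r = 0" | "p = 0" "q = 2" "r = 0" | "p = 0" "q = 0" "r = 2"
      | "p = 1" "q = 1" "r = 0" | "p = 1" "q = 0" "r = 1" | "p = 0" "q = 1" "r = 1" | "p + q + r \<noteq> 2"
    proof (cases "p + q + r = 2")
      case True
      then have "p \<in> {0, 1, 2}" "q \<in> {0, 1, 2}" "r = 2 - p - q" by auto
      with True that show ?thesis by auto
    qed
    then show ?thesis
    proof cases
      case 7
      have c: "p + q + r \<noteq> 2" "p + r + q \<noteq> 2" "q + p + r \<noteq> 2" "q + r + p \<noteq> 2" "r + p + q \<noteq> 2" "r + q + p \<noteq> 2"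
        using 7 by linarith+
      \<comment> \<open>Every term is a chain as in \<open>T1\<close> or a fork as in
        \<open>T2\<close>, and both shapes are nonzero only in total degree 2.\<close>
      have T1: "A [B [C []]] = 0" if "A \<in> MD a" "B \<in> MD b" "C \<in> MD c" "a + b + c \<noteq> 2" for A B C a b c
      proof (cases "c = 0")
        case False
        then have "C [] = 0" using MD_length[OF that(3)] by simp
        then show ?thesis by (simp add: MD_zero_arg0[OF that(1)] MD_zero_arg0[OF that(2)])
      next
        case 0: True
        show ?thesis
        proof (cases "b = 1")
          case False
          then have "B [C []] = 0" using MD_length[OF that(2)] by simp
          then show ?thesis by (simp add: MD_zero_arg0[OF that(1)])
        next
          case True
          with 0 that(4) MD_length[OF that(1)] show ?thesis by simp
        qed
      qed
      have T2: "A [B [], C []] = 0" if "A \<in> MD a" "B \<in> MD b" "C \<in> MD c" "a + b + c \<noteq> 2" for A B C a b c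
      proof (cases "b = 0 \<and> c = 0")
        case False
        then have "C [] = 0 \<or> B [] = 0" using MD_length[OF that(3)] MD_length[OF that(2)] by auto
        then show ?thesis using MD_zero_arg0[OF that(1)] MD_zero_arg[OF that(1), of "[B []]" "[]"] by auto
      next
        case True
        with that(4) MD_length[OF that(1)] show ?thesis by simp
      qed
      show ?thesis by (simp add: D S T1[OF X Y Z c(1)] T1[OF X Z Y c(2)] T1[OF Y X Z c(3)] T1[OF Y Z X c(4)]
            T1[OF Z X Y c(5)] T1[OF Z Y X c(6)] T2[OF X Y Z c(1)] T2[OF X Z Y c(2)] T2[OF Y X Z c(3)]
            T2[OF Y Z X c(4)] T2[OF Z X Y c(5)] T2[OF Z Y X c(6)])
    qed (simp_all add: len len' len'' D S MD_minus_arg0[OF X] MD_minus_arg0[OF Y] MD_minus_arg0[OF Z] MD_zero_arg0[OF X] MD_zero_arg0[OF Y] MD_zero_arg0[OF Z]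
        MD_zero_arg[OF X, of "[_]", simplified] MD_zero_arg[OF Y, of "[_]", simplified]
        MD_zero_arg[OF Z, of "[_]", simplified] sw)
  qed
  then show ?thesis unfolding bracket_Nil bracket_at_one[OF Y Z] bracket_at_one[OF X Y] bracket_at_one[OF X Z] .
qed

text \<open>Contraction of both sides produces the same identity for the triples in which one entry
  is contracted; each of these has smaller total degree or a vanishing entry.\<close>

lemma bracket_jacobi:
  assumes "X \<in> MD p" "Y \<in> MD q" "Z \<in> MD r"
  shows "bracket X (bracket Y Z) =
    bracket (bracket X Y) Z + (- 1) ^ ((p + 1) * (q + 1)) *\<^sub>R bracket Y (bracket X Z)" using assms
proof (induction "p + q + r" arbitrary: p q r X Y Z rule: less_induct)
  case less
  note X = less.prems(1) and Y = less.prems(2) and Z = less.prems(3)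
  note cX = contract_MD_diff[OF X] and cY = contract_MD_diff[OF Y] and cZ = contract_MD_diff[OF Z]
  note z = bracket_zeroM[OF X] bracket_zeroM[OF Y] bracket_zeroM[OF Z] bracket_zeroM[OF bracket_MD[OF X Y]]
    bracket_zeroM[OF bracket_MD[OF Y Z]] bracket_zeroM[OF bracket_MD[OF X Z]]
  show ?case
  proof (rule eq_by_contraction)
    fix f
    have 1: "bracket (contract f X) (bracket Y Z) =
      bracket (bracket (contract f X) Y) Z + (- 1) ^ (p * (q + 1)) *\<^sub>R bracket Y (bracket (contract f X) Z)"
    proof (cases rule: contract_MD_cases[OF X, of f])
      case (2 j)
      with less.hyps[OF _ 2(2) Y Z] show ?thesis by simp
    qed (simp add: z)
    have 2: "bracket X (bracket (contract f Y) Z) =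
      bracket (bracket X (contract f Y)) Z + (- 1) ^ ((p + 1) * q) *\<^sub>R bracket (contract f Y) (bracket X Z)"
    proof (cases rule: contract_MD_cases[OF Y, of f])
      case (2 j)
      with less.hyps[OF _ X 2(2) Z] show ?thesis by simp
    qed (simp add: z)
    have 3: "bracket X (bracket Y (contract f Z)) =
      bracket (bracket X Y) (contract f Z) + (- 1) ^ ((p + 1) * (q + 1)) *\<^sub>R bracket Y (bracket X (contract f Z))"
    proof (cases rule: contract_MD_cases[OF Z, of f])
      case (2 j)
      with less.hyps[OF _ X Y 2(2)] show ?thesis by simp
    qed (simp add: z)
    have 4: "contract f (bracket X (bracket Y Z)) = bracket (contract f X) (bracket Y Z) +
      (- 1) ^ (p + 1) *\<^sub>R (bracket X (bracket (contract f Y) Z) +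
        (- 1) ^ (q + 1) *\<^sub>R bracket X (bracket Y (contract f Z)))"
      unfolding contract_bracket[OF X bracket_MD[OF Y Z]] contract_bracket[OF Y Z]
        bracket_linear2[OF MD_slot_linear[OF bracket_MD[OF cY Z]] MD_slot_linear[OF bracket_MD[OF Y cZ]] MD_slot_linear[OF X]] ..
    have 5: "contract f (bracket Y (bracket X Z)) = bracket (contract f Y) (bracket X Z) +
      (- 1) ^ (q + 1) *\<^sub>R (bracket Y (bracket (contract f X) Z) +
        (- 1) ^ (p + 1) *\<^sub>R bracket Y (bracket X (contract f Z)))"
      unfolding contract_bracket[OF Y bracket_MD[OF X Z]] contract_bracket[OF X Z]
        bracket_linear2[OF MD_slot_linear[OF bracket_MD[OF cX Z]] MD_slot_linear[OF bracket_MD[OF X cZ]] MD_slot_linear[OF Y]] ..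
    have 6: "contract f (bracket (bracket X Y) Z) = bracket (bracket (contract f X) Y) Z +
        (- 1) ^ (p + 1) *\<^sub>R bracket (bracket X (contract f Y)) Z +
        (- 1) ^ (p + q) *\<^sub>R bracket (bracket X Y) (contract f Z)"
      unfolding contract_bracket2[OF X Y Z] contract_bracket[OF X Y]
        bracket_linear1[OF MD_slot_linear[OF bracket_MD[OF cX Y]] MD_slot_linear[OF bracket_MD[OF X cY]] MD_slot_linear[OF Z]] ..
    show "contract f (bracket X (bracket Y Z)) =
      contract f (bracket (bracket X Y) Z + (- 1) ^ ((p + 1) * (q + 1)) *\<^sub>R bracket Y (bracket X Z))"
      unfolding contract_add contract_scale 4 5 6 1 2 3
      by (cases "even p"; cases "even q") (simp_all add: minus_one_power_iff algebra_simps)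
  qed (simp add: bracket_jacobi_Nil[OF X Y Z] scaleR_fun_apply)
qed

section \<open>Wedge products and the Leibniz rule of the bracket\<close>

lemma wedge_length:
  assumes "X \<in> MD p" "Y \<in> MD q" "length fs \<noteq> p + q"
  shows "wedge X Y fs = 0"
proof -
  have "wedge X Y fs = unshuffle_sum (\<lambda>L R. 0) fs" unfolding wedge_def
  proof (rule unshuffle_sum_cong)
    fix L R :: "'a list" assume "length L + length R = length fs"
    then have "length L \<noteq> p \<or> length R \<noteq> q" using assms(3) by auto
    then show "X L * Y R = 0" using MD_length[OF assms(1)] MD_length[OF assms(2)] by auto
  qed
  then show ?thesis by simp
qed

lemma wedge_at_one: "X \<in> MD p \<Longrightarrow> wedge X Y [f] = X [f] * Y [] + (- 1) ^ p *\<^sub>R (X [] * Y [f])"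
  using fun_cong[OF contract_wedge[of X p f Y], of "[]"] by (simp add: contract_def scaleR_fun_apply wedge_Nil)

lemma contract_wedge1:
  assumes X: "X \<in> MD p"
  shows "contract f (wedge (contract g X) Y) =
    wedge (contract f (contract g X)) Y - (- 1) ^ p *\<^sub>R wedge (contract g X) (contract f Y)"
proof (cases p)
  case 0
  with X show ?thesis by (simp add: contract_MD_0)
next
  case (Suc p')
  with contract_wedge[OF contract_MD] X show ?thesis by simp
qed

lemma contract_contract_wedge:
  assumes X: "X \<in> MD p"
  shows "contract g (contract f (wedge X Y)) =
    wedge (contract g (contract f X)) Y + wedge X (contract g (contract f Y)) +
    (- 1) ^ p *\<^sub>R (wedge (contract g X) (contract f Y) - wedge (contract f X) (contract g Y))"
  unfolding contract_wedge[OF X] contract_add contract_scale contract_wedge1[OF X]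
  by (simp add: algebra_simps scaleR_scaleR[symmetric] del: scaleR_scaleR) (simp add: power_add[symmetric])

lemma wedge_MD:
  assumes "X \<in> MD p" "Y \<in> MD q"
  shows "wedge X Y \<in> MD (p + q)"
  using assms
proof (induction "p + q" arbitrary: p q X Y rule: less_induct)
  case less
  note X = less.prems(1) and Y = less.prems(2)
  consider "p = 0" "q = 0" | "p = 1" "q = 0" | "p = 0" "q = 1" | k where "p + q = Suc (Suc k)"
    by (metis One_nat_def add_is_0 not0_implies_Suc add_is_1)
  then show ?case
  proof cases
    case 1
    then show ?thesis by (simp add: MD_0_iff wedge_Nil mult_S MD_in_S[OF X] MD_in_S[OF Y] wedge_length[OF X Y])
  next
    case 2
    have "wedge X Y \<in> MD 1" unfolding MD_1_iff using X Y 2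
      by (auto simp: wedge_at_one[OF X] wedge_length[OF X Y] MD_outside[OF X] MD_length[OF X] mult_S
          MD_in_S[OF X] MD_in_S[OF Y] MD_linear0[OF X] MD_deriv0[OF X] algebra_simps)
    with 2 show ?thesis by simp
  next
    case 3
    have "wedge X Y \<in> MD 1" unfolding MD_1_iff using X Y 3
      by (auto simp: wedge_at_one[OF X] wedge_length[OF X Y] MD_outside[OF Y] MD_length[OF X] mult_S
          MD_length[OF Y] MD_in_S[OF X] MD_in_S[OF Y] MD_linear0[OF Y] MD_deriv0[OF Y] algebra_simps)
    with 3 show ?thesis by simp
  next
    case 4
    have "wedge X Y \<in> MD (Suc (Suc k))"
    proof (rule MD_Suc_SucI)
      show "wedge X Y [] = 0" by (rule wedge_length[OF X Y]) (simp add: 4)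
    next
      fix f ws assume "f \<notin> S"
      then have "contract f X = 0" "contract f Y = 0" using contract_outside X Y by blast+
      then have "contract f (wedge X Y) = 0" by (simp add: contract_wedge[OF X])
      then show "wedge X Y (f # ws) = 0" by (simp add: contract_def fun_eq_iff)
    next
      fix f
      have "wedge (contract f X) Y \<in> MD (Suc k)"
      proof (cases rule: contract_MD_cases[OF X, of f])
        case (2 j)
        with less.hyps[OF _ 2(2) Y] 4 show ?thesis by simp
      qed simp
      moreover have "wedge X (contract f Y) \<in> MD (Suc k)"
      proof (cases rule: contract_MD_cases[OF Y, of f])
        case (2 j)
        with less.hyps[OF _ X 2(2)] 4 show ?thesis by simp
      qed simp
      ultimately show "contract f (wedge X Y) \<in> MD (Suc k)"
        unfolding contract_wedge[OF X] by (intro subspace_add subspace_scale subspace_MD)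
    next
      fix f g ws
      have "contract g (contract f (wedge X Y)) = - contract f (contract g (wedge X Y))"
        unfolding contract_contract_wedge[OF X]
          contract_contract[OF X, of g f] contract_contract[OF Y, of g f]
          wedge_minus1 wedge_minus2 by (simp add: algebra_simps)
      then show "wedge X Y (f # g # ws) = - wedge X Y (g # f # ws)" by (simp add: contract_def fun_eq_iff)
    qed
    with 4 show ?thesis by simp
  qed
qed

lemma wedge_assoc:
  assumes "X \<in> MD p" "Y \<in> MD q" "Z \<in> MD r"
  shows "wedge (wedge X Y) Z = wedge X (wedge Y Z)"
  using assms
proof (induction "p + q + r" arbitrary: p q r X Y Z rule: less_induct)
  case less
  note X = less.prems(1) and Y = less.prems(2) and Z = less.prems(3)
  show ?case
  proof (rule eq_by_contraction)
    fix f
    have 1: "wedge (wedge (contract f X) Y) Z = wedge (contract f X) (wedge Y Z)"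
    proof (cases rule: contract_MD_cases[OF X, of f])
      case (2 j)
      with less.hyps[OF _ 2(2) Y Z] show ?thesis by simp
    qed simp
    have 2: "wedge (wedge X (contract f Y)) Z = wedge X (wedge (contract f Y) Z)"
    proof (cases rule: contract_MD_cases[OF Y, of f])
      case (2 j)
      with less.hyps[OF _ X 2(2) Z] show ?thesis by simp
    qed simp
    have 3: "wedge (wedge X Y) (contract f Z) = wedge X (wedge Y (contract f Z))"
    proof (cases rule: contract_MD_cases[OF Z, of f])
      case (2 j)
      with less.hyps[OF _ X Y 2(2)] show ?thesis by simp
    qed simp
    show "contract f (wedge (wedge X Y) Z) = contract f (wedge X (wedge Y Z))"
      unfolding contract_wedge[OF wedge_MD[OF X Y]] contract_wedge[OF X] contract_wedge[OF Y]
        wedge_add1 wedge_scale1 wedge_add2 wedge_scale2 1 2 3 by (simp add: power_add algebra_simps)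
  qed (simp add: wedge_Nil mult.assoc)
qed

lemma bracket_wedge:
  assumes "X \<in> MD p" "Y \<in> MD q" "Z \<in> MD r"
  shows "bracket X (wedge Y Z) =
    wedge (bracket X Y) Z + (- 1) ^ ((p + 1) * q) *\<^sub>R wedge Y (bracket X Z)" using assms
proof (induction "p + q + r" arbitrary: p q r X Y Z rule: less_induct)
  case less
  note X = less.prems(1) and Y = less.prems(2) and Z = less.prems(3)
  note cX = contract_MD_diff[OF X] and cY = contract_MD_diff[OF Y] and cZ = contract_MD_diff[OF Z]
  note z = bracket_zeroM[OF X] bracket_zeroM[OF Y] bracket_zeroM[OF Z] bracket_zeroM[OF wedge_MD[OF Y Z]]
  \<comment> \<open>Stated with p + q, since the degree p + q - 1 of the bracket is truncated when p
    + q = 0, where the bracket itself vanishes.\<close>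
  have 7: "contract f (wedge (bracket X Y) Z) =
    wedge (contract f (bracket X Y)) Z - (- 1) ^ (p + q) *\<^sub>R wedge (bracket X Y) (contract f Z)" for f
  proof (cases "p + q = 0")
    case True
    with X Y show ?thesis by (simp add: bracket_0_0)
  next
    case False
    then have "(- 1) ^ (p + q - 1) = - ((- 1) ^ (p + q) :: real)" by (cases "p + q") auto
    with contract_wedge[OF bracket_MD[OF X Y]] show ?thesis by simp
  qed
  show ?case
  proof (rule eq_by_contraction)
    fix f
    have 1: "bracket (contract f X) (wedge Y Z) =
      wedge (bracket (contract f X) Y) Z + (- 1) ^ (p * q) *\<^sub>R wedge Y (bracket (contract f X) Z)"
    proof (cases rule: contract_MD_cases[OF X, of f])
      case (2 j)
      with less.hyps[OF _ 2(2) Y Z] show ?thesis by simp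
    qed (simp add: z)
    have 2: "bracket X (wedge (contract f Y) Z) =
      wedge (bracket X (contract f Y)) Z + (- 1) ^ ((p + 1) * (q + 1)) *\<^sub>R wedge (contract f Y) (bracket X Z)"
    proof (cases rule: contract_MD_cases[OF Y, of f])
      case (2 j)
      then show ?thesis using less.hyps[OF _ X 2(2) Z]
        by (cases "even p"; cases "even j") (simp_all add: minus_one_power_iff)
    qed (simp add: z)
    have 3: "bracket X (wedge Y (contract f Z)) =
      wedge (bracket X Y) (contract f Z) + (- 1) ^ ((p + 1) * q) *\<^sub>R wedge Y (bracket X (contract f Z))"
    proof (cases rule: contract_MD_cases[OF Z, of f])
      case (2 j)
      with less.hyps[OF _ X Y 2(2)] show ?thesis by simp
    qed (simp add: z)
    have 4: "contract f (bracket X (wedge Y Z)) = bracket (contract f X) (wedge Y Z) +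
      (- 1) ^ (p + 1) *\<^sub>R (bracket X (wedge (contract f Y) Z) +
        (- 1) ^ q *\<^sub>R bracket X (wedge Y (contract f Z)))"
      unfolding contract_bracket[OF X wedge_MD[OF Y Z]] contract_wedge[OF Y]
        bracket_linear2[OF MD_slot_linear[OF wedge_MD[OF cY Z]] MD_slot_linear[OF wedge_MD[OF Y cZ]] MD_slot_linear[OF X]] ..
    show "contract f (bracket X (wedge Y Z)) =
      contract f (wedge (bracket X Y) Z + (- 1) ^ ((p + 1) * q) *\<^sub>R wedge Y (bracket X Z))"
      unfolding contract_add contract_scale 4 7 contract_wedge[OF Y] contract_bracket[OF X Y]
        contract_bracket[OF X Z] wedge_add1 wedge_scale1 wedge_add2 wedge_scale2 1 2 3
      by (cases "even p"; cases "even q") (simp_all add: minus_one_power_iff algebra_simps)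
  next
    \<comment> \<open>\<open>Y []\<close> is nonzero only for q = 0, and then every sign whose
      exponent contains the factor q is 1.\<close>
    have Y0: "c *\<^sub>R Y [] = Y []" if "q = 0 \<Longrightarrow> c = 1" for c
      using that MD_length[OF Y, of "[]"] by (cases "q = 0") auto
    have "(- 1) ^ ((p + 1) * q) *\<^sub>R (Y [] * (X [Z []] - Z [X []])) =
        ((- 1) ^ ((p + 1) * q) *\<^sub>R Y []) * (X [Z []] - Z [X []])"
      "(- 1) ^ q *\<^sub>R (Y [] * Z [X []]) = ((- 1) ^ q *\<^sub>R Y []) * Z [X []]" by simp_all
    then have s: "(- 1) ^ ((p + 1) * q) *\<^sub>R (Y [] * (X [Z []] - Z [X []])) = Y [] * (X [Z []] - Z [X []])"
      "(- 1) ^ q *\<^sub>R (Y [] * Z [X []]) = Y [] * Z [X []]" by (simp_all only: Y0 mult_0_right power_0)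
    show "bracket X (wedge Y Z) [] =
      (wedge (bracket X Y) Z + (- 1) ^ ((p + 1) * q) *\<^sub>R wedge Y (bracket X Z)) []"
      unfolding bracket_Nil plus_fun_apply scaleR_fun_apply wedge_Nil wedge_at_one[OF Y] s
        MD_deriv0[OF X MD_in_S[OF Y] MD_in_S[OF Z]] by (simp add: algebra_simps)
  qed
qed

section \<open>Comparison of the wedge product with determinants\<close>

lemma wedge_MD_0_right: "Y \<in> MD k \<Longrightarrow> Z \<in> MD 0 \<Longrightarrow> wedge Y Z fs = Y fs * Z []"
proof (induction fs arbitrary: k Y)
  case (Cons f fs)
  have "wedge Y Z (f # fs) = contract f (wedge Y Z) fs" by (simp add: contract_def)
  also have "\<dots> = wedge (contract f Y) Z fs" using Cons.prems by (simp add: contract_wedge contract_MD_0)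
  also have "\<dots> = Y (f # fs) * Z []"
    unfolding Cons.IH[OF contract_MD_diff[OF Cons.prems(1)] Cons.prems(2)] by (simp add: contract_def)
  finally show ?case .
qed (simp add: wedge_Nil)

lemma wedge_MD_0_left: "Z \<in> MD 0 \<Longrightarrow> wedge Z Y fs = Z [] * Y fs"
proof (induction fs arbitrary: Y)
  case (Cons f fs)
  have "wedge Z Y (f # fs) = contract f (wedge Z Y) fs" by (simp add: contract_def)
  also have "\<dots> = wedge Z (contract f Y) fs" using Cons.prems by (simp add: contract_wedge contract_MD_0)
  also have "\<dots> = Z [] * Y (f # fs)" using Cons.IH[OF Cons.prems] by (simp add: contract_def)
  finally show ?case .
qed (simp add: wedge_Nil)

text \<open>Laplace expansion along the last factor, obtained by contracting with the first argument
  again and again.\<close>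

lemma wedge_MD_1_right:
  assumes "Y \<in> MD n" "X \<in> MD 1" "length fs = Suc n"
  shows "wedge Y X fs = (\<Sum>b<Suc n. (- 1) ^ (n - b) *\<^sub>R (Y (take b fs @ drop (Suc b) fs) * X [fs ! b]))"
  using assms
proof (induction fs arbitrary: n Y)
  case (Cons f fs)
  have cX: "contract f X \<in> MD 0" using contract_MD_diff[OF Cons.prems(2), of f] by simp
  have "wedge Y X (f # fs) = contract f (wedge Y X) fs" by (simp add: contract_def)
  also have "\<dots> = wedge (contract f Y) X fs + (- 1) ^ n *\<^sub>R (Y fs * X [f])"
    unfolding contract_wedge[OF Cons.prems(1)]
    by (simp add: scaleR_fun_apply wedge_MD_0_right[OF Cons.prems(1) cX]) (simp add: contract_def)
  finally have 1: "wedge Y X (f # fs) = wedge (contract f Y) X fs + (- 1) ^ n *\<^sub>R (Y fs * X [f])" .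
  show ?case
  proof (cases n)
    case 0
    with 1 Cons.prems show ?thesis by (simp add: contract_MD_0)
  next
    case (Suc m)
    have "wedge (contract f Y) X fs =
      (\<Sum>b<Suc m. (- 1) ^ (m - b) *\<^sub>R (contract f Y (take b fs @ drop (Suc b) fs) * X [fs ! b]))"
      using Cons.prems Suc by (intro Cons.IH contract_MD) auto
    then show ?thesis unfolding 1 by (subst sum.lessThan_Suc_shift) (simp add: Suc contract_def)
  qed
qed simp

lemma MD_move_last: "Y \<in> MD k \<Longrightarrow> Y (us @ h # vs) = (- 1) ^ length vs *\<^sub>R Y (us @ vs @ [h])"
proof (induction vs arbitrary: us)
  case (Cons v vs)
  have "Y (us @ h # v # vs) = - Y ((us @ [v]) @ h # vs)" using MD_alt[OF Cons.prems, of us h v vs] by simp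
  then show ?case using Cons.IH[OF Cons.prems, of "us @ [v]"] by simp
qed simp

end

lemma sum_fun_apply: "(\<Sum>i\<in>I. f i) x = (\<Sum>i\<in>I. f i x)"
  by (induction I rule: infinite_finite_induct) simp_all

text \<open>A permutation of n + 1 positions is one of the first n positions followed by a
  transposition of the last position with some \<open>b\<close>; the sum over the former gives the
  minors of the Laplace expansion.\<close>

lemma wedge_vf_snoc:
  fixes A :: "('a, 'e::real_normed_vector) atlas"
  assumes "function_algebra (smooth_functions A)"
    and X: "X \<in> multiderivations 1 (smooth_functions A)"
    and Y: "wedge_vf A Xs \<in> multiderivations (length Xs) (smooth_functions A)"
  shows "wedge_vf A (Xs @ [X]) = wedge (wedge_vf A Xs) X"
proof (intro ext)
  fix fs x
  interpret function_algebra "smooth_functions A" by fact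
  define n where "n = length Xs"
  define Y where "Y = wedge_vf A Xs"
  have Y: "Y \<in> MD n" using Y by (simp add: Y_def n_def)
  have W: "wedge Y X \<in> MD (Suc n)" using wedge_MD[OF Y X] by simp
  show "wedge_vf A (Xs @ [X]) fs x = wedge (wedge_vf A Xs) X fs x"
  proof (cases "length fs = Suc n \<and> set fs \<subseteq> smooth_functions A")
    case False
    with MD_outside[OF W False] show ?thesis by (auto simp: wedge_vf_def n_def Y_def)
  next
    case True
    let ?t = "\<lambda>b. Transposition.transpose n b"
    have ins: "{..<Suc n} = insert n {..<n}" by auto
    have last: "((Xs @ [X]) ! n) = X" by (simp add: n_def)
    have "wedge_vf A (Xs @ [X]) fs x =
      (\<Sum>\<sigma> | \<sigma> permutes insert n {..<n}. of_int (sign \<sigma>) * (\<Prod>i<Suc n. ((Xs @ [X]) ! i) [fs ! \<sigma> i] x))"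
      using True unfolding ins[symmetric] by (simp add: wedge_vf_def n_def)
    also have "\<dots> = (\<Sum>b\<in>insert n {..<n}. \<Sum>q | q permutes {..<n}.
      of_int (sign (?t b \<circ> q)) * (\<Prod>i<Suc n. ((Xs @ [X]) ! i) [fs ! (?t b \<circ> q) i] x))"
      by (rule sum_over_permutations_insert) auto
    also have "\<dots> = (\<Sum>b\<in>insert n {..<n}. (- 1) ^ (n - b) * (Y (take b fs @ drop (Suc b) fs) x * X [fs ! b] x))"
    proof (rule sum.cong[OF refl])
      fix b assume b: "b \<in> insert n {..<n}"
      \<comment> \<open>The arguments left for the first n factors: entry \<open>b\<close> is
        overwritten by the last one. For \<open>b < n\<close>, moving that entry back to the end
        takes n - b - 1 transpositions, and the transposition with \<open>b\<close> supplies the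
        remaining sign.\<close>
      define gs where "gs = take n (fs[b := fs ! n])"
      have gs: "length gs = n" "set gs \<subseteq> smooth_functions A"
        using True b by (auto simp: gs_def dest!: in_set_takeD set_update_subset_insert[THEN subsetD])
      have sgn: "sign (?t b \<circ> q) = (if b = n then 1 else - 1) * sign q" if "q permutes {..<n}" for q
        using that by (subst sign_compose)
          (auto simp: permutation_swap_id sign_swap_id permutes_imp_permutation[of "{..<n}"])
      have "(\<Prod>i<Suc n. ((Xs @ [X]) ! i) [fs ! (?t b \<circ> q) i] x) = (\<Prod>i<n. (Xs ! i) [gs ! q i] x) * X [fs ! b] x"
        if q: "q permutes {..<n}" for q
      proof -
        have qn: "q n = n" using q by (simp add: permutes_not_in)
        have "fs ! (?t b (q i)) = gs ! q i" if "i < n" for i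
        proof -
          have "q i < n" using permutes_in_image[OF q, of i] that by simp
          with True b show ?thesis by (auto simp: gs_def Transposition.transpose_def nth_list_update)
        qed
        then show ?thesis by (simp add: qn last nth_append n_def[symmetric])
      qed
      then have "(\<Sum>q | q permutes {..<n}.
          of_int (sign (?t b \<circ> q)) * (\<Prod>i<Suc n. ((Xs @ [X]) ! i) [fs ! (?t b \<circ> q) i] x)) =
        (\<Sum>q | q permutes {..<n}. (if b = n then 1 else - 1) * (of_int (sign q) * (\<Prod>i<n. (Xs ! i) [gs ! q i] x)) * X [fs ! b] x)"
        by (intro sum.cong refl) (simp add: sgn mult.assoc)
      also have "\<dots> = (if b = n then 1 else - 1) * Y gs x * X [fs ! b] x"
        using gs by (simp add: Y_def wedge_vf_def n_def sum_distrib_left sum_distrib_right)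
      also have "(if b = n then 1 else - 1) * Y gs x = (- 1) ^ (n - b) * Y (take b fs @ drop (Suc b) fs) x"
      proof (cases "b = n")
        case True
        with \<open>length fs = Suc n \<and> _\<close> show ?thesis by (simp add: gs_def)
      next
        case False
        with b have bn: "b < n" by simp
        have "gs = take b fs @ fs ! n # drop (Suc b) (take n fs)"
          using bn True by (intro nth_equalityI) (auto simp: gs_def nth_append nth_Cons' nth_list_update)
        moreover have "drop (Suc b) (take n fs) @ [fs ! n] = drop (Suc b) fs"
        proof -
          have "take n fs @ [fs ! n] = fs" using True take_Suc_conv_app_nth[of n fs] by simp
          from arg_cong[OF this, of "drop (Suc b)"] show ?thesis using bn True by simp
        qed
        ultimately have "Y gs = (- 1) ^ (n - Suc b) *\<^sub>R Y (take b fs @ drop (Suc b) fs)"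
          using MD_move_last[OF Y, of "take b fs" "fs ! n" "drop (Suc b) (take n fs)"] bn True by simp
        moreover have "n - b = Suc (n - Suc b)" using bn by simp
        ultimately show ?thesis using False by (simp add: scaleR_fun_apply)
      qed
      finally show "(\<Sum>q | q permutes {..<n}.
          of_int (sign (?t b \<circ> q)) * (\<Prod>i<Suc n. ((Xs @ [X]) ! i) [fs ! (?t b \<circ> q) i] x)) =
        (- 1) ^ (n - b) * (Y (take b fs @ drop (Suc b) fs) x * X [fs ! b] x)" by (simp only: mult.assoc)
    qed
    also have "\<dots> = wedge Y X fs x"
      using True by (simp add: wedge_MD_1_right[OF Y X] ins[symmetric] scaleR_fun_apply sum_fun_apply del: sum.lessThan_Suc)
    finally show ?thesis by (simp add: Y_def)
  qed
qed

section \<open>Products of polynomial vector fields form a subalgebra\<close>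

locale polynomial_functions = function_algebra S for S :: "'a::{real_algebra, comm_ring} set" +
  fixes F0 :: "'a set"
  assumes subspace_F0: "subspace F0" and F0_sub: "F0 \<subseteq> S"
    and mult_F0: "f \<in> F0 \<Longrightarrow> g \<in> F0 \<Longrightarrow> f * g \<in> F0"
begin

definition F1 :: "('a list \<Rightarrow> 'a) set"
  where "F1 = {X \<in> MD 1. \<forall>f\<in>F0. X [f] \<in> F0}"

text \<open>Products grow by one vector field at the end, so that closure properties follow by
  induction with the Leibniz rule. Degree 1 needs no span because \<open>F1\<close> is already a
  subspace.\<close>

fun chi :: "nat \<Rightarrow> ('a list \<Rightarrow> 'a) set" where
  "chi 0 = {X \<in> MD 0. X [] \<in> F0}"
| "chi (Suc 0) = F1"
| "chi (Suc (Suc k)) = span {wedge Y X | Y X. Y \<in> chi (Suc k) \<and> X \<in> F1}"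

lemma subspace_chi: "subspace (chi k)"
proof -
  have "subspace (chi 0)" by (rule subspaceI)
       (auto simp: scaleR_fun_apply subspace_0[OF subspace_F0] subspace_add[OF subspace_F0]
         subspace_scale[OF subspace_F0] intro: subspace_add[OF subspace_MD] subspace_scale[OF subspace_MD])
  moreover have "subspace F1" unfolding F1_def by (rule subspaceI)
       (auto simp: scaleR_fun_apply subspace_0[OF subspace_F0] subspace_add[OF subspace_F0]
         subspace_scale[OF subspace_F0] intro: subspace_add[OF subspace_MD] subspace_scale[OF subspace_MD])
  ultimately show ?thesis by (cases k rule: chi.cases) auto
qed

lemmas chi_add = subspace_add[OF subspace_chi]
  and chi_scale = subspace_scale[OF subspace_chi]
  and chi_minus = subspace_neg[OF subspace_chi]
  and chi_zero = subspace_0[OF subspace_chi]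

lemma F1_MD: "X \<in> F1 \<Longrightarrow> X \<in> MD 1"
  by (simp add: F1_def)

lemma chi_MD: "X \<in> chi k \<Longrightarrow> X \<in> MD k"
proof (induction k arbitrary: X rule: chi.induct)
  case (3 k)
  have "span {wedge Y X | Y X. Y \<in> chi (Suc k) \<and> X \<in> F1} \<subseteq> MD (Suc (Suc k))"
    using wedge_MD[OF 3(1) F1_MD] by (intro span_minimal subspace_MD) auto
  with 3 show ?case by auto
qed (auto simp: F1_def)

text \<open>\<open>T\<close> has to be linear on multiderivations only, since the bracket is not
  bilinear on arbitrary maps of lists.\<close>

lemma chi_span_induct [consumes 1, case_names wedge]:
  assumes "A \<in> chi (Suc (Suc k))" "\<And>Y X. Y \<in> chi (Suc k) \<Longrightarrow> X \<in> F1 \<Longrightarrow> T (wedge Y X) \<in> V"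
    and "subspace V" "\<And>A B c. A \<in> MD (Suc (Suc k)) \<Longrightarrow> B \<in> MD (Suc (Suc k)) \<Longrightarrow> T (A + c *\<^sub>R B) = T A + c *\<^sub>R T B"
  shows "T A \<in> V"
proof -
  have T0: "T 0 = 0" using assms(4)[of 0 0 1] by simp
  have "T (A + B) = T A + T B" "T (c *\<^sub>R A) = c *\<^sub>R T A"
    if "A \<in> MD (Suc (Suc k))" "B \<in> MD (Suc (Suc k))" for A B c
    using assms(4)[of A B 1] assms(4)[of 0 A c] that T0 by simp_all
  then have "subspace {A \<in> MD (Suc (Suc k)). T A \<in> V}" using T0 by (intro subspaceI)
      (auto simp: subspace_0[OF assms(3)] intro: subspace_add[OF subspace_MD] subspace_scale[OF subspace_MD]
        subspace_add[OF assms(3)] subspace_scale[OF assms(3)])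
  then have "span {wedge Y X | Y X. Y \<in> chi (Suc k) \<and> X \<in> F1} \<subseteq> {A \<in> MD (Suc (Suc k)). T A \<in> V}"
    using wedge_MD[OF chi_MD F1_MD] assms(2) by (intro span_minimal) auto
  with assms(1) show ?thesis by auto
qed

lemma F0_mult_F1:
  assumes "f \<in> chi 0" "X \<in> F1"
  shows "wedge f X \<in> F1"
  using assms wedge_MD[OF chi_MD[OF assms(1)] F1_MD[OF assms(2)]]
  by (auto simp: F1_def wedge_MD_0_left intro: mult_F0)

lemma wedge_F1_chi:
  assumes "Y \<in> chi k" "X \<in> F1"
  shows "wedge Y X \<in> chi (Suc k)"
proof (cases k)
  case 0
  with F0_mult_F1 assms show ?thesis by simp
next
  case (Suc j)
  with assms show ?thesis by (auto intro: span_base)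
qed

lemma wedge_0_chi:
  assumes f: "f \<in> chi 0" and "Y \<in> chi k"
  shows "wedge f Y \<in> chi k"
  using assms(2)
proof (induction k arbitrary: Y rule: chi.induct)
  case 1
  with f wedge_MD[OF chi_MD[OF f] chi_MD[OF 1]] show ?case by (simp add: wedge_Nil mult_F0)
next
  case 2
  with F0_mult_F1[OF f] show ?case by simp
next
  case (3 k)
  show ?case using 3(2)
  proof (induction rule: chi_span_induct)
    case (wedge Y X)
    have "wedge f (wedge Y X) = wedge (wedge f Y) X"
      by (rule wedge_assoc[symmetric, OF chi_MD[OF f] chi_MD[OF wedge(1)] F1_MD[OF wedge(2)]])
    with wedge_F1_chi[OF 3(1)[OF wedge(1)] wedge(2)] show ?case by simp
  qed (rule subspace_chi wedge_linear2)+
qed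

lemma wedge_chi:
  assumes A: "A \<in> chi a" and "B \<in> chi b"
  shows "wedge A B \<in> chi (a + b)"
  using assms(2)
proof (induction b arbitrary: B rule: chi.induct)
  case 1
  have "wedge A B = wedge B A" using wedge_MD_0_right[OF chi_MD[OF A] chi_MD[OF 1]] wedge_MD_0_left[OF chi_MD[OF 1]]
    by (simp add: fun_eq_iff mult.commute)
  with wedge_0_chi[OF 1 A] show ?case by simp
next
  case 2
  with wedge_F1_chi[OF A] show ?case by simp
next
  case (3 k)
  show ?case using 3(2)
  proof (induction rule: chi_span_induct)
    case (wedge Y X)
    have "wedge A (wedge Y X) = wedge (wedge A Y) X"
      by (rule wedge_assoc[symmetric, OF chi_MD[OF A] chi_MD[OF wedge(1)] F1_MD[OF wedge(2)]])
    with wedge_F1_chi[OF 3(1)[OF wedge(1)] wedge(2)] show ?case by simp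
  qed (rule subspace_chi wedge_linear2)+
qed

lemma bracket_swap_chi:
  assumes "bracket B A \<in> chi k" "A \<in> MD p" "B \<in> MD q"
  shows "bracket A B \<in> chi k"
  unfolding bracket_antisym[OF assms(2,3)] by (intro chi_minus chi_scale assms(1))

lemma bracket_linear2_MD:
  "A \<in> MD k \<Longrightarrow> B \<in> MD k \<Longrightarrow> C \<in> MD j \<Longrightarrow> bracket C (A + c *\<^sub>R B) = bracket C A + c *\<^sub>R bracket C B"
  by (intro bracket_linear2 MD_slot_linear)

lemma bracket_0_chi:
  assumes f: "f \<in> chi 0" and "A \<in> chi a"
  shows "bracket f A \<in> chi (a - 1)"
  using assms(2)
proof (induction a arbitrary: A rule: chi.induct)
  case 1
  with chi_zero[of 0] show ?case by (simp only: bracket_0_0[OF chi_MD[OF f] chi_MD[OF 1]] diff_0_eq_0)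
next
  case 2
  have "bracket f A \<in> MD 0" using bracket_MD[OF chi_MD[OF f] chi_MD[OF 2]] by simp
  moreover have "f [A []] = 0" using f chi_MD[OF 2] MD_length by auto
  ultimately show ?case using 2 f by (simp add: bracket_Nil F1_def subspace_neg[OF subspace_F0])
next
  case (3 k)
  show ?case using 3(2)
  proof (induction rule: chi_span_induct)
    case (wedge Y X)
    have "bracket f Y \<in> chi k" using 3(1)[OF wedge(1)] by simp
    moreover have "bracket f X \<in> chi 0"
    proof -
      have "bracket f X \<in> MD 0" using bracket_MD[OF chi_MD[OF f] F1_MD[OF wedge(2)]] by simp
      moreover have "f [X []] = 0" using f MD_length by auto
      ultimately show ?thesis using wedge(2) f by (simp add: bracket_Nil F1_def subspace_neg[OF subspace_F0])
    qed
    ultimately show ?case unfolding bracket_wedge[OF chi_MD[OF f] chi_MD[OF wedge(1)] F1_MD[OF wedge(2)]]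
      using wedge_F1_chi[OF \<open>bracket f Y \<in> chi k\<close> wedge(2)] wedge_chi[OF wedge(1) \<open>bracket f X \<in> chi 0\<close>]
      by (simp only: add_0_right diff_Suc_1) (intro chi_add chi_scale)
  qed (rule subspace_chi bracket_linear2_MD[OF _ _ chi_MD[OF f]]; assumption)+
qed

lemma bracket_F1_chi:
  assumes V: "V \<in> F1" and "A \<in> chi a"
  shows "bracket V A \<in> chi a"
  using assms(2)
proof (induction a arbitrary: A rule: chi.induct)
  case 1
  have "bracket A V \<in> chi 0" using bracket_0_chi[OF 1, of V 1] V by simp
  then show ?case by (rule bracket_swap_chi[OF _ F1_MD[OF V] chi_MD[OF 1]])
next
  case 2
  have A: "A \<in> F1" using 2 by simp
  have "bracket V A [f] \<in> F0" if "f \<in> F0" for f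
  proof -
    have "V [f, g] = 0" "A [f, g] = 0" for g
      using MD_length[OF F1_MD[OF V], of "[f, g]"] MD_length[OF F1_MD[OF A], of "[f, g]"] by simp_all
    then show ?thesis
      using that A V by (simp add: bracket_at_one[OF F1_MD[OF V] F1_MD[OF A]] F1_def subspace_diff[OF subspace_F0]
          subspace_add[OF subspace_F0] subspace_neg[OF subspace_F0])
  qed
  with bracket_MD[OF F1_MD[OF V] F1_MD[OF A]] show ?case by (simp add: F1_def)
next
  case (3 k)
  show ?case using 3(2)
  proof (induction rule: chi_span_induct)
    case (wedge Y X)
    have "bracket V X \<in> F1"
    proof -
      have "bracket V X [f] \<in> F0" if "f \<in> F0" for f
      proof -
        have "V [f, g] = 0" "X [f, g] = 0" for g
          using MD_length[OF F1_MD[OF V], of "[f, g]"] MD_length[OF F1_MD[OF wedge(2)], of "[f, g]"] by simp_all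
        with that wedge(2) V show ?thesis by (simp add: bracket_at_one[OF F1_MD[OF V] F1_MD[OF wedge(2)]] F1_def
              subspace_diff[OF subspace_F0] subspace_add[OF subspace_F0] subspace_neg[OF subspace_F0])
      qed
      with bracket_MD[OF F1_MD[OF V] F1_MD[OF wedge(2)]] show ?thesis by (simp add: F1_def)
    qed
    then show ?case unfolding bracket_wedge[OF F1_MD[OF V] chi_MD[OF wedge(1)] F1_MD[OF wedge(2)]]
      using wedge_F1_chi[OF 3(1)[OF wedge(1)] wedge(2)] wedge_F1_chi[OF wedge(1)] by (intro chi_add chi_scale)
  qed (rule subspace_chi bracket_linear2_MD[OF _ _ F1_MD[OF V]]; assumption)+
qed

text \<open>The Leibniz rule splits off the last factor of \<open>B\<close>; antisymmetry reduces
  brackets with a function or a vector field to the two preceding lemmas.\<close>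

lemma bracket_chi:
  assumes A: "A \<in> chi a" and "B \<in> chi b"
  shows "bracket A B \<in> chi (a + b - 1)"
  using assms(2)
proof (induction b arbitrary: B rule: chi.induct)
  case 1
  have "bracket B A \<in> chi (a - 1)" by (rule bracket_0_chi[OF 1 A])
  with bracket_swap_chi[OF _ chi_MD[OF A] chi_MD[OF 1]] show ?case by simp
next
  case 2
  have "bracket B A \<in> chi a" using bracket_F1_chi[OF _ A] 2 by simp
  with bracket_swap_chi[OF _ chi_MD[OF A] chi_MD[OF 2]] show ?case by simp
next
  case (3 k)
  show ?case using 3(2)
  proof (induction rule: chi_span_induct)
    case (wedge Y X)
    have "bracket X A \<in> chi a" by (rule bracket_F1_chi[OF wedge(2) A])
    then have "bracket A X \<in> chi a" by (rule bracket_swap_chi[OF _ chi_MD[OF A] F1_MD[OF wedge(2)]])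
    then have "wedge Y (bracket A X) \<in> chi (Suc (a + k))" using wedge_chi[OF wedge(1)] by (simp add: add.commute)
    moreover have "bracket A Y \<in> chi (a + k)" using 3(1)[OF wedge(1)] by simp
    ultimately show ?case unfolding bracket_wedge[OF chi_MD[OF A] chi_MD[OF wedge(1)] F1_MD[OF wedge(2)]]
      using wedge_F1_chi[OF \<open>bracket A Y \<in> chi (a + k)\<close> wedge(2)]
      by (simp only: add_Suc_right diff_Suc_1) (intro chi_add chi_scale)
  qed (rule subspace_chi bracket_linear2_MD[OF _ _ chi_MD[OF A]]; assumption)+
qed

end

text \<open>Splitting off the last vector field turns a determinant product into a wedge product;
  degree by degree both kinds of generators have the same span.\<close>

lemma chi_fp_eq_chi:
  assumes "polynomial_functions (smooth_functions (normal_atlas A C)) (fp_functions A C)"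
  shows "chi_fp k A C =
    polynomial_functions.chi (smooth_functions (normal_atlas A C)) (fp_functions A C) k"
proof -
  interpret polynomial_functions "smooth_functions (normal_atlas A C)" "fp_functions A C" by fact
  define G where "G = (\<lambda>k. {wedge_vf (normal_atlas A C) Xs | Xs. length Xs = k \<and> set Xs \<subseteq> F1})"
  have F1: "fp_vector_fields A C = F1" by (simp add: fp_vector_fields_def F1_def multivector_fields_eq)
  have one: "wedge_vf (normal_atlas A C) [X] = X" if "X \<in> F1" for X
  proof (intro ext)
    fix fs x
    show "wedge_vf (normal_atlas A C) [X] fs x = X fs x"
    proof (cases "length fs = 1 \<and> set fs \<subseteq> smooth_functions (normal_atlas A C)")
      case True
      then show ?thesis by (auto simp: wedge_vf_def length_Suc_conv lessThan_Suc)
    next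
      case False
      with MD_outside[OF F1_MD[OF that] False] show ?thesis by (auto simp: wedge_vf_def)
    qed
  qed
  have "span (G (Suc k)) = chi (Suc k)" for k
  proof (induction k)
    case 0
    have "G (Suc 0) = (\<lambda>X. wedge_vf (normal_atlas A C) [X]) ` F1"
      unfolding G_def by (auto simp: length_Suc_conv image_iff)
    then have "G (Suc 0) = F1" by (simp add: one)
    with subspace_chi[of 1] show ?case by (simp add: span_eq_iff)
  next
    case (Suc k)
    have snoc: "wedge_vf (normal_atlas A C) (Xs @ [X]) = wedge (wedge_vf (normal_atlas A C) Xs) X"
      if "length Xs = Suc k" "set Xs \<subseteq> F1" "X \<in> F1" for Xs X
    proof (rule wedge_vf_snoc)
      have "wedge_vf (normal_atlas A C) Xs \<in> chi (Suc k)"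
        using that by (subst Suc.IH[symmetric], intro span_base) (auto simp: G_def)
      then show "wedge_vf (normal_atlas A C) Xs \<in> MD (length Xs)" using chi_MD that by metis
    qed (use F1_MD that function_algebra_axioms in auto)
    show ?case
    proof
      have "G (Suc (Suc k)) \<subseteq> chi (Suc (Suc k))"
      proof
        fix T assume "T \<in> G (Suc (Suc k))"
        then obtain Zs where Zs: "T = wedge_vf (normal_atlas A C) Zs" "length Zs = Suc (Suc k)" "set Zs \<subseteq> F1"
          by (auto simp: G_def)
        then obtain Xs X where X: "Zs = Xs @ [X]" by (metis append_butlast_last_id list.size(3) nat.distinct(1))
        have "wedge_vf (normal_atlas A C) Xs \<in> chi (Suc k)"
          using Zs X by (subst Suc.IH[symmetric], intro span_base) (auto simp: G_def)
        then have "wedge (wedge_vf (normal_atlas A C) Xs) X \<in> chi (Suc (Suc k))"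
          using Zs X by (intro wedge_F1_chi) auto
        then show "T \<in> chi (Suc (Suc k))" using snoc[of Xs X] Zs X by simp
      qed
      then show "span (G (Suc (Suc k))) \<subseteq> chi (Suc (Suc k))" by (rule span_minimal[OF _ subspace_chi])
      have "wedge Y X \<in> span (G (Suc (Suc k)))" if "Y \<in> chi (Suc k)" "X \<in> F1" for Y X
      proof -
        have "subspace {Y. wedge Y X \<in> span (G (Suc (Suc k)))}"
          by (rule subspaceI) (auto simp: wedge_add1 wedge_scale1 span_zero intro: span_add span_scale)
        moreover have "G (Suc k) \<subseteq> {Y. wedge Y X \<in> span (G (Suc (Suc k)))}"
        proof
          fix T assume "T \<in> G (Suc k)"
          then obtain Xs where Xs: "T = wedge_vf (normal_atlas A C) Xs" "length Xs = Suc k" "set Xs \<subseteq> F1"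
            by (auto simp: G_def)
          then have "wedge T X = wedge_vf (normal_atlas A C) (Xs @ [X])" using snoc that by simp
          also have "\<dots> \<in> G (Suc (Suc k))" using Xs that unfolding G_def by (intro CollectI exI[of _ "Xs @ [X]"]) auto
          finally show "T \<in> {Y. wedge Y X \<in> span (G (Suc (Suc k)))}" by (simp add: span_base)
        qed
        ultimately show ?thesis using span_minimal Suc.IH that(1) by blast
      qed
      then show "chi (Suc (Suc k)) \<subseteq> span (G (Suc (Suc k)))"
        unfolding chi.simps by (intro span_minimal subspace_span) auto
    qed
  qed
  moreover have "chi_fp 0 A C = chi 0"
  proof (intro set_eqI iffI)
    fix X assume "X \<in> chi_fp 0 A C"
    then show "X \<in> chi 0" using F0_sub by (auto simp: chi_fp_def MD_0_iff)
  next
    fix X assume X: "X \<in> chi 0"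
    then have "X = (\<lambda>fs. if fs = [] then X [] else 0)" by (auto simp: MD_0_iff fun_eq_iff)
    then show "X \<in> chi_fp 0 A C" using X by (auto simp: chi_fp_def)
  qed
  ultimately show ?thesis by (cases k) (simp_all add: chi_fp_def G_def F1 del: chi.simps)
qed

section \<open>Higher derived brackets\<close>

text \<open>Moving the right block in front of the left one costs the Koszul sign of their total
  degrees.\<close>

lemma koszul_sum_swap:
  "koszul_sum G ps = koszul_sum (\<lambda>L R. par (deg L * deg R) *\<^sub>R G R L) ps"
proof (induction ps arbitrary: G)
  case (Cons p ps)
  have "koszul_sum G (p # ps) = koszul_sum (\<lambda>L R. par (deg L * deg R) *\<^sub>R
      (G (p # R) L + par (fst p * deg R) *\<^sub>R G R (p # L))) ps" unfolding koszul_sum_Cons by (rule Cons.IH)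
  also have "\<dots> = koszul_sum (\<lambda>L R. par (deg L * deg R) *\<^sub>R G R L) (p # ps)"
    unfolding koszul_sum_Cons by (rule koszul_sum_cong) (simp add: par_def scaleR_add_right)
  finally show ?case .
qed (simp add: par_def)

lemma koszul_sum_single_left:
  "koszul_sum (\<lambda>L R. if L = [] then g R else 0) ps = g ps"
proof (induction ps arbitrary: g)
  case (Cons p ps)
  have "koszul_sum (\<lambda>L R. if L = [] then g R else 0) (p # ps) =
    koszul_sum (\<lambda>L R. if L = [] then g (p # R) else 0) ps"
    unfolding koszul_sum_Cons by (rule koszul_sum_cong) (simp add: par_def)
  then show ?case using Cons.IH[of "\<lambda>R. g (p # R)"] by simp
qed simp

text \<open>The bracket with a fixed element is linear only on a subspace, so the conclusion also
  records that the sums stay inside it.\<close>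

lemma koszul_sum_linear:
  assumes "\<And>x y. x \<in> T \<Longrightarrow> y \<in> T \<Longrightarrow> f (x + y) = f x + f y" "\<And>c x. x \<in> T \<Longrightarrow> f (c *\<^sub>R x) = c *\<^sub>R f x"
    "subspace T" "\<And>L R. mset L + mset R = mset ps \<Longrightarrow> G L R \<in> T"
  shows "koszul_sum (\<lambda>L R. f (G L R)) ps = f (koszul_sum G ps) \<and> koszul_sum G ps \<in> T"
  using assms(4)
proof (induction ps arbitrary: G)
  case (Cons p ps)
  let ?H = "\<lambda>L R. G (p # L) R + par (fst p * deg L) *\<^sub>R G L (p # R)"
  have H: "G (p # L) R \<in> T" "G L (p # R) \<in> T" "?H L R \<in> T" if "mset L + mset R = mset ps" for L R
  proof -
    show "G (p # L) R \<in> T" "G L (p # R) \<in> T" using that Cons.prems by auto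
    then show "?H L R \<in> T" by (intro subspace_add subspace_scale assms(3))
  qed
  have "koszul_sum (\<lambda>L R. f (G L R)) (p # ps) = koszul_sum (\<lambda>L R. f (?H L R)) ps"
    unfolding koszul_sum_Cons by (rule koszul_sum_cong) (simp add: H assms(1,2) subspace_scale[OF assms(3)])
  with Cons.IH[of ?H] H(3) show ?case by (simp add: koszul_sum_Cons)
qed simp

text \<open>Voronov's data: \<open>eps\<close> multiplies by the parity of the degree,
  \<open>vt\<close> embeds the abelian subalgebra and \<open>P\<close> projects onto it. Vertical
  lifts only have to lie in \<open>MV\<close>; closure of \<open>CH\<close> under the bracket keeps
  the first component of the algebra inside \<open>CH\<close>.\<close>

locale higher_derived_brackets =
  fixes MV CH :: "int \<Rightarrow> 'x::real_vector set" and br :: "'x \<Rightarrow> 'x \<Rightarrow> 'x" and eps :: "'x \<Rightarrow> 'x"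
    and WS :: "int \<Rightarrow> 'w::real_vector set" and vt :: "'w \<Rightarrow> 'x" and P :: "'x \<Rightarrow> 'w"
  assumes subspace_MV: "subspace (MV p)" and subspace_CH: "subspace (CH p)" and subspace_WS: "subspace (WS p)"
    and CH_MV: "CH p \<subseteq> MV p"
    and br_linear1: "\<lbrakk>X \<in> span (\<Union>p. MV p); Y \<in> span (\<Union>p. MV p); Z \<in> span (\<Union>p. MV p)\<rbrakk> \<Longrightarrow>
      br (X + c *\<^sub>R Y) Z = br X Z + c *\<^sub>R br Y Z"
    and br_linear2: "\<lbrakk>X \<in> span (\<Union>p. MV p); Y \<in> span (\<Union>p. MV p); Z \<in> span (\<Union>p. MV p)\<rbrakk> \<Longrightarrow>
      br Z (X + c *\<^sub>R Y) = br Z X + c *\<^sub>R br Z Y"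
    and br_MV: "X \<in> MV p \<Longrightarrow> Y \<in> MV q \<Longrightarrow> br X Y \<in> MV (p + q - 1)"
    and br_CH: "X \<in> CH p \<Longrightarrow> Y \<in> CH q \<Longrightarrow> br X Y \<in> CH (p + q - 1)"
    and br_antisym: "X \<in> MV p \<Longrightarrow> Y \<in> MV q \<Longrightarrow> br X Y = - (par ((p + 1) * (q + 1)) *\<^sub>R br Y X)"
    and br_jacobi: "X \<in> MV p \<Longrightarrow> Y \<in> MV q \<Longrightarrow> Z \<in> MV r \<Longrightarrow>
      br X (br Y Z) = br (br X Y) Z + par ((p + 1) * (q + 1)) *\<^sub>R br Y (br X Z)"
    and eps_linear: "eps (X + c *\<^sub>R Y) = eps X + c *\<^sub>R eps Y"
    and eps_MV: "X \<in> MV p \<Longrightarrow> eps X = par p *\<^sub>R X"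
    and vt_linear: "vt (a + c *\<^sub>R b) = vt a + c *\<^sub>R vt b"
    and vt_MV: "a \<in> WS p \<Longrightarrow> vt a \<in> MV p"
    and P_linear: "P (X + c *\<^sub>R Y) = P X + c *\<^sub>R P Y"
    and P_WS: "X \<in> MV p \<Longrightarrow> P X \<in> WS p"
    and P_vt: "a \<in> WS p \<Longrightarrow> P (vt a) = a"
    and abelian: "a \<in> WS p \<Longrightarrow> b \<in> WS q \<Longrightarrow> br (vt a) (vt b) = 0"
    and kernel_P: "X \<in> MV p \<Longrightarrow> Y \<in> MV q \<Longrightarrow> P X = 0 \<Longrightarrow> P Y = 0 \<Longrightarrow> P (br X Y) = 0"
begin

definition T :: "'x set" where "T = span (\<Union>p. MV p)"

lemma subspace_T: "subspace T"
  by (simp add: T_def)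

lemmas scale_T = subspace_scale[OF subspace_T] and add_T = subspace_add[OF subspace_T] and neg_T = subspace_neg[OF subspace_T]

lemma MV_T: "X \<in> MV p \<Longrightarrow> X \<in> T"
  by (auto simp: T_def intro: span_base)

lemma zeros [simp]: "0 \<in> T" "0 \<in> MV p" "0 \<in> CH p" "0 \<in> WS p"
  by (simp_all add: subspace_0 subspace_T subspace_MV subspace_CH subspace_WS)

lemma br_zero [simp]: "X \<in> T \<Longrightarrow> br 0 X = 0" "X \<in> T \<Longrightarrow> br X 0 = 0"
  using br_linear1[of 0 0 X 1] br_linear2[of 0 0 X 1] zeros(1) by (simp_all add: T_def[symmetric])

lemma br_add1: "X \<in> T \<Longrightarrow> Y \<in> T \<Longrightarrow> Z \<in> T \<Longrightarrow> br (X + Y) Z = br X Z + br Y Z"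
  and br_add2: "X \<in> T \<Longrightarrow> Y \<in> T \<Longrightarrow> Z \<in> T \<Longrightarrow> br Z (X + Y) = br Z X + br Z Y"
  using br_linear1[of X Y Z 1] br_linear2[of X Y Z 1] by (simp_all add: T_def)

lemma br_scale1: "X \<in> T \<Longrightarrow> Z \<in> T \<Longrightarrow> br (c *\<^sub>R X) Z = c *\<^sub>R br X Z"
  and br_scale2: "X \<in> T \<Longrightarrow> Z \<in> T \<Longrightarrow> br Z (c *\<^sub>R X) = c *\<^sub>R br Z X"
  using br_linear1[of 0 X Z c] br_linear2[of 0 X Z c] zeros(1) by (simp_all add: T_def[symmetric])

lemma br_minus1: "X \<in> T \<Longrightarrow> Z \<in> T \<Longrightarrow> br (- X) Z = - br X Z"
  and br_minus2: "X \<in> T \<Longrightarrow> Z \<in> T \<Longrightarrow> br Z (- X) = - br Z X"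
  using br_scale1[of X Z "-1"] br_scale2[of X Z "-1"] by simp_all

lemma vt_0 [simp]: "vt 0 = 0"
  using vt_linear[of 0 1 0] by simp

lemma vt_scale: "vt (c *\<^sub>R a) = c *\<^sub>R vt a"
  using vt_linear[of 0 c a] by simp

lemma P_0 [simp]: "P 0 = 0"
  using P_linear[of 0 1 0] by simp

lemma P_add: "P (X + Y) = P X + P Y"
  using P_linear[of X 1 Y] by simp

lemma P_scale: "P (c *\<^sub>R X) = c *\<^sub>R P X"
  using P_linear[of 0 c X] by simp

lemma P_minus: "P (- X) = - P X"
  using P_scale[of "- 1" X] by simp

lemma eps_0 [simp]: "eps 0 = 0"
  using eps_linear[of 0 1 0] by simp

lemma eps_scale: "eps (c *\<^sub>R X) = c *\<^sub>R eps X"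
  using eps_linear[of 0 c X] by simp

lemma eps_T: "X \<in> T \<Longrightarrow> eps X \<in> T"
proof -
  have "subspace {X. eps X \<in> T}" using eps_linear[of _ 1] by (intro subspaceI)
      (auto simp: eps_scale scale_T add_T)
  moreover have "(\<Union>p. MV p) \<subseteq> {X. eps X \<in> T}"
    by (auto simp: eps_MV intro!: scale_T intro: MV_T)
  ultimately show "X \<in> T \<Longrightarrow> eps X \<in> T" unfolding T_def using span_minimal by blast
qed

lemma br_T: "X \<in> T \<Longrightarrow> Y \<in> T \<Longrightarrow> br X Y \<in> T"
proof -
  have 1: "br X Y \<in> T" if X: "X \<in> MV p" and Y: "Y \<in> T" for X Y p
  proof -
    have "subspace {Y \<in> T. br X Y \<in> T}" using MV_T[OF X] by (intro subspaceI)
        (auto simp: br_add2 br_scale2 scale_T add_T)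
    moreover have "(\<Union>p. MV p) \<subseteq> {Y \<in> T. br X Y \<in> T}" using br_MV[OF X] by (blast intro: MV_T)
    ultimately have "T \<subseteq> {Y \<in> T. br X Y \<in> T}" unfolding T_def[symmetric] using span_minimal T_def by metis
    with Y show ?thesis by blast
  qed
  assume X: "X \<in> T" and Y: "Y \<in> T"
  have "subspace {X \<in> T. br X Y \<in> T}" using Y by (intro subspaceI)
      (auto simp: br_add1 br_scale1 scale_T add_T)
  moreover have "(\<Union>p. MV p) \<subseteq> {X \<in> T. br X Y \<in> T}" using 1[OF _ Y] by (blast intro: MV_T)
  ultimately have "T \<subseteq> {X \<in> T. br X Y \<in> T}" using span_minimal T_def by metis
  then show "br X Y \<in> T" using X by blast
qed

lemma T_induct [consumes 1, case_names MV linear]: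
  assumes "X \<in> T" "\<And>p X. X \<in> MV p \<Longrightarrow> Q X"
    "\<And>c X Y. X \<in> T \<Longrightarrow> Y \<in> T \<Longrightarrow> Q X \<Longrightarrow> Q Y \<Longrightarrow> Q (X + c *\<^sub>R Y)"
  shows "Q X"
proof -
  have 0: "Q 0" using assms(2)[OF zeros(2)] .
  have "subspace {X \<in> T. Q X}"
  proof (rule subspaceI)
    fix X Y assume "X \<in> {X \<in> T. Q X}" "Y \<in> {X \<in> T. Q X}"
    then show "X + Y \<in> {X \<in> T. Q X}" using assms(3)[of X Y 1] add_T by simp
  next
    fix c X assume "X \<in> {X \<in> T. Q X}"
    then show "c *\<^sub>R X \<in> {X \<in> T. Q X}" using assms(3)[of 0 X c] 0 scale_T by simp
  qed (simp add: 0)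
  moreover have "(\<Union>p. MV p) \<subseteq> {X \<in> T. Q X}" using assms(2) MV_T by blast
  ultimately have "T \<subseteq> {X \<in> T. Q X}" using span_minimal T_def by metis
  with assms(1) show ?thesis by blast
qed

section \<open>Brackets with elements of the abelian subalgebra\<close>

lemma left_commute_MV:
  assumes a: "a \<in> WS p" and b: "b \<in> WS q" and Z: "Z \<in> T"
  shows "br (vt a) (br (vt b) Z) = par ((p + 1) * (q + 1)) *\<^sub>R br (vt b) (br (vt a) Z)"
  using Z
proof (induction rule: T_induct)
  case (MV r Z)
  with br_jacobi[OF vt_MV[OF a] vt_MV[OF b] MV] abelian[OF a b] show ?case by (simp add: MV_T)
next
  case (linear c X Y)
  then show ?case using MV_T[OF vt_MV[OF a]] MV_T[OF vt_MV[OF b]]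
    by (simp add: br_add2 br_scale2 br_T scale_T scaleR_add_right mult.commute)
qed

text \<open>In the Jacobi identity for a, Z, b the term with [a, b] drops out, so abelian elements
  acting from opposite sides commute without a sign.\<close>

lemma left_right_commute:
  assumes a: "a \<in> WS p" and b: "b \<in> WS q" and Z: "Z \<in> T"
  shows "br (vt a) (br Z (vt b)) = br (br (vt a) Z) (vt b)"
  using Z
proof (induction rule: T_induct)
  case (MV r Z)
  with br_jacobi[OF vt_MV[OF a] MV vt_MV[OF b]] abelian[OF a b] show ?case by (simp add: MV_T)
next
  case (linear c X Y)
  then show ?case using MV_T[OF vt_MV[OF a]] MV_T[OF vt_MV[OF b]]
    by (simp add: br_add2 br_scale2 br_add1 br_scale1 br_T scale_T)
qed

text \<open>Turns right brackets into left brackets; \<open>eps\<close> absorbs the part of the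
  antisymmetry sign that does not involve the degree of \<open>Z\<close>.\<close>

lemma br_vt:
  assumes "Z \<in> MV z" "b \<in> WS (d + 1)"
  shows "br Z (vt b) = par (d * z) *\<^sub>R br (eps (vt b)) Z"
  unfolding br_antisym[OF assms(1) vt_MV[OF assms(2)]] eps_MV[OF vt_MV[OF assms(2)]]
  using br_scale1[OF MV_T[OF vt_MV[OF assms(2)]] MV_T[OF assms(1)]]
    br_minus1[OF MV_T[OF vt_MV[OF assms(2)]] MV_T[OF assms(1)]]
  by (cases "even d"; cases "even z") (simp_all add: par_def)

text \<open>One right bracket becomes a left one, commutes with the other, and is turned back. This
  is the source of the graded symmetry in the vertical entries.\<close>

lemma right_commute:
  assumes a: "a \<in> WS (i + 1)" and b: "b \<in> WS (j + 1)" and Z: "Z \<in> T"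
  shows "br (br Z (vt a)) (vt b) = par (i * j) *\<^sub>R br (br Z (vt b)) (vt a)"
  using Z
proof (induction rule: T_induct)
  case (MV r Z)
  note ta = MV_T[OF vt_MV[OF a]] and tb = MV_T[OF vt_MV[OF b]] and tZ = MV_T[OF MV]
  have "br (br Z (vt a)) (vt b) = par (i * r) *\<^sub>R br (br (eps (vt a)) Z) (vt b)"
    using br_vt[OF MV a] ta tb tZ by (simp add: br_scale1 br_T eps_T)
  also have "br (br (eps (vt a)) Z) (vt b) = br (eps (vt a)) (br Z (vt b))"
    using ta tb tZ by (simp add: eps_MV[OF vt_MV[OF a]] br_scale1 br_T left_right_commute[OF a b])
  also have "\<dots> = par (i * (r + (j + 1) - 1)) *\<^sub>R br (br Z (vt b)) (vt a)"
    using br_vt[OF br_MV[OF MV vt_MV[OF b]] a] by simp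
  finally show ?case by (cases "even i"; cases "even j"; cases "even r") (simp_all add: par_def)
next
  case (linear c X Y)
  then show ?case using MV_T[OF vt_MV[OF a]] MV_T[OF vt_MV[OF b]]
    by (simp add: br_add1 br_scale1 br_T scale_T scaleR_add_right mult.commute)
qed

definition W :: "int \<Rightarrow> ('x \<times> 'w) set"
  where "W d = CH (d + 2) \<times> WS (d + 1)"

abbreviation fold_br :: "'x \<Rightarrow> ('x \<times> 'w) list \<Rightarrow> 'x"
  where "fold_br X vs \<equiv> foldl (\<lambda>X v. br X (vt (snd v))) X vs"

text \<open>Unrolled, this is a sum over the position of the one entry that contributes its first
  component: later entries act on it from the right, earlier ones from the left, and
  \<open>eps\<close> supplies the sign.\<close>

primrec derived :: "('x \<times> 'w) list \<Rightarrow> 'x" where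
  "derived [] = 0"
| "derived (v # vs) = fold_br (fst v) vs + br (eps (vt (snd v))) (derived vs)"

text \<open>On a k-vector field, minus \<open>eps\<close> is (-1)^(k - 1), the sign (-1)^|X| of the
  binary bracket.\<close>

definition binary :: "('x \<times> 'w) list \<Rightarrow> 'x"
  where "binary vs = (case vs of [x, y] \<Rightarrow> br (- eps (fst x)) (fst y) | _ \<Rightarrow> 0)"

definition brackets :: "('x \<times> 'w) list \<Rightarrow> 'x \<times> 'w"
  where "brackets vs = (binary vs, P (derived vs))"

text \<open>Multilinearity must hold for sums of different degrees, so membership in the span
  \<open>T\<close> takes the place of homogeneity.\<close>

definition adm :: "('x \<times> 'w) set" where "adm = {v. fst v \<in> T \<and> vt (snd v) \<in> T}"

lemma subspace_adm: "subspace adm"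
proof (rule subspaceI)
  fix u v assume "u \<in> adm" "v \<in> adm"
  then show "u + v \<in> adm" using vt_linear[of "snd u" 1 "snd v"] add_T by (simp add: adm_def)
next
  fix c v assume "v \<in> adm"
  then show "c *\<^sub>R v \<in> adm" using scale_T by (simp add: adm_def vt_scale)
qed (simp add: adm_def)

lemma fold_br_T: "X \<in> T \<Longrightarrow> set vs \<subseteq> adm \<Longrightarrow> fold_br X vs \<in> T"
  by (induction vs arbitrary: X) (auto simp: adm_def br_T)

lemma fold_br_linear:
  "X \<in> T \<Longrightarrow> Y \<in> T \<Longrightarrow> set vs \<subseteq> adm \<Longrightarrow> fold_br (X + c *\<^sub>R Y) vs = fold_br X vs + c *\<^sub>R fold_br Y vs"
proof (induction vs arbitrary: X Y)
  case (Cons v vs)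
  then show ?case using br_linear1[of X Y "vt (snd v)" c] by (simp add: adm_def br_T T_def[symmetric])
qed simp

lemma fold_br_zero [simp]: "set vs \<subseteq> adm \<Longrightarrow> fold_br 0 vs = 0"
  using fold_br_linear[of 0 0 vs 1] by simp

lemma fold_br_scale: "X \<in> T \<Longrightarrow> set vs \<subseteq> adm \<Longrightarrow> fold_br (c *\<^sub>R X) vs = c *\<^sub>R fold_br X vs"
  using fold_br_linear[of 0 X vs c] by simp

lemma derived_T: "set vs \<subseteq> adm \<Longrightarrow> derived vs \<in> T"
  by (induction vs) (auto simp: br_T eps_T fold_br_T adm_def intro!: add_T)

lemma fold_br_slot_linear:
  assumes "X \<in> T" "set us \<subseteq> adm" "x \<in> adm" "y \<in> adm" "set ws \<subseteq> adm"
  shows "fold_br X (us @ (x + c *\<^sub>R y) # ws) = fold_br X (us @ x # ws) + c *\<^sub>R fold_br X (us @ y # ws)"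
  using assms
proof (induction us arbitrary: X)
  case Nil
  then show ?case using br_linear2[of "vt (snd x)" "vt (snd y)" X c]
    by (simp add: vt_linear adm_def T_def[symmetric] fold_br_linear br_T)
next
  case (Cons u us)
  with br_T show ?case by (simp add: adm_def)
qed

lemma derived_slot_linear:
  assumes "set us \<subseteq> adm" "x \<in> adm" "y \<in> adm" "set ws \<subseteq> adm"
  shows "derived (us @ (x + c *\<^sub>R y) # ws) = derived (us @ x # ws) + c *\<^sub>R derived (us @ y # ws)"
  using assms
proof (induction us)
  case Nil
  then have "eps (vt (snd x)) \<in> T" "eps (vt (snd y)) \<in> T" "fst x \<in> T" "fst y \<in> T" "derived ws \<in> T"
    by (auto simp: adm_def eps_T derived_T)
  then show ?case using br_linear1[of "eps (vt (snd x))" "eps (vt (snd y))" "derived ws" c] Nil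
    by (simp add: vt_linear eps_linear T_def[symmetric] fold_br_linear algebra_simps)
next
  case (Cons u us)
  have 1: "fst u \<in> T" "eps (vt (snd u)) \<in> T" using Cons.prems by (auto simp: adm_def eps_T)
  have "derived (us @ x # ws) \<in> T" "derived (us @ y # ws) \<in> T" using Cons.prems by (simp_all add: derived_T)
  then show ?case using br_linear2[of "derived (us @ x # ws)" "derived (us @ y # ws)" "eps (vt (snd u))" c] Cons 1
      fold_br_slot_linear[of "fst u" us x y ws c] by (simp add: T_def[symmetric] algebra_simps)
qed

lemma binary_other: "length vs \<noteq> 2 \<Longrightarrow> binary vs = 0"
  by (cases vs; cases "tl vs"; cases "tl (tl vs)") (auto simp: binary_def)

lemma binary_slot_linear:
  assumes "set us \<subseteq> adm" "x \<in> adm" "y \<in> adm" "set ws \<subseteq> adm"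
  shows "binary (us @ (x + c *\<^sub>R y) # ws) = binary (us @ x # ws) + c *\<^sub>R binary (us @ y # ws)"
proof -
  consider "length us + length ws \<noteq> 1" | w where "us = []" "ws = [w]" | u where "us = [u]" "ws = []"
    by (cases us; cases ws; cases "tl us"; cases "tl ws") auto
  then show ?thesis
  proof cases
    case 1
    then have "binary (us @ z # ws) = 0" for z by (simp add: binary_other)
    then show ?thesis by simp
  next
    case 2
    then have "fst w \<in> T" "- eps (fst x) \<in> T" "- eps (fst y) \<in> T"
      using assms by (auto simp: adm_def eps_T neg_T)
    then have "br (- eps (fst x) + c *\<^sub>R (- eps (fst y))) (fst w) =
      br (- eps (fst x)) (fst w) + c *\<^sub>R br (- eps (fst y)) (fst w)"
      by (intro br_linear1) (simp_all add: T_def[symmetric])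
    with 2 show ?thesis by (simp add: binary_def eps_linear)
  next
    case 3
    then have "fst x \<in> T" "fst y \<in> T" "- eps (fst u) \<in> T"
      using assms by (auto simp: adm_def eps_T neg_T)
    then show ?thesis using 3 br_linear2[of "fst x" "fst y" "- eps (fst u)" c]
      by (simp add: binary_def T_def[symmetric])
  qed
qed

lemma brackets_linear:
  assumes "set us \<subseteq> adm" "x \<in> adm" "y \<in> adm" "set ws \<subseteq> adm"
  shows "brackets (us @ (x + c *\<^sub>R y) # ws) = brackets (us @ x # ws) + c *\<^sub>R brackets (us @ y # ws)"
  by (simp add: brackets_def binary_slot_linear[OF assms] derived_slot_linear[OF assms] P_linear)

lemma W_adm: "W d \<subseteq> adm"
proof
  fix v assume "v \<in> W d"
  then have "fst v \<in> MV (d + 2)" "vt (snd v) \<in> MV (d + 1)" using vt_MV by (auto simp: W_def intro: subsetD[OF CH_MV])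
  then show "v \<in> adm" using MV_T by (auto simp: adm_def)
qed

lemma brackets_zero: "set us \<subseteq> adm \<Longrightarrow> set ws \<subseteq> adm \<Longrightarrow> brackets (us @ 0 # ws) = 0"
  using brackets_linear[of us 0 0 ws 1] subspace_0[OF subspace_adm] by simp

section \<open>Homogeneous lists and the generalized Jacobi identities\<close>

definition hom :: "(int \<times> 'x \<times> 'w) list \<Rightarrow> bool"
  where "hom ps \<longleftrightarrow> (\<forall>(d, v) \<in> set ps. v \<in> W d)"

lemma hom_simps [simp]: "hom []" "hom (p # ps) \<longleftrightarrow> snd p \<in> W (fst p) \<and> hom ps" "hom (ps @ qs) \<longleftrightarrow> hom ps \<and> hom qs"
  by (auto simp: hom_def)

lemma hom_adm: "hom ps \<Longrightarrow> set (map snd ps) \<subseteq> adm"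
  using W_adm by (fastforce simp: hom_def)

lemma hom_mset: "hom ps \<Longrightarrow> mset L + mset R = mset ps \<Longrightarrow> hom L \<and> hom R"
  unfolding hom_def by (metis UnCI set_mset_mset set_mset_union)

text \<open>\<open>QD\<close> is the summand of the graded square of \<open>D\<close>;
  \<open>QF X\<close> is the cross term contributed by a new first entry whose first component is
  \<open>X\<close>.\<close>

abbreviation "F X ps \<equiv> fold_br X (map snd ps)"
abbreviation "D ps \<equiv> derived (map snd ps)"
abbreviation "B L \<equiv> binary (map snd L)"
abbreviation "QD L R \<equiv> par (deg L) *\<^sub>R br (D L) (D R)"
abbreviation "QF X L R \<equiv> par (deg L) *\<^sub>R br (F X L) (D R)"

lemma W_MV: "v \<in> W d \<Longrightarrow> fst v \<in> MV (d + 2)" "v \<in> W d \<Longrightarrow> snd v \<in> WS (d + 1)"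
  by (auto simp: W_def intro: subsetD[OF CH_MV])

lemma W_vt: "v \<in> W d \<Longrightarrow> vt (snd v) \<in> MV (d + 1)"
  using W_MV(2) vt_MV by blast

lemma F_MV: "X \<in> MV p \<Longrightarrow> hom ps \<Longrightarrow> F X ps \<in> MV (p + deg ps)"
proof (induction ps arbitrary: X p)
  case (Cons w ps)
  have "br X (vt (snd (snd w))) \<in> MV (p + (fst w + 1) - 1)" using Cons.prems by (intro br_MV W_vt) auto
  then show ?case using Cons.IH[of "br X (vt (snd (snd w)))" "p + fst w"] Cons.prems by (simp add: add.assoc)
qed simp

lemma D_MV: "hom ps \<Longrightarrow> D ps \<in> MV (deg ps + 2)"
proof (induction ps)
  case (Cons w ps)
  have "F (fst (snd w)) ps \<in> MV (fst w + 2 + deg ps)" using Cons.prems by (intro F_MV W_MV) auto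
  moreover have "eps (vt (snd (snd w))) \<in> MV (fst w + 1)"
    using Cons.prems W_vt[of "snd w" "fst w"] by (simp add: eps_MV[of _ "fst w + 1"] subspace_scale[OF subspace_MV])
  then have "br (eps (vt (snd (snd w)))) (D ps) \<in> MV (fst w + 1 + (deg ps + 2) - 1)"
    using Cons by (intro br_MV) auto
  ultimately show ?case using subspace_add[OF subspace_MV, of _ "fst w + deg ps + 2"] by (simp add: algebra_simps)
qed simp

lemma left_fold:
  assumes "a \<in> WS p" "Z \<in> T" "hom ps"
  shows "br (vt a) (F Z ps) = F (br (vt a) Z) ps"
  using assms(2,3)
proof (induction ps arbitrary: Z)
  case (Cons w ps)
  have "vt (snd (snd w)) \<in> T" using Cons.prems W_vt[of "snd w" "fst w"] MV_T by simp
  moreover have "snd (snd w) \<in> WS (fst w + 1)" using Cons.prems W_MV by auto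
  ultimately show ?case using Cons left_right_commute[OF assms(1), of "snd (snd w)" "fst w + 1" Z] by (simp add: br_T)
qed simp

text \<open>By the Jacobi identity each right bracket is a graded derivation; iterated, it
  distributes the entries over the two factors by unshuffles.\<close>

lemma fold_br_leibniz:
  assumes "X \<in> MV p" "Y \<in> MV q" "hom ps"
  shows "F (br X Y) ps = koszul_sum (\<lambda>L R. par (deg L * (q + 1)) *\<^sub>R br (F X L) (F Y R)) ps"
  using assms
proof (induction ps arbitrary: X Y p q)
  case (Cons w ps)
  define d a where "d = fst w" and "a = vt (snd (snd w))"
  have a: "a \<in> MV (d + 1)" and hom: "hom ps" using Cons.prems W_vt by (auto simp: a_def d_def)
  have Xa: "br X a \<in> MV (p + d)" and Ya: "br Y a \<in> MV (q + d)"
    using br_MV[OF Cons.prems(1) a] br_MV[OF Cons.prems(2) a] by (simp_all add: add.assoc)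
  note T = MV_T[OF Cons.prems(1)] MV_T[OF Cons.prems(2)] MV_T[OF a]
  have "br (br X Y) a = br X (br Y a) + par (d * (q + 1)) *\<^sub>R br (br X a) Y"
  proof -
    have 1: "br Y (br X a) = - (par ((q + 1) * (p + d + 1)) *\<^sub>R br (br X a) Y)"
      by (rule br_antisym[OF Cons.prems(2) Xa])
    show ?thesis using br_jacobi[OF Cons.prems(1,2) a] unfolding 1
      by (cases "even p"; cases "even q"; cases "even d") (simp_all add: par_def)
  qed
  then have "F (br X Y) (w # ps) = F (br X (br Y a)) ps + par (d * (q + 1)) *\<^sub>R F (br (br X a) Y) ps"
    using T hom_adm[OF hom] by (simp add: a_def[symmetric] fold_br_linear br_T)
  also have "\<dots> = koszul_sum (\<lambda>L R. par (deg L * (q + d + 1)) *\<^sub>R br (F X L) (F (br Y a) R) +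
      par (d * (q + 1)) *\<^sub>R par (deg L * (q + 1)) *\<^sub>R br (F (br X a) L) (F Y R)) ps"
    using Cons.IH[OF Cons.prems(1) Ya hom] Cons.IH[OF Xa Cons.prems(2) hom]
    by (simp only: koszul_sum_add koszul_sum_scaleR)
  also have "\<dots> = koszul_sum (\<lambda>L R. par (deg L * (q + 1)) *\<^sub>R br (F X L) (F Y R)) (w # ps)"
    unfolding koszul_sum_Cons by (rule koszul_sum_cong) (simp add: a_def[symmetric] d_def[symmetric] par_def)
  finally show ?case .
qed (simp add: par_def)

text \<open>What \<open>binary\<close> leaves, up to sign, after a first entry with first component
  \<open>X\<close>.\<close>

definition single :: "'x \<Rightarrow> ('x \<times> 'w) list \<Rightarrow> 'x"
  where "single X vs = (case vs of [y] \<Rightarrow> br X (fst y) | _ \<Rightarrow> 0)"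

abbreviation "SF X L R \<equiv> F (single X (map snd L)) R"

lemma single_MV: "X \<in> MV p \<Longrightarrow> hom L \<Longrightarrow> single X (map snd L) \<in> MV (p + deg L + 1)"
proof (cases L rule: remdups_adj.cases)
  case (2 y)
  assume "X \<in> MV p" "hom L"
  then have "br X (fst (snd y)) \<in> MV (p + (fst y + 2) - 1)" using 2 by (intro br_MV W_MV) auto
  with 2 show ?thesis by (simp add: single_def algebra_simps)
qed (auto simp: single_def)

lemma lam_MV: "a \<in> WS (d + 1) \<Longrightarrow> X \<in> MV p \<Longrightarrow> br (eps (vt a)) X \<in> MV (p + d)"
  using br_MV[of "eps (vt a)" "d + 1" X p] by (simp add: eps_MV[OF vt_MV] subspace_scale[OF subspace_MV] vt_MV add.commute)

lemma lam_fold: "a \<in> WS p \<Longrightarrow> Z \<in> T \<Longrightarrow> hom ps \<Longrightarrow> br (eps (vt a)) (F Z ps) = F (br (eps (vt a)) Z) ps"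
  using left_fold[of a p Z ps] hom_adm[of ps] MV_T[OF vt_MV, of a p]
  by (simp add: eps_MV[OF vt_MV] br_scale1 fold_br_T fold_br_scale br_T)

lemma lam_leibniz:
  assumes "a \<in> WS (d + 1)" "U \<in> MV p" "V \<in> MV q"
  shows "br (eps (vt a)) (br U V) = br (br (eps (vt a)) U) V + par (d * (p + 1)) *\<^sub>R br U (br (eps (vt a)) V)"
proof -
  note T = MV_T[OF assms(2)] MV_T[OF assms(3)] MV_T[OF vt_MV[OF assms(1)]]
  show ?thesis using br_jacobi[OF vt_MV[OF assms(1)] assms(2,3)] T by (cases "even d"; cases "even p")
       (simp_all add: eps_MV[OF vt_MV[OF assms(1)]] par_def br_minus1 br_minus2 br_T)
qed

lemma lam_koszul_sum:
  assumes "a \<in> WS d" "\<And>L R. mset L + mset R = mset ps \<Longrightarrow> G L R \<in> T"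
  shows "br (eps (vt a)) (koszul_sum G ps) = koszul_sum (\<lambda>L R. br (eps (vt a)) (G L R)) ps"
  using koszul_sum_linear[of T "br (eps (vt a))" ps G] assms(2) eps_T[OF MV_T[OF vt_MV[OF assms(1)]]]
  by (simp add: br_add2 br_scale2 subspace_T)

text \<open>Only those terms survive in which \<open>X\<close> meets the first component of one
  entry before any vertical part acts. Both sides satisfy the same recursion in the first entry,
  \<open>K\<close> for the left and \<open>J\<close> for the right side.\<close>

lemma derived_right_sum:
  assumes "X \<in> MV p" "hom ps"
  shows "koszul_sum (QF X) ps =
    koszul_sum (SF X) ps" using assms
proof (induction ps arbitrary: X p)
  case Nil
  then show ?case by (simp add: single_def MV_T)
next
  case (Cons w ps)
  define d b Y where "d = fst w" and "b = snd (snd w)" and "Y = fst (snd w)"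
  have b: "b \<in> WS (d + 1)" and Y: "Y \<in> MV (d + 2)" and hom: "hom ps" and X: "X \<in> MV p"
    using Cons.prems W_MV by (auto simp: b_def d_def Y_def)
  define l where "l = (\<lambda>Z. br (eps (vt b)) Z)"
  have Xb: "br X (vt b) = par (d * p) *\<^sub>R l X" using br_vt[OF X b] by (simp add: l_def)
  have sub: "hom L" "hom R" if "mset L + mset R = mset ps" for L R using hom_mset[OF hom that] by auto
  have K: "koszul_sum (QF X) (w # ps) = F (br X Y) ps +
    par (d * (p + 1)) *\<^sub>R l (koszul_sum (QF X) ps)"
  proof -
    have "koszul_sum (QF X) (w # ps) =
      koszul_sum (\<lambda>L R. par (deg L * (d + 2 + 1)) *\<^sub>R br (F X L) (F Y R) +
        par (d * (p + 1)) *\<^sub>R l (QF X L R)) ps" unfolding koszul_sum_Cons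
    proof (rule koszul_sum_cong)
      fix L R assume LR: "mset L + mset R = mset ps"
      note h = sub[OF LR]
      have U: "F X L \<in> MV (p + deg L)" and V: "D R \<in> MV (deg R + 2)" and FY: "F Y R \<in> MV (d + 2 + deg R)"
        using F_MV[OF X h(1)] D_MV[OF h(2)] F_MV[OF Y h(2)] by auto
      have lV: "l (D R) \<in> MV (deg R + 2 + d)" using lam_MV[OF b V] by (simp add: l_def)
      have 1: "F X (w # L) = par (d * p) *\<^sub>R l (F X L)"
        using lam_fold[OF b MV_T[OF X] h(1)] Xb hom_adm[OF h(1)] MV_T[OF lam_MV[OF b X]]
        by (simp add: b_def[symmetric] l_def fold_br_scale)
      have 2: "D (w # R) = F Y R + l (D R)" by (simp add: Y_def b_def l_def)
      \<comment> \<open>The two terms in which the vertical part \<open>b\<close> hits one factor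
        are to be collected into its action on the whole bracket.\<close>
      have 3: "l (br (F X L) (D R)) = br (l (F X L)) (D R) + par (d * (p + deg L + 1)) *\<^sub>R br (F X L) (l (D R))"
        unfolding l_def by (rule lam_leibniz[OF b U V])
      have T: "F X L \<in> T" "D R \<in> T" "F Y R \<in> T" "l (D R) \<in> T" "l (F X L) \<in> T" "br (F X L) (D R) \<in> T"
        using MV_T[OF U] MV_T[OF V] MV_T[OF FY] MV_T[OF lV] MV_T[OF lam_MV[OF b U]] by (auto simp: l_def br_T)
      have ls: "l (c *\<^sub>R br (F X L) (D R)) = c *\<^sub>R l (br (F X L) (D R))" for c
        unfolding l_def using T eps_T[OF MV_T[OF vt_MV[OF b]]] by (simp add: br_scale2)
      show "par (deg (w # L)) *\<^sub>R br (F X (w # L)) (D R) +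
        par (fst w * deg L) *\<^sub>R par (deg L) *\<^sub>R br (F X L) (D (w # R)) =
        par (deg L * (d + 2 + 1)) *\<^sub>R br (F X L) (F Y R) + par (d * (p + 1)) *\<^sub>R l (QF X L R)"
        unfolding 1 2 ls 3 d_def[symmetric] deg_simps
        using T by (cases "even d"; cases "even p"; cases "even (deg L)")
          (simp_all add: par_def br_add2 br_minus1 br_minus2 scaleR_add_right)
    qed
    also have "\<dots> = koszul_sum (\<lambda>L R. par (deg L * (d + 2 + 1)) *\<^sub>R br (F X L) (F Y R)) ps +
      par (d * (p + 1)) *\<^sub>R koszul_sum (\<lambda>L R. l (QF X L R)) ps"
      by (simp only: koszul_sum_add koszul_sum_scaleR)
    also have "koszul_sum (\<lambda>L R. l (QF X L R)) ps =
      l (koszul_sum (QF X) ps)" unfolding l_def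
    proof (rule lam_koszul_sum[OF b, symmetric])
      fix L R assume "mset L + mset R = mset ps"
      from sub[OF this] show "QF X L R \<in> T"
        using MV_T[OF F_MV[OF X]] MV_T[OF D_MV] by (intro scale_T br_T) auto
    qed
    finally show ?thesis by (simp only: fold_br_leibniz[OF X Y hom])
  qed
  have J: "koszul_sum (SF X) (w # ps) = F (br X Y) ps +
    par (d * (p + 1)) *\<^sub>R l (koszul_sum (SF X) ps)"
  proof -
    have "koszul_sum (SF X) (w # ps) =
      koszul_sum (\<lambda>L R. (if L = [] then F (br X Y) R else 0) +
        par (d * (p + 1)) *\<^sub>R l (SF X L R)) ps" unfolding koszul_sum_Cons
    proof (rule koszul_sum_cong)
      fix L R assume LR: "mset L + mset R = mset ps"
      note h = sub[OF LR]
      define Z where "Z = single X (map snd L)"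
      have Z: "Z \<in> MV (p + deg L + 1)" unfolding Z_def by (rule single_MV[OF X h(1)])
      have 1: "F (single X (map snd (w # L))) R = (if L = [] then F (br X Y) R else 0)"
        using hom_adm[OF h(2)] by (cases L) (auto simp: single_def Y_def)
      have lZ: "l Z \<in> T" using MV_T[OF lam_MV[OF b Z]] by (simp add: l_def)
      have "F Z (w # R) = par (d * (p + deg L + 1)) *\<^sub>R l (F Z R)"
        using br_vt[OF Z b] lam_fold[OF b MV_T[OF Z] h(2)] hom_adm[OF h(2)] lZ
        by (simp add: b_def[symmetric] l_def fold_br_scale)
      then show "F (single X (map snd (w # L))) R + par (fst w * deg L) *\<^sub>R F (single X (map snd L)) (w # R) =
        (if L = [] then F (br X Y) R else 0) + par (d * (p + 1)) *\<^sub>R l (SF X L R)"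
        unfolding 1 Z_def[symmetric] d_def[symmetric]
        by (cases "even d"; cases "even p"; cases "even (deg L)") (simp_all add: par_def)
    qed
    also have "\<dots> = F (br X Y) ps + par (d * (p + 1)) *\<^sub>R koszul_sum (\<lambda>L R. l (SF X L R)) ps"
      by (simp only: koszul_sum_add koszul_sum_scaleR koszul_sum_single_left)
    also have "koszul_sum (\<lambda>L R. l (SF X L R)) ps =
      l (koszul_sum (SF X) ps)" unfolding l_def
    proof (rule lam_koszul_sum[OF b, symmetric])
      fix L R assume "mset L + mset R = mset ps"
      from sub[OF this] show "SF X L R \<in> T" by (intro MV_T[OF F_MV[OF single_MV[OF X]]])
    qed
    finally show ?thesis .
  qed
  show ?case unfolding K J Cons.IH[OF X hom] ..
qed

text \<open>A new first entry contributes two families of cross terms. Exchanging the blocks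
  identifies them, whence the factor 2, and \<open>derived_right_sum\<close> evaluates them. The
  remaining terms follow by induction, because bracketing with a vertical lift is a graded
  derivation.\<close>

lemma derived_square:
  assumes "hom ps"
  shows "koszul_sum QD ps =
    - (2 *\<^sub>R koszul_sum (\<lambda>L R. F (B L) R) ps)" using assms
proof (induction ps)
  case Nil
  then show ?case by (simp add: binary_def)
next
  case (Cons v ps)
  define d a X where "d = fst v" and "a = snd (snd v)" and "X = fst (snd v)"
  have a: "a \<in> WS (d + 1)" and X: "X \<in> MV (d + 2)" and hom: "hom ps"
    using Cons.prems W_MV by (auto simp: a_def d_def X_def)
  define l where "l = (\<lambda>Z. br (eps (vt a)) Z)"
  have sub: "hom L" "hom R" if "mset L + mset R = mset ps" for L R using hom_mset[OF hom that] by auto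
  have lT: "l U \<in> T" if "U \<in> T" for U
    unfolding l_def using that eps_T[OF MV_T[OF vt_MV[OF a]]] by (rule br_T[rotated])
  have lscale: "l (c *\<^sub>R U) = c *\<^sub>R l U" if "U \<in> T" for U c
    unfolding l_def using that eps_T[OF MV_T[OF vt_MV[OF a]]] by (simp add: br_scale2)
  define K where "K = koszul_sum (SF X) ps"
  define Q where "Q = koszul_sum QD ps"
  define H where "H = koszul_sum (\<lambda>L R. F (B L) R) ps"
  have "koszul_sum QD (v # ps) =
    koszul_sum (\<lambda>L R. par d *\<^sub>R QF X L R +
      par (d * deg L + deg L) *\<^sub>R br (D L) (F X R) + par d *\<^sub>R l (QD L R)) ps"
    unfolding koszul_sum_Cons
  proof (rule koszul_sum_cong)
    fix L R assume LR: "mset L + mset R = mset ps"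
    note h = sub[OF LR]
    have U: "D L \<in> MV (deg L + 2)" and V: "D R \<in> MV (deg R + 2)"
      and FL: "F X L \<in> MV (d + 2 + deg L)" and FR: "F X R \<in> MV (d + 2 + deg R)"
      using F_MV[OF X h(1)] F_MV[OF X h(2)] D_MV[OF h(1)] D_MV[OF h(2)] by auto
    have 1: "D (v # L) = F X L + l (D L)" "D (v # R) = F X R + l (D R)" by (simp_all add: X_def a_def l_def)
    have 3: "l (br (D L) (D R)) = br (l (D L)) (D R) + par (d * (deg L + 2 + 1)) *\<^sub>R br (D L) (l (D R))"
      unfolding l_def by (rule lam_leibniz[OF a U V])
    have T: "F X L \<in> T" "D L \<in> T" "D R \<in> T" "F X R \<in> T" "l (D R) \<in> T" "l (D L) \<in> T" "br (D L) (D R) \<in> T"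
      using MV_T[OF U] MV_T[OF V] MV_T[OF FL] MV_T[OF FR] by (auto intro: lT br_T)
    show "par (deg (v # L)) *\<^sub>R br (D (v # L)) (D R) + par (fst v * deg L) *\<^sub>R par (deg L) *\<^sub>R br (D L) (D (v # R)) =
      par d *\<^sub>R QF X L R +
      par (d * deg L + deg L) *\<^sub>R br (D L) (F X R) + par d *\<^sub>R l (QD L R)"
      unfolding 1 lscale[OF T(7)] 3 d_def[symmetric] deg_simps using T by (cases "even d"; cases "even (deg L)")
        (simp_all add: par_def br_add1 br_add2 scaleR_add_right)
  qed
  also have "\<dots> = par d *\<^sub>R koszul_sum (QF X) ps +
    koszul_sum (\<lambda>L R. par (d * deg L + deg L) *\<^sub>R br (D L) (F X R)) ps +
    par d *\<^sub>R koszul_sum (\<lambda>L R. l (QD L R)) ps"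
    by (simp only: koszul_sum_add koszul_sum_scaleR)
  also have "koszul_sum (QF X) ps = K"
    unfolding K_def by (rule derived_right_sum[OF X hom])
  also have "koszul_sum (\<lambda>L R. par (d * deg L + deg L) *\<^sub>R br (D L) (F X R)) ps =
    koszul_sum (\<lambda>L R. par d *\<^sub>R QF X L R) ps"
    unfolding koszul_sum_swap[where G = "\<lambda>L R. par (d * deg L + deg L) *\<^sub>R br (D L) (F X R)"]
  proof (rule koszul_sum_cong)
    fix L R assume LR: "mset L + mset R = mset ps"
    note h = sub[OF LR]
    show "par (deg L * deg R) *\<^sub>R par (d * deg R + deg R) *\<^sub>R br (D R) (F X L) =
      par d *\<^sub>R QF X L R" unfolding br_antisym[OF D_MV[OF h(2)] F_MV[OF X h(1)]]
      by (cases "even d"; cases "even (deg L)"; cases "even (deg R)") (simp_all add: par_def)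
  qed
  also have "\<dots> = par d *\<^sub>R K" unfolding koszul_sum_scaleR K_def derived_right_sum[OF X hom] ..
  also have "koszul_sum (\<lambda>L R. l (QD L R)) ps = l Q" unfolding Q_def l_def
  proof (rule lam_koszul_sum[OF a, symmetric])
    fix L R assume "mset L + mset R = mset ps"
    from sub[OF this] show "QD L R \<in> T"
      using MV_T[OF D_MV] by (intro scale_T br_T) auto
  qed
  finally have 1: "koszul_sum QD (v # ps) =
    par d *\<^sub>R K + par d *\<^sub>R K + par d *\<^sub>R l Q" .
  have binMV: "B L \<in> MV (deg L + 3)" if "hom L" for L
  proof (cases "length L = 2")
    case True
    then obtain x y where L: "L = [x, y]" by (auto simp: length_Suc_conv numeral_2_eq_2)
    have x: "fst (snd x) \<in> MV (fst x + 2)" and y: "fst (snd y) \<in> MV (fst y + 2)" using that L W_MV by auto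
    have "- eps (fst (snd x)) \<in> MV (fst x + 2)"
      using x by (simp add: eps_MV[OF x] subspace_neg[OF subspace_MV] subspace_scale[OF subspace_MV])
    from br_MV[OF this y] show ?thesis using L by (simp add: binary_def algebra_simps)
  qed (simp add: binary_other)
  have "koszul_sum (\<lambda>L R. F (B L) R) (v # ps) =
    koszul_sum (\<lambda>L R. - (par d *\<^sub>R SF X L R) + par d *\<^sub>R l (F (B L) R)) ps"
    unfolding koszul_sum_Cons
  proof (rule koszul_sum_cong)
    fix L R assume LR: "mset L + mset R = mset ps"
    note h = sub[OF LR]
    define Z where "Z = B L"
    have Z: "Z \<in> MV (deg L + 3)" unfolding Z_def by (rule binMV[OF h(1)])
    have "binary (map snd (v # L)) = - (par d *\<^sub>R single X (map snd L))"
    proof (cases "length L = 1")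
      case True
      then obtain y where L: "L = [y]" by (auto simp: length_Suc_conv)
      have "fst (snd y) \<in> T" using h L W_MV(1)[of "snd y" "fst y"] MV_T by simp
      then show ?thesis using L MV_T[OF X]
        by (simp add: binary_def single_def X_def[symmetric] eps_MV[OF X] br_minus1 br_scale1
            scale_T par_def)
    next
      case False
      then have "single X (map snd L) = 0" by (cases L; cases "tl L") (auto simp: single_def)
      then show ?thesis using False binary_other[of "map snd (v # L)"] by simp
    qed
    moreover have s: "single X (map snd L) \<in> T" by (rule MV_T[OF single_MV[OF X h(1)]])
    ultimately have 1: "F (binary (map snd (v # L))) R = - (par d *\<^sub>R SF X L R)"
      using fold_br_scale[OF s hom_adm[OF h(2)], of "- par d"] by simp
    have "F Z (v # R) = par (d * (deg L + 3)) *\<^sub>R l (F Z R)"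
      using br_vt[OF Z a] lam_fold[OF a MV_T[OF Z] h(2)] hom_adm[OF h(2)] lT[OF MV_T[OF Z]]
      by (simp add: a_def[symmetric] l_def fold_br_scale)
    then show "F (binary (map snd (v # L))) R + par (fst v * deg L) *\<^sub>R F (B L) (v # R) =
      - (par d *\<^sub>R SF X L R) + par d *\<^sub>R l (F (B L) R)"
      unfolding 1 Z_def[symmetric] d_def[symmetric] by (cases "even d"; cases "even (deg L)") (simp_all add: par_def)
  qed
  also have "\<dots> = - (par d *\<^sub>R K) + par d *\<^sub>R koszul_sum (\<lambda>L R. l (F (B L) R)) ps"
    by (simp only: koszul_sum_add koszul_sum_scaleR koszul_sum_minus K_def)
  also have "koszul_sum (\<lambda>L R. l (F (B L) R)) ps = l H" unfolding l_def H_def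
  proof (rule lam_koszul_sum[OF a, symmetric])
    fix L R assume "mset L + mset R = mset ps"
    from sub[OF this] show "F (B L) R \<in> T" by (intro MV_T[OF F_MV[OF binMV]])
  qed
  finally have 2: "koszul_sum (\<lambda>L R. F (B L) R) (v # ps) = - (par d *\<^sub>R K) + par d *\<^sub>R l H" .
  have HT: "H \<in> T" unfolding H_def by (rule koszul_sum_linear[where f = "\<lambda>x. x", THEN conjunct2])
       (auto simp: subspace_T intro: MV_T[OF F_MV[OF binMV]] dest: sub)
  have "Q = - (2 *\<^sub>R H)" unfolding Q_def H_def by (rule Cons.IH[OF hom])
  then have lQ: "l Q = - (2 *\<^sub>R l H)" using lscale[OF HT, of "- 2"] by simp
  show ?case unfolding 1 2 lQ scaleR_2 by (simp add: scaleR_add_right scaleR_diff_right)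
qed

text \<open>Each argument is its vertical part plus an element of the kernel: \<open>P\<close> kills
  the bracket of the kernel parts, and the bracket of the vertical parts is zero.\<close>

lemma P_br:
  assumes X: "X \<in> MV p" and Y: "Y \<in> MV q"
  shows "P (br X Y) = P (br (vt (P X)) Y) + P (br X (vt (P Y)))"
proof -
  have v: "vt (P X) \<in> MV p" "vt (P Y) \<in> MV q" using X Y P_WS vt_MV by auto
  have "X - vt (P X) \<in> MV p" "Y - vt (P Y) \<in> MV q" using X Y v subspace_diff[OF subspace_MV] by auto
  moreover have "P (X - vt (P X)) = 0" "P (Y - vt (P Y)) = 0"
    using P_linear[of X "- 1" "vt (P X)"] P_linear[of Y "- 1" "vt (P Y)"] P_vt[OF P_WS[OF X]] P_vt[OF P_WS[OF Y]]
    by simp_all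
  ultimately have "P (br (X - vt (P X)) (Y - vt (P Y))) = 0" by (rule kernel_P)
  moreover have "br (X - vt (P X)) (Y - vt (P Y)) =
    br X Y - br X (vt (P Y)) - br (vt (P X)) Y + br (vt (P X)) (vt (P Y))"
    using br_linear1[of X "vt (P X)" "Y - vt (P Y)" "- 1"] br_linear2[of Y "vt (P Y)" X "- 1"]
      br_linear2[of Y "vt (P Y)" "vt (P X)" "- 1"] MV_T[OF X] MV_T[OF Y] MV_T[OF v(1)] MV_T[OF v(2)]
      subspace_diff[OF subspace_T] by (simp add: T_def[symmetric])
  moreover have "br (vt (P X)) (vt (P Y)) = 0" by (rule abelian[OF P_WS[OF X] P_WS[OF Y]])
  ultimately have "P (br X Y - br X (vt (P Y)) - br (vt (P X)) Y) = 0" by simp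
  then show ?thesis
    using P_linear[of "br X Y - br X (vt (P Y))" "-1" "br (vt (P X)) Y"] P_linear[of "br X Y" "-1" "br X (vt (P Y))"]
    by (simp add: algebra_simps)
qed

lemma P_koszul_sum: "P (koszul_sum G ps) = koszul_sum (\<lambda>L R. P (G L R)) ps"
  using koszul_sum_linear[of UNIV P ps G] by (simp add: P_add P_scale)

lemma derived_P_sum:
  assumes hom: "hom ps"
  shows "koszul_sum (\<lambda>L R. P (br (eps (vt (P (D L)))) (D R))) ps =
    - koszul_sum (\<lambda>L R. P (F (B L) R)) ps"
proof -
  define G :: "(int \<times> 'x \<times> 'w) list \<Rightarrow> (int \<times> 'x \<times> 'w) list \<Rightarrow> 'w"
    where "G = (\<lambda>L R. P (br (eps (vt (P (D L)))) (D R)))"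
  \<comment> \<open>Adding the sum with exchanged blocks produces both terms of \<open>P_br\<close>,
    so the doubled sum is \<open>P\<close> of the graded square of \<open>D\<close>; the factor 2
    cancels at the end.\<close>
  have "koszul_sum G ps + koszul_sum G ps =
    koszul_sum G ps + koszul_sum (\<lambda>L R. par (deg L * deg R) *\<^sub>R G R L) ps"
    using koszul_sum_swap[of G ps] by simp
  also have "\<dots> = koszul_sum (\<lambda>L R. G L R + par (deg L * deg R) *\<^sub>R G R L) ps"
    by (simp only: koszul_sum_add)
  also have "\<dots> = koszul_sum (\<lambda>L R. P (QD L R)) ps"
  proof (rule koszul_sum_cong)
    fix L R assume "mset L + mset R = mset ps"
    note h = hom_mset[OF hom this]
    have U: "D L \<in> MV (deg L + 2)" and V: "D R \<in> MV (deg R + 2)" using D_MV h by auto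
    have vU: "vt (P (D L)) \<in> MV (deg L + 2)" and vV: "vt (P (D R)) \<in> MV (deg R + 2)"
      using U V P_WS vt_MV by auto
    note T = MV_T[OF U] MV_T[OF V] MV_T[OF vU] MV_T[OF vV]
    have "G R L = par (deg R) *\<^sub>R P (br (vt (P (D R))) (D L))"
      unfolding G_def eps_MV[OF vV] by (simp add: br_scale1[OF T(4) T(1)] P_scale par_def)
    also have "br (vt (P (D R))) (D L) = - (par ((deg R + 2 + 1) * (deg L + 2 + 1)) *\<^sub>R br (D L) (vt (P (D R))))"
      by (rule br_antisym[OF vV U])
    finally have "par (deg L * deg R) *\<^sub>R G R L = par (deg L) *\<^sub>R P (br (D L) (vt (P (D R))))"
      by (cases "even (deg L)"; cases "even (deg R)") (simp_all add: par_def P_minus)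
    moreover have "G L R = par (deg L) *\<^sub>R P (br (vt (P (D L))) (D R))"
      unfolding G_def eps_MV[OF vU] by (simp add: br_scale1[OF T(3) T(2)] P_scale par_def)
    ultimately show "G L R + par (deg L * deg R) *\<^sub>R G R L = P (QD L R)"
      by (simp add: P_scale P_br[OF U V] scaleR_add_right)
  qed
  also have "\<dots> = - (2 *\<^sub>R P (koszul_sum (\<lambda>L R. F (B L) R) ps))"
    unfolding P_koszul_sum[symmetric] derived_square[OF hom] by (simp add: P_minus P_scale)
  finally have "2 *\<^sub>R koszul_sum G ps = 2 *\<^sub>R (- koszul_sum (\<lambda>L R. P (F (B L) R)) ps)"
    by (simp add: P_koszul_sum scaleR_2)
  then show ?thesis unfolding G_def by (simp only: scaleR_cancel_left) auto
qed

text \<open>Only lists of three entries contribute, and for them this is the graded Jacobi identity;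
  \<open>w\<close> stands for the second components, which \<open>binary\<close> ignores.\<close>

lemma binary_jacobi:
  assumes hom: "hom ps"
  shows "koszul_sum (\<lambda>L R. binary ((B L, w L) # map snd R)) ps = 0"
proof (cases "length ps = 3")
  case False
  have "koszul_sum (\<lambda>L R. binary ((B L, w L) # map snd R)) ps = koszul_sum (\<lambda>L R. 0) ps"
  proof (rule koszul_sum_cong)
    fix L R assume "mset L + mset R = mset ps"
    then have "length L + length R \<noteq> 3" using False by (metis size_mset size_union)
    then have "length L \<noteq> 2 \<or> length R \<noteq> 1" by auto
    then show "binary ((B L, w L) # map snd R) = 0"
    proof
      assume "length L \<noteq> 2"
      then have 0: "B L = 0" by (simp add: binary_other)
      show ?thesis
      proof (cases "length R = 1")
        case True
        then obtain z where R: "R = [z]" by (auto simp: length_Suc_conv)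
        have "fst (snd z) \<in> T"
          using hom_mset[OF hom \<open>mset L + mset R = mset ps\<close>] R W_MV(1)[of "snd z" "fst z"] MV_T by simp
        then show ?thesis unfolding 0 using R by (simp add: binary_def)
      qed (simp add: binary_other)
    qed (simp add: binary_other)
  qed
  then show ?thesis by (simp add: koszul_sum_0)
next
  case True
  then obtain i X a j Y b k Z c where ps: "ps = [(i, X, a), (j, Y, b), (k, Z, c)]"
    by (auto simp: length_Suc_conv numeral_3_eq_3)
  have X: "X \<in> MV (i + 2)" and Y: "Y \<in> MV (j + 2)" and Z: "Z \<in> MV (k + 2)" using hom ps W_MV by fastforce+
  have bin: "binary [(binary [(A, a), (B, b)], c), (C, e)] = par (q + 1) *\<^sub>R br (br A B) C"
    if "A \<in> MV (p + 2)" "B \<in> MV (q + 2)" "C \<in> MV (r + 2)" for A B C p q r a b c e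
  proof -
    have AB: "br A B \<in> MV (p + 2 + (q + 2) - 1)" by (rule br_MV[OF that(1,2)])
    have "binary [(A, a), (B, b)] = - (par p *\<^sub>R br A B)" using MV_T[OF that(1)] MV_T[OF that(2)]
      by (simp add: binary_def eps_MV[OF that(1)] br_minus1 br_scale1 scale_T par_def)
    then have "binary [(binary [(A, a), (B, b)], c), (C, e)] = br (par (p + (p + 2 + (q + 2) - 1)) *\<^sub>R br A B) C"
      using eps_scale[of "- par p" "br A B"] by (simp add: binary_def eps_MV[OF AB] par_def)
    also have "\<dots> = par (q + 1) *\<^sub>R br (br A B) C"
      unfolding br_scale1[OF MV_T[OF AB] MV_T[OF that(3)]] by (simp add: par_def)
    finally show ?thesis .
  qed
  have zero: "binary [(0, c), (C, e)] = 0" if "C \<in> T" for C c e using that by (simp add: binary_def)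
  note T = MV_T[OF X] MV_T[OF Y] MV_T[OF Z]
  have small: "binary [] = 0" "binary [u] = 0" "binary [u, v, u'] = 0" "binary [u, v, u', v'] = 0" for u v u' v'
    by (simp_all add: binary_def)
  have "koszul_sum (\<lambda>L R. binary ((B L, w L) # map snd R)) ps =
    par (j + 1) *\<^sub>R br (br X Y) Z + par (k * j) *\<^sub>R par (k + 1) *\<^sub>R br (br X Z) Y +
    par (i * (j + k)) *\<^sub>R par (k + 1) *\<^sub>R br (br Y Z) X" unfolding ps koszul_sum_Cons koszul_sum_Nil
    using bin[OF X Y Z] bin[OF X Z Y] bin[OF Y Z X] T by (simp add: small zero mult.commute[of k j] par_def)
  also have "br (br Y Z) X = - (par ((j + 2 + (k + 2) - 1 + 1) * (i + 2 + 1)) *\<^sub>R br X (br Y Z))"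
    by (rule br_antisym[OF br_MV[OF Y Z] X])
  also have "br (br X Z) Y = - (par ((i + 2 + (k + 2) - 1 + 1) * (j + 2 + 1)) *\<^sub>R br Y (br X Z))"
    by (rule br_antisym[OF br_MV[OF X Z] Y])
  finally show ?thesis unfolding br_jacobi[OF X Y Z]
    by (cases "even i"; cases "even j"; cases "even k") (simp_all add: par_def)
qed

text \<open>In the second component a nested bracket splits into a term from the inner first
  component and one from the inner second component; by \<open>derived_P_sum\<close> their sums
  cancel.\<close>

lemma brackets_jacobi:
  assumes hom: "hom ps"
  shows "koszul_sum (\<lambda>L R. brackets (brackets (map snd L) # map snd R)) ps = 0"
proof -
  have "koszul_sum (\<lambda>L R. brackets (brackets (map snd L) # map snd R)) ps =
    koszul_sum (\<lambda>L R. (binary ((B L, P (D L)) # map snd R), 0) +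
      (0, P (F (B L) R) + P (br (eps (vt (P (D L)))) (D R)))) ps" by (simp add: brackets_def P_add)
  also have "\<dots> = koszul_sum (\<lambda>L R. (binary ((B L, P (D L)) # map snd R), 0)) ps +
      koszul_sum (\<lambda>L R. (0, P (F (B L) R) + P (br (eps (vt (P (D L)))) (D R)))) ps"
    by (rule koszul_sum_add)
  also have "koszul_sum (\<lambda>L R. (binary ((B L, P (D L)) # map snd R), 0)) ps =
    (koszul_sum (\<lambda>L R. binary ((B L, P (D L)) # map snd R)) ps, 0)"
    using koszul_sum_linear[of UNIV "\<lambda>x. (x, 0)"] by (simp add: prod_eq_iff)
  also have "koszul_sum (\<lambda>L R. (0, P (F (B L) R) + P (br (eps (vt (P (D L)))) (D R)))) ps =
    (0, koszul_sum (\<lambda>L R. P (F (B L) R) + P (br (eps (vt (P (D L)))) (D R))) ps)"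
    using koszul_sum_linear[of UNIV "\<lambda>x. (0, x)"] by (simp add: prod_eq_iff)
  finally show ?thesis
    using binary_jacobi[OF hom, of "\<lambda>L. P (D L)"] derived_P_sum[OF hom] by (simp add: koszul_sum_add zero_prod_def)
qed

text \<open>The symmetry axiom exchanges homogeneous neighbours among arbitrary other entries.
  Commuting with those entries requires their second components to lie in the span of
  \<open>WS\<close>.\<close>

definition tot :: "('x \<times> 'w) set" where "tot = adm \<inter> {v. snd v \<in> span (\<Union>p. WS p)}"

lemma tot_adm: "set vs \<subseteq> tot \<Longrightarrow> set vs \<subseteq> adm"
  by (auto simp: tot_def)

lemma W_tot: "W d \<subseteq> tot"
proof
  fix v assume v: "v \<in> W d"
  then have "snd v \<in> (\<Union>p. WS p)" using W_MV(2) by blast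
  then show "v \<in> tot" using W_adm[of d] v span_base[of "snd v"] by (auto simp: tot_def)
qed

lemma total_space_tot: "total_space W \<subseteq> tot"
  unfolding total_space_def
proof (rule span_minimal)
  show "(\<Union>d. W d) \<subseteq> tot" using W_tot by blast
  have "subspace {v :: 'x \<times> 'w. snd v \<in> span (\<Union>p. WS p)}"
    by (rule subspaceI) (auto simp: span_zero span_add span_scale)
  then show "subspace tot" unfolding tot_def by (intro subspace_inter subspace_adm)
qed

lemma left_right_commute_span:
  assumes a: "a \<in> WS p" and b: "b \<in> span (\<Union>p. WS p)" and Z: "Z \<in> T"
  shows "vt b \<in> T \<and> br (vt a) (br Z (vt b)) = br (br (vt a) Z) (vt b)"
proof -
  note ta = MV_T[OF vt_MV[OF a]]
  have "subspace {b. vt b \<in> T \<and> br (vt a) (br Z (vt b)) = br (br (vt a) Z) (vt b)}" (is "subspace ?V")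
  proof (rule subspaceI)
    fix b b' assume "b \<in> ?V" "b' \<in> ?V"
    then show "b + b' \<in> ?V" using ta Z vt_linear[of b 1 b']
      by (simp add: br_add2 br_T add_T)
  next
    fix c b assume "b \<in> ?V"
    then show "c *\<^sub>R b \<in> ?V" using ta Z by (simp add: vt_scale br_scale2 br_T scale_T)
  qed (simp add: Z ta br_T)
  moreover have "(\<Union>p. WS p) \<subseteq> ?V" using left_right_commute[OF a _ Z] MV_T[OF vt_MV] by blast
  ultimately show ?thesis using span_minimal b by blast
qed

lemma left_fold_tot:
  assumes "a \<in> WS p" "Z \<in> T" "set vs \<subseteq> tot"
  shows "br (vt a) (fold_br Z vs) = fold_br (br (vt a) Z) vs"
  using assms(2,3)
proof (induction vs arbitrary: Z)
  case (Cons v vs)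
  have "snd v \<in> span (\<Union>p. WS p)" using Cons.prems by (auto simp: tot_def)
  then show ?case using Cons left_right_commute_span[OF assms(1), of "snd v" Z] by (simp add: br_T)
qed simp

lemma fold_br_swap:
  assumes "Z \<in> T" "set us \<subseteq> adm" "x \<in> W i" "y \<in> W j" "set ws \<subseteq> adm"
  shows "fold_br Z (us @ x # y # ws) = par (i * j) *\<^sub>R fold_br Z (us @ y # x # ws)"
  using assms(1,2)
proof (induction us arbitrary: Z)
  case Nil
  have "vt (snd x) \<in> T" "vt (snd y) \<in> T" using assms W_vt MV_T by blast+
  then show ?case using right_commute[OF W_MV(2)[OF assms(3)] W_MV(2)[OF assms(4)] Nil(1)] Nil assms(5)
    by (simp add: fold_br_scale br_T)
next
  case (Cons u us)
  with br_T show ?case by (simp add: adm_def)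
qed

text \<open>At the head, three kinds of terms are matched separately: those with the first component
  of \<open>x\<close>, those with that of \<open>y\<close>, both by turning a right bracket into a
  left one, and those where both vertical parts act from the left.\<close>

lemma derived_swap:
  assumes "set us \<subseteq> tot" "x \<in> W i" "y \<in> W j" "set ws \<subseteq> tot"
  shows "derived (us @ x # y # ws) = par (i * j) *\<^sub>R derived (us @ y # x # ws)"
  using assms(1)
proof (induction us)
  case Nil
  define X a Y b where "X = fst x" and "a = snd x" and "Y = fst y" and "b = snd y"
  have X: "X \<in> MV (i + 2)" and Y: "Y \<in> MV (j + 2)" and a: "a \<in> WS (i + 1)" and b: "b \<in> WS (j + 1)"
    using assms W_MV by (auto simp: X_def Y_def a_def b_def)
  note ws = tot_adm[OF assms(4)]
  define Da where "Da = derived ws"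
  have T: "X \<in> T" "Y \<in> T" "vt a \<in> T" "vt b \<in> T" "Da \<in> T" "fold_br X ws \<in> T" "fold_br Y ws \<in> T"
    using MV_T[OF X] MV_T[OF Y] MV_T[OF vt_MV[OF a]] MV_T[OF vt_MV[OF b]] derived_T[OF ws] fold_br_T ws
    by (auto simp: Da_def)
  have e: "eps (vt a) = par (i + 1) *\<^sub>R vt a" "eps (vt b) = par (j + 1) *\<^sub>R vt b"
    using eps_MV[OF vt_MV[OF a]] eps_MV[OF vt_MV[OF b]] by auto
  have fold: "fold_br (br X (vt b)) ws = par (i * j + j + 1) *\<^sub>R br (vt b) (fold_br X ws)"
    if X: "X \<in> MV (i + 2)" and b: "b \<in> WS (j + 1)" for X b i j
  proof -
    have T: "X \<in> T" "vt b \<in> T" "fold_br X ws \<in> T" using MV_T[OF X] MV_T[OF vt_MV[OF b]] fold_br_T ws by auto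
    have e: "eps (vt b) = par (j + 1) *\<^sub>R vt b" using eps_MV[OF vt_MV[OF b]] by simp
    show ?thesis unfolding br_vt[OF X b] e left_fold_tot[OF b T(1) assms(4)] using T fold_br_scale[OF br_T[OF T(2,1)] ws]
      by (cases "even i"; cases "even j") (simp_all add: par_def br_scale1 br_minus1 fold_br_scale[where c = "-1", simplified] ws br_T)
  qed
  note 1 = fold[OF X b] and 2 = fold[OF Y a]
  have 3: "br (vt a) (br (vt b) Da) = par (i * j) *\<^sub>R br (vt b) (br (vt a) Da)"
    using left_commute_MV[OF a b T(5)] by (simp add: par_def)
  have LR: "derived (x # y # ws) = fold_br (br X (vt b)) ws +
      par (i + 1) *\<^sub>R (br (vt a) (fold_br Y ws) + par (j + 1) *\<^sub>R br (vt a) (br (vt b) Da))"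
    "derived (y # x # ws) = fold_br (br Y (vt a)) ws +
      par (j + 1) *\<^sub>R (br (vt b) (fold_br X ws) + par (i + 1) *\<^sub>R br (vt b) (br (vt a) Da))"
    using T by (simp_all add: X_def[symmetric] Y_def[symmetric] a_def[symmetric] b_def[symmetric] Da_def[symmetric]
      e br_scale1 br_scale2 br_add2 br_T add_T scale_T scaleR_add_right)
  show ?case unfolding append_Nil LR 1 2 3 by (cases "even i"; cases "even j") (simp_all add: par_def algebra_simps)
next
  case (Cons u us)
  have u: "fst u \<in> T" "eps (vt (snd u)) \<in> T" using Cons.prems by (auto simp: tot_def adm_def eps_T)
  have us: "set us \<subseteq> adm" and ws: "set ws \<subseteq> adm" using Cons.prems assms(4) by (auto simp: tot_def)
  have xy: "x \<in> adm" "y \<in> adm" using assms W_adm by auto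
  have D: "derived (us @ y # x # ws) \<in> T" using us ws xy by (intro derived_T) auto
  have "derived (us @ x # y # ws) = par (i * j) *\<^sub>R derived (us @ y # x # ws)" using Cons by simp
  with fold_br_swap[OF u(1) us assms(2,3) ws] u D show ?case by (simp add: br_scale2 scaleR_add_right)
qed

lemma binary_swap:
  assumes "x \<in> W i" "y \<in> W j"
  shows "binary (us @ x # y # ws) = par (i * j) *\<^sub>R binary (us @ y # x # ws)"
proof (cases "us = [] \<and> ws = []")
  case True
  note X = W_MV(1)[OF assms(1)] and Y = W_MV(1)[OF assms(2)]
  note T = MV_T[OF X] MV_T[OF Y]
  have "binary [x, y] = - (par i *\<^sub>R br (fst x) (fst y))"
    using T by (simp add: binary_def eps_MV[OF X] br_minus1 br_scale1 scale_T par_def)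
  also have "br (fst x) (fst y) = - (par ((i + 2 + 1) * (j + 2 + 1)) *\<^sub>R br (fst y) (fst x))"
    by (rule br_antisym[OF X Y])
  also have "- (par i *\<^sub>R - (par ((i + 2 + 1) * (j + 2 + 1)) *\<^sub>R br (fst y) (fst x))) =
    par (i * j) *\<^sub>R - (par j *\<^sub>R br (fst y) (fst x))"
    by (cases "even i"; cases "even j") (simp_all add: par_def)
  also have "- (par j *\<^sub>R br (fst y) (fst x)) = binary [y, x]"
    using T by (simp add: binary_def eps_MV[OF Y] br_minus1 br_scale1 scale_T par_def)
  finally show ?thesis using True by simp
next
  case False
  then have "length us + length ws \<noteq> 0" by simp
  then show ?thesis by (simp add: binary_other del: add_is_0)
qed

lemma binary_CH: "x \<in> W i \<Longrightarrow> y \<in> W j \<Longrightarrow> binary [x, y] \<in> CH (i + j + 3)"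
proof -
  assume x: "x \<in> W i" and y: "y \<in> W j"
  then have "fst x \<in> CH (i + 2)" "fst y \<in> CH (j + 2)" by (auto simp: W_def)
  moreover have "- eps (fst x) \<in> CH (i + 2)" unfolding eps_MV[OF W_MV(1)[OF x]]
    by (intro subspace_neg[OF subspace_CH] subspace_scale[OF subspace_CH]) fact
  ultimately have "br (- eps (fst x)) (fst y) \<in> CH (i + 2 + (j + 2) - 1)" by (intro br_CH)
  then show ?thesis by (simp add: binary_def algebra_simps)
qed

lemma hom_zip:
  assumes "list_all2 (\<lambda>d v. v \<in> W d) ds vs"
  shows "hom (zip ds vs)" "map fst (zip ds vs) = ds" "map snd (zip ds vs) = vs" "deg (zip ds vs) = sum_list ds"
  using assms by (auto simp: hom_def list_all2_iff deg_def)

lemma brackets_W: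
  assumes "list_all2 (\<lambda>d v. v \<in> W d) ds vs"
  shows "brackets vs \<in> W (sum_list ds + 1)"
proof -
  note h = hom_zip[OF assms]
  have "P (derived vs) \<in> WS (sum_list ds + 1 + 1)" using P_WS[OF D_MV[OF h(1)]] h by (simp add: add.assoc)
  moreover have "binary vs \<in> CH (sum_list ds + 1 + 2)"
  proof (cases "length vs = 2")
    case True
    then obtain x y where vs: "vs = [x, y]" by (auto simp: length_Suc_conv numeral_2_eq_2)
    then obtain i j where "ds = [i, j]" "x \<in> W i" "y \<in> W j" using assms by (auto simp: list_all2_Cons2)
    with binary_CH[of x i y j] vs show ?thesis by (simp add: algebra_simps)
  qed (simp add: binary_other)
  ultimately show ?thesis by (simp add: W_def brackets_def)
qed

lemma brackets_Nil [simp]: "brackets [] = 0"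
  by (simp add: brackets_def binary_def zero_prod_def)

theorem Linfty1_algebra_brackets:
  assumes "graded_space W"
  shows "Linfty1_algebra W brackets"
  unfolding Linfty1_algebra_def
proof (intro conjI allI impI; (elim conjE)?)
  show "graded_space W" by fact
next
  fix us x y c ws assume "set us \<union> {x, y} \<union> set ws \<subseteq> total_space W"
  then have "set us \<subseteq> adm" "x \<in> adm" "y \<in> adm" "set ws \<subseteq> adm" using total_space_tot by (auto simp: tot_def)
  then show "brackets (us @ (x + c *\<^sub>R y) # ws) = brackets (us @ x # ws) + c *\<^sub>R brackets (us @ y # ws)"
    by (rule brackets_linear)
next
  fix ds vs assume "list_all2 (\<lambda>d v. v \<in> W d) ds vs"
  then show "brackets vs \<in> W (sum_list ds + 1)" by (rule brackets_W)
next
  fix us x y ws i j assume 1: "set us \<union> set ws \<subseteq> total_space W" and x: "x \<in> W i" and y: "y \<in> W j"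
  have us: "set us \<subseteq> tot" and ws: "set ws \<subseteq> tot" using 1 total_space_tot by auto
  show "brackets (us @ x # y # ws) = (if odd (i * j) then - 1 else 1) *\<^sub>R brackets (us @ y # x # ws)"
    using binary_swap[OF x y, of us ws] derived_swap[OF us x y ws] by (simp add: brackets_def P_scale par_def P_minus)
next
  fix ds vs assume "vs \<noteq> []" and l: "list_all2 (\<lambda>d v. v \<in> W d) ds vs"
  note h = hom_zip[OF l]
  have len: "length ds = length vs" using l by (rule list_all2_lengthD)
  have adm: "set vs \<subseteq> adm" using hom_adm[OF h(1)] h by simp
  have 0: "koszul_sum (\<lambda>L R. brackets (brackets (map snd L) # map snd R)) (zip ds vs) = 0"
    by (rule brackets_jacobi[OF h(1)])
  have "(\<Sum>I\<in>Pow {..<length vs}. koszul_sign ds I *\<^sub>R brackets (brackets (nths vs I) # nths vs (- I))) = 0"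
    using 0 len h unfolding koszul_sum_def by (simp add: nths_map[symmetric])
  \<comment> \<open>The axiom leaves out the empty left block; its summand is zero because
    \<open>brackets []\<close> is.\<close>
  moreover have "(\<Sum>I\<in>Pow {..<length vs}. koszul_sign ds I *\<^sub>R brackets (brackets (nths vs I) # nths vs (- I))) =
    koszul_sign ds {} *\<^sub>R brackets (brackets (nths vs {}) # nths vs (- {})) +
    (\<Sum>I\<in>Pow {..<length vs} - {{}}. koszul_sign ds I *\<^sub>R brackets (brackets (nths vs I) # nths vs (- I)))"
    by (rule sum.remove) auto
  moreover have "brackets (brackets (nths vs {}) # nths vs (- {})) = 0"
    using brackets_zero[of "[]" "nths vs (- {})"] adm by (simp add: nths_all)
  ultimately show "(\<Sum>I\<in>Pow {..<length vs} - {{}}.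
      koszul_sign ds I *\<^sub>R brackets (brackets (nths vs I) # nths vs (- I))) = 0" by simp
qed

lemma brackets_unary: "X \<in> CH p \<Longrightarrow> brackets [(X, 0)] = (0, P X)"
  by (simp add: brackets_def binary_def)

lemma CH_T: "X \<in> CH p \<Longrightarrow> X \<in> T"
  using CH_MV MV_T by blast

lemma brackets_binary: "X \<in> CH p \<Longrightarrow> Y \<in> CH q \<Longrightarrow> brackets [(X, 0), (Y, 0)] = (- (par p *\<^sub>R br X Y), 0)"
  using CH_T[of X p] CH_T[of Y q] eps_MV[of X p] CH_MV[of p]
  by (auto simp: brackets_def binary_def br_minus1 br_scale1 scale_T br_T)

lemma vt_WS_T: "set as \<subseteq> (\<Union>p. WS p) \<Longrightarrow> a \<in> set as \<Longrightarrow> vt a \<in> T"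
  using MV_T[OF vt_MV] by blast

abbreviation "inW \<equiv> map (\<lambda>a. (0, a))"
abbreviation "inX \<equiv> map (\<lambda>X. (X, 0))"

lemma derived_zero: "set as \<subseteq> (\<Union>p. WS p) \<Longrightarrow> derived (inW as) = 0"
proof (induction as)
  case (Cons a as)
  then have "set (inW as) \<subseteq> adm" "eps (vt a) \<in> T"
    using vt_WS_T[OF Cons.prems] by (auto simp: adm_def intro!: eps_T)
  with Cons show ?case by simp
qed simp

lemma brackets_mixed:
  assumes X: "X \<in> CH p" and as: "as \<noteq> []" "set as \<subseteq> (\<Union>p. WS p)"
  shows "brackets ((X, 0) # inW as) = (0, P (foldl br X (map vt as)))"
proof -
  have T: "X \<in> T" by (rule CH_T[OF X])
  have "binary ((X, 0) # inW as) = 0"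
    using as T by (cases "tl as"; cases as) (auto simp: binary_def br_minus1 eps_T neg_T)
  moreover have "fold_br X (inW as) = foldl br X (map vt as)" by (simp add: foldl_map)
  ultimately show ?thesis using derived_zero[OF as(2)] by (simp add: brackets_def)
qed

text \<open>With two or more entries from \<open>CH\<close>, whichever of them is distinguished in
  \<open>derived\<close>, another one acts through its zero vertical part.\<close>

lemma brackets_others:
  assumes Xs: "set Xs \<subseteq> (\<Union>p. CH p)" and as: "set as \<subseteq> (\<Union>p. WS p)"
    and len: "Xs \<noteq> [] \<or> as \<noteq> []" "length Xs \<noteq> 1" "\<not> (length Xs = 2 \<and> as = [])"
  shows "brackets (inX Xs @ inW as) = 0"
proof (cases Xs)
  case Nil
  have "binary (inW as) = 0"
  proof (cases "length as = 2")
    case True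
    then show ?thesis by (auto simp: length_Suc_conv numeral_2_eq_2 binary_def)
  qed (simp add: binary_other)
  with Nil derived_zero[OF as] show ?thesis by (simp add: brackets_def zero_prod_def)
next
  case (Cons X Xs')
  have adm: "set (inX Ys @ inW as) \<subseteq> adm" if "set Ys \<subseteq> set Xs" for Ys
  proof -
    have "X \<in> T" if "X \<in> set Xs" for X using that Xs CH_T by blast
    with that vt_WS_T[OF as] show ?thesis by (auto simp: adm_def)
  qed
  have zero: "derived (inX Ys @ inW as) \<in> T" if "set Ys \<subseteq> set Xs" for Ys
    by (rule derived_T[OF adm[OF that]])
  obtain Y Ys where Xs': "Xs' = Y # Ys" using Cons len(2) by (cases Xs') auto
  have XT: "X \<in> T" using Xs Cons by (auto intro: CH_T)
  have sub: "set Ys \<subseteq> set Xs" "set Xs' \<subseteq> set Xs" using Cons Xs' by auto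
  have "binary (inX Xs @ inW as) = 0"
    using len(3) Cons Xs' by (intro binary_other) auto
  moreover have "derived (inX Xs @ inW as) = 0"
  proof -
    have f: "fold_br (br X (vt 0)) (inX Ys @ inW as) = 0"
      using XT fold_br_zero[OF adm[OF sub(1)]] by simp
    have "derived (inX Xs @ inW as) =
      fold_br (br X (vt 0)) (inX Ys @ inW as) +
      br (eps (vt 0)) (derived (inX Xs' @ inW as))" by (simp add: Cons Xs')
    then show ?thesis unfolding f using zero[OF sub(2)] by simp
  qed
  ultimately show ?thesis by (simp add: brackets_def zero_prod_def)
qed

end

section \<open>Smooth functions on open sets\<close>

abbreviation "orthonormal E \<equiv> \<forall>e\<in>E. \<forall>e'\<in>E. e \<bullet> e' = (if e = e' then 1 else 0 :: real)"

text \<open>Gram-Schmidt orthonormalization, dropping a vector that depends on the previous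
  ones.\<close>

lemma orthonormal_span:
  assumes "finite (B :: 'a::real_inner set)"
  shows "\<exists>E. finite E \<and> orthonormal E \<and> span B \<subseteq> span E"
  using assms
proof (induction B)
  case empty
  show ?case by (rule exI[of _ "{}"]) simp
next
  case (insert b B)
  then obtain E where E: "finite E" "orthonormal E" "span B \<subseteq> span E" by blast
  define u where "u = b - (\<Sum>e\<in>E. (b \<bullet> e) *\<^sub>R e)"
  have orth: "u \<bullet> e = 0" if "e \<in> E" for e
  proof -
    have "(\<Sum>e'\<in>E. (b \<bullet> e') * (e' \<bullet> e)) = (\<Sum>e'\<in>E. if e' = e then b \<bullet> e' else 0)"
      using E that by (intro sum.cong) auto
    with E that show ?thesis by (simp add: u_def inner_diff_left inner_sum_left sum.delta)
  qed
  have sumE: "(\<Sum>e\<in>E. (b \<bullet> e) *\<^sub>R e) \<in> span E" by (intro span_sum span_scale span_base)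
  show ?case
  proof (cases "u = 0")
    case True
    then have "b \<in> span E" using sumE by (simp add: u_def)
    then have "insert b B \<subseteq> span E" using E(3) span_superset by blast
    with E show ?thesis by (intro exI[of _ E]) (simp add: span_minimal)
  next
    case False
    define w where "w = (1 / norm u) *\<^sub>R u"
    have w: "w \<bullet> w = 1" "\<And>e. e \<in> E \<Longrightarrow> w \<bullet> e = 0" "\<And>e. e \<in> E \<Longrightarrow> e \<bullet> w = 0"
      using False orth by (simp_all add: w_def power2_norm_eq_inner[symmetric] power2_eq_square inner_commute)
    have "b = norm u *\<^sub>R w + (\<Sum>e\<in>E. (b \<bullet> e) *\<^sub>R e)" using False by (simp add: w_def u_def)
    moreover have "norm u *\<^sub>R w + (\<Sum>e\<in>E. (b \<bullet> e) *\<^sub>R e) \<in> span (insert w E)"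
      by (intro span_add[OF span_scale[OF span_base]] subsetD[OF span_mono sumE]) auto
    ultimately have "b \<in> span (insert w E)" by simp
    moreover have "B \<subseteq> span (insert w E)" using E(3) span_superset[of B] span_mono[of E "insert w E"] by blast
    ultimately have "span (insert b B) \<subseteq> span (insert w E)" by (intro span_minimal) auto
    with E w show ?thesis by (intro exI[of _ "insert w E"]) auto
  qed
qed

lemma orthonormal_basis_exists:
  "\<exists>E :: 'a::finite_dim_inner set. finite E \<and> orthonormal E \<and> span E = UNIV"
proof -
  obtain B :: "'a set" where B: "finite B" "\<And>x. \<exists>c. x = (\<Sum>b\<in>B. c b *\<^sub>R b)" using finite_dim by blast
  have "x \<in> span B" for x
  proof -
    obtain c where c: "x = (\<Sum>b\<in>B. c b *\<^sub>R b)" using B(2) by blast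
    show "x \<in> span B" unfolding c by (intro span_sum span_scale span_base)
  qed
  then have B': "span B = UNIV" by auto
  obtain E where "finite E" "orthonormal E" "span B \<subseteq> span E"
    using orthonormal_span[OF B(1)] by (elim exE conjE)
  then show ?thesis unfolding B' by (intro exI[of _ E] conjI) auto
qed

text \<open>Plays the role of \<open>Basis\<close>; in dimension 0 it is the empty set.\<close>

definition onb :: "'a::finite_dim_inner set"
  where "onb = (SOME E. finite E \<and> orthonormal E \<and> span E = UNIV)"

lemma onb:
  shows "finite (onb :: 'a::finite_dim_inner set)" and "span (onb :: 'a set) = UNIV"
    and "\<And>e e' :: 'a. e \<in> onb \<Longrightarrow> e' \<in> onb \<Longrightarrow> e \<bullet> e' = (if e = e' then 1 else 0)"
proof -
  have "finite (onb :: 'a set) \<and> (\<forall>e\<in>onb. \<forall>e'\<in>onb. (e :: 'a) \<bullet> e' = (if e = e' then 1 else 0)) \<and> span (onb :: 'a set) = UNIV"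
    unfolding onb_def by (rule someI_ex[OF orthonormal_basis_exists])
  then show "finite (onb :: 'a::finite_dim_inner set)" and "span (onb :: 'a set) = UNIV"
    and "\<And>e e' :: 'a. e \<in> onb \<Longrightarrow> e' \<in> onb \<Longrightarrow> e \<bullet> e' = (if e = e' then 1 else 0)" by auto
qed

declare onb(1) [simp]

lemma onb_expansion: "(\<Sum>e\<in>onb. (x \<bullet> e) *\<^sub>R e) = (x :: 'a::finite_dim_inner)"
proof -
  have "subspace {x :: 'a. (\<Sum>e\<in>onb. (x \<bullet> e) *\<^sub>R e) = x}" by (rule subspaceI)
       (simp_all add: inner_add_left scaleR_add_left sum.distrib scaleR_sum_right[symmetric] flip: scaleR_scaleR)
  moreover have "onb \<subseteq> {x :: 'a. (\<Sum>e\<in>onb. (x \<bullet> e) *\<^sub>R e) = x}"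
  proof
    fix b :: 'a assume b: "b \<in> onb"
    have "(\<Sum>e\<in>onb. (b \<bullet> e) *\<^sub>R e) = (\<Sum>e\<in>onb. if e = b then b else 0)"
      using b by (intro sum.cong) (auto simp: onb(3))
    then show "b \<in> {x. (\<Sum>e\<in>onb. (x \<bullet> e) *\<^sub>R e) = x}" using b onb(1) by (simp add: sum.delta)
  qed
  ultimately have "span onb \<subseteq> {x :: 'a. (\<Sum>e\<in>onb. (x \<bullet> e) *\<^sub>R e) = x}" by (intro span_minimal)
  then show ?thesis by (auto simp: onb(2))
qed

lemma linear_onb:
  assumes "linear (f :: 'a::finite_dim_inner \<Rightarrow> 'b::real_vector)"
  shows "f x = (\<Sum>e\<in>onb. (x \<bullet> e) *\<^sub>R f e)"
  by (subst onb_expansion[of x, symmetric]) (simp add: linear_sum[OF assms] linear_scale[OF assms])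

text \<open>Makes closed balls compact, as the cut-off arguments require, and the space complete, as
  integrals depending on a parameter require. A bounded sequence converges along a subsequence in
  one basis direction after the other.\<close>

instance finite_dim_inner \<subseteq> heine_borel
proof
  fix f :: "nat \<Rightarrow> 'a" assume f: "bounded (range f)"
  define g where "g = (\<lambda>d n e. (f n :: 'a) \<bullet> e)"
  have "\<exists>r l. strict_mono r \<and> (\<forall>e\<in>D. (\<lambda>n. f (r n) \<bullet> e) \<longlonglongrightarrow> l e)" if "finite D" for D :: "'a set"
    using that
  proof induction
    case empty
    show ?case by (intro exI[of _ "\<lambda>n. n"]) (simp add: strict_mono_def)
  next
    case (insert d D)
    then obtain r l where r: "strict_mono r" "\<forall>e\<in>D. (\<lambda>n. f (r n) \<bullet> e) \<longlonglongrightarrow> l e" by blast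
    have "bounded ((\<lambda>x. x \<bullet> d) ` range f)"
      by (rule bounded_linear_image[OF f bounded_linear_inner_left])
    then have "bounded (range (\<lambda>n. f (r n) \<bullet> d))" by (rule bounded_subset) auto
    then obtain m q where q: "strict_mono q" "((\<lambda>n. f (r n) \<bullet> d) \<circ> q) \<longlonglongrightarrow> m"
      using bounded_imp_convergent_subsequence[of "\<lambda>n. f (r n) \<bullet> d"] by blast
    have "(\<lambda>n. f (r (q n)) \<bullet> e) \<longlonglongrightarrow> (if e = d then m else l e)" if "e \<in> insert d D" for e
    proof (cases "e = d")
      case False
      with that r(2) LIMSEQ_subseq_LIMSEQ[OF _ q(1)] show ?thesis by (fastforce simp: o_def)
    qed (use q(2) in \<open>simp add: o_def\<close>)
    then show ?case using strict_mono_o[OF r(1) q(1), unfolded o_def]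
      by (intro exI[of _ "\<lambda>n. r (q n)"] exI[of _ "\<lambda>e. if e = d then m else l e"]) auto
  qed
  then obtain r l where r: "strict_mono r" "\<forall>e\<in>onb. (\<lambda>n. f (r n) \<bullet> e) \<longlonglongrightarrow> l e" using onb(1) by blast
  have "(\<lambda>n. \<Sum>e\<in>onb. (f (r n) \<bullet> e) *\<^sub>R e) \<longlonglongrightarrow> (\<Sum>e\<in>onb. l e *\<^sub>R e)"
    using r(2) by (intro tendsto_sum tendsto_scaleR) auto
  then show "\<exists>l r. strict_mono r \<and> (f \<circ> r) \<longlonglongrightarrow> l" using r(1) by (auto simp: onb_expansion o_def)
qed

instance finite_dim_inner \<subseteq> banach ..

section \<open>Differential calculus with \<open>Ck_on\<close> and \<open>smooth_on\<close>\<close>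

abbreviation "fd f x \<equiv> frechet_derivative f (at x)"

lemma fd_eqI: "(f has_derivative f') (at x) \<Longrightarrow> fd f x = f'"
  using frechet_derivative_at by metis

lemma fd_has_derivative: "f differentiable (at x) \<Longrightarrow> (f has_derivative fd f x) (at x)"
  by (simp add: frechet_derivative_works)

lemma fd_linear: "f differentiable (at x) \<Longrightarrow> linear (fd f x)"
  using fd_has_derivative has_derivative_linear by blast

lemma Ck_on_cong_imp:
  "open S \<Longrightarrow> (\<And>x. x \<in> S \<Longrightarrow> f x = g x) \<Longrightarrow> Ck_on k S f \<Longrightarrow> Ck_on k S g"
proof (induction k arbitrary: f g)
  case 0
  then show ?case by (simp cong: continuous_on_cong)
next
  case (Suc k)
  have "(g has_derivative fd f x) (at x)" if "x \<in> S" for x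
    using Suc.prems that by (intro has_derivative_transform_within_open[OF fd_has_derivative, of f x S g]) auto
  then have 1: "g differentiable (at x)" "fd g x = fd f x" if "x \<in> S" for x
    using that by (auto simp: differentiable_def fd_eqI)
  have "Ck_on k S (\<lambda>x. fd g x v)" for v
  proof (rule Suc.IH[OF Suc.prems(1)])
    show "Ck_on k S (\<lambda>x. fd f x v)" using Suc.prems(3) by simp
  qed (simp add: 1(2))
  with 1 show ?case by simp
qed

lemma Ck_on_cong: "open S \<Longrightarrow> (\<And>x. x \<in> S \<Longrightarrow> f x = g x) \<Longrightarrow> Ck_on k S f = Ck_on k S g"
  using Ck_on_cong_imp[of S f g] Ck_on_cong_imp[of S g f] by auto

lemma Ck_on_subset: "Ck_on k S f \<Longrightarrow> T \<subseteq> S \<Longrightarrow> Ck_on k T f"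
  by (induction k arbitrary: f) (auto intro: continuous_on_subset)

lemma Ck_on_Suc: "Ck_on (Suc k) S f \<Longrightarrow> Ck_on k S f"
proof (induction k arbitrary: f)
  case 0
  then show ?case by (auto intro!: continuous_at_imp_continuous_on differentiable_imp_continuous_within)
next
  case (Suc k)
  with Ck_on.simps(2) show ?case by blast
qed

lemma Ck_on_locally:
  "(\<And>x. x \<in> S \<Longrightarrow> \<exists>T. open T \<and> x \<in> T \<and> Ck_on k T f) \<Longrightarrow> Ck_on k S f"
proof (induction k arbitrary: f)
  case 0
  have "continuous (at x) f" if "x \<in> S" for x using 0[OF that] continuous_on_eq_continuous_at by auto
  then show ?case by (simp add: continuous_at_imp_continuous_on)
next
  case (Suc k)
  have "Ck_on k S (\<lambda>x. fd f x v)" for v by (rule Suc.IH) (use Suc.prems in fastforce)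
  moreover have "f differentiable (at x)" if "x \<in> S" for x using Suc.prems[OF that] by auto
  ultimately show ?case by simp
qed

lemma Ck_on_const: "Ck_on k S (\<lambda>x. c)"
proof (induction k arbitrary: c)
  case (Suc k)
  have "fd (\<lambda>x. c) x = (\<lambda>v. 0)" for x by (rule fd_eqI) simp
  with Suc show ?case by simp
qed simp

lemma Ck_on_linear: "bounded_linear f \<Longrightarrow> Ck_on k S f"
proof (cases k)
  case (Suc j)
  assume f: "bounded_linear f"
  then have "fd f x = f" for x by (intro fd_eqI bounded_linear_imp_has_derivative)
  with Suc f show ?thesis by (simp add: bounded_linear_imp_differentiable Ck_on_const)
qed (auto intro: linear_continuous_on)

lemma Ck_on_add: "open S \<Longrightarrow> Ck_on k S f \<Longrightarrow> Ck_on k S g \<Longrightarrow> Ck_on k S (\<lambda>x. f x + g x)"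
proof (induction k arbitrary: f g)
  case (Suc k)
  have "((\<lambda>x. f x + g x) has_derivative (\<lambda>v. fd f x v + fd g x v)) (at x)" if "x \<in> S" for x
    using Suc.prems that by (intro has_derivative_add fd_has_derivative) auto
  then have 1: "(\<lambda>x. f x + g x) differentiable (at x)" "fd (\<lambda>x. f x + g x) x = (\<lambda>v. fd f x v + fd g x v)" if "x \<in> S" for x
    using that by (auto simp: differentiable_def fd_eqI)
  have "Ck_on k S (\<lambda>x. fd (\<lambda>x. f x + g x) x v)" for v
  proof (rule Ck_on_cong_imp[OF Suc.prems(1)])
    show "Ck_on k S (\<lambda>x. fd f x v + fd g x v)" using Suc by simp
  qed (simp add: 1)
  with 1 show ?case by simp
qed (auto intro: continuous_on_add)

lemma Ck_on_bilinear:
  assumes "bounded_bilinear m"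
  shows "open S \<Longrightarrow> Ck_on k S f \<Longrightarrow> Ck_on k S g \<Longrightarrow> Ck_on k S (\<lambda>x. m (f x) (g x))"
proof (induction k arbitrary: f g)
  case 0
  with bounded_bilinear.continuous_on[OF assms] show ?case by auto
next
  case (Suc k)
  let ?h = "\<lambda>x. m (f x) (g x)"
  have "(?h has_derivative (\<lambda>v. m (f x) (fd g x v) + m (fd f x v) (g x))) (at x)" if "x \<in> S" for x
    using Suc.prems that by (intro bounded_bilinear.FDERIV[OF assms] fd_has_derivative) auto
  then have 1: "?h differentiable (at x)" "fd ?h x = (\<lambda>v. m (f x) (fd g x v) + m (fd f x v) (g x))" if "x \<in> S" for x
    using that by (auto simp: differentiable_def fd_eqI)
  have "Ck_on k S (\<lambda>x. fd ?h x v)" for v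
  proof (rule Ck_on_cong_imp[OF Suc.prems(1)])
    show "Ck_on k S (\<lambda>x. m (f x) (fd g x v) + m (fd f x v) (g x))"
      using Suc.prems by (intro Ck_on_add Suc.IH Ck_on_Suc[of k S f] Ck_on_Suc[of k S g]) auto
  qed (simp add: 1)
  with 1 show ?case by simp
qed

lemma Ck_on_linear_compose:
  assumes "bounded_linear L"
  shows "open S \<Longrightarrow> Ck_on k S f \<Longrightarrow> Ck_on k S (\<lambda>x. L (f x))"
proof (induction k arbitrary: f)
  case 0
  with bounded_linear.continuous_on[OF assms] show ?case by auto
next
  case (Suc k)
  have "((\<lambda>x. L (f x)) has_derivative (\<lambda>v. L (fd f x v))) (at x)" if "x \<in> S" for x
    using Suc.prems that by (intro bounded_linear.has_derivative[OF assms] fd_has_derivative) auto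
  then have 1: "(\<lambda>x. L (f x)) differentiable (at x)" "fd (\<lambda>x. L (f x)) x = (\<lambda>v. L (fd f x v))" if "x \<in> S" for x
    using that by (auto simp: differentiable_def fd_eqI)
  have "Ck_on k S (\<lambda>x. fd (\<lambda>x. L (f x)) x v)" for v
    by (rule Ck_on_cong_imp[of S "\<lambda>x. L (fd f x v)"]) (use Suc in \<open>auto simp: 1\<close>)
  with 1 show ?case by simp
qed

lemma Ck_on_sum:
  "open S \<Longrightarrow> (\<And>i. i \<in> I \<Longrightarrow> Ck_on k S (f i)) \<Longrightarrow> Ck_on k S (\<lambda>x. \<Sum>i\<in>I. f i x)"
  by (induction I rule: infinite_finite_induct) (auto intro: Ck_on_const Ck_on_add)

lemma Ck_on_compose:
  fixes f :: "'a::real_normed_vector \<Rightarrow> 'b::finite_dim_inner"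
  shows "open S \<Longrightarrow> open T \<Longrightarrow> f ` S \<subseteq> T \<Longrightarrow> Ck_on k S f \<Longrightarrow> Ck_on k T g \<Longrightarrow> Ck_on k S (\<lambda>x. g (f x))"
proof (induction k arbitrary: g)
  case 0
  then show ?case by (auto intro: continuous_on_compose2)
next
  case (Suc k)
  let ?h = "\<lambda>x. g (f x)"
  have "(?h has_derivative (\<lambda>v. fd g (f x) (fd f x v))) (at x)" if "x \<in> S" for x
    using Suc.prems that by (intro has_derivative_compose[of f _ x UNIV g] fd_has_derivative) auto
  then have 1: "?h differentiable (at x)" "fd ?h x = (\<lambda>v. fd g (f x) (fd f x v))" if "x \<in> S" for x
    using that by (auto simp: differentiable_def fd_eqI)
  have "Ck_on k S (\<lambda>x. fd ?h x v)" for v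
  proof (rule Ck_on_cong_imp[OF Suc.prems(1)])
    \<comment> \<open>The chain rule differentiates \<open>g\<close> in the moving direction
      \<open>fd f x v\<close>, whereas \<open>Ck_on\<close> speaks of fixed directions; the
      orthonormal expansion separates the two.\<close>
    show "Ck_on k S (\<lambda>x. \<Sum>e\<in>onb. (fd f x v \<bullet> e) *\<^sub>R fd g (f x) e)"
      using Suc.prems Ck_on_Suc[of k S f] by (intro Ck_on_sum Ck_on_bilinear[OF bounded_bilinear_scaleR] Suc.IH
          Ck_on_linear_compose[OF bounded_linear_inner_left]) auto
    fix x assume x: "x \<in> S"
    then have "linear (fd g (f x))" using Suc.prems by (intro fd_linear) auto
    then show "(\<Sum>e\<in>onb. (fd f x v \<bullet> e) *\<^sub>R fd g (f x) e) = fd ?h x v"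
      unfolding 1(2)[OF x] by (rule linear_onb[symmetric])
  qed
  with 1 show ?case by simp
qed

lemma Ck_on_inverse:
  fixes f :: "'a::real_normed_vector \<Rightarrow> real"
  shows "open S \<Longrightarrow> (\<And>x. x \<in> S \<Longrightarrow> f x \<noteq> 0) \<Longrightarrow> Ck_on k S f \<Longrightarrow> Ck_on k S (\<lambda>x. inverse (f x))"
proof (induction k)
  case 0
  then show ?case by (auto intro: continuous_on_inverse)
next
  case (Suc k)
  let ?h = "\<lambda>x. inverse (f x)"
  have "(?h has_derivative (\<lambda>v. - (inverse (f x) * fd f x v * inverse (f x)))) (at x)" if "x \<in> S" for x
    using Suc.prems that by (intro Deriv.has_derivative_inverse fd_has_derivative) auto
  then have 1: "?h differentiable (at x)" "fd ?h x = (\<lambda>v. - (inverse (f x) * fd f x v * inverse (f x)))" if "x \<in> S" for x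
    using that by (auto simp: differentiable_def fd_eqI)
  have h: "Ck_on k S ?h" using Suc Ck_on_Suc by blast
  have "Ck_on k S (\<lambda>x. fd ?h x v)" for v
  proof (rule Ck_on_cong_imp[OF Suc.prems(1)])
    show "Ck_on k S (\<lambda>x. - (inverse (f x) * fd f x v * inverse (f x)))" using Suc.prems h
      by (intro Ck_on_bilinear[OF bounded_bilinear_mult] Ck_on_linear_compose[OF bounded_linear_minus[OF bounded_linear_ident]]) auto
  qed (simp add: 1)
  with 1 show ?case by simp
qed

lemma smooth_on_cong: "open S \<Longrightarrow> (\<And>x. x \<in> S \<Longrightarrow> f x = g x) \<Longrightarrow> smooth_on S f = smooth_on S g"
  unfolding smooth_on_def using Ck_on_cong[of S f g] by auto

lemma smooth_on_subset: "smooth_on S f \<Longrightarrow> T \<subseteq> S \<Longrightarrow> smooth_on T f"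
  unfolding smooth_on_def using Ck_on_subset by blast

lemma smooth_on_locally:
  "(\<And>x. x \<in> S \<Longrightarrow> \<exists>T. open T \<and> x \<in> T \<and> smooth_on T f) \<Longrightarrow> smooth_on S f"
  unfolding smooth_on_def
proof
  fix k assume loc: "\<And>x. x \<in> S \<Longrightarrow> \<exists>T. open T \<and> x \<in> T \<and> (\<forall>k. Ck_on k T f)"
  show "Ck_on k S f"
  proof (rule Ck_on_locally)
    fix x assume "x \<in> S"
    from loc[OF this] obtain T where "open T" "x \<in> T" "\<forall>k. Ck_on k T f" by (elim exE conjE)
    then show "\<exists>T. open T \<and> x \<in> T \<and> Ck_on k T f" by (intro exI[of _ T]) simp
  qed
qed

lemma smooth_on_const: "smooth_on S (\<lambda>x. c)"
  by (simp add: smooth_on_def Ck_on_const)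

lemma smooth_on_linear: "bounded_linear f \<Longrightarrow> smooth_on S f"
  by (simp add: smooth_on_def Ck_on_linear)

lemma smooth_on_ident: "smooth_on S (\<lambda>x. x)"
  by (rule smooth_on_linear) (rule bounded_linear_ident)

lemma smooth_on_fst: "smooth_on S fst" and smooth_on_snd: "smooth_on S snd"
  by (auto intro: smooth_on_linear bounded_linear_fst bounded_linear_snd)

lemma smooth_on_linear_compose: "bounded_linear L \<Longrightarrow> open S \<Longrightarrow> smooth_on S f \<Longrightarrow> smooth_on S (\<lambda>x. L (f x))"
  by (simp add: smooth_on_def Ck_on_linear_compose)

lemma smooth_on_add: "open S \<Longrightarrow> smooth_on S f \<Longrightarrow> smooth_on S g \<Longrightarrow> smooth_on S (\<lambda>x. f x + g x)"
  by (simp add: smooth_on_def Ck_on_add)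

lemma smooth_on_scaleR: "open S \<Longrightarrow> smooth_on S f \<Longrightarrow> smooth_on S g \<Longrightarrow> smooth_on S (\<lambda>x. f x *\<^sub>R g x)"
  by (simp add: smooth_on_def Ck_on_bilinear[OF bounded_bilinear_scaleR])

lemma smooth_on_mult:
  "open S \<Longrightarrow> smooth_on S f \<Longrightarrow> smooth_on S g \<Longrightarrow> smooth_on S (\<lambda>x. f x * g x :: 'b::real_normed_algebra)"
  by (simp add: smooth_on_def Ck_on_bilinear[OF bounded_bilinear_mult])

lemma smooth_on_inner: "open S \<Longrightarrow> smooth_on S f \<Longrightarrow> smooth_on S g \<Longrightarrow> smooth_on S (\<lambda>x. f x \<bullet> g x)"
  by (simp add: smooth_on_def Ck_on_bilinear[OF bounded_bilinear_inner])

lemma smooth_on_minus: "open S \<Longrightarrow> smooth_on S f \<Longrightarrow> smooth_on S (\<lambda>x. - f x)"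
  by (rule smooth_on_linear_compose[OF bounded_linear_minus[OF bounded_linear_ident]])

lemma smooth_on_diff: "open S \<Longrightarrow> smooth_on S f \<Longrightarrow> smooth_on S g \<Longrightarrow> smooth_on S (\<lambda>x. f x - g x)"
  using smooth_on_add[of S f "\<lambda>x. - g x"] smooth_on_minus[of S g] by simp

lemma smooth_on_sum: "open S \<Longrightarrow> (\<And>i. i \<in> I \<Longrightarrow> smooth_on S (f i)) \<Longrightarrow> smooth_on S (\<lambda>x. \<Sum>i\<in>I. f i x)"
  by (simp add: smooth_on_def Ck_on_sum)

lemma smooth_on_inverse:
  "open S \<Longrightarrow> smooth_on S f \<Longrightarrow> (\<And>x. x \<in> S \<Longrightarrow> f x \<noteq> (0 :: real)) \<Longrightarrow> smooth_on S (\<lambda>x. inverse (f x))"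
  by (simp add: smooth_on_def Ck_on_inverse)

lemma smooth_on_compose:
  fixes f :: "'a::real_normed_vector \<Rightarrow> 'b::finite_dim_inner"
  shows "open S \<Longrightarrow> open T \<Longrightarrow> f ` S \<subseteq> T \<Longrightarrow> smooth_on S f \<Longrightarrow> smooth_on T g \<Longrightarrow> smooth_on S (\<lambda>x. g (f x))"
  unfolding smooth_on_def using Ck_on_compose by blast

lemma smooth_on_Pair:
  fixes f :: "'a::real_normed_vector \<Rightarrow> 'b::real_normed_vector" and g :: "'a \<Rightarrow> 'c::real_normed_vector"
  shows "open S \<Longrightarrow> smooth_on S f \<Longrightarrow> smooth_on S g \<Longrightarrow> smooth_on S (\<lambda>x. (f x, g x))"
proof -
  assume S: "open S" "smooth_on S f" "smooth_on S g"
  have L: "bounded_linear (\<lambda>y :: 'b. (y, 0 :: 'c))" "bounded_linear (\<lambda>y :: 'c. (0 :: 'b, y))"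
    by (rule bounded_linear_Pair bounded_linear_ident bounded_linear_zero)+
  from smooth_on_add[OF S(1) smooth_on_linear_compose[OF L(1) S(1,2)] smooth_on_linear_compose[OF L(2) S(1,3)]]
  show ?thesis by simp
qed

lemma smooth_on_differentiable: "smooth_on S f \<Longrightarrow> x \<in> S \<Longrightarrow> f differentiable (at x)"
  unfolding smooth_on_def by (metis Ck_on.simps(2))

lemma smooth_on_fd: "smooth_on S f \<Longrightarrow> smooth_on S (\<lambda>x. fd f x v)"
  unfolding smooth_on_def by (metis Ck_on.simps(2))

lemma smooth_on_continuous: "smooth_on S f \<Longrightarrow> continuous_on S f"
  unfolding smooth_on_def by (metis Ck_on.simps(1))

lemma fd_compose:
  "f differentiable (at x) \<Longrightarrow> g differentiable (at (f x)) \<Longrightarrow> fd (\<lambda>x. g (f x)) x = (\<lambda>v. fd g (f x) (fd f x v))"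
  by (intro fd_eqI has_derivative_compose[of f _ x UNIV g] fd_has_derivative)

section \<open>Bump functions and Hadamard's lemma\<close>

definition flat :: "nat \<Rightarrow> real \<Rightarrow> real"
  where "flat n x = (if x > 0 then (1 / x) ^ n * exp (- (1 / x)) else 0)"

lemma flat_tendsto_0: "(flat n \<longlongrightarrow> 0) (at 0)"
proof -
  have "((\<lambda>u. u ^ n / exp u) \<longlongrightarrow> (0::real)) at_top" by (rule tendsto_power_div_exp_0)
  from filterlim_compose[OF this filterlim_inverse_at_top_right]
  have 1: "((\<lambda>x. inverse x ^ n / exp (inverse x)) \<longlongrightarrow> (0::real)) (at_right 0)" .
  have "(flat n \<longlongrightarrow> 0) (at_right 0)" by (rule Lim_transform_eventually[OF 1])
       (auto simp: flat_def eventually_at_right_field exp_minus field_simps intro!: exI[of _ 1])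
  moreover have "(flat n \<longlongrightarrow> 0) (at_left 0)"
    by (rule tendsto_eventually) (auto simp: flat_def eventually_at_left_field intro!: exI[of _ "- 1"])
  ultimately show ?thesis by (simp add: filterlim_split_at)
qed

text \<open>The powers of 1/x make the family closed under differentiation up to linear
  combinations, so smoothness follows for all members at once by induction on the order.\<close>

lemma flat_has_derivative:
  "(flat n has_real_derivative flat (n + 2) x - real n * flat (n + 1) x) (at x)"
proof -
  consider "x > 0" | "x < 0" | "x = 0" by linarith
  then show ?thesis
  proof cases
    case 1
    have "((\<lambda>x. (1 / x) ^ n * exp (- (1 / x))) has_real_derivative flat (n + 2) x - real n * flat (n + 1) x) (at x)"
    proof -
      define y where "y = 1 / x"
      have y: "((\<lambda>x. 1 / x) has_real_derivative - (y\<^sup>2)) (at x)"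
        using 1 by (auto intro!: derivative_eq_intros simp: y_def power2_eq_square)
      have "((\<lambda>x. (1 / x) ^ n * exp (- (1 / x))) has_real_derivative
        y ^ n * (exp (- y) * y\<^sup>2) + real n * ((- (y\<^sup>2)) * y ^ (n - Suc 0)) * exp (- y)) (at x)"
        using DERIV_mult[OF DERIV_power[OF y, of n] DERIV_fun_exp[OF DERIV_minus[OF y]]]
        by (simp add: y_def algebra_simps)
      moreover have "y ^ n * (exp (- y) * y\<^sup>2) + real n * ((- (y\<^sup>2)) * y ^ (n - Suc 0)) * exp (- y) =
        flat (n + 2) x - real n * flat (n + 1) x"
        using 1 by (cases n) (simp_all add: flat_def y_def[symmetric] power_add power2_eq_square algebra_simps)
      ultimately show ?thesis by simp
    qed
    then show ?thesis
      by (rule has_field_derivative_transform_within_open[of _ _ _ "{0<..}"]) (use 1 in \<open>auto simp: flat_def\<close>)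
  next
    case 2
    have "((\<lambda>x. 0) has_real_derivative flat (n + 2) x - real n * flat (n + 1) x) (at x)"
      using 2 by (simp add: flat_def)
    then show ?thesis
      by (rule has_field_derivative_transform_within_open[of _ _ _ "{..<0}"]) (use 2 in \<open>auto simp: flat_def\<close>)
  next
    case 3
    \<comment> \<open>The difference quotient at 0 is the next member of the family, which tends to
      0.\<close>
    have "((\<lambda>h. (flat n (0 + h) - flat n 0) / h) \<longlongrightarrow> 0) (at 0)"
    proof (rule Lim_transform_eventually[OF flat_tendsto_0[of "Suc n"]])
      show "\<forall>\<^sub>F h in at 0. flat (Suc n) h = (flat n (0 + h) - flat n 0) / h"
        by (rule always_eventually) (auto simp: flat_def field_simps)
    qed
    with 3 show ?thesis by (simp add: DERIV_def flat_def)
  qed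
qed

lemma Ck_on_le: "Ck_on (j + i) S f \<Longrightarrow> Ck_on j S f"
proof (induction i)
  case (Suc i)
  then show ?case using Ck_on_Suc[of "j + i" S f] by (simp del: Ck_on.simps)
qed simp

lemma Ck_on_flat: "Ck_on k UNIV (flat n)"
proof (induction k arbitrary: n)
  case 0
  have "continuous (at x) (flat n)" for x using flat_has_derivative[of n x] DERIV_isCont by blast
  then show ?case by (simp add: continuous_at_imp_continuous_on)
next
  case (Suc k)
  have "(flat n has_derivative (\<lambda>v. (flat (n + 2) x - real n * flat (n + 1) x) * v)) (at x)" for x
    using flat_has_derivative[of n x] by (simp add: has_field_derivative_def)
  then have 1: "flat n differentiable (at x)" "fd (flat n) x = (\<lambda>v. (flat (n + 2) x - real n * flat (n + 1) x) * v)" for x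
    by (auto simp: differentiable_def fd_eqI)
  have "Ck_on k UNIV (\<lambda>x. (flat (n + 2) x + - real n * flat (n + 1) x) * v)" for v using Suc.IH
    by (intro Ck_on_bilinear[OF bounded_bilinear_mult] Ck_on_add Ck_on_const) auto
  then show ?case by (simp add: 1)
qed

lemma smooth_on_flat: "smooth_on UNIV (flat 0)"
  by (simp add: smooth_on_def Ck_on_flat)

lemma flat_pos: "x > 0 \<Longrightarrow> flat 0 x > 0" and flat_nonneg: "flat 0 x \<ge> 0" and flat_zero: "x \<le> 0 \<Longrightarrow> flat 0 x = 0"
  by (auto simp: flat_def)

definition step :: "real \<Rightarrow> real"
  where "step t = flat 0 (2 - t) * inverse (flat 0 (2 - t) + flat 0 (t - 1))"

lemma step_1: "t \<le> 1 \<Longrightarrow> step t = 1"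
  using flat_pos[of "2 - t"] flat_zero[of "t - 1"] by (simp add: step_def)

lemma step_0: "t \<ge> 2 \<Longrightarrow> step t = 0"
  using flat_zero[of "2 - t"] by (simp add: step_def)

lemma smooth_on_step: "smooth_on UNIV step"
proof -
  have a: "smooth_on UNIV (\<lambda>t. flat 0 (2 - t))" and b: "smooth_on UNIV (\<lambda>t. flat 0 (t - 1))"
    by (intro smooth_on_compose[OF _ _ _ _ smooth_on_flat] smooth_on_diff smooth_on_const smooth_on_ident; simp)+
  have "flat 0 (2 - t) + flat 0 (t - 1) \<noteq> 0" for t
  proof (cases "t < 2")
    case True
    then show ?thesis using flat_pos[of "2 - t"] flat_nonneg[of "t - 1"] by simp
  next
    case False
    then show ?thesis using flat_pos[of "t - 1"] flat_nonneg[of "2 - t"] by simp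
  qed
  then show ?thesis unfolding step_def[abs_def] by (intro smooth_on_mult smooth_on_inverse smooth_on_add a b) auto
qed

lemma bump_exists:
  fixes p :: "'a::real_inner"
  assumes "r > 0"
  shows "\<exists>b. smooth_on UNIV b \<and> (\<forall>x. dist x p < r / 2 \<longrightarrow> b x = 1) \<and> (\<forall>x. r \<le> dist x p \<longrightarrow> b x = (0 :: real))"
proof (intro exI conjI allI impI)
  \<comment> \<open>The squared distance is smooth; the factor 2 / r^2 sends distance r to 2, where
    \<open>step\<close> has become 0, and distances below r / 2 to values below 1 / 2, where it is
    1.\<close>
  define b where "b = (\<lambda>x. step (((x - p) \<bullet> (x - p)) * (2 / r\<^sup>2)))"
  show "smooth_on UNIV b" unfolding b_def
    by (intro smooth_on_compose[OF _ _ _ _ smooth_on_step] smooth_on_mult smooth_on_inner smooth_on_diff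
        smooth_on_const smooth_on_ident) auto
  have d: "(x - p) \<bullet> (x - p) = (dist x p)\<^sup>2" for x by (simp add: dist_norm power2_norm_eq_inner)
  show "b x = 1" if "dist x p < r / 2" for x
  proof -
    have "(dist x p)\<^sup>2 \<le> (r / 2)\<^sup>2" using that by (intro power_mono) auto
    then have "(dist x p)\<^sup>2 * 4 \<le> r\<^sup>2" by (simp add: power_divide)
    moreover have "2 * (dist x p)\<^sup>2 \<le> (dist x p)\<^sup>2 * 4" by simp
    ultimately have "2 * (dist x p)\<^sup>2 \<le> r\<^sup>2" by linarith
    then show ?thesis unfolding b_def d using assms by (intro step_1) (simp add: field_simps)
  qed
  show "b x = 0" if "r \<le> dist x p" for x
  proof -
    have "r\<^sup>2 \<le> (dist x p)\<^sup>2" using that assms by (intro power_mono) auto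
    then show ?thesis unfolding b_def d using assms by (intro step_0) (simp add: field_simps)
  qed
qed

lemma smooth_on_bump_mult:
  fixes h :: "'a::real_inner \<Rightarrow> real"
  assumes "smooth_on (ball p R) h" "smooth_on UNIV b" "\<And>x. r \<le> dist x p \<Longrightarrow> b x = 0" "r < R"
  shows "smooth_on UNIV (\<lambda>x. if x \<in> ball p R then b x * h x else 0)" (is "smooth_on _ ?f")
proof (rule smooth_on_locally)
  fix x :: 'a
  show "\<exists>T. open T \<and> x \<in> T \<and> smooth_on T ?f"
  proof (cases "x \<in> ball p R")
    case True
    have "smooth_on (ball p R) (\<lambda>x. b x * h x)"
      using assms by (intro smooth_on_mult smooth_on_subset[OF assms(2)]) auto
    then have "smooth_on (ball p R) ?f" by (subst smooth_on_cong[where g = "\<lambda>x. b x * h x"]) auto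
    with True show ?thesis by blast
  next
    case False
    then have "x \<in> - cball p r" using assms(4) by (auto simp: dist_commute)
    moreover have "smooth_on (- cball p r) ?f"
      by (subst smooth_on_cong[where g = "\<lambda>x. 0"]) (auto simp: assms(3) dist_commute smooth_on_const)
    ultimately show ?thesis by (intro exI[of _ "- cball p r"]) auto
  qed
qed

text \<open>Averages along the segments from \<open>p\<close>, as in the remainder of Taylor's formula.\<close>

definition radial_average :: "nat \<Rightarrow> 'a::finite_dim_inner \<Rightarrow> ('a \<Rightarrow> real) \<Rightarrow> 'a \<Rightarrow> real"
  where "radial_average m p f x = integral (cbox 0 1) (\<lambda>t. t ^ m * f (p + t *\<^sub>R (x - p)))"

abbreviation "seg p x t \<equiv> p + t *\<^sub>R (x - p)"

lemma segment_in_ball: "x \<in> ball p r \<Longrightarrow> 0 \<le> t \<Longrightarrow> t \<le> (1::real) \<Longrightarrow> seg p x t \<in> ball (p :: 'a::real_normed_vector) r"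
  using mult_right_mono[of t 1 "norm (x - p)"] by (auto simp: dist_norm norm_minus_commute[of p x])

lemma continuous_radial:
  assumes "continuous_on (ball (p :: 'a::real_normed_vector) r) (f :: 'a \<Rightarrow> real)"
  shows "continuous_on (ball p r \<times> cbox 0 1) (\<lambda>(x, t). t ^ m * f (seg p x t))"
proof -
  have "continuous_on (ball p r \<times> cbox 0 1) (\<lambda>z. f (p + snd z *\<^sub>R (fst z - p)))"
    by (rule continuous_on_compose2[OF assms]) (auto intro!: continuous_intros segment_in_ball simp del: mem_ball)
  then show ?thesis by (auto simp: case_prod_beta intro!: continuous_intros)
qed

text \<open>Differentiation under the integral sign. The inner derivative of the segment contributes
  one more factor t, which is why the weights t^m are carried along.\<close>

lemma radial_average_has_derivative:
  fixes f :: "'a::finite_dim_inner \<Rightarrow> real"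
  assumes f: "Ck_on 1 (ball p r) f" and x: "x \<in> ball p r"
  shows "(radial_average m p f has_derivative (\<lambda>v. radial_average (Suc m) p (\<lambda>y. fd f y v) x)) (at x)"
proof -
  define g where "g = (\<lambda>x t. t ^ m * f (seg p x t))"
  \<comment> \<open>The derivative has to be a bounded linear function depending continuously on the
    parameters, so it is assembled from its values on the orthonormal basis.\<close>
  define g' where "g' = (\<lambda>x t. \<Sum>e\<in>onb. (t ^ Suc m * fd f (seg p x t) e) *\<^sub>R blinfun_inner_left (e :: 'a))"
  have diff: "f differentiable (at y)" and cont: "continuous_on (ball p r) (\<lambda>y. fd f y v)" if "y \<in> ball p r" for y v
    using f that by auto
  have contf: "continuous_on (ball p r) f" using Ck_on_Suc[of 0] f by simp
  have g'_apply: "blinfun_apply (g' x t) v = t ^ Suc m * fd f (seg p x t) v"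
    if "x \<in> ball p r" "t \<in> cbox 0 1" for x t v
  proof -
    have "linear (fd f (seg p x t))" using that by (intro fd_linear diff segment_in_ball) auto
    from linear_onb[OF this, of v] show ?thesis
      by (simp add: g'_def blinfun.sum_left blinfun.scaleR_left sum_distrib_left mult.commute mult.left_commute)
  qed
  have "((\<lambda>x. integral (cbox 0 1) (g x)) has_derivative integral (cbox 0 1) (g' x)) (at x within ball p r)"
  proof (rule leibniz_rule[where U = "ball p r"])
    fix x t assume xt: "x \<in> ball p r" "t \<in> cbox 0 (1::real)"
    then have "((\<lambda>x. f (seg p x t)) has_derivative (\<lambda>v. fd f (seg p x t) (t *\<^sub>R v))) (at x)"
      by (intro has_derivative_compose[of "\<lambda>x. seg p x t" _ _ UNIV f] fd_has_derivative diff segment_in_ball)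
         (auto intro!: derivative_eq_intros)
    have "linear (fd f (seg p x t))" using xt by (intro fd_linear diff segment_in_ball) auto
    then have "fd f (seg p x t) (t *\<^sub>R v) = t * fd f (seg p x t) v" for v
      by (simp add: linear_scale)
    then have "((\<lambda>x. g x t) has_derivative (\<lambda>v. t ^ m * (t * fd f (seg p x t) v))) (at x)"
      unfolding g_def
      using has_derivative_mult_right[OF \<open>((\<lambda>x. f (seg p x t)) has_derivative _) (at x)\<close>, of "t ^ m"] by simp
    moreover have "blinfun_apply (g' x t) = (\<lambda>v. t ^ m * (t * fd f (seg p x t) v))"
      using g'_apply[OF xt] by (simp add: fun_eq_iff)
    ultimately show "((\<lambda>x. g x t) has_derivative blinfun_apply (g' x t)) (at x within ball p r)"
      using has_derivative_at_withinI by simp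
  next
    fix x assume "x \<in> ball p r"
    then have "continuous_on (cbox 0 1) (\<lambda>t. (\<lambda>(x, t). t ^ m * f (seg p x t)) (x, t))"
      by (intro continuous_on_compose2[OF continuous_radial[OF contf, of m]]) (auto intro!: continuous_intros)
    then show "g x integrable_on cbox 0 1" by (auto simp: g_def intro: integrable_continuous_real)
  next
    have "continuous_on (ball p r \<times> cbox 0 1) (\<lambda>z. (snd z ^ Suc m * fd f (p + snd z *\<^sub>R (fst z - p)) e) *\<^sub>R blinfun_inner_left e)" for e
      using continuous_radial[of p r "\<lambda>y. fd f y e" "Suc m"] cont[OF x, of e]
      by (intro continuous_on_scaleR) (auto simp: case_prod_beta)
    then show "continuous_on (ball p r \<times> cbox 0 1) (\<lambda>(x, t). g' x t)"
      unfolding g'_def case_prod_beta by (intro continuous_on_sum) auto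
  qed (use x in auto)
  moreover have "blinfun_apply (integral (cbox 0 1) (g' x)) = (\<lambda>v. radial_average (Suc m) p (\<lambda>y. fd f y v) x)"
  proof
    fix v
    have "continuous_on (cbox 0 1) (\<lambda>t. (t ^ Suc m * fd f (seg p x t) e) *\<^sub>R blinfun_inner_left e)" for e
    proof -
      have "continuous_on (cbox 0 1) (\<lambda>t. (\<lambda>(x, t). t ^ Suc m * fd f (seg p x t) e) (x, t))"
        using cont[OF x, of e] x
        by (intro continuous_on_compose2[OF continuous_radial[of p r "\<lambda>y. fd f y e" "Suc m"]]) (auto intro!: continuous_intros)
      then show ?thesis by (intro continuous_on_scaleR) auto
    qed
    then have "g' x integrable_on cbox 0 1" unfolding g'_def by (intro integrable_continuous continuous_on_sum)
    from integral_linear[OF this blinfun.bounded_linear_left[of v]]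
    have "blinfun_apply (integral (cbox 0 1) (g' x)) v = integral (cbox 0 1) (\<lambda>t. blinfun_apply (g' x t) v)"
      by (simp add: o_def)
    also have "\<dots> = radial_average (Suc m) p (\<lambda>y. fd f y v) x"
      unfolding radial_average_def using g'_apply[OF x] by (intro integral_cong) auto
    finally show "blinfun_apply (integral (cbox 0 1) (g' x)) v = radial_average (Suc m) p (\<lambda>y. fd f y v) x" .
  qed
  moreover have "at x within ball p r = at x" using x by (intro at_within_open) auto
  ultimately show ?thesis by (simp add: g_def radial_average_def[abs_def])
qed

text \<open>One order is lost, since differentiation under the integral asks for a continuous
  derivative of the integrand.\<close>

lemma Ck_on_radial_average:
  fixes f :: "'a::finite_dim_inner \<Rightarrow> real"
  shows "Ck_on (Suc k) (ball p r) f \<Longrightarrow> Ck_on k (ball p r) (radial_average m p f)"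
proof (induction k arbitrary: f m)
  case 0
  then have "continuous (at x) (radial_average m p f)" if "x \<in> ball p r" for x
    using radial_average_has_derivative[of p r f x m] that has_derivative_continuous by auto
  then show ?case by (simp add: continuous_at_imp_continuous_on)
next
  case (Suc k)
  have "Ck_on (Suc 0) (ball p r) f" using Ck_on_le[of "Suc 0" "Suc k"] Suc.prems by (simp del: Ck_on.simps)
  then have D: "(radial_average m p f has_derivative (\<lambda>v. radial_average (Suc m) p (\<lambda>y. fd f y v) x)) (at x)" if "x \<in> ball p r" for x
    using that by (intro radial_average_has_derivative[of p r]) auto
  have "Ck_on k (ball p r) (\<lambda>x. fd (radial_average m p f) x v)" for v
  proof (rule Ck_on_cong_imp[OF open_ball])
    show "Ck_on k (ball p r) (radial_average (Suc m) p (\<lambda>y. fd f y v))" using Suc.prems by (intro Suc.IH) auto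
    fix x assume "x \<in> ball p r"
    from fd_eqI[OF D[OF this]] show "radial_average (Suc m) p (\<lambda>y. fd f y v) x = fd (radial_average m p f) x v" by simp
  qed
  with differentiableI[OF D] show ?case by simp
qed

text \<open>The fundamental theorem of calculus along the segment from \<open>p\<close> to
  \<open>x\<close>, with the derivative expanded in the orthonormal basis.\<close>

lemma hadamard:
  fixes f :: "'a::finite_dim_inner \<Rightarrow> real"
  assumes f: "smooth_on (ball p r) f" and r: "r > 0"
  shows "\<exists>g. (\<forall>e. smooth_on (ball p r) (g e)) \<and> (\<forall>e. g e p = fd f p e) \<and>
    (\<forall>x\<in>ball p r. f x = f p + (\<Sum>e\<in>onb. ((x - p) \<bullet> e) * g e x))"
proof (intro exI conjI allI ballI)
  let ?g = "\<lambda>e. radial_average 0 p (\<lambda>y. fd f y e)"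
  show "smooth_on (ball p r) (?g e)" for e
    using smooth_on_fd[OF f] Ck_on_radial_average unfolding smooth_on_def by blast
  show "?g e p = fd f p e" for e by (simp add: radial_average_def)
  fix x assume x: "x \<in> ball p r"
  have diff: "f differentiable (at (seg p x t))" if "t \<in> cbox 0 1" for t
    using smooth_on_differentiable[OF f segment_in_ball[OF x]] that by auto
  have "((\<lambda>t. fd f (seg p x t) (x - p)) has_integral f (p + 1 *\<^sub>R (x - p)) - f (p + 0 *\<^sub>R (x - p))) {0..1}"
  proof (rule fundamental_theorem_of_calculus)
    fix t :: real assume t: "t \<in> {0..1}"
    have "((\<lambda>t. f (seg p x t)) has_derivative (\<lambda>h. fd f (seg p x t) (h *\<^sub>R (x - p)))) (at t)"
      using t by (intro has_derivative_compose[of "\<lambda>t. seg p x t" _ _ UNIV f] fd_has_derivative diff)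
        (auto intro!: derivative_eq_intros)
    moreover have "linear (fd f (seg p x t))" using t by (intro fd_linear diff) auto
    ultimately show "((\<lambda>t. f (seg p x t)) has_vector_derivative fd f (seg p x t) (x - p)) (at t within {0..1})"
      by (auto simp: has_vector_derivative_def linear_scale intro: has_derivative_at_withinI)
  qed simp
  then have 1: "f x - f p = integral (cbox 0 1) (\<lambda>t. fd f (seg p x t) (x - p))"
    by (simp add: integral_unique)
  also have "\<dots> = integral (cbox 0 1) (\<lambda>t. \<Sum>e\<in>onb. ((x - p) \<bullet> e) * (t ^ 0 * fd f (seg p x t) e))"
  proof (rule integral_cong)
    fix t :: real assume "t \<in> cbox 0 1"
    then have "linear (fd f (seg p x t))" by (intro fd_linear diff)
    from linear_onb[OF this, of "x - p"]
    show "fd f (seg p x t) (x - p) = (\<Sum>e\<in>onb. ((x - p) \<bullet> e) * (t ^ 0 * fd f (seg p x t) e))" by simp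
  qed
  also have "\<dots> = (\<Sum>e\<in>onb. ((x - p) \<bullet> e) * ?g e x)"
  proof (subst integral_sum)
    fix e :: 'a
    have "continuous_on (cbox 0 1) (\<lambda>t. (\<lambda>(x, t). t ^ 0 * fd f (seg p x t) e) (x, t))"
      using smooth_on_continuous[OF smooth_on_fd[OF f, of e]] x
      by (intro continuous_on_compose2[OF continuous_radial[of p r "\<lambda>y. fd f y e" 0]]) (auto intro!: continuous_intros)
    then show "(\<lambda>t. ((x - p) \<bullet> e) * (t ^ 0 * fd f (seg p x t) e)) integrable_on cbox 0 1"
      by (intro integrable_continuous continuous_on_mult continuous_on_const) auto
  qed (simp_all add: radial_average_def)
  finally show "f x = f p + (\<Sum>e\<in>onb. ((x - p) \<bullet> e) * ?g e x)" by simp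
qed

section \<open>Charts and tangent vectors\<close>

abbreviation "iv \<equiv> the_inv_into"

lemma iv_simps:
  "inj_on \<phi> U \<Longrightarrow> q \<in> U \<Longrightarrow> iv U \<phi> (\<phi> q) = q"
  "inj_on \<phi> U \<Longrightarrow> z \<in> \<phi> ` U \<Longrightarrow> \<phi> (iv U \<phi> z) = z"
  "inj_on \<phi> U \<Longrightarrow> z \<in> \<phi> ` U \<Longrightarrow> iv U \<phi> z \<in> U"
  by (auto simp: the_inv_into_f_f)

lemma iv_subset: "inj_on \<phi> U \<Longrightarrow> V \<subseteq> U \<Longrightarrow> z \<in> \<phi> ` V \<Longrightarrow> iv V \<phi> z = iv U \<phi> z"
  by (auto simp: the_inv_into_f_f inj_on_subset subset_iff)

lemma compatibleD:
  assumes "compatible (U, \<phi>) (V, \<theta>)"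
  shows "open (\<phi> ` (U \<inter> V))" "open (\<theta> ` (U \<inter> V))"
    "smooth_on (\<phi> ` (U \<inter> V)) (\<theta> \<circ> iv U \<phi>)" "smooth_on (\<theta> ` (U \<inter> V)) (\<phi> \<circ> iv V \<theta>)"
  using assms by (auto simp: compatible_def)

lemma compatible_sym: "compatible a b \<Longrightarrow> compatible b a"
  by (auto simp: compatible_def Int_commute split: prod.splits)

text \<open>The last map may have values in any normed space, so that the lemma covers transition
  maps as well as coordinate expressions of real functions.\<close>

lemma transition_compose:
  fixes \<phi> :: "'a \<Rightarrow> 'd::finite_dim_inner" and \<kappa> :: "'a \<Rightarrow> 'e::finite_dim_inner" and \<theta> :: "'a \<Rightarrow> 'g::real_normed_vector"
  assumes inj: "inj_on \<phi> U" "inj_on \<kappa> W"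
    and o1: "open (\<phi> ` (U \<inter> W))" and s1: "smooth_on (\<phi> ` (U \<inter> W)) (\<kappa> \<circ> iv U \<phi>)"
    and o2: "open (\<kappa> ` (W \<inter> V))" and s2: "smooth_on (\<kappa> ` (W \<inter> V)) (\<theta> \<circ> iv W \<kappa>)"
    and p: "p \<in> U" "p \<in> V" "p \<in> W"
  shows "\<exists>T. open T \<and> \<phi> p \<in> T \<and> T \<subseteq> \<phi> ` (U \<inter> V) \<and> smooth_on T (\<theta> \<circ> iv U \<phi>)"
proof -
  define T where "T = \<phi> ` (U \<inter> W) \<inter> (\<kappa> \<circ> iv U \<phi>) -` (\<kappa> ` (W \<inter> V))"
  have T: "open T" unfolding T_def by (intro continuous_open_preimage smooth_on_continuous s1 o1 o2)
  have mem: "\<exists>q. z = \<phi> q \<and> q \<in> U \<and> q \<in> W \<and> q \<in> V" if "z \<in> T" for z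
  proof -
    from that obtain q where q: "z = \<phi> q" "q \<in> U" "q \<in> W" and "\<kappa> (iv U \<phi> z) \<in> \<kappa> ` (W \<inter> V)"
      by (auto simp: T_def)
    then have "\<kappa> q \<in> \<kappa> ` (W \<inter> V)" using inj by (simp add: iv_simps)
    then have "q \<in> V" using inj(2) q by (auto dest: inj_onD)
    with q show ?thesis by blast
  qed
  have "smooth_on T (\<lambda>z. (\<theta> \<circ> iv W \<kappa>) ((\<kappa> \<circ> iv U \<phi>) z))"
    by (rule smooth_on_compose[OF T o2 _ smooth_on_subset[OF s1] s2]) (auto simp: T_def)
  moreover have "(\<theta> \<circ> iv W \<kappa>) ((\<kappa> \<circ> iv U \<phi>) z) = (\<theta> \<circ> iv U \<phi>) z" if "z \<in> T" for z
    using mem[OF that] inj by (auto simp: iv_simps)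
  ultimately have "smooth_on T (\<theta> \<circ> iv U \<phi>)"
    using smooth_on_cong[OF T, of "\<lambda>z. (\<theta> \<circ> iv W \<kappa>) ((\<kappa> \<circ> iv U \<phi>) z)" "\<theta> \<circ> iv U \<phi>"] by simp
  moreover have "\<phi> p \<in> T" using p inj by (auto simp: T_def iv_simps)
  moreover have "T \<subseteq> \<phi> ` (U \<inter> V)" using mem by blast
  ultimately show ?thesis using T by blast
qed

text \<open>Openness and smoothness are local, so it is enough to factor through an auxiliary chart
  around each common point.\<close>

lemma compatible_via:
  fixes \<phi> :: "'a \<Rightarrow> 'e::finite_dim_inner" and \<theta> :: "'a \<Rightarrow> 'e"
  assumes "inj_on \<phi> U" "inj_on \<theta> V"
    and via: "\<And>p. p \<in> U \<inter> V \<Longrightarrow> \<exists>W \<kappa>. p \<in> W \<and> inj_on \<kappa> W \<and> compatible (U, \<phi>) (W, \<kappa>) \<and> compatible (V, \<theta>) (W, \<kappa> :: 'a \<Rightarrow> 'e)"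
  shows "compatible (U, \<phi>) (V, \<theta>)"
proof -
  have *: "open (\<phi> ` (U \<inter> V)) \<and> smooth_on (\<phi> ` (U \<inter> V)) (\<theta> \<circ> iv U \<phi>)"
    if inj: "inj_on \<phi> U" and via: "\<And>p. p \<in> U \<inter> V \<Longrightarrow> \<exists>W \<kappa>. p \<in> W \<and> inj_on \<kappa> W \<and>
      compatible (U, \<phi>) (W, \<kappa>) \<and> compatible (V, \<theta>) (W, \<kappa> :: 'a \<Rightarrow> 'e)"
    for U V and \<phi> \<theta> :: "'a \<Rightarrow> 'e"
  proof -
    have loc: "\<exists>T. open T \<and> z \<in> T \<and> T \<subseteq> \<phi> ` (U \<inter> V) \<and> smooth_on T (\<theta> \<circ> iv U \<phi>)" if "z \<in> \<phi> ` (U \<inter> V)" for z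
    proof -
      from that obtain p where p: "z = \<phi> p" "p \<in> U" "p \<in> V" by auto
      obtain W \<kappa> where W: "p \<in> W" "inj_on \<kappa> W" "compatible (U, \<phi>) (W, \<kappa>)" "compatible (V, \<theta>) (W, \<kappa> :: 'a \<Rightarrow> 'e)"
        using via[of p] p by auto
      note c = compatibleD[OF W(3)] and d = compatibleD[OF compatible_sym[OF W(4)]]
      show ?thesis unfolding p(1) by (rule transition_compose[OF inj W(2) c(1) c(3) d(1) d(3) p(2,3) W(1)])
    qed
    have "open (\<phi> ` (U \<inter> V))" by (subst open_subopen) (use loc in blast)
    moreover have "smooth_on (\<phi> ` (U \<inter> V)) (\<theta> \<circ> iv U \<phi>)"
      by (rule smooth_on_locally) (use loc in blast)
    ultimately show ?thesis by simp
  qed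
  have "open (\<phi> ` (U \<inter> V)) \<and> smooth_on (\<phi> ` (U \<inter> V)) (\<theta> \<circ> iv U \<phi>)"
    by (rule *[OF assms(1) via])
  moreover have "open (\<theta> ` (V \<inter> U)) \<and> smooth_on (\<theta> ` (V \<inter> U)) (\<phi> \<circ> iv V \<theta>)"
    by (rule *[OF assms(2)]) (use via in blast)
  ultimately show ?thesis by (simp add: compatible_def Int_commute)
qed

lemma mopenI:
  assumes "W \<subseteq> carrier_of A" "\<And>U \<phi>. (U, \<phi>) \<in> A \<Longrightarrow> open (\<phi> ` (U \<inter> W))"
  shows "mopen A W"
  using assms by (auto simp: mopen_def)

lemma mopenD: "mopen A W \<Longrightarrow> (U, \<phi>) \<in> A \<Longrightarrow> open (\<phi> ` (U \<inter> W))" "mopen A W \<Longrightarrow> W \<subseteq> carrier_of A"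
  by (auto simp: mopen_def)

lemma in_carrierI: "(U, \<phi>) \<in> A \<Longrightarrow> q \<in> U \<Longrightarrow> q \<in> carrier_of A"
  by (force simp: carrier_of_def)

text \<open>The structure shared by the atlases of \<open>M\<close>, of the submanifold and of the
  normal bundle; the Hausdorff property of \<open>M\<close> enters later through cut-off
  functions.\<close>

locale pre_manifold =
  fixes A :: "('a, 'e::finite_dim_inner) atlas"
  assumes charts: "(U, \<phi>) \<in> A \<Longrightarrow> inj_on \<phi> U \<and> open (\<phi> ` U)"
    and compat: "a \<in> A \<Longrightarrow> b \<in> A \<Longrightarrow> compatible a b"
begin

abbreviation mchart :: "'a set \<Rightarrow> ('a \<Rightarrow> 'e) \<Rightarrow> bool"
  where "mchart U \<phi> \<equiv> (U, \<phi>) \<in> maximal_atlas A"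

lemma mchart_inj: "mchart U \<phi> \<Longrightarrow> inj_on \<phi> U"
  and mchart_open: "mchart U \<phi> \<Longrightarrow> open (\<phi> ` U)"
  and mchart_carrier: "mchart U \<phi> \<Longrightarrow> U \<subseteq> carrier_of A"
  and mchart_compat: "mchart U \<phi> \<Longrightarrow> b \<in> A \<Longrightarrow> compatible (U, \<phi>) b"
  by (simp_all add: maximal_atlas_def)

lemma chart_mchart: "(U, \<phi>) \<in> A \<Longrightarrow> mchart U \<phi>"
  using charts compat by (auto simp: maximal_atlas_def carrier_of_def)

lemma carrier_chart: "p \<in> carrier_of A \<Longrightarrow> \<exists>U \<phi>. (U, \<phi>) \<in> A \<and> p \<in> U"
  by (auto simp: carrier_of_def)

lemma mchart_compatible: "mchart U \<phi> \<Longrightarrow> mchart V \<theta> \<Longrightarrow> compatible (U, \<phi>) (V, \<theta>)"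
proof (rule compatible_via)
  fix p assume 1: "mchart U \<phi>" "mchart V \<theta>" and "p \<in> U \<inter> V"
  then obtain W \<kappa> where W: "(W, \<kappa>) \<in> A" "p \<in> W" using carrier_chart mchart_carrier by blast
  show "\<exists>W \<kappa>. p \<in> W \<and> inj_on \<kappa> W \<and> compatible (U, \<phi>) (W, \<kappa>) \<and> compatible (V, \<theta>) (W, \<kappa> :: 'a \<Rightarrow> 'e)"
    using W charts mchart_compat[OF 1(1) W(1)] mchart_compat[OF 1(2) W(1)] by blast
qed (auto dest: mchart_inj)

definition sm_at :: "'a set \<Rightarrow> ('a \<Rightarrow> 'e) \<Rightarrow> 'a \<Rightarrow> ('a \<Rightarrow> real) \<Rightarrow> bool"
  where "sm_at U \<phi> p f \<longleftrightarrow> (\<exists>T. open T \<and> \<phi> p \<in> T \<and> T \<subseteq> \<phi> ` U \<and> smooth_on T (f \<circ> iv U \<phi>))"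

lemma sm_at_change:
  assumes "mchart U \<phi>" "mchart V \<theta>" "p \<in> U" "p \<in> V" "sm_at U \<phi> p f"
  shows "sm_at V \<theta> p f"
proof -
  obtain T where T: "open T" "\<phi> p \<in> T" "T \<subseteq> \<phi> ` U" "smooth_on T (f \<circ> iv U \<phi>)" using assms(5) by (auto simp: sm_at_def)
  note c = compatibleD[OF mchart_compatible[OF assms(2,1)]] and inj = mchart_inj[OF assms(1)] mchart_inj[OF assms(2)]
  \<comment> \<open>The region on which \<open>f\<close> is known to be smooth; in
    \<open>transition_compose\<close>, \<open>f\<close> on this region takes the place of the last
    chart.\<close>
  define X where "X = iv U \<phi> ` T"
  have X: "\<phi> ` (U \<inter> X) = T" "X \<subseteq> U" using T(3) inj(1) by (auto simp: X_def iv_simps image_iff) (metis Int_iff iv_simps(2,3) imageI subsetD)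
  have "iv X \<phi> z = iv U \<phi> z" if "z \<in> T" for z using that X iv_subset[OF inj(1) X(2), of z] by (simp add: Int_absorb1)
  then have s: "smooth_on T (f \<circ> iv U \<phi>)" using T by simp
  have "\<exists>T'. open T' \<and> \<theta> p \<in> T' \<and> T' \<subseteq> \<theta> ` (V \<inter> X) \<and> smooth_on T' (f \<circ> iv V \<theta>)"
  proof (rule transition_compose[OF inj(2) inj(1)])
    show "p \<in> X" using T(2) assms(3) inj(1) by (auto simp: X_def iv_simps image_iff intro!: bexI[of _ "\<phi> p"])
  qed (use c X T s assms in simp_all)
  then show ?thesis unfolding sm_at_def by blast
qed

lemma mopen_mchart: "mopen A W \<Longrightarrow> mchart U \<phi> \<Longrightarrow> open (\<phi> ` (U \<inter> W))"
proof -
  assume W: "mopen A W" and U: "mchart U \<phi>"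
  have "\<exists>T. open T \<and> z \<in> T \<and> T \<subseteq> \<phi> ` (U \<inter> W)" if "z \<in> \<phi> ` (U \<inter> W)" for z
  proof -
    from that obtain p where p: "z = \<phi> p" "p \<in> U" "p \<in> W" by auto
    then obtain V \<theta> where V: "(V, \<theta>) \<in> A" "p \<in> V" using carrier_chart mchart_carrier U by blast
    note c = compatibleD[OF mchart_compat[OF U V(1)]]
    have "open (\<theta> ` (V \<inter> W))" using W V by (auto simp: mopen_def)
    then have "\<exists>T. open T \<and> \<phi> p \<in> T \<and> T \<subseteq> \<phi> ` (U \<inter> W) \<and> smooth_on T ((\<lambda>_. 0 :: real) \<circ> iv U \<phi>)"
      using charts[OF V(1)] mchart_inj[OF U] p V
      by (intro transition_compose[OF _ _ c(1) c(3)]) (auto simp: o_def smooth_on_const)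
    with p show ?thesis by blast
  qed
  then show ?thesis by (subst open_subopen) blast
qed

lemma mopen_iv_image:
  assumes "mchart U \<phi>" "open T" "T \<subseteq> \<phi> ` U"
  shows "mopen A (iv U \<phi> ` T)"
proof (rule mopenI)
  note inj = mchart_inj[OF assms(1)]
  have sub: "iv U \<phi> ` T \<subseteq> U" using assms(3) inj by (auto simp: iv_simps)
  then show "iv U \<phi> ` T \<subseteq> carrier_of A" using mchart_carrier[OF assms(1)] by blast
  fix V \<theta> assume V: "(V, \<theta>) \<in> A"
  note c = compatibleD[OF compatible_sym[OF mchart_compat[OF assms(1) V]]]
  have "\<theta> ` (V \<inter> iv U \<phi> ` T) = \<theta> ` (V \<inter> U) \<inter> (\<phi> \<circ> iv V \<theta>) -` T"
  proof (intro set_eqI iffI)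
    fix y assume "y \<in> \<theta> ` (V \<inter> iv U \<phi> ` T)"
    then obtain z where "z \<in> T" "y = \<theta> (iv U \<phi> z)" "iv U \<phi> z \<in> V" by auto
    then show "y \<in> \<theta> ` (V \<inter> U) \<inter> (\<phi> \<circ> iv V \<theta>) -` T"
      using sub assms(3) inj charts[OF V] by (auto simp: iv_simps subset_iff)
  next
    fix y assume "y \<in> \<theta> ` (V \<inter> U) \<inter> (\<phi> \<circ> iv V \<theta>) -` T"
    then obtain q where q: "q \<in> V" "q \<in> U" "y = \<theta> q" "\<phi> (iv V \<theta> y) \<in> T" by auto
    then have "\<phi> q \<in> T" using charts[OF V] by (simp add: iv_simps)
    then have "q \<in> iv U \<phi> ` T" using q inj by (auto simp: iv_simps image_iff intro!: bexI[of _ "\<phi> q"])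
    then show "y \<in> \<theta> ` (V \<inter> iv U \<phi> ` T)" using q by blast
  qed
  then show "open (\<theta> ` (V \<inter> iv U \<phi> ` T))"
    by (simp only:) (intro continuous_open_preimage smooth_on_continuous c(3) c(1) assms(2))
qed

lemma mopen_chart: "mchart U \<phi> \<Longrightarrow> mopen A U"
proof -
  assume U: "mchart U \<phi>"
  then have "iv U \<phi> ` \<phi> ` U = U" using mchart_inj by (auto simp: iv_simps image_image)
  with mopen_iv_image[OF U mchart_open[OF U]] show ?thesis by simp
qed

lemma mopen_Int: "mopen A V \<Longrightarrow> mopen A W \<Longrightarrow> mopen A (V \<inter> W)"
proof (rule mopenI)
  assume 1: "mopen A V" "mopen A W"
  then show "V \<inter> W \<subseteq> carrier_of A" using mopenD(2) by blast
  fix U \<phi> assume U: "(U, \<phi>) \<in> A"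
  have "\<phi> ` (U \<inter> (V \<inter> W)) = \<phi> ` (U \<inter> V) \<inter> \<phi> ` (U \<inter> W)"
    using charts[OF U] by (auto simp: image_iff dest: inj_onD)
  then show "open (\<phi> ` (U \<inter> (V \<inter> W)))" using mopenD(1)[OF 1(1) U] mopenD(1)[OF 1(2) U] by (simp add: open_Int)
qed

text \<open>\<open>smooth_near\<close> quantifies over all charts of a restricted atlas; smooth
  transition maps reduce it to a single chart of the maximal atlas.\<close>

lemma smooth_near_iff:
  assumes U: "mchart U \<phi>" and p: "p \<in> U"
  shows "smooth_near A p f \<longleftrightarrow> sm_at U \<phi> p f"
proof
  assume "smooth_near A p f"
  then obtain W where W: "mopen A W" "p \<in> W" "smooth_fun (restrict_atlas A W) f" by (auto simp: smooth_near_def)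
  obtain V \<theta> where V: "(V, \<theta>) \<in> A" "p \<in> V" using p carrier_chart mchart_carrier[OF U] by blast
  have o: "open (\<theta> ` (V \<inter> W))" using W(1) V by (auto simp: mopen_def)
  have "smooth_on (\<theta> ` (V \<inter> W)) (f \<circ> iv (V \<inter> W) \<theta>)"
    using W(3) V by (auto simp: smooth_fun_def restrict_atlas_def)
  then have "smooth_on (\<theta> ` (V \<inter> W)) (f \<circ> iv V \<theta>)"
    using iv_subset[of \<theta> V "V \<inter> W"] charts[OF V(1)] by (subst smooth_on_cong[OF o, of _ "f \<circ> iv (V \<inter> W) \<theta>"]) auto
  then have "sm_at V \<theta> p f" using o V W(2) by (auto simp: sm_at_def)
  then show "sm_at U \<phi> p f" by (rule sm_at_change[OF chart_mchart[OF V(1)] U V(2) p])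
next
  assume "sm_at U \<phi> p f"
  then obtain T where T: "open T" "\<phi> p \<in> T" "T \<subseteq> \<phi> ` U" "smooth_on T (f \<circ> iv U \<phi>)" by (auto simp: sm_at_def)
  note inj = mchart_inj[OF U]
  define W where "W = iv U \<phi> ` T"
  have W: "mopen A W" unfolding W_def by (rule mopen_iv_image[OF U T(1,3)])
  have "smooth_on (\<theta> ` (V \<inter> W)) (f \<circ> iv (V \<inter> W) \<theta>)" if V: "(V, \<theta>) \<in> A" for V \<theta>
  proof (rule smooth_on_locally)
    fix z assume "z \<in> \<theta> ` (V \<inter> W)"
    then obtain q where q: "q \<in> V" "q \<in> W" "z = \<theta> q" by auto
    have "q \<in> U" "\<phi> q \<in> T" using q(2) T(3) inj by (auto simp: W_def iv_simps subset_iff)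
    then have "sm_at U \<phi> q f" using T by (auto simp: sm_at_def)
    then have "sm_at V \<theta> q f" by (rule sm_at_change[OF U chart_mchart[OF V] \<open>q \<in> U\<close> q(1)])
    then obtain T' where T': "open T'" "\<theta> q \<in> T'" "smooth_on T' (f \<circ> iv V \<theta>)" by (auto simp: sm_at_def)
    have o: "open (\<theta> ` (V \<inter> W))" using W V by (auto simp: mopen_def)
    have "smooth_on (T' \<inter> \<theta> ` (V \<inter> W)) (f \<circ> iv (V \<inter> W) \<theta>)"
      using iv_subset[of \<theta> V "V \<inter> W"] charts[OF V] smooth_on_subset[OF T'(3)] o T'(1)
      by (subst smooth_on_cong[of _ _ "f \<circ> iv V \<theta>"]) auto
    then show "\<exists>T. open T \<and> z \<in> T \<and> smooth_on T (f \<circ> iv (V \<inter> W) \<theta>)"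
      using o T' q by (intro exI[of _ "T' \<inter> \<theta> ` (V \<inter> W)"]) auto
  qed
  then have "smooth_fun (restrict_atlas A W) f" by (auto simp: smooth_fun_def restrict_atlas_def)
  moreover have "p \<in> W" using T(2) p inj by (auto simp: W_def iv_simps image_iff intro!: bexI[of _ "\<phi> p"])
  ultimately show "smooth_near A p f" using W unfolding smooth_near_def by blast
qed

lemma smooth_fun_iff: "smooth_fun A f \<longleftrightarrow> (\<forall>p\<in>carrier_of A. smooth_near A p f)"
proof
  assume f: "smooth_fun A f"
  show "\<forall>p\<in>carrier_of A. smooth_near A p f"
  proof
    fix p assume "p \<in> carrier_of A"
    then obtain U \<phi> where U: "(U, \<phi>) \<in> A" "p \<in> U" using carrier_chart by blast
    then have "sm_at U \<phi> p f" using f charts[OF U(1)] unfolding sm_at_def smooth_fun_def by blast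
    then show "smooth_near A p f" using smooth_near_iff[OF chart_mchart[OF U(1)] U(2)] by blast
  qed
next
  assume f: "\<forall>p\<in>carrier_of A. smooth_near A p f"
  have "smooth_on (\<phi> ` U) (f \<circ> iv U \<phi>)" if U: "(U, \<phi>) \<in> A" for U \<phi>
  proof (rule smooth_on_locally)
    fix z assume "z \<in> \<phi> ` U"
    then obtain q where q: "q \<in> U" "z = \<phi> q" by auto
    then have "q \<in> carrier_of A" using U in_carrierI by metis
    then have "sm_at U \<phi> q f" using f smooth_near_iff[OF chart_mchart[OF U] q(1)] by blast
    then show "\<exists>T. open T \<and> z \<in> T \<and> smooth_on T (f \<circ> iv U \<phi>)" using q by (auto simp: sm_at_def)
  qed
  then show "smooth_fun A f" by (auto simp: smooth_fun_def)
qed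

lemma smooth_near_carrier: "smooth_near A p f \<Longrightarrow> p \<in> carrier_of A"
  by (auto simp: smooth_near_def mopen_def)

lemma smooth_near_cong:
  assumes "mopen A W" "p \<in> W" "\<And>q. q \<in> W \<Longrightarrow> f q = g q" "smooth_near A p f"
  shows "smooth_near A p g"
proof -
  obtain U \<phi> where U: "(U, \<phi>) \<in> A" "p \<in> U" using smooth_near_carrier[OF assms(4)] carrier_chart by blast
  note m = chart_mchart[OF U(1)]
  obtain T where T: "open T" "\<phi> p \<in> T" "T \<subseteq> \<phi> ` U" "smooth_on T (f \<circ> iv U \<phi>)"
    using assms(4) smooth_near_iff[OF m U(2)] by (auto simp: sm_at_def)
  let ?T = "T \<inter> \<phi> ` (U \<inter> W)"
  have "open ?T" by (intro open_Int T mopen_mchart[OF assms(1) m])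
  moreover have "smooth_on ?T (g \<circ> iv U \<phi>)"
    using smooth_on_subset[OF T(4), of ?T] assms(3) mchart_inj[OF m]
    by (subst smooth_on_cong[OF \<open>open ?T\<close>, of _ "f \<circ> iv U \<phi>"]) (auto simp: iv_simps)
  ultimately have "sm_at U \<phi> p g" using T U assms(2) unfolding sm_at_def by (intro exI[of _ ?T]) auto
  with smooth_near_iff[OF m U(2)] show ?thesis by blast
qed

lemma sm_at_lift2:
  assumes "sm_at U \<phi> p f" "sm_at U \<phi> p g"
    "\<And>(S :: 'e set) f' g'. open S \<Longrightarrow> smooth_on S f' \<Longrightarrow> smooth_on S g' \<Longrightarrow> smooth_on S (\<lambda>x. h (f' x) (g' x))"
  shows "sm_at U \<phi> p (\<lambda>q. h (f q) (g q))"
proof -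
  obtain T where T: "open T" "\<phi> p \<in> T" "T \<subseteq> \<phi> ` U" "smooth_on T (f \<circ> iv U \<phi>)" using assms(1) by (auto simp: sm_at_def)
  obtain R where R: "open R" "\<phi> p \<in> R" "R \<subseteq> \<phi> ` U" "smooth_on R (g \<circ> iv U \<phi>)" using assms(2) by (auto simp: sm_at_def)
  have "smooth_on (T \<inter> R) (\<lambda>x. h ((f \<circ> iv U \<phi>) x) ((g \<circ> iv U \<phi>) x))"
  proof (rule assms(3))
    show "smooth_on (T \<inter> R) (f \<circ> iv U \<phi>)" by (rule smooth_on_subset[OF T(4)]) simp
    show "smooth_on (T \<inter> R) (g \<circ> iv U \<phi>)" by (rule smooth_on_subset[OF R(4)]) simp
  qed (intro open_Int T R)
  then show ?thesis unfolding sm_at_def using T R by (intro exI[of _ "T \<inter> R"]) (auto simp: o_def)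
qed

lemma smooth_near_add: "smooth_near A p f \<Longrightarrow> smooth_near A p g \<Longrightarrow> smooth_near A p (\<lambda>q. f q + g q)"
  and smooth_near_mult: "smooth_near A p f \<Longrightarrow> smooth_near A p g \<Longrightarrow> smooth_near A p (\<lambda>q. f q * g q)"
proof -
  assume fg: "smooth_near A p f" "smooth_near A p g"
  obtain U \<phi> where U: "(U, \<phi>) \<in> A" "p \<in> U" using smooth_near_carrier[OF fg(1)] carrier_chart by blast
  note i = smooth_near_iff[OF chart_mchart[OF U(1)] U(2)]
  show "smooth_near A p (\<lambda>q. f q + g q)" "smooth_near A p (\<lambda>q. f q * g q)"
    using sm_at_lift2[of U \<phi> p f g "(+)", OF _ _ smooth_on_add] sm_at_lift2[of U \<phi> p f g "(*)", OF _ _ smooth_on_mult] fg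
    unfolding i by blast+
qed

lemma smooth_near_const: "p \<in> carrier_of A \<Longrightarrow> smooth_near A p (\<lambda>q. c)"
proof -
  assume "p \<in> carrier_of A"
  then obtain U \<phi> where U: "(U, \<phi>) \<in> A" "p \<in> U" using carrier_chart by blast
  have "sm_at U \<phi> p (\<lambda>q. c)" using U charts by (auto simp: sm_at_def o_def smooth_on_const)
  with smooth_near_iff[OF chart_mchart[OF U(1)] U(2)] show ?thesis by blast
qed

lemma smooth_near_chart:
  assumes "mchart U \<phi>" "p \<in> U" "open T" "\<phi> p \<in> T" "smooth_on T h"
  shows "smooth_near A p (\<lambda>q. h (\<phi> q))"
proof -
  let ?T = "T \<inter> \<phi> ` U"
  have o: "open ?T" using assms mchart_open by auto
  have "smooth_on ?T ((\<lambda>q. h (\<phi> q)) \<circ> iv U \<phi>)"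
    using smooth_on_subset[OF assms(5), of ?T] mchart_inj[OF assms(1)]
    by (subst smooth_on_cong[OF o, of _ h]) (auto simp: iv_simps)
  then have "sm_at U \<phi> p (\<lambda>q. h (\<phi> q))" using o assms unfolding sm_at_def by (intro exI[of _ ?T]) auto
  with smooth_near_iff[OF assms(1,2)] show ?thesis by blast
qed

lemma smooth_near_coord: "mchart U \<phi> \<Longrightarrow> p \<in> U \<Longrightarrow> smooth_near A p (\<lambda>q. \<phi> q \<bullet> w)"
  by (rule smooth_near_chart[of U \<phi> p UNIV "\<lambda>z. z \<bullet> w"]) (auto intro: smooth_on_linear bounded_linear_inner_left)

lemma smooth_near_differentiable:
  "mchart U \<phi> \<Longrightarrow> p \<in> U \<Longrightarrow> smooth_near A p f \<Longrightarrow> (f \<circ> iv U \<phi>) differentiable (at (\<phi> p))"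
  using smooth_near_iff[of U \<phi> p f] smooth_on_differentiable by (auto simp: sm_at_def)

section \<open>Tangent vectors in coordinates\<close>

definition tvec :: "'a set \<Rightarrow> ('a \<Rightarrow> 'e) \<Rightarrow> 'a \<Rightarrow> 'e \<Rightarrow> ('a \<Rightarrow> real) \<Rightarrow> real"
  where "tvec U \<phi> p \<xi> f = (if smooth_near A p f then fd (f \<circ> iv U \<phi>) (\<phi> p) \<xi> else 0)"

lemma smooth_near_linear: "smooth_near A p f \<Longrightarrow> smooth_near A p g \<Longrightarrow> smooth_near A p (f + c *\<^sub>R g)"
  using smooth_near_add[of p f "\<lambda>q. c * g q"] smooth_near_mult[OF smooth_near_const, of p g c] smooth_near_carrier
  by (auto simp: plus_fun_def scaleR_fun_def)

lemma smooth_near_times: "smooth_near A p f \<Longrightarrow> smooth_near A p g \<Longrightarrow> smooth_near A p (f * g)"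
  using smooth_near_mult by (simp add: times_fun_def)

lemma tangentD:
  assumes "v \<in> tangent_space A p"
  shows "\<not> smooth_near A p f \<Longrightarrow> v f = 0"
    "smooth_near A p f \<Longrightarrow> smooth_near A p g \<Longrightarrow> v (f + c *\<^sub>R g) = v f + c * v g"
    "smooth_near A p f \<Longrightarrow> smooth_near A p g \<Longrightarrow> v (f * g) = f p * v g + g p * v f"
  using assms by (auto simp: tangent_space_def)

lemma tangent_zero:
  assumes "v \<in> tangent_space A p"
  shows "v 0 = 0"
proof (cases "smooth_near A p 0")
  case True
  with tangentD(2)[OF assms True True, of 1] show ?thesis by simp
qed (simp add: tangentD(1)[OF assms])

lemma tangent_local:
  assumes v: "v \<in> tangent_space A p" and W: "mopen A W" "p \<in> W" and eq: "\<And>q. q \<in> W \<Longrightarrow> f q = g q"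
  shows "v f = v g"
proof (cases "smooth_near A p f")
  case f: True
  have g: "smooth_near A p g" by (rule smooth_near_cong[OF W eq f])
  define h where "h = f + (- 1) *\<^sub>R g"
  \<comment> \<open>An indicator function can serve as cut-off, because functions are only asked to
    be smooth near \<open>p\<close>. Both \<open>b\<close> and \<open>h\<close> vanish at
    \<open>p\<close>, so the product rule kills \<open>b * h\<close>, which equals
    \<open>h\<close>.\<close>
  define b :: "'a \<Rightarrow> real" where "b = (\<lambda>q. if q \<in> W then 0 else 1)"
  have h: "smooth_near A p h" unfolding h_def by (rule smooth_near_linear[OF f g])
  have "p \<in> carrier_of A" using mopenD(2)[OF W(1)] W(2) by blast
  then have b: "smooth_near A p b" by (intro smooth_near_cong[OF W _ smooth_near_const[of p 0]]) (auto simp: b_def)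
  have "b * h = h" using eq by (auto simp: fun_eq_iff b_def h_def scaleR_fun_def)
  then have "v h = b p * v h + h p * v b" using tangentD(3)[OF v b h] by simp
  then have "v h = 0" using W eq by (simp add: b_def h_def scaleR_fun_def)
  then show ?thesis using tangentD(2)[OF v f g, of "- 1"] by (simp add: h_def)
next
  case False
  then have "\<not> smooth_near A p g" using smooth_near_cong[OF W, of g f] eq by auto
  with False show ?thesis by (simp add: tangentD(1)[OF v])
qed

lemma tangent_const:
  assumes v: "v \<in> tangent_space A p" and p: "p \<in> carrier_of A"
  shows "v (\<lambda>q. c) = 0"
proof -
  note 1 = smooth_near_const[OF p, of 1] and 0 = smooth_near_const[OF p, of 0]
  have eq: "(\<lambda>q. 1 :: real) * (\<lambda>q. 1) = (\<lambda>q. 1)" by (simp add: fun_eq_iff)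
  have "v (\<lambda>q. 1) = 0" using tangentD(3)[OF v 1 1, unfolded eq] by simp
  have cc: "0 + c *\<^sub>R (\<lambda>q. 1) = (\<lambda>q. c)" by (simp add: fun_eq_iff scaleR_fun_def)
  have "v (0 + c *\<^sub>R (\<lambda>q. 1)) = v 0 + c * v (\<lambda>q. 1)"
    using 0 1 by (intro tangentD(2)[OF v]) (simp_all add: zero_fun_def)
  then show ?thesis unfolding cc using \<open>v (\<lambda>q. 1) = 0\<close> tangent_zero[OF v] by simp
qed

lemma smooth_near_sum:
  "p \<in> carrier_of A \<Longrightarrow> (\<And>i. i \<in> I \<Longrightarrow> smooth_near A p (f i)) \<Longrightarrow> smooth_near A p (\<Sum>i\<in>I. f i)"
proof (induction I rule: infinite_finite_induct)
  case (insert i I)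
  have "smooth_near A p ((\<Sum>i\<in>I. f i) + 1 *\<^sub>R f i)" by (rule smooth_near_linear) (use insert in auto)
  then show ?case unfolding sum.insert[OF insert(1,2)] by (simp only: scaleR_one add.commute)
qed (simp_all add: zero_fun_def smooth_near_const)

lemma tangent_sum:
  assumes v: "v \<in> tangent_space A p" and p: "p \<in> carrier_of A"
  shows "(\<And>i. i \<in> I \<Longrightarrow> smooth_near A p (f i)) \<Longrightarrow> v (\<Sum>i\<in>I. f i) = (\<Sum>i\<in>I. v (f i))"
proof (induction I rule: infinite_finite_induct)
  case (insert i I)
  have "v ((\<Sum>i\<in>I. f i) + 1 *\<^sub>R f i) = v (\<Sum>i\<in>I. f i) + 1 * v (f i)"
    using insert.prems smooth_near_sum[OF p, of I f] by (intro tangentD(2)[OF v]) auto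
  with insert show ?case unfolding sum.insert[OF insert(1,2)]
    by (simp only: scaleR_one add.commute insert_iff simp_thms mult_1)
qed (simp_all add: tangent_zero[OF v])

lemma nbhd_of_chart:
  assumes "mchart U \<phi>" "p \<in> U" "open T" "\<phi> p \<in> T"
  obtains W where "mopen A W" "p \<in> W" "W \<subseteq> U" "\<And>q. q \<in> W \<Longrightarrow> \<phi> q \<in> T"
proof
  let ?T = "T \<inter> \<phi> ` U"
  note inj = mchart_inj[OF assms(1)]
  show "mopen A (iv U \<phi> ` ?T)" using assms mchart_open by (intro mopen_iv_image) auto
  show "p \<in> iv U \<phi> ` ?T" using assms inj by (auto simp: image_iff iv_simps intro!: bexI[of _ "\<phi> p"])
  show "iv U \<phi> ` ?T \<subseteq> U" using inj by (auto simp: iv_simps)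
  show "\<phi> q \<in> T" if "q \<in> iv U \<phi> ` ?T" for q using that inj by (auto simp: iv_simps)
qed

lemma tvec_eval:
  assumes U: "mchart U \<phi>" "p \<in> U" and T: "open T" "\<phi> p \<in> T" and h: "smooth_on T h"
  shows "tvec U \<phi> p \<xi> (\<lambda>q. h (\<phi> q)) = fd h (\<phi> p) \<xi>"
proof -
  have "fd ((\<lambda>q. h (\<phi> q)) \<circ> iv U \<phi>) (\<phi> p) = fd h (\<phi> p)"
  proof (rule sym, rule frechet_derivative_transform_within_open)
    show "h differentiable at (\<phi> p)" by (rule smooth_on_differentiable[OF h T(2)])
    show "open (\<phi> ` U)" by (rule mchart_open[OF U(1)])
  qed (use U mchart_inj[OF U(1)] in \<open>auto simp: iv_simps\<close>)
  with smooth_near_chart[OF U T h] show ?thesis by (simp add: tvec_def)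
qed

lemma tvec_coord:
  assumes "mchart U \<phi>" "p \<in> U"
  shows "tvec U \<phi> p \<xi> (\<lambda>q. \<phi> q \<bullet> w) = \<xi> \<bullet> w"
proof -
  have "fd (\<lambda>z. z \<bullet> w) (\<phi> p) = (\<lambda>z. z \<bullet> w)"
    by (intro fd_eqI bounded_linear_imp_has_derivative bounded_linear_inner_left)
  then show ?thesis
    using tvec_eval[OF assms, of UNIV "\<lambda>z. z \<bullet> w" \<xi>] by (simp add: smooth_on_linear bounded_linear_inner_left)
qed

lemma tvec_add_scale:
  assumes "mchart U \<phi>" "p \<in> U"
  shows "tvec U \<phi> p (\<xi> + c *\<^sub>R \<eta>) = tvec U \<phi> p \<xi> + c *\<^sub>R tvec U \<phi> p \<eta>"
proof
  fix f
  show "tvec U \<phi> p (\<xi> + c *\<^sub>R \<eta>) f = (tvec U \<phi> p \<xi> + c *\<^sub>R tvec U \<phi> p \<eta>) f"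
  proof (cases "smooth_near A p f")
    case True
    have "linear (fd (f \<circ> iv U \<phi>) (\<phi> p))" by (intro fd_linear smooth_near_differentiable assms True)
    with True show ?thesis by (simp add: tvec_def scaleR_fun_def linear_add linear_scale)
  qed (simp add: tvec_def scaleR_fun_def)
qed

lemma tvec_0: "mchart U \<phi> \<Longrightarrow> p \<in> U \<Longrightarrow> tvec U \<phi> p 0 = 0"
  using tvec_add_scale[of U \<phi> p 0 1 0] by simp

lemma tvec_inject:
  assumes "mchart U \<phi>" "p \<in> U" "tvec U \<phi> p \<xi> = tvec U \<phi> p \<eta>"
  shows "\<xi> = \<eta>"
proof -
  have "\<xi> \<bullet> w = \<eta> \<bullet> w" for w using tvec_coord[OF assms(1,2)] assms(3) by metis
  then have "(\<xi> - \<eta>) \<bullet> (\<xi> - \<eta>) = 0" by (simp add: inner_diff_left)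
  then show ?thesis by simp
qed

lemma tvec_tangent:
  assumes U: "mchart U \<phi>" "p \<in> U"
  shows "tvec U \<phi> p \<xi> \<in> tangent_space A p"
  unfolding tangent_space_def
proof (intro CollectI conjI allI impI; (elim conjE)?)
  fix f assume "\<not> smooth_near A p f"
  then show "tvec U \<phi> p \<xi> f = 0" by (simp add: tvec_def)
next
  fix f g :: "'a \<Rightarrow> real" and c assume fg: "smooth_near A p f" "smooth_near A p g"
  let ?f = "f \<circ> iv U \<phi>" and ?g = "g \<circ> iv U \<phi>"
  have d: "(?f has_derivative fd ?f (\<phi> p)) (at (\<phi> p))" "(?g has_derivative fd ?g (\<phi> p)) (at (\<phi> p))"
    by (intro fd_has_derivative smooth_near_differentiable U fg)+
  have p: "iv U \<phi> (\<phi> p) = p" using U mchart_inj by (simp add: iv_simps)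
  have "(f + c *\<^sub>R g) \<circ> iv U \<phi> = (\<lambda>z. ?f z + c * ?g z)" "(f * g) \<circ> iv U \<phi> = (\<lambda>z. ?f z * ?g z)"
    by (simp_all add: fun_eq_iff scaleR_fun_def)
  moreover have "fd (\<lambda>z. ?f z + c * ?g z) (\<phi> p) = (\<lambda>\<xi>. fd ?f (\<phi> p) \<xi> + c * fd ?g (\<phi> p) \<xi>)"
    by (intro fd_eqI has_derivative_add d has_derivative_mult_right)
  moreover have "fd (\<lambda>z. ?f z * ?g z) (\<phi> p) = (\<lambda>\<xi>. ?f (\<phi> p) * fd ?g (\<phi> p) \<xi> + fd ?f (\<phi> p) \<xi> * ?g (\<phi> p))"
    by (intro fd_eqI has_derivative_mult d)
  ultimately show "tvec U \<phi> p \<xi> (f + c *\<^sub>R g) = tvec U \<phi> p \<xi> f + c * tvec U \<phi> p \<xi> g"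
    "tvec U \<phi> p \<xi> (f * g) = f p * tvec U \<phi> p \<xi> g + g p * tvec U \<phi> p \<xi> f"
    using fg smooth_near_linear[OF fg, of c] smooth_near_times[OF fg] p by (simp_all add: tvec_def)
qed

lemma ball_in_chart:
  assumes "sm_at U \<phi> p f"
  obtains r where "r > 0" "ball (\<phi> p) r \<subseteq> \<phi> ` U" "smooth_on (ball (\<phi> p) r) (f \<circ> iv U \<phi>)"
proof -
  obtain T where T: "open T" "\<phi> p \<in> T" "T \<subseteq> \<phi> ` U" "smooth_on T (f \<circ> iv U \<phi>)" using assms by (auto simp: sm_at_def)
  then obtain r where "r > 0" "ball (\<phi> p) r \<subseteq> T" using open_contains_ball by blast
  with that T smooth_on_subset show ?thesis by blast
qed

text \<open>By Hadamard's lemma \<open>f\<close> is near \<open>p\<close> a constant plus a sum of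
  products \<open>d e * G e\<close> with \<open>d e p = 0\<close>. The product rule then leaves only
  the values of \<open>v\<close> on the coordinates.\<close>

lemma tangent_eq_tvec:
  assumes v: "v \<in> tangent_space A p" and U: "mchart U \<phi>" "p \<in> U"
  shows "v = tvec U \<phi> p (\<Sum>e\<in>onb. v (\<lambda>q. \<phi> q \<bullet> e) *\<^sub>R e)"
proof
  fix f
  define \<xi> where "\<xi> = (\<Sum>e\<in>onb. v (\<lambda>q. \<phi> q \<bullet> e) *\<^sub>R e)"
  show "v f = tvec U \<phi> p \<xi> f"
  proof (cases "smooth_near A p f")
    case f: True
    have pc: "p \<in> carrier_of A" by (rule smooth_near_carrier[OF f])
    have inj: "inj_on \<phi> U" by (rule mchart_inj[OF U(1)])
    have "sm_at U \<phi> p f" using f smooth_near_iff[OF U] by blast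
    then obtain r where r: "r > 0" "ball (\<phi> p) r \<subseteq> \<phi> ` U" "smooth_on (ball (\<phi> p) r) (f \<circ> iv U \<phi>)"
      by (rule ball_in_chart)
    obtain g where g: "\<And>e. smooth_on (ball (\<phi> p) r) (g e)" "\<And>e. g e (\<phi> p) = fd (f \<circ> iv U \<phi>) (\<phi> p) e"
      "\<And>x. x \<in> ball (\<phi> p) r \<Longrightarrow> (f \<circ> iv U \<phi>) x = (f \<circ> iv U \<phi>) (\<phi> p) + (\<Sum>e\<in>onb. ((x - \<phi> p) \<bullet> e) * g e x)"
      using hadamard[OF r(3,1)] by blast
    have "\<phi> p \<in> ball (\<phi> p) r" using r(1) by simp
    from nbhd_of_chart[OF U open_ball this] obtain W
      where W: "mopen A W" "p \<in> W" "W \<subseteq> U" "\<And>q. q \<in> W \<Longrightarrow> \<phi> q \<in> ball (\<phi> p) r" by metis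
    define c where "c = (\<lambda>e q. \<phi> q \<bullet> e)"
    define d where "d = (\<lambda>e. c e + (- 1) *\<^sub>R (\<lambda>q. c e p))"
    define G where "G = (\<lambda>e q. g e (\<phi> q))"
    have sc: "smooth_near A p (c e)" for e unfolding c_def by (rule smooth_near_coord[OF U])
    have sd: "smooth_near A p (d e)" for e unfolding d_def by (intro smooth_near_linear sc smooth_near_const pc)
    have sG: "smooth_near A p (G e)" for e
      unfolding G_def by (rule smooth_near_chart[OF U open_ball _ g(1)]) (use r in simp)
    define R where "R = (\<lambda>q. f p) + 1 *\<^sub>R (\<Sum>e\<in>onb. d e * G e)"
    have "f q = R q" if "q \<in> W" for q using g(3)[OF W(4)[OF that]] that W(3) U(2) inj
      by (simp add: R_def sum_fun_apply d_def c_def G_def iv_simps subset_iff scaleR_fun_def inner_diff_left)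
    then have "v f = v R" by (rule tangent_local[OF v W(1,2)])
    also have "\<dots> = v (\<lambda>q. f p) + 1 * v (\<Sum>e\<in>onb. d e * G e)"
      unfolding R_def by (intro tangentD(2)[OF v] smooth_near_const pc smooth_near_sum smooth_near_times sd sG)
    also have "\<dots> = (\<Sum>e\<in>onb. v (d e * G e))"
      using tangent_sum[OF v pc, of onb "\<lambda>e. d e * G e"] by (simp add: tangent_const[OF v pc] smooth_near_times sd sG)
    also have "\<dots> = (\<Sum>e\<in>onb. v (c e) * fd (f \<circ> iv U \<phi>) (\<phi> p) e)"
    proof (rule sum.cong[OF refl])
      fix e :: 'e
      have "v (d e) = v (c e)"
        unfolding d_def using tangentD(2)[OF v sc smooth_near_const[OF pc], of e "- 1"] tangent_const[OF v pc] by simp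
      moreover have "d e p = 0" by (simp add: d_def scaleR_fun_def)
      ultimately show "v (d e * G e) = v (c e) * fd (f \<circ> iv U \<phi>) (\<phi> p) e"
        using tangentD(3)[OF v sd sG, of e e] g(2) by (simp add: G_def)
    qed
    also have "\<dots> = fd (f \<circ> iv U \<phi>) (\<phi> p) \<xi>"
    proof -
      have "linear (fd (f \<circ> iv U \<phi>) (\<phi> p))" by (intro fd_linear smooth_near_differentiable U f)
      then show ?thesis by (simp add: \<xi>_def linear_sum linear_scale c_def)
    qed
    finally show ?thesis using f by (simp add: tvec_def)
  qed (simp add: tvec_def tangentD(1)[OF v])
qed

lemma tangent_tvecE:
  assumes "v \<in> tangent_space A p" "mchart U \<phi>" "p \<in> U"
  obtains \<xi> where "v = tvec U \<phi> p \<xi>" using tangent_eq_tvec[OF assms] that by blast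

lemma tangent_subspace: "p \<in> carrier_of A \<Longrightarrow> subspace (tangent_space A p)"
proof -
  assume "p \<in> carrier_of A"
  then obtain U \<phi> where "(U, \<phi>) \<in> A" and p: "p \<in> U" using carrier_chart by blast
  then have U: "mchart U \<phi>" by (simp add: chart_mchart)
  have *: "v + c *\<^sub>R w \<in> tangent_space A p" if vw: "v \<in> tangent_space A p" "w \<in> tangent_space A p" for v w c
  proof -
    obtain \<xi> \<eta> where "v = tvec U \<phi> p \<xi>" "w = tvec U \<phi> p \<eta>"
      using tangent_tvecE[OF vw(1) U p] tangent_tvecE[OF vw(2) U p] by metis
    then show ?thesis using tvec_tangent[OF U p, of "\<xi> + c *\<^sub>R \<eta>"] by (simp add: tvec_add_scale[OF U p])
  qed
  have 0: "0 \<in> tangent_space A p" using tvec_tangent[OF U p, of 0] tvec_0[OF U p] by simp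
  show ?thesis by (rule subspaceI) (use 0 *[of _ _ 1] *[OF 0] in auto)
qed

lemma transition_smooth:
  assumes "mchart U \<phi>" "mchart V \<theta>"
  shows "open (\<phi> ` (U \<inter> V))" "smooth_on (\<phi> ` (U \<inter> V)) (\<theta> \<circ> iv U \<phi>)"
  using compatibleD[OF mchart_compatible[OF assms]] by auto

lemma tvec_change:
  assumes U: "mchart U \<phi>" "p \<in> U" and V: "mchart V \<theta>" "p \<in> V"
  shows "tvec U \<phi> p \<xi> = tvec V \<theta> p (fd (\<theta> \<circ> iv U \<phi>) (\<phi> p) \<xi>)"
proof
  fix f
  note t = transition_smooth[OF U(1) V(1)] and inj = mchart_inj[OF U(1)] mchart_inj[OF V(1)]
  show "tvec U \<phi> p \<xi> f = tvec V \<theta> p (fd (\<theta> \<circ> iv U \<phi>) (\<phi> p) \<xi>) f"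
  proof (cases "smooth_near A p f")
    case True
    have p: "(\<theta> \<circ> iv U \<phi>) (\<phi> p) = \<theta> p" using U inj by (simp add: iv_simps)
    have d: "(\<theta> \<circ> iv U \<phi>) differentiable at (\<phi> p)"
      using U V by (intro smooth_on_differentiable[OF t(2)]) auto
    have d': "(f \<circ> iv V \<theta>) differentiable at ((\<theta> \<circ> iv U \<phi>) (\<phi> p))"
      unfolding p by (rule smooth_near_differentiable[OF V True])
    have "fd (f \<circ> iv U \<phi>) (\<phi> p) = fd (\<lambda>z. (f \<circ> iv V \<theta>) ((\<theta> \<circ> iv U \<phi>) z)) (\<phi> p)"
      by (rule frechet_derivative_transform_within_open[OF smooth_near_differentiable[OF U True] t(1)])
         (use U V inj in \<open>auto simp: iv_simps\<close>)
    also have "\<dots> = (\<lambda>\<xi>. fd (f \<circ> iv V \<theta>) (\<theta> p) (fd (\<theta> \<circ> iv U \<phi>) (\<phi> p) \<xi>))"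
      unfolding fd_compose[OF d d'] p ..
    finally show ?thesis using True by (simp add: tvec_def)
  qed (simp add: tvec_def)
qed

end

lemma smooth_on_cong_imp: "open S \<Longrightarrow> smooth_on S f \<Longrightarrow> (\<And>x. x \<in> S \<Longrightarrow> f x = g x) \<Longrightarrow> smooth_on S g"
  using smooth_on_cong[of S f g] by simp

context pre_manifold
begin

lemma smooth_functionsI:
  "(\<And>p. p \<in> carrier_of A \<Longrightarrow> smooth_near A p f) \<Longrightarrow> (\<And>x. x \<notin> carrier_of A \<Longrightarrow> f x = 0) \<Longrightarrow> f \<in> smooth_functions A"
  by (auto simp: smooth_functions_def smooth_fun_iff)

lemma smooth_functionsD:
  "f \<in> smooth_functions A \<Longrightarrow> p \<in> carrier_of A \<Longrightarrow> smooth_near A p f"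
  "f \<in> smooth_functions A \<Longrightarrow> x \<notin> carrier_of A \<Longrightarrow> f x = 0"
  by (auto simp: smooth_functions_def smooth_fun_iff)

sublocale fa: function_algebra "smooth_functions A"
proof
  have lin: "f + c *\<^sub>R g \<in> smooth_functions A" if fg: "f \<in> smooth_functions A" "g \<in> smooth_functions A" for f g c
  proof (rule smooth_functionsI)
    fix p assume "p \<in> carrier_of A"
    then show "smooth_near A p (f + c *\<^sub>R g)" by (intro smooth_near_linear smooth_functionsD(1) fg)
  qed (simp add: scaleR_fun_def smooth_functionsD(2)[OF fg(1)] smooth_functionsD(2)[OF fg(2)])
  have 0: "0 \<in> smooth_functions A" by (rule smooth_functionsI) (auto simp: zero_fun_def smooth_near_const)
  show "subspace (smooth_functions A)" by (rule subspaceI) (use 0 lin[of _ _ 1] lin[OF 0] in auto)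
  fix f g assume fg: "f \<in> smooth_functions A" "g \<in> smooth_functions A"
  show "f * g \<in> smooth_functions A"
  proof (rule smooth_functionsI)
    fix p assume "p \<in> carrier_of A"
    then show "smooth_near A p (f * g)" by (intro smooth_near_times smooth_functionsD(1) fg)
  qed (simp add: smooth_functionsD(2)[OF fg(1)])
qed

end

section \<open>Submanifolds\<close>

locale submanifold = pre_manifold A
  for A :: "('a, 'c::finite_dim_inner \<times> 'f::finite_dim_inner) atlas" +
  fixes C :: "'a set"
  assumes embedded: "embedded_submanifold A C"
begin

abbreviation slice :: "'a set \<Rightarrow> ('a \<Rightarrow> 'c \<times> 'f) \<Rightarrow> bool"
  where "slice U \<phi> \<equiv> (U, \<phi>) \<in> slice_charts A C"

lemma slice_mchart: "slice U \<phi> \<Longrightarrow> mchart U \<phi>"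
  by (simp add: slice_charts_def)

lemma slice_iff: "slice U \<phi> \<Longrightarrow> q \<in> U \<Longrightarrow> q \<in> C \<longleftrightarrow> snd (\<phi> q) = 0"
  by (auto simp: slice_charts_def)

lemma slice_exists: "p \<in> C \<Longrightarrow> \<exists>U \<phi>. slice U \<phi> \<and> p \<in> U"
  using embedded by (force simp: embedded_submanifold_def carrier_of_def)

lemma C_carrier: "C \<subseteq> carrier_of A"
  using slice_exists slice_mchart mchart_carrier by blast

lemma slice_chart_zero: "slice U \<phi> \<Longrightarrow> p \<in> U \<Longrightarrow> p \<in> C \<Longrightarrow> \<phi> p = (fst (\<phi> p), 0)"
  using slice_iff by (simp add: prod_eq_iff)

lemma sub_chart_image: "slice U \<phi> \<Longrightarrow> V \<subseteq> U \<Longrightarrow> (fst \<circ> \<phi>) ` (V \<inter> C) = {x. (x, 0) \<in> \<phi> ` V}"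
proof (intro set_eqI iffI)
  fix x assume a: "slice U \<phi>" "V \<subseteq> U" "x \<in> {x. (x, 0) \<in> \<phi> ` V}"
  then obtain q where "q \<in> V" "(x, 0) = \<phi> q" by auto
  then show "x \<in> (fst \<circ> \<phi>) ` (V \<inter> C)"
    using a slice_iff[of U \<phi> q] by (intro image_eqI[of _ _ q]) (auto simp: prod_eq_iff)
next
  fix x assume a: "slice U \<phi>" "V \<subseteq> U" "x \<in> (fst \<circ> \<phi>) ` (V \<inter> C)"
  then obtain q where q: "q \<in> V" "q \<in> C" "x = fst (\<phi> q)" by auto
  then have "(x, 0) = \<phi> q" using slice_chart_zero[OF a(1), of q] a(2) by auto
  then show "x \<in> {x. (x, 0) \<in> \<phi> ` V}" using q by blast
qed

lemma sub_chart_inj: "slice U \<phi> \<Longrightarrow> inj_on (fst \<circ> \<phi>) (U \<inter> C)"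
proof (rule inj_onI)
  fix p q assume a: "slice U \<phi>" "p \<in> U \<inter> C" "q \<in> U \<inter> C" "(fst \<circ> \<phi>) p = (fst \<circ> \<phi>) q"
  then have "\<phi> p = \<phi> q" using slice_chart_zero[of U \<phi> p] slice_chart_zero[of U \<phi> q] by (simp add: prod_eq_iff)
  then show "p = q" using a mchart_inj[OF slice_mchart[OF a(1)]] by (auto dest: inj_onD)
qed

lemma sub_iv:
  assumes "slice U \<phi>" "x \<in> (fst \<circ> \<phi>) ` (U \<inter> C)"
  shows "iv (U \<inter> C) (fst \<circ> \<phi>) x = iv U \<phi> (x, 0)"
proof -
  obtain q where q: "q \<in> U" "q \<in> C" "x = fst (\<phi> q)" using assms(2) by auto
  have "iv (U \<inter> C) (fst \<circ> \<phi>) x = q" using iv_simps(1)[OF sub_chart_inj[OF assms(1)], of q] q by simp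
  moreover have "(x, 0) = \<phi> q" using slice_chart_zero[OF assms(1)] q by simp
  ultimately show ?thesis using mchart_inj[OF slice_mchart[OF assms(1)]] q by (simp add: iv_simps)
qed

lemma bounded_linear_pair0: "bounded_linear (\<lambda>x :: 'c. (x, 0 :: 'f))"
  by (intro bounded_linear_Pair bounded_linear_ident bounded_linear_zero)

lemma open_slice: "open (T :: ('c \<times> 'f) set) \<Longrightarrow> open {x. (x, 0) \<in> T}"
proof -
  assume "open T"
  moreover have "{x. (x, 0) \<in> T} = (\<lambda>x. (x, 0)) -` T" by auto
  ultimately show ?thesis using open_vimage[OF _ linear_continuous_on[OF bounded_linear_pair0]] by simp
qed

lemma smooth_on_slice:
  fixes T :: "('c \<times> 'f) set"
  assumes "open T" "smooth_on T h"
  shows "smooth_on {x. (x, 0) \<in> T} (\<lambda>x. h (x, 0))"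
  by (rule smooth_on_compose[OF open_slice[OF assms(1)] assms(1) _ smooth_on_linear[OF bounded_linear_pair0] assms(2)]) auto

lemma pre_manifold_sub: "pre_manifold (sub_atlas A C)"
proof
  fix U' \<phi>' assume "(U', \<phi>') \<in> sub_atlas A C"
  then obtain U \<phi> where 1: "slice U \<phi>" "U' = U \<inter> C" "\<phi>' = fst \<circ> \<phi>" by (auto simp: sub_atlas_def)
  show "inj_on \<phi>' U' \<and> open (\<phi>' ` U')" unfolding 1(2,3) sub_chart_image[OF 1(1) order_refl]
    using sub_chart_inj[OF 1(1)] open_slice[OF mchart_open[OF slice_mchart[OF 1(1)]]] by simp
next
  have *: "open (\<phi>' ` (U' \<inter> V')) \<and> smooth_on (\<phi>' ` (U' \<inter> V')) (\<theta>' \<circ> iv U' \<phi>')"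
    if s: "(U', \<phi>') \<in> sub_atlas A C" "(V', \<theta>') \<in> sub_atlas A C" for U' V' \<phi>' \<theta>'
  proof -
    obtain U \<phi> where 1: "slice U \<phi>" "U' = U \<inter> C" "\<phi>' = fst \<circ> \<phi>" using s(1) by (auto simp: sub_atlas_def)
    obtain V \<theta> where 2: "slice V \<theta>" "V' = V \<inter> C" "\<theta>' = fst \<circ> \<theta>" using s(2) by (auto simp: sub_atlas_def)
    note t = transition_smooth[OF slice_mchart[OF 1(1)] slice_mchart[OF 2(1)]]
    have im: "\<phi>' ` (U' \<inter> V') = {x. (x, 0) \<in> \<phi> ` (U \<inter> V)}"
      using sub_chart_image[OF 1(1), of "U \<inter> V"] 1 2 by (simp add: Int_ac)
    have o: "open (\<phi>' ` (U' \<inter> V'))" unfolding im by (rule open_slice[OF t(1)])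
    have "smooth_on {x. (x, 0) \<in> \<phi> ` (U \<inter> V)} (\<lambda>x. fst ((\<theta> \<circ> iv U \<phi>) (x, 0)))"
      using smooth_on_linear_compose[OF bounded_linear_fst open_slice[OF t(1)] smooth_on_slice[OF t]] .
    then have s: "smooth_on (\<phi>' ` (U' \<inter> V')) (\<lambda>x. fst ((\<theta> \<circ> iv U \<phi>) (x, 0)))" unfolding im .
    have "fst ((\<theta> \<circ> iv U \<phi>) (x, 0)) = (\<theta>' \<circ> iv U' \<phi>') x" if "x \<in> \<phi>' ` (U' \<inter> V')" for x
      using sub_iv[OF 1(1), of x] that 1 2 by auto
    with o smooth_on_cong_imp[OF o s] show ?thesis by blast
  qed
  fix a b assume "a \<in> sub_atlas A C" "b \<in> sub_atlas A C"
  then show "compatible a b" using *[of "fst a" "snd a" "fst b" "snd b"] *[of "fst b" "snd b" "fst a" "snd a"]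
    by (auto simp: compatible_def Int_commute split: prod.splits)
qed

sublocale sub: pre_manifold "sub_atlas A C" by (rule pre_manifold_sub)

lemma sub_carrier: "carrier_of (sub_atlas A C) = C"
proof
  show "C \<subseteq> carrier_of (sub_atlas A C)"
  proof
    fix p assume p: "p \<in> C"
    then obtain U \<phi> where "slice U \<phi>" "p \<in> U" using slice_exists by blast
    then show "p \<in> carrier_of (sub_atlas A C)"
      using p by (intro in_carrierI[of "U \<inter> C" "fst \<circ> \<phi>"]) (auto simp: sub_atlas_def)
  qed
qed (auto simp: carrier_of_def sub_atlas_def)

lemma sub_mchart: "slice U \<phi> \<Longrightarrow> sub.mchart (U \<inter> C) (fst \<circ> \<phi>)"
  by (rule sub.chart_mchart) (auto simp: sub_atlas_def)

lemma sub_smooth_near: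
  assumes U: "slice U \<phi>" "p \<in> U" "p \<in> C" and f: "smooth_near A p f"
  shows "smooth_near (sub_atlas A C) p f"
    "sub.tvec (U \<inter> C) (fst \<circ> \<phi>) p x f = tvec U \<phi> p (x, 0) f"
proof -
  note m = slice_mchart[OF U(1)] and sm = sub_mchart[OF U(1)]
  obtain T where T: "open T" "\<phi> p \<in> T" "T \<subseteq> \<phi> ` U" "smooth_on T (f \<circ> iv U \<phi>)"
    using f smooth_near_iff[OF m U(2)] by (auto simp: sm_at_def)
  define T' where "T' = {x. (x, 0) \<in> T}"
  have T': "open T'" "T' \<subseteq> (fst \<circ> \<phi>) ` (U \<inter> C)"
    using open_slice[OF T(1)] sub_chart_image[OF U(1) order_refl] T(3) by (auto simp: T'_def)
  have "smooth_on T' (\<lambda>x. (f \<circ> iv U \<phi>) (x, 0))" unfolding T'_def by (rule smooth_on_slice[OF T(1,4)])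
  moreover have eq: "(f \<circ> iv (U \<inter> C) (fst \<circ> \<phi>)) x = (f \<circ> iv U \<phi>) (x, 0)" if "x \<in> T'" for x
    using sub_iv[OF U(1), of x] that T'(2) by auto
  ultimately have s: "smooth_on T' (f \<circ> iv (U \<inter> C) (fst \<circ> \<phi>))"
    using smooth_on_cong[OF T'(1), of "f \<circ> iv (U \<inter> C) (fst \<circ> \<phi>)"] by auto
  have p: "(fst \<circ> \<phi>) p \<in> T'" "(fst (\<phi> p), 0) = \<phi> p" using T(2) slice_chart_zero[OF U] by (simp_all add: T'_def)
  then have "sub.sm_at (U \<inter> C) (fst \<circ> \<phi>) p f" using T' s unfolding sub.sm_at_def by blast
  then show n: "smooth_near (sub_atlas A C) p f" using sub.smooth_near_iff[OF sm] U by auto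
  have d: "(f \<circ> iv U \<phi>) differentiable at (fst (\<phi> p), 0)"
    unfolding p(2) by (rule smooth_near_differentiable[OF m U(2) f])
  have "fd (f \<circ> iv (U \<inter> C) (fst \<circ> \<phi>)) ((fst \<circ> \<phi>) p) = fd (\<lambda>x. (f \<circ> iv U \<phi>) (x, 0)) ((fst \<circ> \<phi>) p)"
    by (rule frechet_derivative_transform_within_open[OF smooth_on_differentiable[OF s p(1)] T'(1) p(1) eq])
  also have "\<dots> = (\<lambda>x. fd (f \<circ> iv U \<phi>) (fst (\<phi> p), 0) (x, 0))"
  proof -
    have c: "fd (\<lambda>x. (f \<circ> iv U \<phi>) (x, 0)) (fst (\<phi> p)) =
      (\<lambda>v. fd (f \<circ> iv U \<phi>) (fst (\<phi> p), 0) (fd (\<lambda>x. (x, 0)) (fst (\<phi> p)) v))"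
      by (rule fd_compose[OF bounded_linear_imp_differentiable[OF bounded_linear_pair0] d])
    have l: "fd (\<lambda>x :: 'c. (x, 0 :: 'f)) (fst (\<phi> p)) = (\<lambda>x. (x, 0))"
      by (rule fd_eqI[OF bounded_linear_imp_has_derivative[OF bounded_linear_pair0]])
    show ?thesis by (simp only: c l comp_apply[of fst \<phi> p])
  qed
  finally show "sub.tvec (U \<inter> C) (fst \<circ> \<phi>) p x f = tvec U \<phi> p (x, 0) f"
    using n f p(2) by (simp add: sub.tvec_def tvec_def)
qed

lemma smooth_near_normal_coord: "slice U \<phi> \<Longrightarrow> p \<in> U \<Longrightarrow> smooth_near A p (\<lambda>q. snd (\<phi> q) \<bullet> w)"
  using smooth_near_coord[of U \<phi> p "(0, w)"] slice_mchart by (simp add: inner_prod_def)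

lemma tvec_normal_coord:
  "slice U \<phi> \<Longrightarrow> p \<in> U \<Longrightarrow> tvec U \<phi> p \<xi> (\<lambda>q. snd (\<phi> q) \<bullet> w) = snd \<xi> \<bullet> w"
  using tvec_coord[of U \<phi> p \<xi> "(0, w)"] slice_mchart by (simp add: inner_prod_def)

lemma inner_all_zero: "(\<And>w. x \<bullet> w = 0) \<Longrightarrow> x = (0 :: 'z::real_inner)"
  by (metis inner_eq_zero_iff)

lemma tangent_sub_eq:
  assumes U: "slice U \<phi>" "p \<in> U" "p \<in> C"
  shows "tangent_sub A C p = {tvec U \<phi> p (x, 0) | x. True}"
proof (intro set_eqI iffI)
  note m = slice_mchart[OF U(1)] and sm = sub_mchart[OF U(1)]
  fix v
  {
    assume "v \<in> {tvec U \<phi> p (x, 0) | x. True}"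
    then obtain x where v: "v = tvec U \<phi> p (x, 0)" by blast
    have "sub.tvec (U \<inter> C) (fst \<circ> \<phi>) p x \<in> tangent_space (sub_atlas A C) p"
      using U by (intro sub.tvec_tangent sm) auto
    then show "v \<in> tangent_sub A C p"
      unfolding tangent_sub_def v using tvec_tangent[OF m U(2)] sub_smooth_near(2)[OF U]
      by (auto intro!: bexI[of _ "sub.tvec (U \<inter> C) (fst \<circ> \<phi>) p x"])
  next
    assume "v \<in> tangent_sub A C p"
    then obtain u where v: "v \<in> tangent_space A p" and u: "u \<in> tangent_space (sub_atlas A C) p"
      and vu: "\<And>f. smooth_near A p f \<Longrightarrow> v f = u f" by (auto simp: tangent_sub_def)
    obtain \<xi> where \<xi>: "v = tvec U \<phi> p \<xi>" by (rule tangent_tvecE[OF v m U(2)])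
    have "snd \<xi> \<bullet> w = 0" for w
    proof -
      have "snd \<xi> \<bullet> w = u (\<lambda>q. snd (\<phi> q) \<bullet> w)"
        using vu[OF smooth_near_normal_coord[OF U(1,2)], of w] tvec_normal_coord[OF U(1,2)] \<xi> by simp
      also have "\<dots> = u 0" by (rule sub.tangent_local[OF u sub.mopen_chart[OF sm]]) (use U slice_iff in auto)
      finally show ?thesis using sub.tangent_zero[OF u] by simp
    qed
    then have "snd \<xi> = 0" by (rule inner_all_zero)
    then have "\<xi> = (fst \<xi>, 0)" by (simp add: prod_eq_iff)
    then show "v \<in> {tvec U \<phi> p (x, 0) | x. True}" using \<xi> by (metis (mono_tags, lifting) mem_Collect_eq)
  }
qed

lemma tangent_sub_iff:
  assumes U: "slice U \<phi>" "p \<in> U" "p \<in> C"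
  shows "v \<in> tangent_sub A C p \<longleftrightarrow> v \<in> tangent_space A p \<and> (\<forall>w. v (\<lambda>q. snd (\<phi> q) \<bullet> w) = 0)"
proof
  assume v: "v \<in> tangent_sub A C p"
  then obtain x where "v = tvec U \<phi> p (x, 0)" using tangent_sub_eq[OF U] by blast
  then show "v \<in> tangent_space A p \<and> (\<forall>w. v (\<lambda>q. snd (\<phi> q) \<bullet> w) = 0)"
    using v tvec_normal_coord[OF U(1,2), of "(x, 0)"] by (simp add: tangent_sub_def)
next
  assume v: "v \<in> tangent_space A p \<and> (\<forall>w. v (\<lambda>q. snd (\<phi> q) \<bullet> w) = 0)"
  obtain \<xi> where \<xi>: "v = tvec U \<phi> p \<xi>" by (rule tangent_tvecE[OF conjunct1[OF v] slice_mchart[OF U(1)] U(2)])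
  have "snd \<xi> = 0" by (rule inner_all_zero) (use v \<xi> tvec_normal_coord[OF U(1,2)] in simp)
  then have "\<xi> = (fst \<xi>, 0)" by (simp add: prod_eq_iff)
  then show "v \<in> tangent_sub A C p" using \<xi> tangent_sub_eq[OF U] by (metis (mono_tags, lifting) mem_Collect_eq)
qed

end

section \<open>Multivector fields at a point\<close>

text \<open>Extension of local functions by cut-off is assumed here; for the normal bundle it will
  be derived from the Hausdorff property of the base.\<close>

locale bump_manifold = pre_manifold A for A :: "('a, 'e::finite_dim_inner) atlas" +
  assumes extension: "\<lbrakk>(U, \<phi>) \<in> A; p \<in> U; open T; \<phi> p \<in> T; T \<subseteq> \<phi> ` U; smooth_on T h\<rbrakk> \<Longrightarrow>
    \<exists>F\<in>smooth_functions A. \<exists>W. mopen A W \<and> p \<in> W \<and> W \<subseteq> U \<and> (\<forall>q\<in>W. F q = h (\<phi> q)) \<and>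
      (\<forall>q. q \<notin> U \<or> \<phi> q \<notin> T \<longrightarrow> F q = 0)"
begin

abbreviation "S \<equiv> smooth_functions A"

lemma extend_near:
  assumes "smooth_near A p f"
  shows "\<exists>F\<in>S. \<exists>W. mopen A W \<and> p \<in> W \<and> (\<forall>q\<in>W. F q = f q)"
proof -
  obtain U \<phi> where U: "(U, \<phi>) \<in> A" "p \<in> U" using smooth_near_carrier[OF assms] carrier_chart by blast
  note m = chart_mchart[OF U(1)]
  obtain T where T: "open T" "\<phi> p \<in> T" "T \<subseteq> \<phi> ` U" "smooth_on T (f \<circ> iv U \<phi>)"
    using assms smooth_near_iff[OF m U(2)] by (auto simp: sm_at_def)
  obtain F W where F: "F \<in> S" "mopen A W" "p \<in> W" "W \<subseteq> U" "\<forall>q\<in>W. F q = (f \<circ> iv U \<phi>) (\<phi> q)"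
    using extension[OF U T] by blast
  have "F q = f q" if "q \<in> W" for q using F(4,5) that mchart_inj[OF m] by (auto simp: iv_simps subset_iff)
  with F show ?thesis by blast
qed

lemma bump_at:
  assumes W: "mopen A W" "p \<in> W"
  shows "\<exists>b\<in>S. b p = 1 \<and> (\<forall>q. q \<notin> W \<longrightarrow> b q = 0)"
proof -
  obtain U \<phi> where U: "(U, \<phi>) \<in> A" "p \<in> U" using mopenD(2)[OF W(1)] W(2) carrier_chart by blast
  have "open (\<phi> ` (U \<inter> W))" by (rule mopenD(1)[OF W(1) U(1)])
  then obtain F W' where F: "F \<in> S" "p \<in> W'" "\<forall>q\<in>W'. F q = (1 :: real)" "\<forall>q. q \<notin> U \<or> \<phi> q \<notin> \<phi> ` (U \<inter> W) \<longrightarrow> F q = 0"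
    using extension[OF U, of "\<phi> ` (U \<inter> W)" "\<lambda>_. 1"] U W(2) smooth_on_const by blast
  have "F q = 0" if "q \<notin> W" for q using F(4) that charts[OF U(1)] by (auto dest: inj_onD)
  with F show ?thesis by blast
qed

definition point_derivation :: "'a \<Rightarrow> (('a \<Rightarrow> real) \<Rightarrow> real) \<Rightarrow> bool"
  where "point_derivation p Y \<longleftrightarrow> (\<forall>f\<in>S. \<forall>g\<in>S. (\<forall>c. Y (f + c *\<^sub>R g) = Y f + c * Y g) \<and>
    Y (f * g) = f p * Y g + g p * Y f)"

lemma point_derivation_local:
  assumes Y: "point_derivation p Y" and W: "mopen A W" "p \<in> W" and fg: "f \<in> S" "g \<in> S" "\<And>q. q \<in> W \<Longrightarrow> f q = g q"
  shows "Y f = Y g"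
proof -
  obtain b where b: "b \<in> S" "b p = 1" "\<forall>q. q \<notin> W \<longrightarrow> b q = 0" using bump_at[OF W] by blast
  define h where "h = f + (- 1) *\<^sub>R g"
  have h: "h \<in> S" unfolding h_def by (intro fa.add_S fa.scale_S fg)
  have Y0: "Y 0 = 0" using Y fa.zero_S unfolding point_derivation_def
    by (metis add_cancel_right_right mult_1 scaleR_one add_0)
  have "b * h = 0" using b fg by (auto simp: fun_eq_iff h_def scaleR_fun_def)
  then have "Y (b * h) = 0" using Y0 by simp
  moreover have "h p = 0" using fg W by (simp add: h_def scaleR_fun_def)
  ultimately have "Y h = 0" using Y b h by (simp add: point_derivation_def)
  moreover have "Y h = Y f + - 1 * Y g" unfolding h_def using Y fg unfolding point_derivation_def by blast
  ultimately show ?thesis by simp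
qed

text \<open>\<open>Y\<close> acts on global functions, tangent vectors on functions smooth near
  \<open>p\<close>. Such a function is replaced by a global one that agrees with it near
  \<open>p\<close>, and by locality the choice does not matter.\<close>

lemma point_derivation_tangent:
  assumes Y: "point_derivation p Y" and p: "p \<in> carrier_of A"
  shows "\<exists>v\<in>tangent_space A p. \<forall>f\<in>S. v f = Y f"
proof -
  define ext where "ext = (\<lambda>f. SOME F. F \<in> S \<and> (\<exists>W. mopen A W \<and> p \<in> W \<and> (\<forall>q\<in>W. F q = f q)))"
  define v where "v = (\<lambda>f. if smooth_near A p f then Y (ext f) else 0)"
  have ext: "ext f \<in> S \<and> (\<exists>W. mopen A W \<and> p \<in> W \<and> (\<forall>q\<in>W. ext f q = f q))" if "smooth_near A p f" for f
  proof -
    have "\<exists>F. F \<in> S \<and> (\<exists>W. mopen A W \<and> p \<in> W \<and> (\<forall>q\<in>W. F q = f q))" using extend_near[OF that] by blast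
    then show ?thesis unfolding ext_def by (rule someI_ex)
  qed
  have vY: "v f = Y F" if f: "smooth_near A p f" and "F \<in> S" "mopen A W" "p \<in> W" "\<forall>q\<in>W. F q = f q" for f F W
  proof -
    obtain W' where "mopen A W'" "p \<in> W'" "\<forall>q\<in>W'. ext f q = f q" using ext[OF f] by blast
    then show ?thesis
      using point_derivation_local[OF Y mopen_Int[of W W'], of "ext f" F] that ext[OF f] by (simp add: v_def)
  qed
  have "v \<in> tangent_space A p" unfolding tangent_space_def
  proof (intro CollectI conjI allI impI; (elim conjE)?)
    fix f g :: "'a \<Rightarrow> real" and c assume f: "smooth_near A p f" and g: "smooth_near A p g"
    obtain W where W: "mopen A W" "p \<in> W" "\<forall>q\<in>W. ext f q = f q" using ext[OF f] by blast
    obtain W' where W': "mopen A W'" "p \<in> W'" "\<forall>q\<in>W'. ext g q = g q" using ext[OF g] by blast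
    have I: "mopen A (W \<inter> W')" "p \<in> W \<inter> W'" using W W' mopen_Int by auto
    have S: "ext f \<in> S" "ext g \<in> S" using ext f g by auto
    have at: "ext f p = f p" "ext g p = g p" using W W' by auto
    have "v (f + c *\<^sub>R g) = Y (ext f + c *\<^sub>R ext g)"
    proof (rule vY[OF smooth_near_linear[OF f g] _ I])
      show "ext f + c *\<^sub>R ext g \<in> S" by (intro fa.add_S fa.scale_S S)
    qed (use W W' in \<open>simp add: scaleR_fun_def\<close>)
    then show "v (f + c *\<^sub>R g) = v f + c * v g" using Y S f g by (simp add: point_derivation_def v_def)
    have "v (f * g) = Y (ext f * ext g)"
    proof (rule vY[OF smooth_near_times[OF f g] _ I])
      show "ext f * ext g \<in> S" by (intro fa.mult_S S)
    qed (use W W' in simp)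
    then show "v (f * g) = f p * v g + g p * v f" using Y S f g at by (simp add: point_derivation_def v_def)
  qed (simp add: v_def)
  moreover have "v f = Y f" if "f \<in> S" for f
    using vY[OF smooth_functionsD(1)[OF that p] that mopen_chart] p carrier_chart chart_mchart that by blast
  ultimately show ?thesis by blast
qed

lemma tangent_determined:
  assumes "v \<in> tangent_space A p" "w \<in> tangent_space A p" "\<And>f. f \<in> S \<Longrightarrow> v f = w f"
  shows "v = w"
proof
  fix f
  show "v f = w f"
  proof (cases "smooth_near A p f")
    case True
    obtain F W where F: "F \<in> S" "mopen A W" "p \<in> W" "\<forall>q\<in>W. F q = f q" using extend_near[OF True] by blast
    have e: "F q = f q" if "q \<in> W" for q using F(4) that ..
    show ?thesis
      using tangent_local[OF assms(1) F(2,3) e] tangent_local[OF assms(2) F(2,3) e] assms(3)[OF F(1)] by simp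
  next
    case False
    show ?thesis unfolding tangentD(1)[OF assms(1) False] tangentD(1)[OF assms(2) False] ..
  qed
qed

lemma MD_point_derivation:
  assumes "X \<in> fa.MD k"
  shows "point_derivation p (\<lambda>f. X (us @ f # ws) p)"
  unfolding point_derivation_def using fa.MD_linear[OF assms] fa.MD_deriv[OF assms] by (simp add: scaleR_fun_def)

text \<open>In each single slot, the value at \<open>p\<close> is a point derivation and hence given
  by a tangent vector at \<open>p\<close>.\<close>

lemma MD_determined:
  assumes X: "X \<in> fa.MD k" and fg: "f \<in> S" "g \<in> S" and p: "p \<in> carrier_of A"
    and eq: "\<And>v. v \<in> tangent_space A p \<Longrightarrow> v f = v g"
  shows "X (us @ f # ws) p = X (us @ g # ws) p"
  using point_derivation_tangent[OF MD_point_derivation[OF X, of p us ws] p] fg eq by metis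

lemma MD_determined_list:
  assumes X: "X \<in> fa.MD k" and p: "p \<in> carrier_of A"
    and eq: "list_all2 (\<lambda>f g. f \<in> S \<and> g \<in> S \<and> (\<forall>v\<in>tangent_space A p. v f = v g)) fs gs"
  shows "X (us @ fs) p = X (us @ gs) p"
  using eq
proof (induction fs gs arbitrary: us)
  case (Cons f fs g gs)
  have "X (us @ f # fs) p = X (us @ g # fs) p" using Cons.hyps(1) by (intro MD_determined[OF X _ _ p]) auto
  also have "\<dots> = X ((us @ [g]) @ fs) p" by simp
  also have "\<dots> = X ((us @ [g]) @ gs) p" by (rule Cons.IH)
  finally show ?case by simp
qed simp

text \<open>Shows that the definite description in \<open>sharp\<close> denotes: by
  \<open>MD_determined\<close> all functions with differential \<open>\<alpha>\<close> give the same
  values, and a tangent vector is determined by its values on \<open>S\<close>.\<close>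

lemma sharp_eq:
  assumes X: "X \<in> fa.MD 2" and p: "p \<in> carrier_of A" and f: "f \<in> S"
    and \<alpha>: "\<And>w. w \<in> tangent_space A p \<Longrightarrow> w f = \<alpha> w"
  shows "sharp A X p \<alpha> \<in> tangent_space A p" "\<And>g. g \<in> S \<Longrightarrow> sharp A X p \<alpha> g = X [f, g] p"
proof -
  let ?P = "\<lambda>v. v \<in> tangent_space A p \<and> (\<forall>f\<in>S. \<forall>g\<in>S. (\<forall>w\<in>tangent_space A p. w f = \<alpha> w) \<longrightarrow> v g = X [f, g] p)"
  obtain v where v: "v \<in> tangent_space A p" "\<forall>g\<in>S. v g = X [f, g] p"
    using point_derivation_tangent[OF MD_point_derivation[OF X, of p "[f]" "[]"] p] by auto
  have Pv: "?P v"
  proof (intro conjI ballI impI v(1))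
    fix f' g assume f': "f' \<in> S" and g: "g \<in> S" and "\<forall>w\<in>tangent_space A p. w f' = \<alpha> w"
    then have "X ([] @ f # [g]) p = X ([] @ f' # [g]) p" using \<alpha> by (intro MD_determined[OF X f f' p]) auto
    then show "v g = X [f', g] p" using v(2) g by simp
  qed
  moreover have "w = v" if "?P w" for w by (rule tangent_determined) (use that v f \<alpha> in auto)
  ultimately have "sharp A X p \<alpha> = v" unfolding sharp_def by (rule the_equality)
  then show "sharp A X p \<alpha> \<in> tangent_space A p" "\<And>g. g \<in> S \<Longrightarrow> sharp A X p \<alpha> g = X [f, g] p"
    using v by auto
qed

end

text \<open>The differentials of the functions \<open>F w\<close> span the conormal space at \<open>p\<close>.\<close>

lemma (in submanifold) coisotropic_at:
  assumes B: "bump_manifold A" and U: "slice U \<kappa>" "p \<in> U" "p \<in> C"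
    and X: "X \<in> multiderivations 2 (smooth_functions A)"
    and F: "\<And>w. F w \<in> smooth_functions A"
    and W: "\<And>w. \<exists>W. mopen A W \<and> p \<in> W \<and> (\<forall>q\<in>W. F w q = snd (\<kappa> q) \<bullet> w)"
  shows "sharp A X p ` annihilator A C p \<subseteq> tangent_sub A C p \<longleftrightarrow> (\<forall>w w'. X [F w, F w'] p = 0)"
proof -
  interpret bump_manifold A by (rule B)
  note m = slice_mchart[OF U(1)]
  have p: "p \<in> carrier_of A" using U(3) C_carrier by blast
  have vF: "v (F w) = v (\<lambda>q. snd (\<kappa> q) \<bullet> w)" if "v \<in> tangent_space A p" for v w
  proof -
    obtain W where W': "mopen A W" "p \<in> W" "\<forall>q\<in>W. F w q = snd (\<kappa> q) \<bullet> w" using W by blast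
    then have e: "F w q = snd (\<kappa> q) \<bullet> w" if "q \<in> W" for q using that by blast
    show ?thesis by (rule tangent_local[OF that W'(1,2) e])
  qed
  have sub: "v \<in> tangent_sub A C p \<longleftrightarrow> (\<forall>w. v (F w) = 0)" if "v \<in> tangent_space A p" for v
    using tangent_sub_iff[OF U] that vF[OF that] by simp
  have ann: "\<exists>w. \<forall>v\<in>tangent_space A p. v (F w) = \<alpha> v" if \<alpha>: "\<alpha> \<in> annihilator A C p" for \<alpha>
  proof -
    have lin: "\<alpha> (v + c *\<^sub>R w) = \<alpha> v + c * \<alpha> w" if "v \<in> tangent_space A p" "w \<in> tangent_space A p" for v w c
      using \<alpha> that by (auto simp: annihilator_def cotangent_space_def)
    have van: "\<alpha> v = 0" if "v \<in> tangent_sub A C p" for v using \<alpha> that by (auto simp: annihilator_def)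
    define L where "L = (\<lambda>y. \<alpha> (tvec U \<kappa> p (0, y)))"
    have "linear L"
    proof (rule linearI)
      have "L (y + c *\<^sub>R z) = L y + c * L z" for y z c
        using lin[OF tvec_tangent[OF m U(2)] tvec_tangent[OF m U(2)], of "(0, y)" c "(0, z)"]
        by (simp add: L_def tvec_add_scale[OF m U(2), symmetric])
      from this[of _ 1] this[of 0] show "L (y + z) = L y + L z" "L (c *\<^sub>R y) = c *\<^sub>R L y" for y z c
        using van[of "tvec U \<kappa> p (0, 0)"] tangent_sub_eq[OF U] by (auto simp: L_def)
    qed
    \<comment> \<open>The vector representing the linear functional \<open>L\<close> by the inner
      product.\<close>
    define w where "w = (\<Sum>e\<in>onb. L e *\<^sub>R e)"
    have Lw: "L y = y \<bullet> w" for y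
      using linear_onb[OF \<open>linear L\<close>, of y] by (simp add: w_def inner_sum_right mult.commute)
    have "v (F w) = \<alpha> v" if v: "v \<in> tangent_space A p" for v
    proof -
      obtain \<xi> where \<xi>: "v = tvec U \<kappa> p \<xi>" by (rule tangent_tvecE[OF v m U(2)])
      have "v = tvec U \<kappa> p (fst \<xi>, 0) + 1 *\<^sub>R tvec U \<kappa> p (0, snd \<xi>)"
        unfolding tvec_add_scale[OF m U(2), symmetric] by (simp add: \<xi>)
      then have "\<alpha> v = \<alpha> (tvec U \<kappa> p (fst \<xi>, 0)) + 1 * \<alpha> (tvec U \<kappa> p (0, snd \<xi>))"
        using lin[OF tvec_tangent[OF m U(2)] tvec_tangent[OF m U(2)]] by metis
      also have "\<dots> = snd \<xi> \<bullet> w"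
        using van[of "tvec U \<kappa> p (fst \<xi>, 0)"] tangent_sub_eq[OF U] Lw[of "snd \<xi>"] by (auto simp: L_def)
      finally show ?thesis using vF[OF v] \<xi> tvec_normal_coord[OF U(1,2)] by simp
    qed
    then show ?thesis by blast
  qed
  \<comment> \<open>The differential of \<open>F w\<close>, set to zero off the tangent space as
    \<open>cotangent_space\<close> demands.\<close>
  have mem: "(\<lambda>v. if v \<in> tangent_space A p then v (F w) else 0) \<in> annihilator A C p" for w
    unfolding annihilator_def cotangent_space_def
    using sub subspace_add[OF tangent_subspace[OF p]] subspace_scale[OF tangent_subspace[OF p]]
    by (auto simp: tangent_sub_def scaleR_fun_def)
  show ?thesis
  proof
    assume sh: "sharp A X p ` annihilator A C p \<subseteq> tangent_sub A C p"
    show "\<forall>w w'. X [F w, F w'] p = 0"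
    proof (intro allI)
      fix w w'
      define \<alpha> where "\<alpha> = (\<lambda>v. if v \<in> tangent_space A p then v (F w) else 0)"
      note s = sharp_eq[OF X p F, of w \<alpha>]
      have "sharp A X p \<alpha> \<in> tangent_sub A C p" using sh mem[of w] by (auto simp: \<alpha>_def)
      then have "sharp A X p \<alpha> (F w') = 0" using sub s(1) by (simp add: \<alpha>_def)
      then show "X [F w, F w'] p = 0" using s(2)[OF _ F, of w'] by (simp add: \<alpha>_def)
    qed
  next
    assume z: "\<forall>w w'. X [F w, F w'] p = 0"
    show "sharp A X p ` annihilator A C p \<subseteq> tangent_sub A C p"
    proof clarify
      fix \<alpha> assume "\<alpha> \<in> annihilator A C p"
      then obtain w where w: "\<forall>v\<in>tangent_space A p. v (F w) = \<alpha> v" using ann by blast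
      note s = sharp_eq[OF X p F, of w \<alpha>]
      show "sharp A X p \<alpha> \<in> tangent_sub A C p" using sub[OF s(1)] s(2)[OF _ F] w z by simp
    qed
  qed
qed

section \<open>The normal bundle\<close>

context submanifold
begin

abbreviation N :: "('a normal, 'c \<times> 'f) atlas"
  where "N \<equiv> normal_atlas A C"

text \<open>The normal vector at \<open>p\<close> with fibre coordinate \<open>y\<close> in the bundle chart induced by \<open>\<phi>\<close>.\<close>

definition nv :: "'a set \<Rightarrow> ('a \<Rightarrow> 'c \<times> 'f) \<Rightarrow> 'a \<Rightarrow> 'f \<Rightarrow> 'a coset"
  where "nv U \<phi> p y = {tvec U \<phi> p (x, y) | x. True}"

abbreviation NU :: "'a set \<Rightarrow> 'a normal set"
  where "NU U \<equiv> SIGMA p:U \<inter> C. normal_space A C p"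

abbreviation NC :: "('a \<Rightarrow> 'c \<times> 'f) \<Rightarrow> 'a normal \<Rightarrow> 'c \<times> 'f"
  where "NC \<equiv> normal_chart"

lemma nv_mem: "tvec U \<phi> p (x, y) \<in> nv U \<phi> p y"
  by (auto simp: nv_def)

lemma nvE: "v \<in> nv U \<phi> p y \<Longrightarrow> \<exists>x. v = tvec U \<phi> p (x, y)"
  by (auto simp: nv_def)

context
  fixes U \<phi> p
  assumes U: "slice U \<phi>" "p \<in> U" "p \<in> C"
begin

lemma tvec_add: "tvec U \<phi> p (\<xi> + c *\<^sub>R \<eta>) = tvec U \<phi> p \<xi> + c *\<^sub>R tvec U \<phi> p \<eta>"
  by (rule tvec_add_scale[OF slice_mchart[OF U(1)] U(2)])

lemma tangent_sub_nv: "tangent_sub A C p = nv U \<phi> p 0"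
  unfolding tangent_sub_eq[OF U] nv_def ..

lemma nv_coset: "{tvec U \<phi> p (x, y) + u | u. u \<in> tangent_sub A C p} = nv U \<phi> p y"
proof (intro set_eqI iffI)
  fix v assume "v \<in> {tvec U \<phi> p (x, y) + u | u. u \<in> tangent_sub A C p}"
  then obtain x' where "v = tvec U \<phi> p (x, y) + 1 *\<^sub>R tvec U \<phi> p (x', 0)" by (auto simp: tangent_sub_nv nv_def)
  then show "v \<in> nv U \<phi> p y" unfolding tvec_add[symmetric] by (auto simp: nv_def)
next
  fix v assume "v \<in> nv U \<phi> p y"
  then obtain x' where x': "v = tvec U \<phi> p (x', y)" by (auto simp: nv_def)
  have "v = tvec U \<phi> p (x, y) + 1 *\<^sub>R tvec U \<phi> p (x' - x, 0)" unfolding tvec_add[symmetric] x' by simp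
  then show "v \<in> {tvec U \<phi> p (x, y) + u | u. u \<in> tangent_sub A C p}"
    using nv_mem[of U \<phi> p "x' - x" 0] by (auto simp: tangent_sub_nv)
qed

lemma normal_space_eq: "normal_space A C p = range (nv U \<phi> p)"
proof (intro set_eqI iffI)
  fix \<xi> assume "\<xi> \<in> normal_space A C p"
  then obtain v where v: "v \<in> tangent_space A p" "\<xi> = {v + u | u. u \<in> tangent_sub A C p}" by (auto simp: normal_space_def)
  obtain \<zeta> where "v = tvec U \<phi> p \<zeta>" by (rule tangent_tvecE[OF v(1) slice_mchart[OF U(1)] U(2)])
  then have "\<xi> = nv U \<phi> p (snd \<zeta>)" using v(2) nv_coset[of "fst \<zeta>" "snd \<zeta>"] by simp
  then show "\<xi> \<in> range (nv U \<phi> p)" by blast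
next
  fix \<xi> assume "\<xi> \<in> range (nv U \<phi> p)"
  then obtain y where "\<xi> = {tvec U \<phi> p (0, y) + u | u. u \<in> tangent_sub A C p}" using nv_coset by auto
  then show "\<xi> \<in> normal_space A C p"
    unfolding normal_space_def using tvec_tangent[OF slice_mchart[OF U(1)] U(2)] by blast
qed

lemma nv_in [simp]: "nv U \<phi> p y \<in> normal_space A C p"
  by (simp add: normal_space_eq)

lemma nvC: "\<xi> \<in> normal_space A C p \<Longrightarrow> \<exists>y. \<xi> = nv U \<phi> p y"
  by (auto simp: normal_space_eq)

lemma normal_chart_nv: "NC \<phi> (p, nv U \<phi> p y) = (fst (\<phi> p), y)"
proof -
  have *: "tvec U \<phi> p (x, y) (\<lambda>q. w \<bullet> snd (\<phi> q)) = w \<bullet> y" for x w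
    using tvec_normal_coord[OF U(1,2), of "(x, y)" w] by (simp add: inner_commute)
  have "(THE y'. \<exists>v\<in>nv U \<phi> p y. \<forall>w. w \<bullet> y' = v (\<lambda>q. w \<bullet> snd (\<phi> q))) = y"
  proof (rule the_equality)
    show "\<exists>v\<in>nv U \<phi> p y. \<forall>w. w \<bullet> y = v (\<lambda>q. w \<bullet> snd (\<phi> q))"
      by (rule bexI[OF _ nv_mem[of _ _ _ 0]]) (simp add: *)
    fix y' assume "\<exists>v\<in>nv U \<phi> p y. \<forall>w. w \<bullet> y' = v (\<lambda>q. w \<bullet> snd (\<phi> q))"
    then have "w \<bullet> y' = w \<bullet> y" for w by (auto simp: nv_def *)
    then have "(y' - y) \<bullet> w = 0" for w by (metis inner_commute inner_diff_left right_minus_eq)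
    then have "y' - y = 0" by (rule inner_all_zero)
    then show "y' = y" by simp
  qed
  then show ?thesis by (simp add: normal_chart_def)
qed

lemma nv_inject: "nv U \<phi> p y = nv U \<phi> p z \<longleftrightarrow> y = z"
  using normal_chart_nv by (metis prod.inject)

lemma normal_zero_nv: "normal_zero A C p = nv U \<phi> p 0"
  by (simp add: normal_zero_def tangent_sub_nv)

lemma normal_add_nv: "normal_add (nv U \<phi> p y) (nv U \<phi> p z) = nv U \<phi> p (y + z)"
proof (intro set_eqI iffI)
  fix v assume "v \<in> normal_add (nv U \<phi> p y) (nv U \<phi> p z)"
  then obtain x x' where "v = tvec U \<phi> p (x, y) + 1 *\<^sub>R tvec U \<phi> p (x', z)" by (auto simp: normal_add_def nv_def)
  then show "v \<in> nv U \<phi> p (y + z)" unfolding tvec_add[symmetric] by (auto simp: nv_def)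
next
  fix v assume "v \<in> nv U \<phi> p (y + z)"
  then obtain x where "v = tvec U \<phi> p (x, y + z)" by (auto simp: nv_def)
  then have "v = tvec U \<phi> p (x, y) + 1 *\<^sub>R tvec U \<phi> p (0, z)" unfolding tvec_add[symmetric] by simp
  then show "v \<in> normal_add (nv U \<phi> p y) (nv U \<phi> p z)" unfolding normal_add_def by (auto simp: nv_def)
qed

lemma normal_scale_nv: "normal_scale A C p t (nv U \<phi> p y) = nv U \<phi> p (t *\<^sub>R y)"
proof (intro set_eqI iffI)
  fix v assume "v \<in> normal_scale A C p t (nv U \<phi> p y)"
  then obtain x x' where "v = tvec U \<phi> p (x', 0) + t *\<^sub>R tvec U \<phi> p (x, y)"
    by (auto simp: normal_scale_def nv_def tangent_sub_nv add.commute)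
  then show "v \<in> nv U \<phi> p (t *\<^sub>R y)" unfolding tvec_add[symmetric] by (auto simp: nv_def)
next
  fix v assume "v \<in> nv U \<phi> p (t *\<^sub>R y)"
  then obtain x where x: "v = tvec U \<phi> p (x, t *\<^sub>R y)" by (auto simp: nv_def)
  have "v = tvec U \<phi> p (x, 0) + t *\<^sub>R tvec U \<phi> p (0, y)" unfolding tvec_add[symmetric] x by simp
  then show "v \<in> normal_scale A C p t (nv U \<phi> p y)" unfolding normal_scale_def by (auto simp: nv_def tangent_sub_nv add.commute)
qed

end

lemma nv_change:
  assumes U: "slice U \<phi>" "p \<in> U" "p \<in> C" and V: "slice V \<theta>" "p \<in> V"
  shows "nv U \<phi> p y = nv V \<theta> p (snd (fd (\<theta> \<circ> iv U \<phi>) (\<phi> p) (0, y)))"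
proof -
  obtain z where z: "nv U \<phi> p y = nv V \<theta> p z" using nvC[OF V U(3) nv_in[OF U]] by blast
  have "tvec V \<theta> p (fd (\<theta> \<circ> iv U \<phi>) (\<phi> p) (0, y)) \<in> nv V \<theta> p z"
    using nv_mem[of U \<phi> p 0 y] z tvec_change[OF slice_mchart[OF U(1)] U(2) slice_mchart[OF V(1)] V(2)] by simp
  then obtain x where "fd (\<theta> \<circ> iv U \<phi>) (\<phi> p) (0, y) = (x, z)"
    using nvE tvec_inject[OF slice_mchart[OF V(1)] V(2)] by blast
  with z show ?thesis by simp
qed

lemma NU_memE:
  assumes U: "slice U \<phi>" and P: "P \<in> NU U"
  obtains p y where "P = (p, nv U \<phi> p y)" "p \<in> U" "p \<in> C" "NC \<phi> P = (fst (\<phi> p), y)"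
proof -
  obtain p \<xi> where p: "P = (p, \<xi>)" "p \<in> U" "p \<in> C" "\<xi> \<in> normal_space A C p" using P by auto
  obtain y where "\<xi> = nv U \<phi> p y" using nvC[OF U p(2,3,4)] by blast
  with that p normal_chart_nv[OF U p(2,3)] show ?thesis by blast
qed

lemma NC_inj: "slice U \<phi> \<Longrightarrow> inj_on (NC \<phi>) (NU U)"
proof (rule inj_onI)
  fix P Q assume U: "slice U \<phi>" and P: "P \<in> NU U" and Q: "Q \<in> NU U" and eq: "NC \<phi> P = NC \<phi> Q"
  from NU_memE[OF U P] obtain p y where p: "P = (p, nv U \<phi> p y)" "p \<in> U" "p \<in> C" "NC \<phi> P = (fst (\<phi> p), y)" .
  from NU_memE[OF U Q] obtain q z where q: "Q = (q, nv U \<phi> q z)" "q \<in> U" "q \<in> C" "NC \<phi> Q = (fst (\<phi> q), z)" .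
  have "(fst \<circ> \<phi>) p = (fst \<circ> \<phi>) q" using p(4) q(4) eq by simp
  then have "p = q" by (rule inj_onD[OF sub_chart_inj[OF U]]) (use p q in auto)
  then show "P = Q" using p q eq by simp
qed

lemma NC_image: "slice U \<phi> \<Longrightarrow> W \<subseteq> U \<Longrightarrow> NC \<phi> ` NU W = {(x, y :: 'f). (x, 0) \<in> \<phi> ` W}"
proof (intro set_eqI iffI)
  fix z assume a: "slice U \<phi>" "W \<subseteq> U" "z \<in> NC \<phi> ` NU W"
  then obtain P where P: "P \<in> NU W" "z = NC \<phi> P" by blast
  then have "P \<in> NU U" using a(2) by auto
  from NU_memE[OF a(1) this] obtain p y where p: "P = (p, nv U \<phi> p y)" "p \<in> U" "p \<in> C" "NC \<phi> P = (fst (\<phi> p), y)" .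
  have "(fst (\<phi> p), 0) = \<phi> p" using slice_chart_zero[OF a(1) p(2,3)] by simp
  moreover have "p \<in> W" using P p(1) by simp
  ultimately show "z \<in> {(x, y). (x, 0) \<in> \<phi> ` W}" using p(4) P(2) by auto
next
  fix z assume a: "slice U \<phi>" "W \<subseteq> U" "z \<in> {(x, y :: 'f). (x, 0) \<in> \<phi> ` W}"
  then obtain p where p: "p \<in> W" "\<phi> p = (fst z, 0)" by auto
  then have "p \<in> U" "p \<in> C" using a slice_iff[OF a(1), of p] by auto
  then show "z \<in> NC \<phi> ` NU W" using normal_chart_nv[OF a(1), of p "snd z"] nv_in[OF a(1), of p "snd z"] p
    by (intro image_eqI[of _ _ "(p, nv U \<phi> p (snd z))"]) auto
qed

lemma iv_NC:
  assumes U: "slice U \<phi>" and z: "(x, 0) \<in> \<phi> ` U"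
  shows "iv (NU U) (NC \<phi>) (x, y) = (iv U \<phi> (x, 0), nv U \<phi> (iv U \<phi> (x, 0)) y)"
    "iv U \<phi> (x, 0) \<in> U" "iv U \<phi> (x, 0) \<in> C" "\<phi> (iv U \<phi> (x, 0)) = (x, 0)"
proof -
  note m = mchart_inj[OF slice_mchart[OF U]]
  show p: "iv U \<phi> (x, 0) \<in> U" "\<phi> (iv U \<phi> (x, 0)) = (x, 0)" using z m by (auto simp: iv_simps)
  then show c: "iv U \<phi> (x, 0) \<in> C" using slice_iff[OF U] by simp
  have "NC \<phi> (iv U \<phi> (x, 0), nv U \<phi> (iv U \<phi> (x, 0)) y) = (x, y)"
    using normal_chart_nv[OF U p(1) c] p(2) by simp
  moreover have "(iv U \<phi> (x, 0), nv U \<phi> (iv U \<phi> (x, 0)) y) \<in> NU U" using p c nv_in[OF U p(1) c] by simp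
  ultimately show "iv (NU U) (NC \<phi>) (x, y) = (iv U \<phi> (x, 0), nv U \<phi> (iv U \<phi> (x, 0)) y)"
    using iv_simps(1)[OF NC_inj[OF U]] by metis
qed

lemma open_cylinder: "open (T :: ('c \<times> 'f) set) \<Longrightarrow> open {(x, y :: 'f). (x, 0) \<in> T}"
proof -
  assume "open T"
  then have "open ({x. (x, 0) \<in> T} \<times> (UNIV :: 'f set))" by (intro open_Times open_slice open_UNIV)
  moreover have "{x. (x, 0) \<in> T} \<times> (UNIV :: 'f set) = {(x, y). (x, 0) \<in> T}" by auto
  ultimately show ?thesis by simp
qed

abbreviation "dom0 U \<phi> \<equiv> {x :: 'c. (x, 0 :: 'f) \<in> \<phi> ` U}"
abbreviation "cyl U \<phi> \<equiv> {(x :: 'c, y :: 'f). (x, 0 :: 'f) \<in> \<phi> ` U}"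

lemma open_dom0: "slice U \<phi> \<Longrightarrow> open (dom0 U \<phi>)" and open_cyl: "slice U \<phi> \<Longrightarrow> open (cyl U \<phi>)"
  using open_slice open_cylinder mchart_open slice_mchart by blast+

lemma normal_transition:
  assumes U: "slice U \<phi>" and V: "slice V \<theta>" and z: "(x, 0) \<in> \<phi> ` (U \<inter> V)"
  shows "(NC \<theta> \<circ> iv (NU U) (NC \<phi>)) (x, y) =
    (fst ((\<theta> \<circ> iv U \<phi>) (x, 0)), snd (fd (\<theta> \<circ> iv U \<phi>) (x, 0) (0, y)))"
proof -
  have z': "(x, 0) \<in> \<phi> ` U" using z by auto
  note i = iv_NC[OF U z']
  have v: "iv U \<phi> (x, 0) \<in> V" using z mchart_inj[OF slice_mchart[OF U]] by (auto simp: iv_simps)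
  show ?thesis using i nv_change[OF U i(2,3) V v, of y] normal_chart_nv[OF V v i(3)] by simp
qed

lemma smooth_normal_transition:
  assumes U: "slice U \<phi>" and V: "slice V \<theta>"
  shows "smooth_on (NC \<phi> ` (NU U \<inter> NU V)) (NC \<theta> \<circ> iv (NU U) (NC \<phi>))" "open (NC \<phi> ` (NU U \<inter> NU V))"
proof -
  note t = transition_smooth[OF slice_mchart[OF U] slice_mchart[OF V]]
  let ?\<tau> = "\<theta> \<circ> iv U \<phi>" and ?T = "\<phi> ` (U \<inter> V)"
  define D where "D = {(x, y :: 'f). (x, 0) \<in> ?T}"
  have im: "NC \<phi> ` (NU U \<inter> NU V) = D"
    using NC_image[OF U, of "U \<inter> V"] unfolding D_def by (simp add: Sigma_Int_distrib1[symmetric] Int_ac)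
  have D: "open D" unfolding D_def by (rule open_cylinder[OF t(1)])
  then show "open (NC \<phi> ` (NU U \<inter> NU V))" by (simp only: im)
  have pull: "smooth_on D (\<lambda>z. h (fst z, 0))" if "smooth_on ?T h" for h :: "'c \<times> 'f \<Rightarrow> 'z::real_normed_vector"
    by (rule smooth_on_compose[OF D t(1) _ _ that])
       (auto simp: D_def intro!: smooth_on_Pair smooth_on_fst smooth_on_const D[unfolded D_def])
  \<comment> \<open>The fibre coordinate enters as the direction of a derivative; expanding it in
    the orthonormal basis leaves derivatives in fixed directions, which are smooth.\<close>
  have "smooth_on D (\<lambda>z. (fst (?\<tau> (fst z, 0)), \<Sum>e\<in>onb. (snd z \<bullet> e) *\<^sub>R snd (fd ?\<tau> (fst z, 0) (0, e))))"
    by (intro smooth_on_Pair smooth_on_sum smooth_on_scaleR smooth_on_inner smooth_on_snd smooth_on_const D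
        smooth_on_linear_compose[OF bounded_linear_fst] smooth_on_linear_compose[OF bounded_linear_snd] pull[OF smooth_on_fd[OF t(2)]] pull[OF t(2)])
  moreover have "(fst (?\<tau> (fst z, 0)), \<Sum>e\<in>onb. (snd z \<bullet> e) *\<^sub>R snd (fd ?\<tau> (fst z, 0) (0, e))) =
      (NC \<theta> \<circ> iv (NU U) (NC \<phi>)) z" if "z \<in> D" for z
  proof -
    have z: "(fst z, 0) \<in> ?T" using that by (auto simp: D_def)
    have l: "linear (fd ?\<tau> (fst z, 0))" by (rule fd_linear[OF smooth_on_differentiable[OF t(2) z]])
    have "linear (\<lambda>y. snd (fd ?\<tau> (fst z, 0) (0, y)))"
    proof (rule linearI)
      show "snd (fd ?\<tau> (fst z, 0) (0, y + y')) = snd (fd ?\<tau> (fst z, 0) (0, y)) + snd (fd ?\<tau> (fst z, 0) (0, y'))" for y y'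
        using linear_add[OF l, of "(0, y)" "(0, y')"] by simp
      show "snd (fd ?\<tau> (fst z, 0) (0, c *\<^sub>R y)) = c *\<^sub>R snd (fd ?\<tau> (fst z, 0) (0, y))" for c y
        using linear_scale[OF l, of c "(0, y)"] by simp
    qed
    from linear_onb[OF this, of "snd z"] show ?thesis using normal_transition[OF U V z, of "snd z"] by simp
  qed
  ultimately show "smooth_on (NC \<phi> ` (NU U \<inter> NU V)) (NC \<theta> \<circ> iv (NU U) (NC \<phi>))"
    unfolding im by (rule smooth_on_cong_imp[OF D])
qed

lemma pre_manifold_N: "pre_manifold N"
proof
  fix V \<Phi> assume "(V, \<Phi>) \<in> N"
  then obtain U \<phi> where "slice U \<phi>" "V = NU U" "\<Phi> = NC \<phi>" by (auto simp: normal_atlas_def)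
  then show "inj_on \<Phi> V \<and> open (\<Phi> ` V)"
    using NC_inj NC_image[of U \<phi> U] open_cylinder[OF mchart_open[OF slice_mchart]] by simp
next
  fix a b assume "a \<in> N" "b \<in> N"
  then obtain U \<phi> V \<theta> where "slice U \<phi>" "slice V \<theta>" "a = (NU U, NC \<phi>)" "b = (NU V, NC \<theta>)"
    by (auto simp: normal_atlas_def)
  then show "compatible a b"
    using smooth_normal_transition[of U \<phi> V \<theta>] smooth_normal_transition[of V \<theta> U \<phi>]
    by (simp add: compatible_def Int_commute)
qed

sublocale N: pre_manifold N by (rule pre_manifold_N)

lemma N_chart: "slice U \<phi> \<Longrightarrow> (NU U, NC \<phi>) \<in> N"
  by (auto simp: normal_atlas_def)

lemma N_mchart: "slice U \<phi> \<Longrightarrow> N.mchart (NU U) (NC \<phi>)"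
  by (rule N.chart_mchart[OF N_chart])

lemma N_carrier: "carrier_of N = normal_total A C"
proof
  show "normal_total A C \<subseteq> carrier_of N"
  proof
    fix P assume P: "P \<in> normal_total A C"
    then have "fst P \<in> C" by (auto simp: normal_total_def)
    then obtain U \<phi> where U: "slice U \<phi>" "fst P \<in> U" using slice_exists by blast
    show "P \<in> carrier_of N"
      by (rule in_carrierI[OF N_chart[OF U(1)]]) (use P U in \<open>auto simp: normal_total_def\<close>)
  qed
qed (auto simp: carrier_of_def normal_atlas_def normal_total_def)

lemma mopen_N:
  assumes W: "mopen A W"
  shows "mopen N (NU W)"
proof (rule mopenI)
  show "NU W \<subseteq> carrier_of N" by (auto simp: N_carrier normal_total_def)
  fix V \<Phi> assume "(V, \<Phi>) \<in> N"
  then obtain U \<phi> where V: "slice U \<phi>" "V = NU U" "\<Phi> = NC \<phi>" by (auto simp: normal_atlas_def)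
  have "\<Phi> ` (V \<inter> NU W) = {(x, y). (x, 0) \<in> \<phi> ` (U \<inter> W)}"
    using NC_image[OF V(1), of "U \<inter> W"] V by (simp add: Sigma_Int_distrib1[symmetric] Int_ac)
  then show "open (\<Phi> ` (V \<inter> NU W))" using open_cylinder[OF mopen_mchart[OF W slice_mchart[OF V(1)]]] by simp
qed

end

section \<open>Extension of functions on the normal bundle\<close>

context pre_manifold
begin

lemma istopology_mopen: "istopology (mopen A)"
  unfolding istopology_def
proof (intro conjI allI impI)
  fix \<K> assume K: "\<forall>K\<in>\<K>. mopen A K"
  show "mopen A (\<Union>\<K>)"
  proof (rule mopenI)
    show "\<Union>\<K> \<subseteq> carrier_of A" using K mopenD(2) by blast
    fix U \<phi> assume U: "(U, \<phi>) \<in> A"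
    have "\<phi> ` (U \<inter> \<Union>\<K>) = (\<Union>K\<in>\<K>. \<phi> ` (U \<inter> K))" by auto
    then show "open (\<phi> ` (U \<inter> \<Union>\<K>))" using K mopenD(1)[OF _ U] by auto
  qed
qed (rule mopen_Int)

lemma openin_mopen: "openin (topology (mopen A)) = mopen A"
  by (rule topology_inverse'[OF istopology_mopen])

lemma topspace_mopen: "topspace (topology (mopen A)) = carrier_of A"
proof -
  have "p \<in> \<Union>{W. mopen A W}" if "p \<in> carrier_of A" for p
    using carrier_chart[OF that] mopen_chart[OF chart_mchart] by blast
  then show ?thesis unfolding topspace_def openin_mopen using mopenD(2) by blast
qed

text \<open>Compact subsets of chart domains are closed because the manifold is Hausdorff.\<close>

lemma complement_compact:
  assumes H: "Hausdorff_space (topology (mopen A))" and U: "mchart U \<phi>" and K: "compact K" "K \<subseteq> \<phi> ` U"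
  shows "mopen A (carrier_of A - iv U \<phi> ` K)"
proof -
  let ?X = "topology (mopen A)"
  note inj = mchart_inj[OF U]
  have "continuous_map (top_of_set K) ?X (iv U \<phi>)"
  proof -
    have sub: "iv U \<phi> ` K \<subseteq> U" using K(2) inj by (auto simp: iv_simps)
    show "continuous_map (top_of_set K) ?X (iv U \<phi>)"
      unfolding continuous_map topspace_mopen openin_mopen topspace_euclidean_subtopology
    proof (intro conjI allI impI)
      show "iv U \<phi> ` K \<subseteq> carrier_of A" using sub mchart_carrier[OF U] by blast
      fix W assume W: "mopen A W"
      have "iv U \<phi> x \<in> W \<longleftrightarrow> x \<in> \<phi> ` (U \<inter> W)" if x: "x \<in> K" for x
      proof -
        obtain q where "q \<in> U" "x = \<phi> q" using x K(2) by blast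
        with inj show ?thesis by (auto simp: iv_simps dest: inj_onD)
      qed
      then have "{x \<in> K. iv U \<phi> x \<in> W} = K \<inter> \<phi> ` (U \<inter> W)" by blast
      then show "openin (top_of_set K) {x \<in> K. iv U \<phi> x \<in> W}"
        using mopen_mchart[OF W U] by (simp add: openin_open_Int)
    qed
  qed
  then have "compactin ?X (iv U \<phi> ` K)"
    using image_compactin K(1) by (metis compactin_euclidean_iff compactin_subtopology order_refl)
  then have "closedin ?X (iv U \<phi> ` K)" by (rule compactin_imp_closedin[OF H])
  then show ?thesis by (simp add: closedin_def openin_mopen topspace_mopen)
qed

end

locale smooth_submanifold =
  fixes A :: "('a, 'c::finite_dim_inner \<times> 'f::finite_dim_inner) atlas" and C :: "'a set"
  assumes smooth_manifold: "smooth_manifold A" and embedded_sub: "embedded_submanifold A C"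

sublocale smooth_submanifold \<subseteq> submanifold A C
  by unfold_locales (use smooth_manifold embedded_sub in \<open>auto simp: smooth_manifold_def\<close>)

context smooth_submanifold
begin

text \<open>\<open>K\<close> bounds the support in the base directions. At a point outside the
  bundle chart, the part of the normal bundle over the complement of \<open>K\<close> is a
  neighbourhood on which the function vanishes; it is open because compact sets in the Hausdorff
  base are closed.\<close>

lemma chart_function_smooth:
  fixes G :: "'c \<times> 'f \<Rightarrow> real"
  assumes U: "slice U \<phi>" and K: "compact K" "\<And>x. x \<in> K \<Longrightarrow> (x, 0) \<in> \<phi> ` U"
    and G: "smooth_on UNIV G" "\<And>x y. x \<notin> K \<Longrightarrow> G (x, y) = 0"
  shows "(\<lambda>P. if P \<in> NU U then G (NC \<phi> P) else 0) \<in> smooth_functions N" (is "?F \<in> _")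
proof (rule N.smooth_functionsI)
  fix P assume P: "P \<in> carrier_of N"
  show "smooth_near N P ?F"
  proof (cases "P \<in> NU U")
    case True
    show ?thesis by (rule N.smooth_near_cong[OF N.mopen_chart[OF N_mchart[OF U]] True _
            N.smooth_near_chart[OF N_mchart[OF U] True open_UNIV UNIV_I G(1)]]) simp
  next
    case False
    obtain p \<xi> where p: "P = (p, \<xi>)" "p \<in> C" "\<xi> \<in> normal_space A C p" using P by (auto simp: N_carrier normal_total_def)
    let ?K = "(\<lambda>x. (x, 0 :: 'f)) ` K"
    let ?W = "carrier_of A - iv U \<phi> ` ?K"
    have kU: "iv U \<phi> (x, 0) \<in> U" if "x \<in> K" for x
      using K(2)[OF that] mchart_inj[OF slice_mchart[OF U]] by (simp add: iv_simps)
    have W: "mopen A ?W"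
      using smooth_manifold slice_mchart[OF U] K compact_continuous_image[OF linear_continuous_on[OF bounded_linear_pair0] K(1)]
      by (intro complement_compact) (auto simp: smooth_manifold_def)
    have "p \<notin> U" using False p by simp
    then have PW: "P \<in> NU ?W" using p C_carrier kU by auto
    have F0: "?F Q = 0" if "Q \<in> NU ?W" for Q
    proof (cases "Q \<in> NU U")
      case True
      from NU_memE[OF U True] obtain q y where q: "Q = (q, nv U \<phi> q y)" "q \<in> U" "q \<in> C" "NC \<phi> Q = (fst (\<phi> q), y)" .
      have "fst (\<phi> q) \<notin> K"
      proof
        assume k: "fst (\<phi> q) \<in> K"
        have "q = iv U \<phi> (fst (\<phi> q), 0)"
          using slice_chart_zero[OF U q(2,3)] iv_simps(1)[OF mchart_inj[OF slice_mchart[OF U]] q(2)] by simp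
        then show False using k that q(1) by auto
      qed
      with G(2) q(4) show ?thesis by simp
    next
      case False
      then show ?thesis by (simp only: if_False)
    qed
    show ?thesis by (rule N.smooth_near_cong[OF mopen_N[OF W] PW _ N.smooth_near_const[OF P]]) (rule F0[symmetric])
  qed
next
  fix P assume "P \<notin> carrier_of N"
  then have "P \<notin> NU U" using N_carrier by (auto simp: normal_total_def)
  then show "?F P = 0" by (simp only: if_False)
qed

sublocale N: bump_manifold N
proof
  fix V \<Phi> P T and h :: "'c \<times> 'f \<Rightarrow> real"
  assume V: "(V, \<Phi>) \<in> N" and P: "P \<in> V" and T: "open T" "\<Phi> P \<in> T" "T \<subseteq> \<Phi> ` V" and h: "smooth_on T h"
  obtain U \<phi> where U: "slice U \<phi>" "V = NU U" "\<Phi> = NC \<phi>" using V by (auto simp: normal_atlas_def)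
  obtain R where R: "R > 0" "ball (\<Phi> P) R \<subseteq> T" using T open_contains_ball by blast
  have "R / 2 > 0" using R by simp
  then obtain b where b: "smooth_on UNIV b" "\<And>x. dist x (\<Phi> P) < R / 4 \<Longrightarrow> b x = 1"
      "\<And>x. R / 2 \<le> dist x (\<Phi> P) \<Longrightarrow> b x = (0 :: real)"
    using bump_exists[of "R / 2" "\<Phi> P"] by auto
  define G where "G = (\<lambda>x. if x \<in> ball (\<Phi> P) R then b x * h x else 0)"
  have sG: "smooth_on UNIV G"
    unfolding G_def by (rule smooth_on_bump_mult[OF smooth_on_subset[OF h R(2)] b(1), where r = "R / 2"]) (use R b(3) in auto)
  have far: "G x = 0" if "R / 2 \<le> dist x (\<Phi> P)" for x using b(3)[OF that] by (simp add: G_def)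
  \<comment> \<open>The base projection of the closed ball that contains the support of
    \<open>G\<close>; the ball of radius \<open>R\<close> inside \<open>T\<close> keeps it within
    the slice chart.\<close>
  define K where "K = cball (fst (\<Phi> P)) (R / 2)"
  define F where "F = (\<lambda>Q. if Q \<in> NU U then G (NC \<phi> Q) else 0)"
  have "F \<in> smooth_functions N" unfolding F_def
  proof (rule chart_function_smooth[OF U(1)])
    show "compact K" by (simp add: K_def)
    show "(x, 0) \<in> \<phi> ` U" if "x \<in> K" for x
    proof -
      have "dist (x, snd (\<Phi> P)) (\<Phi> P) = dist x (fst (\<Phi> P))" by (simp add: dist_prod_def)
      then have "(x, snd (\<Phi> P)) \<in> ball (\<Phi> P) R" using that R by (simp add: K_def dist_commute)
      then have "(x, snd (\<Phi> P)) \<in> \<Phi> ` V" using R T by blast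
      with NC_image[OF U(1) order_refl] U show ?thesis by auto
    qed
    show "G (x, y) = 0" if "x \<notin> K" for x y
    proof (rule far)
      have "dist x (fst (\<Phi> P)) \<le> dist (x, y) (\<Phi> P)" using dist_fst_le[of "(x, y)" "\<Phi> P"] by simp
      then show "R / 2 \<le> dist (x, y) (\<Phi> P)" using that by (simp add: K_def dist_commute)
    qed
  qed (rule sG)
  moreover
  have m: "N.mchart V \<Phi>" by (rule N.chart_mchart[OF V])
  have "\<Phi> P \<in> ball (\<Phi> P) (R / 4)" using R by simp
  from N.nbhd_of_chart[OF m P open_ball this]
  obtain W where W: "mopen N W" "P \<in> W" "W \<subseteq> V" "\<And>q. q \<in> W \<Longrightarrow> \<Phi> q \<in> ball (\<Phi> P) (R / 4)" by metis
  have "F Q = h (\<Phi> Q)" if "Q \<in> W" for Q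
  proof -
    have "dist (\<Phi> Q) (\<Phi> P) < R / 4" using W(4)[OF that] by (simp add: dist_commute)
    then have "b (\<Phi> Q) = 1" "\<Phi> Q \<in> ball (\<Phi> P) R" using b(2) R by (auto simp: dist_commute)
    with W(3) that U show ?thesis by (auto simp: F_def G_def)
  qed
  moreover have "F Q = 0" if "Q \<notin> V \<or> \<Phi> Q \<notin> T" for Q using that R U by (auto simp: F_def G_def)
  ultimately show "\<exists>F\<in>smooth_functions N. \<exists>W. mopen N W \<and> P \<in> W \<and> W \<subseteq> V \<and> (\<forall>q\<in>W. F q = h (\<Phi> q)) \<and>
      (\<forall>q. q \<notin> V \<or> \<Phi> q \<notin> T \<longrightarrow> F q = 0)" using W by blast
qed

end

section \<open>Vertical derivatives\<close>

context smooth_submanifold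
begin

abbreviation "FL \<equiv> fibrewise_linear A C"
abbreviation "SC \<equiv> smooth_functions (sub_atlas A C)"
abbreviation "Ntv U \<phi> \<equiv> N.tvec (NU U) (NC \<phi>)"
abbreviation "FP \<equiv> fibre_polynomials A C"
abbreviation "FPF \<equiv> fp_functions A C"
abbreviation "SN \<equiv> smooth_functions N"
abbreviation "ND \<equiv> normal_dual A C"
abbreviation "NS \<equiv> normal_space A C"
abbreviation "vd \<equiv> vertical_derivative A C"
abbreviation "zs \<equiv> normal_zero A C"

lemma totalI [intro]: "p \<in> C \<Longrightarrow> \<xi> \<in> NS p \<Longrightarrow> (p, \<xi>) \<in> carrier_of N"
  by (simp add: N_carrier normal_total_def)

lemma zs_in: "p \<in> C \<Longrightarrow> zs p \<in> NS p"
proof -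
  assume p: "p \<in> C"
  then obtain U \<phi> where U: "slice U \<phi>" "p \<in> U" using slice_exists by blast
  with normal_zero_nv[OF U p] nv_in[OF U p] show ?thesis by simp
qed

lemma fibre_add_scale:
  assumes "p \<in> C" "\<xi> \<in> NS p" "\<eta> \<in> NS p"
  shows "normal_add \<xi> (normal_scale A C p t \<eta>) \<in> NS p"
proof -
  obtain U \<phi> where U: "slice U \<phi>" "p \<in> U" using slice_exists assms(1) by blast
  note U' = U assms(1)
  obtain y where y: "\<xi> = nv U \<phi> p y" using nvC[OF U' assms(2)] by blast
  obtain z where z: "\<eta> = nv U \<phi> p z" using nvC[OF U' assms(3)] by blast
  show ?thesis unfolding y z normal_scale_nv[OF U'] normal_add_nv[OF U'] by (rule nv_in[OF U'])
qed

lemma ND_D: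
  assumes "l \<in> ND p"
  shows "\<eta> \<notin> NS p \<Longrightarrow> l \<eta> = 0"
    "\<eta> \<in> NS p \<Longrightarrow> \<zeta> \<in> NS p \<Longrightarrow> l (normal_add \<eta> (normal_scale A C p c \<zeta>)) = l \<eta> + c * l \<zeta>"
  using assms by (auto simp: normal_dual_def)

lemma ND_add_scale: "l \<in> ND p \<Longrightarrow> l' \<in> ND p \<Longrightarrow> l + c *\<^sub>R l' \<in> ND p"
  by (auto simp: normal_dual_def scaleR_fun_def algebra_simps)

lemma ND_zero: "0 \<in> ND p"
  by (auto simp: normal_dual_def)

lemma ND_sum: "(\<And>i. i \<in> I \<Longrightarrow> l i \<in> ND p) \<Longrightarrow> (\<Sum>i\<in>I. c i *\<^sub>R l i) \<in> ND p"
proof (induction I rule: infinite_finite_induct)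
  case (insert i I)
  then have "(\<Sum>i\<in>I. c i *\<^sub>R l i) + c i *\<^sub>R l i \<in> ND p" by (intro ND_add_scale) auto
  then show ?case unfolding sum.insert[OF insert(1,2)] by (subst add.commute)
qed (simp_all add: ND_zero)

lemma ND_coordI:
  assumes U: "slice U \<phi>" "p \<in> U" "p \<in> C"
    and out: "\<And>\<eta>. \<eta> \<notin> NS p \<Longrightarrow> l \<eta> = 0"
    and lin: "\<And>y z c. l (nv U \<phi> p (y + c *\<^sub>R z)) = l (nv U \<phi> p y) + c * l (nv U \<phi> p z)"
  shows "l \<in> ND p"
  unfolding normal_dual_def
proof (intro CollectI conjI allI impI ballI out)
  fix \<eta> \<zeta> c assume "\<eta> \<in> NS p" "\<zeta> \<in> NS p"
  then obtain y z where yz: "\<eta> = nv U \<phi> p y" "\<zeta> = nv U \<phi> p z" using nvC[OF U] by blast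
  show "l (normal_add \<eta> (normal_scale A C p c \<zeta>)) = l \<eta> + c * l \<zeta>"
    unfolding yz normal_scale_nv[OF U] normal_add_nv[OF U] by (rule lin)
qed

lemma ND_coord:
  assumes U: "slice U \<phi>" "p \<in> U" "p \<in> C" and l: "l \<in> ND p"
  shows "l (nv U \<phi> p y) = y \<bullet> (\<Sum>e\<in>onb. l (nv U \<phi> p e) *\<^sub>R e)"
proof -
  have lin: "l (nv U \<phi> p (y + c *\<^sub>R z)) = l (nv U \<phi> p y) + c * l (nv U \<phi> p z)" for y z c
    using ND_D(2)[OF l nv_in[OF U] nv_in[OF U], of y c z] by (simp only: normal_scale_nv[OF U] normal_add_nv[OF U])
  have 0: "l (nv U \<phi> p 0) = 0" using lin[of 0 1 0] by simp
  have "linear (\<lambda>y. l (nv U \<phi> p y))"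
  proof (rule linearI)
    show "l (nv U \<phi> p (y + z)) = l (nv U \<phi> p y) + l (nv U \<phi> p z)" for y z using lin[of y 1 z] by simp
    show "l (nv U \<phi> p (c *\<^sub>R z)) = c *\<^sub>R l (nv U \<phi> p z)" for c z using lin[of 0 c z] 0 by simp
  qed
  from linear_onb[OF this, of y] show ?thesis by (simp add: inner_sum_right mult.commute)
qed

lemma ND_eqI:
  assumes U: "slice U \<phi>" "p \<in> U" "p \<in> C" and "l \<in> ND p" "l' \<in> ND p" "\<And>y. l (nv U \<phi> p y) = l' (nv U \<phi> p y)"
  shows "l = l'"
proof
  fix \<eta>
  show "l \<eta> = l' \<eta>"
  proof (cases "\<eta> \<in> NS p")
    case True
    then obtain y where "\<eta> = nv U \<phi> p y" using nvC[OF U] by blast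
    with assms(6) show ?thesis by simp
  qed (simp add: ND_D(1)[OF assms(4)] ND_D(1)[OF assms(5)])
qed

lemma fibre_derivative:
  assumes U: "slice U \<phi>" "p \<in> U" "p \<in> C" and F: "smooth_near N (p, nv U \<phi> p (z + t *\<^sub>R y)) F"
  shows "((\<lambda>t. F (p, nv U \<phi> p (z + t *\<^sub>R y))) has_real_derivative
    Ntv U \<phi> (p, nv U \<phi> p (z + t *\<^sub>R y)) (0, y) F) (at t)"
proof -
  let ?f = "F \<circ> iv (NU U) (NC \<phi>)" and ?x = "fst (\<phi> p)" and ?z = "z + t *\<^sub>R y"
  have P: "(p, nv U \<phi> p w) \<in> NU U" for w using U nv_in[OF U] by simp
  have cP: "NC \<phi> (p, nv U \<phi> p w) = (?x, w)" for w by (rule normal_chart_nv[OF U])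
  have iP: "F (p, nv U \<phi> p w) = ?f (?x, w)" for w using iv_simps(1)[OF NC_inj[OF U(1)] P[of w]] cP by simp
  have d: "?f differentiable at (?x, ?z)" using N.smooth_near_differentiable[OF N_mchart[OF U(1)] P F] cP by simp
  have "((\<lambda>t. (?x, z + t *\<^sub>R y)) has_derivative (\<lambda>t. t *\<^sub>R (0, y))) (at t)"
    by (auto intro!: derivative_eq_intros has_derivative_Pair)
  from has_derivative_compose[OF this fd_has_derivative[OF d]]
  have "((\<lambda>t. ?f (?x, z + t *\<^sub>R y)) has_derivative (\<lambda>\<tau>. fd ?f (?x, ?z) (\<tau> *\<^sub>R (0, y)))) (at t)" .
  moreover have "fd ?f (?x, ?z) (\<tau> *\<^sub>R (0, y)) = fd ?f (?x, ?z) (0, y) * \<tau>" for \<tau>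
    unfolding linear_scale[OF fd_linear[OF d]] by simp
  ultimately have "((\<lambda>t. ?f (?x, z + t *\<^sub>R y)) has_real_derivative fd ?f (?x, ?z) (0, y)) (at t)"
    unfolding has_field_derivative_def by (simp only:)
  moreover have "Ntv U \<phi> (p, nv U \<phi> p ?z) (0, y) F = fd ?f (?x, ?z) (0, y)"
    using F cP by (simp only: N.tvec_def if_True)
  ultimately show ?thesis unfolding iP by (simp only:)
qed

lemma vd_eq:
  assumes U: "slice U \<phi>" "p \<in> U" "p \<in> C" and F: "smooth_near N (p, nv U \<phi> p z) F"
  shows "vd p (nv U \<phi> p z) F (nv U \<phi> p y) = Ntv U \<phi> (p, nv U \<phi> p z) (0, y) F"
  using DERIV_imp_deriv[OF fibre_derivative[OF U, of z 0 y F]] F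
  by (simp add: vertical_derivative_def nv_in[OF U] normal_scale_nv[OF U] normal_add_nv[OF U])

lemma vd_outside: "\<eta> \<notin> NS p \<Longrightarrow> vd p \<xi> F \<eta> = 0"
  by (simp add: vertical_derivative_def)

lemma vd_ND:
  assumes p: "p \<in> C" "\<xi> \<in> NS p" and F: "smooth_near N (p, \<xi>) F"
  shows "vd p \<xi> F \<in> ND p"
proof -
  obtain U \<phi> where U: "slice U \<phi>" "p \<in> U" using slice_exists p by blast
  note U = U p(1)
  obtain z where z: "\<xi> = nv U \<phi> p z" using nvC[OF U p(2)] by blast
  have P: "(p, nv U \<phi> p z) \<in> NU U" using U nv_in[OF U] by simp
  show ?thesis
  proof (rule ND_coordI[OF U vd_outside])
    fix y w c
    have "Ntv U \<phi> (p, nv U \<phi> p z) ((0, y) + c *\<^sub>R (0, w)) F =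
        (Ntv U \<phi> (p, nv U \<phi> p z) (0, y) + c *\<^sub>R Ntv U \<phi> (p, nv U \<phi> p z) (0, w)) F"
      by (simp only: N.tvec_add_scale[OF N_mchart[OF U(1)] P])
    then show "vd p \<xi> F (nv U \<phi> p (y + c *\<^sub>R w)) = vd p \<xi> F (nv U \<phi> p y) + c * vd p \<xi> F (nv U \<phi> p w)"
      using F unfolding z by (simp add: vd_eq[OF U] scaleR_fun_def)
  qed
qed

text \<open>For a fixed fibre vector the vertical derivative is a tangent vector, from which it
  inherits linearity and the product rule.\<close>

lemma vd_tangent:
  assumes p: "p \<in> C" "\<xi> \<in> NS p" "\<eta> \<in> NS p"
  shows "\<exists>v\<in>tangent_space N (p, \<xi>). \<forall>F. smooth_near N (p, \<xi>) F \<longrightarrow> vd p \<xi> F \<eta> = v F"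
proof -
  obtain U \<phi> where U: "slice U \<phi>" "p \<in> U" using slice_exists p by blast
  note U = U p(1)
  obtain z where z: "\<xi> = nv U \<phi> p z" using nvC[OF U p(2)] by blast
  obtain y where y: "\<eta> = nv U \<phi> p y" using nvC[OF U p(3)] by blast
  have P: "(p, nv U \<phi> p z) \<in> NU U" using U nv_in[OF U] by simp
  show ?thesis unfolding z y using N.tvec_tangent[OF N_mchart[OF U(1)] P] vd_eq[OF U] by blast
qed

lemma vd_linear:
  assumes p: "p \<in> C" "\<xi> \<in> NS p" and F: "smooth_near N (p, \<xi>) F" and G: "smooth_near N (p, \<xi>) G"
  shows "vd p \<xi> (F + c *\<^sub>R G) = vd p \<xi> F + c *\<^sub>R vd p \<xi> G"
    "vd p \<xi> (F * G) = F (p, \<xi>) *\<^sub>R vd p \<xi> G + G (p, \<xi>) *\<^sub>R vd p \<xi> F"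
proof -
  have "vd p \<xi> (F + c *\<^sub>R G) \<eta> = (vd p \<xi> F + c *\<^sub>R vd p \<xi> G) \<eta> \<and>
    vd p \<xi> (F * G) \<eta> = (F (p, \<xi>) *\<^sub>R vd p \<xi> G + G (p, \<xi>) *\<^sub>R vd p \<xi> F) \<eta>" for \<eta>
  proof (cases "\<eta> \<in> NS p")
    case True
    obtain v where v: "v \<in> tangent_space N (p, \<xi>)" "\<And>F. smooth_near N (p, \<xi>) F \<Longrightarrow> vd p \<xi> F \<eta> = v F"
      using vd_tangent[OF p True] by blast
    show ?thesis
      using v(2)[OF N.smooth_near_linear[OF F G, of c]] v(2)[OF N.smooth_near_times[OF F G]] v(2)[OF F] v(2)[OF G]
        N.tangentD(2)[OF v(1) F G, of c] N.tangentD(3)[OF v(1) F G] by (simp add: scaleR_fun_def)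
  qed (simp add: vd_outside scaleR_fun_def)
  from conjunct1[OF this] conjunct2[OF this]
  show "vd p \<xi> (F + c *\<^sub>R G) = vd p \<xi> F + c *\<^sub>R vd p \<xi> G"
    "vd p \<xi> (F * G) = F (p, \<xi>) *\<^sub>R vd p \<xi> G + G (p, \<xi>) *\<^sub>R vd p \<xi> F"
    by (blast intro: ext)+
qed

lemma SN_near: "F \<in> SN \<Longrightarrow> p \<in> C \<Longrightarrow> \<xi> \<in> NS p \<Longrightarrow> smooth_near N (p, \<xi>) F"
  by (rule N.smooth_functionsD(1)) auto

lemma fibrewise_linearD:
  assumes "F \<in> FL"
  shows "F \<in> SN" "p \<in> C \<Longrightarrow> (\<lambda>\<eta>. F (p, \<eta>)) \<in> ND p"
  using assms by (auto simp: fibrewise_linear_def)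

lemma vd_fibrewise_linear:
  assumes F: "F \<in> FL" and p: "p \<in> C" "\<xi> \<in> NS p"
  shows "vd p \<xi> F = (\<lambda>\<eta>. F (p, \<eta>))"
proof
  fix \<eta>
  note l = fibrewise_linearD(2)[OF F p(1)]
  show "vd p \<xi> F \<eta> = F (p, \<eta>)"
  proof (cases "\<eta> \<in> NS p")
    case True
    have "F (p, normal_add \<xi> (normal_scale A C p t \<eta>)) = F (p, \<xi>) + t * F (p, \<eta>)" for t
      using ND_D(2)[OF l p(2) True] by simp
    moreover have "deriv (\<lambda>t. F (p, \<xi>) + t * F (p, \<eta>)) 0 = F (p, \<eta>)"
      by (rule DERIV_imp_deriv) (auto intro!: derivative_eq_intros)
    ultimately show ?thesis using True by (simp add: vertical_derivative_def)
  next
    case False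
    with ND_D(1)[OF l] vd_outside show ?thesis by simp
  qed
qed

lemma fibrewise_linear_zero: "F \<in> FL \<Longrightarrow> p \<in> C \<Longrightarrow> F (p, zs p) = 0"
proof -
  assume F: "F \<in> FL" and p: "p \<in> C"
  obtain U \<phi> where U: "slice U \<phi>" "p \<in> U" using slice_exists p by blast
  show ?thesis using ND_coord[OF U p fibrewise_linearD(2)[OF F p], of 0] normal_zero_nv[OF U p] by simp
qed

text \<open>The cut-off depends on the base coordinate alone, so multiplying by it preserves
  functions that are linear or affine along the fibres.\<close>

lemma cutoff:
  assumes U: "slice U \<phi>" "p \<in> U" "p \<in> C"
  shows "\<exists>\<beta> W. mopen A W \<and> p \<in> W \<and> W \<subseteq> U \<and> (\<forall>q\<in>W. \<beta> (fst (\<phi> q)) = 1) \<and>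
    (\<forall>G. smooth_on UNIV G \<longrightarrow> (\<lambda>P. if P \<in> NU U then \<beta> (fst (NC \<phi> P)) * G (NC \<phi> P) else 0) \<in> SN)"
proof -
  note m = slice_mchart[OF U(1)]
  have o: "open (dom0 U \<phi>)" by (rule open_slice[OF mchart_open[OF m]])
  have x0: "fst (\<phi> p) \<in> dom0 U \<phi>" using slice_chart_zero[OF U] U(2) by (auto simp: image_iff)
  obtain R where R: "R > 0" "ball (fst (\<phi> p)) R \<subseteq> (dom0 U \<phi>)" using o x0 open_contains_ball by metis
  have "R / 2 > 0" using R by simp
  then obtain \<beta> where b: "smooth_on UNIV \<beta>" "\<And>x. dist x (fst (\<phi> p)) < R / 4 \<Longrightarrow> \<beta> x = 1"
      "\<And>x. R / 2 \<le> dist x (fst (\<phi> p)) \<Longrightarrow> \<beta> x = (0 :: real)"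
    using bump_exists[of "R / 2" "fst (\<phi> p)"] by auto
  have "\<phi> p \<in> ball (\<phi> p) (R / 4)" using R by simp
  from nbhd_of_chart[OF m U(2) open_ball this]
  obtain W where W: "mopen A W" "p \<in> W" "W \<subseteq> U" "\<And>q. q \<in> W \<Longrightarrow> \<phi> q \<in> ball (\<phi> p) (R / 4)" by metis
  have "\<beta> (fst (\<phi> q)) = 1" if "q \<in> W" for q
    using W(4)[OF that] dist_fst_le[of "\<phi> q" "\<phi> p"] b(2)[of "fst (\<phi> q)"] by (simp add: dist_commute)
  moreover have "(\<lambda>P. if P \<in> NU U then \<beta> (fst (NC \<phi> P)) * G (NC \<phi> P) else 0) \<in> SN" if G: "smooth_on UNIV G" for G
  proof -
    have s: "smooth_on UNIV (\<lambda>z. \<beta> (fst z) * G z)"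
      by (rule smooth_on_mult[OF open_UNIV smooth_on_compose[OF open_UNIV open_UNIV subset_UNIV smooth_on_fst b(1)] G])
    show ?thesis by (rule chart_function_smooth[OF U(1) compact_cball[of "fst (\<phi> p)" "R / 2"] _ s])
         (use R b(3) in \<open>auto simp: subset_iff dist_commute\<close>)
  qed
  ultimately show ?thesis using W by blast
qed

text \<open>Over \<open>W\<close> these functions are fibre coordinates, so for \<open>w\<close> in
  the orthonormal basis they form a local frame of the dual bundle that consists of global fibrewise
  linear functions.\<close>

lemma dual_frame:
  assumes U: "slice U \<phi>" "p \<in> U" "p \<in> C"
  shows "\<exists>B W. mopen A W \<and> p \<in> W \<and> W \<subseteq> U \<and> (\<forall>w. B w \<in> FL) \<and>
    (\<forall>w q y. q \<in> W \<inter> C \<longrightarrow> B w (q, nv U \<phi> q y) = y \<bullet> w)"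
proof -
  obtain \<beta> W where W: "mopen A W" "p \<in> W" "W \<subseteq> U" "\<forall>q\<in>W. \<beta> (fst (\<phi> q)) = (1 :: real)"
    and s: "\<And>G. smooth_on UNIV G \<Longrightarrow> (\<lambda>P. if P \<in> NU U then \<beta> (fst (NC \<phi> P)) * G (NC \<phi> P) else 0) \<in> SN"
    using cutoff[OF U] by blast
  define B where "B = (\<lambda>w P. if P \<in> NU U then \<beta> (fst (NC \<phi> P)) * (snd (NC \<phi> P) \<bullet> w) else 0)"
  have B: "B w (q, nv U \<phi> q y) = \<beta> (fst (\<phi> q)) * (y \<bullet> w)" if "q \<in> U" "q \<in> C" for w q y
    using normal_chart_nv[OF U(1) that] nv_in[OF U(1) that] that by (simp add: B_def)
  have "B w \<in> FL" for w unfolding fibrewise_linear_def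
  proof (intro CollectI conjI ballI)
    show "B w \<in> SN" unfolding B_def by (rule s) (intro smooth_on_inner smooth_on_snd smooth_on_const open_UNIV)
    fix q assume q: "q \<in> C"
    show "(\<lambda>\<eta>. B w (q, \<eta>)) \<in> ND q"
    proof (cases "q \<in> U")
      case True
      show ?thesis
        by (rule ND_coordI[OF U(1) True q]) (simp_all add: B[OF True q] inner_add_left algebra_simps, simp add: B_def)
    next
      case False
      then have "(\<lambda>\<eta>. B w (q, \<eta>)) = 0" by (simp add: B_def fun_eq_iff)
      then show ?thesis by (simp only: ND_zero)
    qed
  qed
  moreover have "B w (q, nv U \<phi> q y) = y \<bullet> w" if "q \<in> W \<inter> C" for w q y
    using B[of q w y] W(3,4) that by auto
  ultimately show ?thesis using W by blast
qed

lemma fibrewise_linear_extension: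
  assumes p: "p \<in> C" and l: "l \<in> ND p"
  shows "\<exists>F\<in>FL. (\<lambda>\<eta>. F (p, \<eta>)) = l"
proof -
  obtain U \<phi> where U: "slice U \<phi>" "p \<in> U" using slice_exists p by blast
  note U = U p
  obtain B W where W: "p \<in> W" "\<forall>w. B w \<in> FL"
      "\<forall>w q y. q \<in> W \<inter> C \<longrightarrow> B w (q, nv U \<phi> q y) = y \<bullet> w"
    using dual_frame[OF U] by (elim exE conjE) (erule meta_allE, erule meta_allE, erule meta_impE, assumption)
  let ?w = "\<Sum>e\<in>onb. l (nv U \<phi> p e) *\<^sub>R e"
  have B: "B ?w \<in> FL" using W(2) ..
  have "B ?w (p, nv U \<phi> p y) = l (nv U \<phi> p y)" for y using W(1,3) p unfolding ND_coord[OF U l, of y] by simp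
  then have "(\<lambda>\<eta>. B ?w (p, \<eta>)) = l" by (rule ND_eqI[OF U fibrewise_linearD(2)[OF B p] l])
  then show ?thesis using B ..
qed

end

section \<open>Projection and vertical lift\<close>

context smooth_submanifold
begin

abbreviation "WS k \<equiv> wedge_sections k A C"

lemma WS_outside: "a \<in> WS k \<Longrightarrow> \<not> (p \<in> C \<and> length ls = k \<and> set ls \<subseteq> ND p) \<Longrightarrow> a p ls = 0"
  by (simp add: wedge_sections_def)

lemma WS_alt: "a \<in> WS k \<Longrightarrow> a p (us @ l # l' # ws) = - a p (us @ l' # l # ws)"
  unfolding wedge_sections_def by blast

lemma WS_smooth:
  "a \<in> WS k \<Longrightarrow> length Fs = k \<Longrightarrow> set Fs \<subseteq> FL \<Longrightarrow>
    (\<lambda>p. a p (map (\<lambda>F \<eta>. F (p, \<eta>)) Fs)) \<in> SC"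
  unfolding wedge_sections_def by blast

lemma WS_linear:
  assumes a: "a \<in> WS k" and l: "l \<in> ND p" "l' \<in> ND p"
  shows "a p (us @ (l + c *\<^sub>R l') # ws) = a p (us @ l # ws) + c * a p (us @ l' # ws)"
proof (cases "p \<in> C \<and> length us + length ws + 1 = k \<and> set us \<union> {l, l'} \<union> set ws \<subseteq> ND p")
  case True
  with a show ?thesis unfolding wedge_sections_def by blast
next
  case False
  then have "a p (us @ h # ws) = 0" for h using l by (intro WS_outside[OF a]) auto
  then show ?thesis by simp
qed

lemma WS_zero_arg: "a \<in> WS k \<Longrightarrow> a p (us @ 0 # ws) = 0"
  using WS_linear[OF _ ND_zero ND_zero, of a k p us 1 ws] by simp

lemma WS_scale_arg: "a \<in> WS k \<Longrightarrow> l \<in> ND p \<Longrightarrow> a p (us @ (c *\<^sub>R l) # ws) = c * a p (us @ l # ws)"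
  using WS_linear[OF _ ND_zero, of a k l p us c ws] by (simp add: WS_zero_arg)

lemma WS_sum_arg:
  assumes a: "a \<in> WS k"
  shows "(\<And>i. i \<in> I \<Longrightarrow> l i \<in> ND p) \<Longrightarrow>
    a p (us @ (\<Sum>i\<in>I. c i *\<^sub>R l i) # ws) = (\<Sum>i\<in>I. c i * a p (us @ l i # ws))"
proof (induction I rule: infinite_finite_induct)
  case (insert i I)
  have s: "(\<Sum>i\<in>I. c i *\<^sub>R l i) \<in> ND p" by (rule ND_sum) (use insert in auto)
  have "a p (us @ ((\<Sum>i\<in>I. c i *\<^sub>R l i) + c i *\<^sub>R l i) # ws) = (\<Sum>i\<in>I. c i * a p (us @ l i # ws)) + c i * a p (us @ l i # ws)"
    using WS_linear[OF a s, of "l i" us "c i" ws] insert by simp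
  then show ?case unfolding sum.insert[OF insert(1,2)] by (simp only: add.commute)
qed (simp_all add: WS_zero_arg[OF a])

lemma subspace_WS: "subspace (WS k)"
proof -
  have lin: "a + c *\<^sub>R b \<in> WS k" if ab: "a \<in> WS k" "b \<in> WS k" for a b c unfolding wedge_sections_def
  proof (intro CollectI conjI allI impI ballI; (elim conjE)?)
    have e: "(a + c *\<^sub>R b) p ls = a p ls + c * b p ls" for p ls by (simp add: scaleR_fun_def)
    show "(a + c *\<^sub>R b) p ls = 0" if "\<not> (p \<in> C \<and> length ls = k \<and> set ls \<subseteq> ND p)" for p ls
      unfolding e using WS_outside[OF ab(1) that] WS_outside[OF ab(2) that] by simp
    show "(a + c *\<^sub>R b) p (us @ l # l' # ws) = - (a + c *\<^sub>R b) p (us @ l' # l # ws)" for p us l l' ws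
      unfolding e using WS_alt[OF ab(1), of p us l l' ws] WS_alt[OF ab(2), of p us l l' ws] by simp
    show "(a + c *\<^sub>R b) p (us @ (l + d *\<^sub>R l') # ws) = (a + c *\<^sub>R b) p (us @ l # ws) + d * (a + c *\<^sub>R b) p (us @ l' # ws)"
      if "set us \<union> {l, l'} \<union> set ws \<subseteq> ND p" for p us l l' d ws
      unfolding e using WS_linear[OF ab(1), of l p l' us d ws] WS_linear[OF ab(2), of l p l' us d ws] that by (simp add: algebra_simps)
    fix Fs assume Fs: "length Fs = k" "set Fs \<subseteq> FL"
    have "(\<lambda>p. a p (map (\<lambda>F \<eta>. F (p, \<eta>)) Fs)) + c *\<^sub>R (\<lambda>p. b p (map (\<lambda>F \<eta>. F (p, \<eta>)) Fs)) \<in> SC"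
      by (intro sub.fa.add_S sub.fa.scale_S WS_smooth[OF _ Fs] ab)
    then show "(\<lambda>p. (a + c *\<^sub>R b) p (map (\<lambda>F \<eta>. F (p, \<eta>)) Fs)) \<in> SC"
      by (simp add: plus_fun_def scaleR_fun_def)
  qed
  have 0: "0 \<in> WS k" using sub.fa.zero_S by (auto simp: wedge_sections_def zero_fun_def)
  show ?thesis by (rule subspaceI) (use 0 lin[of _ _ 1] lin[OF 0] in auto)
qed

text \<open>The ideal of the zero section. The differentials of its elements along the zero section
  are the covectors that vanish on TC.\<close>

definition Z0 :: "('a normal \<Rightarrow> real) set"
  where "Z0 = {F \<in> SN. \<forall>q\<in>C. F (q, zs q) = 0}"

lemma Z0_D: "F \<in> Z0 \<Longrightarrow> F \<in> SN" "F \<in> Z0 \<Longrightarrow> q \<in> C \<Longrightarrow> F (q, zs q) = 0"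
  by (auto simp: Z0_def)

lemma Z0_fibrewise_linear: "F \<in> FL \<Longrightarrow> F \<in> Z0"
  using fibrewise_linear_zero fibrewise_linearD(1) by (simp add: Z0_def)

lemma Z0_linear: "F \<in> Z0 \<Longrightarrow> G \<in> Z0 \<Longrightarrow> F + c *\<^sub>R G \<in> Z0"
  by (simp add: Z0_def scaleR_fun_apply N.fa.add_S N.fa.scale_S)

lemma subspace_Z0: "subspace Z0"
proof -
  have 0: "0 \<in> Z0" by (simp add: Z0_def)
  show ?thesis by (rule subspaceI) (use 0 Z0_linear[of _ _ 1] Z0_linear[OF 0] in auto)
qed

lemma tvec_zero_section:
  assumes U: "slice U \<phi>" "p \<in> U" "p \<in> C" and F: "F \<in> Z0"
  shows "Ntv U \<phi> (p, zs p) (x, 0) F = 0"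
proof -
  let ?f = "F \<circ> iv (NU U) (NC \<phi>)" and ?x = "fst (\<phi> p)" and ?T = "dom0 U \<phi>"
  have P: "(p, zs p) \<in> NU U" using U zs_in by simp
  have sF: "smooth_near N (p, zs p) F" by (rule SN_near[OF Z0_D(1)[OF F] U(3) zs_in[OF U(3)]])
  have c: "NC \<phi> (p, zs p) = (?x, 0)" using normal_chart_nv[OF U, of 0] normal_zero_nv[OF U] by simp
  have d: "?f differentiable at (?x, 0)" using N.smooth_near_differentiable[OF N_mchart[OF U(1)] P sF] c by simp
  have T: "open ?T" by (rule open_dom0[OF U(1)])
  have x: "?x \<in> ?T" using slice_chart_zero[OF U] U(2) by (auto simp: image_iff)
  have z: "?f (x', 0) = 0" if x': "x' \<in> ?T" for x'
  proof -
    have "(x', 0) \<in> \<phi> ` U" using x' by simp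
    note i = iv_NC[OF U(1) this]
    show ?thesis using i(1)[of 0] normal_zero_nv[OF U(1) i(2,3)] Z0_D(2)[OF F i(3)] by simp
  qed
  have "fd (\<lambda>x. ?f (x, 0)) ?x = (\<lambda>v. fd ?f (?x, 0) (fd (\<lambda>x :: 'c. (x, 0 :: 'f)) ?x v))"
    by (rule fd_compose[OF bounded_linear_imp_differentiable[OF bounded_linear_pair0] d])
  also have "fd (\<lambda>x :: 'c. (x, 0 :: 'f)) ?x = (\<lambda>x. (x, 0))"
    by (rule fd_eqI[OF bounded_linear_imp_has_derivative[OF bounded_linear_pair0]])
  also have "fd (\<lambda>x. ?f (x, 0)) ?x = (\<lambda>v. 0)"
  proof (rule fd_eqI)
    show "((\<lambda>x. ?f (x, 0)) has_derivative (\<lambda>v. 0)) (at ?x)"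
      by (rule has_derivative_transform_within_open[OF has_derivative_const T x]) (rule z[symmetric])
  qed
  finally have "fd ?f (?x, 0) (x, 0) = 0" by metis
  with sF c show ?thesis by (simp add: N.tvec_def)
qed

text \<open>A tangent vector at a point of the zero section splits into a part along that section,
  which kills \<open>Z0\<close>, and a vertical part.\<close>

lemma Z0_determined:
  assumes p: "p \<in> C" and F: "F \<in> Z0" and G: "G \<in> Z0" and eq: "vd p (zs p) F = vd p (zs p) G"
    and v: "v \<in> tangent_space N (p, zs p)"
  shows "v F = v G"
proof -
  obtain U \<phi> where U: "slice U \<phi>" "p \<in> U" using slice_exists p by blast
  note U = U p
  have P: "(p, zs p) \<in> NU U" using U zs_in by simp
  obtain \<xi> where \<xi>: "v = Ntv U \<phi> (p, zs p) \<xi>" by (rule N.tangent_tvecE[OF v N_mchart[OF U(1)] P])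
  have "v = Ntv U \<phi> (p, zs p) (fst \<xi>, 0) + 1 *\<^sub>R Ntv U \<phi> (p, zs p) (0, snd \<xi>)"
    unfolding N.tvec_add_scale[OF N_mchart[OF U(1)] P, symmetric] \<xi> by simp
  then have "v H = vd p (zs p) H (nv U \<phi> p (snd \<xi>))" if "H \<in> Z0" for H
    using tvec_zero_section[OF U that] vd_eq[OF U, of 0 H] SN_near[OF Z0_D(1)[OF that] p zs_in[OF p]] normal_zero_nv[OF U]
    by simp
  with F G eq show ?thesis by simp
qed

lemma conormal_extension:
  assumes p: "p \<in> C" and l: "l \<in> ND p"
  shows "conormal_extension A C p l \<in> Z0" "vd p (zs p) (conormal_extension A C p l) = l"
proof -
  obtain F where F: "F \<in> FL" "(\<lambda>\<eta>. F (p, \<eta>)) = l" using fibrewise_linear_extension[OF p l] by blast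
  let ?P = "\<lambda>F. F \<in> SN \<and> (\<forall>q\<in>C. F (q, zs q) = 0) \<and> vd p (zs p) F = l"
  have "?P F" using F vd_fibrewise_linear[OF F(1) p zs_in[OF p]] Z0_D[OF Z0_fibrewise_linear[OF F(1)]] by simp
  then have "?P (conormal_extension A C p l)" unfolding conormal_extension_def by (rule someI[where P = ?P])
  then show "conormal_extension A C p l \<in> Z0" "vd p (zs p) (conormal_extension A C p l) = l" by (auto simp: Z0_def)
qed

text \<open>Frees \<open>Proj\<close> from the choice in its definition: by
  \<open>Z0_determined\<close> the chosen extensions have the same differentials as
  \<open>Fs\<close>, and a multiderivation sees nothing else.\<close>

lemma Proj_eq:
  assumes X: "X \<in> N.fa.MD k" and p: "p \<in> C" and Fs: "set Fs \<subseteq> Z0"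
  shows "Proj A C X p (map (vd p (zs p)) Fs) = X Fs (p, zs p)"
proof -
  have nd: "vd p (zs p) F \<in> ND p" if "F \<in> Z0" for F
    by (rule vd_ND[OF p zs_in[OF p] SN_near[OF Z0_D(1)[OF that] p zs_in[OF p]]])
  have P: "(p, zs p) \<in> carrier_of N" using p zs_in by blast
  have "X ([] @ map (conormal_extension A C p) (map (vd p (zs p)) Fs)) (p, zs p) = X ([] @ Fs) (p, zs p)"
  proof (rule N.MD_determined_list[OF X P])
    show "list_all2 (\<lambda>f g. f \<in> SN \<and> g \<in> SN \<and> (\<forall>v\<in>tangent_space N (p, zs p). v f = v g))
        (map (conormal_extension A C p) (map (vd p (zs p)) Fs)) Fs" unfolding list_all2_conv_all_nth
    proof (intro conjI allI impI ballI)
      fix i assume "i < length (map (conormal_extension A C p) (map (vd p (zs p)) Fs))"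
      then have i: "i < length Fs" by simp
      then have F: "Fs ! i \<in> Z0" using Fs by (auto dest: nth_mem)
      note e = conormal_extension[OF p nd[OF F]]
      show "map (conormal_extension A C p) (map (vd p (zs p)) Fs) ! i \<in> SN" using i Z0_D(1)[OF e(1)] by simp
      show "Fs ! i \<in> SN" by (rule Z0_D(1)[OF F])
      fix v assume v: "v \<in> tangent_space N (p, zs p)"
      show "v (map (conormal_extension A C p) (map (vd p (zs p)) Fs) ! i) = v (Fs ! i)"
        using Z0_determined[OF p e(1) F e(2) v] i by simp
    qed simp
  qed
  moreover have "set (map (vd p (zs p)) Fs) \<subseteq> ND p" using Fs nd by auto
  ultimately show ?thesis using p by (simp add: Proj_def)
qed

lemma ND_list_extension:
  assumes p: "p \<in> C" and ls: "set ls \<subseteq> ND p"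
  shows "\<exists>Fs. set Fs \<subseteq> Z0 \<and> ls = map (vd p (zs p)) Fs"
proof (intro exI conjI)
  show "set (map (conormal_extension A C p) ls) \<subseteq> Z0" using conormal_extension(1)[OF p] ls by auto
  show "ls = map (vd p (zs p)) (map (conormal_extension A C p) ls)"
    using conormal_extension(2)[OF p] ls by (auto simp: map_idI subset_iff intro!: map_idI[symmetric])
qed

lemma Proj_outside: "\<not> (p \<in> C \<and> set ls \<subseteq> ND p) \<Longrightarrow> Proj A C X p ls = 0"
  by (auto simp: Proj_def)

text \<open>\<open>\<sigma>\<close> is the fibre coordinate of the section \<open>g\<close> over a
  slice chart; the lemma serves the zero section as well as the section defining the graph.\<close>

lemma pullback_smooth:
  assumes F: "F \<in> SN" and g: "\<And>U \<phi>. slice U \<phi> \<Longrightarrow>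
      \<exists>\<sigma>. smooth_on (dom0 U \<phi>) \<sigma> \<and> (\<forall>q\<in>U \<inter> C. g q = nv U \<phi> q (\<sigma> (fst (\<phi> q))))"
  shows "(\<lambda>p. if p \<in> C then F (p, g p) else 0) \<in> SC" (is "?F \<in> _")
proof (rule sub.smooth_functionsI)
  fix p assume "p \<in> carrier_of (sub_atlas A C)"
  then have p: "p \<in> C" by (simp add: sub_carrier)
  obtain U \<phi> where U: "slice U \<phi>" "p \<in> U" using slice_exists p by blast
  obtain \<sigma> where \<sigma>: "smooth_on (dom0 U \<phi>) \<sigma>" "\<forall>q\<in>U \<inter> C. g q = nv U \<phi> q (\<sigma> (fst (\<phi> q)))"
    using g[OF U(1)] by (elim exE conjE)
  let ?T = "dom0 U \<phi>" and ?f = "F \<circ> iv (NU U) (NC \<phi>)"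
  have s: "smooth_on (cyl U \<phi>) ?f"
    using F N_chart[OF U(1)] NC_image[OF U(1) order_refl] by (auto simp: smooth_functions_def smooth_fun_def)
  have o: "open (cyl U \<phi>)" by (rule open_cyl[OF U(1)])
  have o0: "open ?T" by (rule open_dom0[OF U(1)])
  have s0: "smooth_on ?T (\<lambda>x. ?f (x, \<sigma> x))"
    by (rule smooth_on_compose[OF o0 o _ smooth_on_Pair[OF o0 smooth_on_ident \<sigma>(1)] s]) auto
  have pU: "p \<in> U \<inter> C" using U p by simp
  have x: "(fst \<circ> \<phi>) p \<in> ?T" using slice_chart_zero[OF U p] U(2) by (auto simp: image_iff)
  show "smooth_near (sub_atlas A C) p ?F"
  proof (rule sub.smooth_near_cong[OF sub.mopen_chart[OF sub_mchart[OF U(1)]] pU _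
        sub.smooth_near_chart[OF sub_mchart[OF U(1)] pU o0 x s0]])
    fix q assume q: "q \<in> U \<inter> C"
    have "(fst (\<phi> q), 0) \<in> \<phi> ` U" using slice_chart_zero[OF U(1), of q] q by (auto simp: image_iff)
    note i = iv_NC[OF U(1) this]
    have "iv U \<phi> (fst (\<phi> q), 0) = q"
      using slice_chart_zero[OF U(1), of q] q iv_simps(1)[OF mchart_inj[OF slice_mchart[OF U(1)]], of q] by simp
    then show "?f ((fst \<circ> \<phi>) q, \<sigma> ((fst \<circ> \<phi>) q)) = ?F q"
      using i(1)[of "\<sigma> (fst (\<phi> q))"] \<sigma>(2) q by simp
  qed
qed (simp add: sub_carrier)

lemma zero_section_smooth: "F \<in> SN \<Longrightarrow> (\<lambda>p. if p \<in> C then F (p, zs p) else 0) \<in> SC"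
  by (rule pullback_smooth, assumption, rule exI[of _ "\<lambda>_. 0"], intro conjI ballI smooth_on_const normal_zero_nv) auto

lemma Proj_WS:
  assumes X: "X \<in> N.fa.MD k"
  shows "Proj A C X \<in> WS k"
  unfolding wedge_sections_def
proof (intro CollectI conjI allI impI ballI; (elim conjE)?)
  show "Proj A C X p ls = 0" if "\<not> (p \<in> C \<and> length ls = k \<and> set ls \<subseteq> ND p)" for p ls
    using that N.fa.MD_length[OF X] by (auto simp: Proj_def)
  show "Proj A C X p (us @ l # l' # ws) = - Proj A C X p (us @ l' # l # ws)" for p us l l' ws
  proof -
    let ?e = "conormal_extension A C p"
    have "X (map ?e us @ ?e l # ?e l' # map ?e ws) (p, zs p) = - X (map ?e us @ ?e l' # ?e l # map ?e ws) (p, zs p)"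
      using fun_cong[OF N.fa.MD_alt[OF X, of "map ?e us" "?e l" "?e l'" "map ?e ws"], of "(p, zs p)"]
      by (simp only: fun_Compl_def)
    then show ?thesis by (simp add: Proj_def)
  qed
  fix p us l l' c ws assume p: "p \<in> C" and "set us \<union> {l, l'} \<union> set ws \<subseteq> ND p"
  then have nd: "set us \<subseteq> ND p" "set [l, l'] \<subseteq> ND p" "set ws \<subseteq> ND p" by auto
  obtain Us where Us: "set Us \<subseteq> Z0" "us = map (vd p (zs p)) Us" using ND_list_extension[OF p nd(1)] by blast
  obtain Vs where Vs: "set Vs \<subseteq> Z0" "ws = map (vd p (zs p)) Vs" using ND_list_extension[OF p nd(3)] by blast
  define F where "F = conormal_extension A C p l"
  define G where "G = conormal_extension A C p l'"
  have F: "F \<in> Z0" "vd p (zs p) F = l" unfolding F_def using conormal_extension[OF p, of l] nd by auto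
  have G: "G \<in> Z0" "vd p (zs p) G = l'" unfolding G_def using conormal_extension[OF p, of l'] nd by auto
  have FG: "vd p (zs p) (F + c *\<^sub>R G) = l + c *\<^sub>R l'"
    using vd_linear(1)[OF p zs_in[OF p] SN_near[OF Z0_D(1)[OF F(1)] p zs_in[OF p]] SN_near[OF Z0_D(1)[OF G(1)] p zs_in[OF p]], of c]
      F(2) G(2) by simp
  have e: "Proj A C X p (us @ vd p (zs p) H # ws) = X (Us @ H # Vs) (p, zs p)" if H: "H \<in> Z0" for H
  proof -
    have "set (Us @ H # Vs) \<subseteq> Z0" using Us Vs H by auto
    from Proj_eq[OF X p this] show ?thesis by (simp add: Us(2) Vs(2))
  qed
  have "Proj A C X p (us @ (l + c *\<^sub>R l') # ws) = X (Us @ (F + c *\<^sub>R G) # Vs) (p, zs p)"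
    using e[OF Z0_linear[OF F(1) G(1), of c]] by (simp only: FG)
  also have "\<dots> = X (Us @ F # Vs) (p, zs p) + c * X (Us @ G # Vs) (p, zs p)"
    using N.fa.MD_linear[OF X Z0_D(1)[OF F(1)] Z0_D(1)[OF G(1)], of Us c Vs] by (simp add: scaleR_fun_apply)
  also have "\<dots> = Proj A C X p (us @ l # ws) + c * Proj A C X p (us @ l' # ws)"
    using e[OF F(1)] e[OF G(1)] F(2) G(2) by simp
  finally show "Proj A C X p (us @ (l + c *\<^sub>R l') # ws) = Proj A C X p (us @ l # ws) + c * Proj A C X p (us @ l' # ws)" .
next
  fix Fs assume Fs: "length Fs = k" "set Fs \<subseteq> FL"
  have "(\<lambda>p. if p \<in> C then X Fs (p, zs p) else 0) \<in> SC"
    by (rule zero_section_smooth[OF N.fa.MD_in_S[OF X]])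
  moreover have "Proj A C X p (map (\<lambda>F \<eta>. F (p, \<eta>)) Fs) = (if p \<in> C then X Fs (p, zs p) else 0)" for p
  proof (cases "p \<in> C")
    case True
    have m: "map (\<lambda>F \<eta>. F (p, \<eta>)) Fs = map (vd p (zs p)) Fs"
      using Fs(2) vd_fibrewise_linear[OF _ True zs_in[OF True]] by auto
    have "set Fs \<subseteq> Z0" using Fs(2) Z0_fibrewise_linear by blast
    from Proj_eq[OF X True this] show ?thesis unfolding m using True by simp
  qed (simp add: Proj_def)
  ultimately show "(\<lambda>p. Proj A C X p (map (\<lambda>F \<eta>. F (p, \<eta>)) Fs)) \<in> SC"
    by simp
qed

text \<open>Every list of conormal covectors consists of vertical derivatives of elements of
  \<open>Z0\<close>, so testing on \<open>Z0\<close> loses nothing.\<close>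

lemma Proj_zero_iff:
  assumes X: "X \<in> N.fa.MD k"
  shows "Proj A C X = 0 \<longleftrightarrow> (\<forall>Fs. set Fs \<subseteq> Z0 \<longrightarrow> X Fs \<in> Z0)"
proof
  assume 0: "Proj A C X = 0"
  show "\<forall>Fs. set Fs \<subseteq> Z0 \<longrightarrow> X Fs \<in> Z0"
    unfolding Z0_def[of] using Proj_eq[OF X] 0 N.fa.MD_in_S[OF X] by (auto simp: Z0_def)
next
  assume z: "\<forall>Fs. set Fs \<subseteq> Z0 \<longrightarrow> X Fs \<in> Z0"
  show "Proj A C X = 0"
  proof (intro ext)
    fix p ls
    show "Proj A C X p ls = 0 p ls"
    proof (cases "p \<in> C \<and> set ls \<subseteq> ND p")
      case True
      then obtain Fs where Fs: "set Fs \<subseteq> Z0" "ls = map (vd p (zs p)) Fs" using ND_list_extension by blast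
      with Proj_eq[OF X _ Fs(1), of p] z Z0_D(2) True show ?thesis by simp
    qed (simp add: Proj_outside)
  qed
qed

text \<open>Maps that preserve \<open>Z0\<close> can be inserted into each other and combined
  linearly, and the bracket is built in this way.\<close>

lemma Proj_kernel:
  assumes X: "X \<in> N.fa.MD k" and Y: "Y \<in> N.fa.MD l" and 0: "Proj A C X = 0" "Proj A C Y = 0"
  shows "Proj A C (schouten X Y) = 0"
proof -
  have XY: "schouten X Y \<in> N.fa.MD (k + l - 1)" unfolding schouten_eq_bracket by (rule N.fa.bracket_MD[OF X Y])
  have zX: "X Fs \<in> Z0" and zY: "Y Fs \<in> Z0" if "set Fs \<subseteq> Z0" for Fs
    using Proj_zero_iff[OF X] Proj_zero_iff[OF Y] 0 that by auto
  have "schouten X Y Fs \<in> Z0" if Fs: "set Fs \<subseteq> Z0" for Fs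
  proof -
    have sub: "set (nths Fs I) \<subseteq> Z0" for I using Fs set_nths_subset by (metis order_trans)
    have "X (Y (nths Fs I) # nths Fs (- I)) \<in> Z0" "Y (X (nths Fs I) # nths Fs (- I)) \<in> Z0" for I
      using zX zY sub by simp_all
    then show ?thesis unfolding schouten_def Let_def
      by (intro subspace_sum[OF subspace_Z0] subspace_scale[OF subspace_Z0] subspace_diff[OF subspace_Z0])
  qed
  with Proj_zero_iff[OF XY] show ?thesis by blast
qed

lemma pullback_smooth_near:
  assumes g: "g \<in> SC" and p: "p \<in> C" "\<xi> \<in> NS p"
  shows "smooth_near N (p, \<xi>) (\<lambda>P. g (fst P))"
proof -
  obtain U \<phi> where U: "slice U \<phi>" "p \<in> U" using slice_exists p by blast
  let ?T = "cyl U \<phi>" and ?g = "g \<circ> iv (U \<inter> C) (fst \<circ> \<phi>)"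
  note oS = mchart_open[OF slice_mchart[OF U(1)]]
  have oT: "open ?T" by (rule open_cylinder[OF oS])
  have "smooth_on ((fst \<circ> \<phi>) ` (U \<inter> C)) ?g"
  proof -
    have "(U \<inter> C, fst \<circ> \<phi>) \<in> sub_atlas A C" using U(1) by (auto simp: sub_atlas_def)
    with g show ?thesis unfolding smooth_functions_def smooth_fun_def by blast
  qed
  then have "smooth_on (dom0 U \<phi>) ?g" by (simp only: sub_chart_image[OF U(1) order_refl])
  then have s: "smooth_on ?T (\<lambda>z. ?g (fst z))"
    by (rule smooth_on_compose[OF oT open_slice[OF oS] _ smooth_on_fst, rotated]) auto
  have P: "(p, \<xi>) \<in> NU U" using U p by simp
  have cP: "NC \<phi> (p, \<xi>) \<in> ?T" using imageI[OF P, of "NC \<phi>"] unfolding NC_image[OF U(1) order_refl] .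
  show ?thesis
  proof (rule N.smooth_near_cong[OF N.mopen_chart[OF N_mchart[OF U(1)]] P _
        N.smooth_near_chart[OF N_mchart[OF U(1)] P oT cP s]])
    fix Q assume Q: "Q \<in> NU U"
    from NU_memE[OF U(1) Q] obtain q y where q: "Q = (q, nv U \<phi> q y)" "q \<in> U" "q \<in> C" "NC \<phi> Q = (fst (\<phi> q), y)" .
    show "?g (fst (NC \<phi> Q)) = g (fst Q)" using iv_simps(1)[OF sub_chart_inj[OF U(1)], of q] q by simp
  qed
qed

lemma chart_derivative_smooth_near:
  assumes F: "F \<in> SN" and U: "slice U \<phi>" and P: "P \<in> NU U"
  shows "smooth_near N P (\<lambda>Q. Ntv U \<phi> Q \<zeta> F)"
proof -
  let ?f = "F \<circ> iv (NU U) (NC \<phi>)"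
  have s: "smooth_on (NC \<phi> ` NU U) ?f" using F N_chart[OF U] by (auto simp: smooth_functions_def smooth_fun_def)
  have P': "NC \<phi> P \<in> NC \<phi> ` NU U" using P by (rule imageI)
  show ?thesis
  proof (rule N.smooth_near_cong[OF N.mopen_chart[OF N_mchart[OF U]] P _
        N.smooth_near_chart[OF N_mchart[OF U] P N.mchart_open[OF N_mchart[OF U]] P' smooth_on_fd[OF s]]])
    fix Q assume Q: "Q \<in> NU U"
    then have "Q \<in> carrier_of N" by auto
    then show "fd ?f (NC \<phi> Q) \<zeta> = Ntv U \<phi> Q \<zeta> F"
      using N.smooth_functionsD(1)[OF F] by (simp add: N.tvec_def)
  qed
qed

text \<open>The vertical derivatives are expanded in a local frame of the dual bundle, one after the other.\<close>

lemma vert_smooth_near: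
  assumes a: "a \<in> WS k" and p: "p \<in> C" "\<xi> \<in> NS p"
  shows "set Fs \<subseteq> SN \<Longrightarrow> set Gs \<subseteq> FL \<Longrightarrow>
    smooth_near N (p, \<xi>) (\<lambda>Q. a (fst Q) (map (\<lambda>G \<eta>. G (fst Q, \<eta>)) Gs @ map (vd (fst Q) (snd Q)) Fs))"
proof (induction Fs arbitrary: Gs)
  case Nil
  show ?case
  proof (cases "length Gs = k")
    case True
    with pullback_smooth_near[OF WS_smooth[OF a True Nil(2)] p] show ?thesis by simp
  next
    case False
    then have "(\<lambda>Q. a (fst Q) (map (\<lambda>G \<eta>. G (fst Q, \<eta>)) Gs @ map (vd (fst Q) (snd Q)) [])) = (\<lambda>Q. 0)"
      by (intro ext WS_outside[OF a]) simp
    with N.smooth_near_const[OF totalI[OF p]] show ?thesis by simp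
  qed
next
  case (Cons F Fs)
  obtain U \<phi> where U: "slice U \<phi>" "p \<in> U" using slice_exists p by blast
  note U = U p(1)
  from dual_frame[OF U] obtain B W where W: "mopen A W" "p \<in> W" "W \<subseteq> U" and B: "\<forall>w. B w \<in> FL"
    and BW: "\<forall>w q y. q \<in> W \<inter> C \<longrightarrow> B w (q, nv U \<phi> q y) = y \<bullet> w"
    by (elim exE conjE) (erule meta_allE, erule meta_allE, erule meta_impE, assumption)
  have F: "F \<in> SN" and Fs: "set Fs \<subseteq> SN" using Cons.prems by auto
  have B': "B w \<in> FL" for w using B ..
  let ?a = "\<lambda>e Q. a (fst Q) (map (\<lambda>G \<eta>. G (fst Q, \<eta>)) (Gs @ [B e]) @ map (vd (fst Q) (snd Q)) Fs)"
  let ?D = "\<lambda>e Q. Ntv U \<phi> Q (0, e) F"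
  have P: "(p, \<xi>) \<in> NU U" "(p, \<xi>) \<in> NU W" using U W p by auto
  have "smooth_near N (p, \<xi>) (?D e * ?a e)" for e
    by (rule N.smooth_near_times[OF chart_derivative_smooth_near[OF F U(1) P(1)] Cons.IH[OF Fs]]) (use Cons.prems B' in auto)
  then have s: "smooth_near N (p, \<xi>) (\<Sum>e\<in>onb. ?D e * ?a e)" by (intro N.smooth_near_sum totalI p)
  show ?case
  proof (rule N.smooth_near_cong[OF mopen_N[OF W(1)] P(2) _ s])
    fix Q assume Q: "Q \<in> NU W"
    then have QU: "Q \<in> NU U" using W by auto
    from NU_memE[OF U(1) QU] obtain q z where q: "Q = (q, nv U \<phi> q z)" "q \<in> U" "q \<in> C" "NC \<phi> Q = (fst (\<phi> q), z)" .
    note Uq = U(1) q(2,3)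
    have sF: "smooth_near N (q, nv U \<phi> q z) F" by (rule SN_near[OF F q(3) nv_in[OF Uq]])
    have nd: "vd q (nv U \<phi> q z) F \<in> ND q" by (rule vd_ND[OF q(3) nv_in[OF Uq] sF])
    let ?l = "\<lambda>e \<eta>. B e (q, \<eta>)"
    have l: "?l e \<in> ND q" for e by (rule fibrewise_linearD(2)[OF B' q(3)])
    have "vd q (nv U \<phi> q z) F = (\<Sum>e\<in>onb. ?D e Q *\<^sub>R ?l e)"
    proof (rule ND_eqI[OF Uq nd ND_sum[OF l]])
      fix y
      have "vd q (nv U \<phi> q z) F (nv U \<phi> q y) = (\<Sum>e\<in>onb. (y \<bullet> e) * vd q (nv U \<phi> q z) F (nv U \<phi> q e))"
        using ND_coord[OF Uq nd, of y] by (simp add: inner_sum_right mult.commute)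
      also have "\<dots> = (\<Sum>e\<in>onb. ?D e Q * (y \<bullet> e))"
        by (rule sum.cong[OF refl]) (simp add: vd_eq[OF Uq sF] q(1))
      also have "\<dots> = (\<Sum>e\<in>onb. ?D e Q * ?l e (nv U \<phi> q y))"
        by (rule sum.cong[OF refl]) (use BW Q q in simp)
      finally show "vd q (nv U \<phi> q z) F (nv U \<phi> q y) = (\<Sum>e\<in>onb. ?D e Q *\<^sub>R ?l e) (nv U \<phi> q y)"
        by (simp add: sum_fun_apply scaleR_fun_apply)
    qed
    then have "a q (map (\<lambda>G \<eta>. G (q, \<eta>)) Gs @ vd q (nv U \<phi> q z) F # map (vd q (nv U \<phi> q z)) Fs) =
        (\<Sum>e\<in>onb. ?D e Q * a q (map (\<lambda>G \<eta>. G (q, \<eta>)) Gs @ ?l e # map (vd q (nv U \<phi> q z)) Fs))"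
      using WS_sum_arg[OF a l, where c = "\<lambda>e. ?D e Q" and I = onb] by (simp only:)
    then show "(\<Sum>e\<in>onb. ?D e * ?a e) Q = a (fst Q) (map (\<lambda>G \<eta>. G (fst Q, \<eta>)) Gs @ map (vd (fst Q) (snd Q)) (F # Fs))"
      by (simp add: sum_fun_apply q(1))
  qed
qed

section \<open>Vertical lifts as an abelian complement of the kernel\<close>

lemma vert_apply:
  "set Fs \<subseteq> SN \<Longrightarrow> p \<in> C \<Longrightarrow> \<xi> \<in> NS p \<Longrightarrow> vert A C a Fs (p, \<xi>) = a p (map (vd p \<xi>) Fs)"
  by (simp add: vert_def normal_total_def)

lemma vert_outside: "\<not> (set Fs \<subseteq> SN \<and> P \<in> carrier_of N) \<Longrightarrow> vert A C a Fs P = 0"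
  by (cases P) (auto simp: vert_def N_carrier)

lemma vert_eqI:
  assumes "\<And>p \<xi>. p \<in> C \<Longrightarrow> \<xi> \<in> NS p \<Longrightarrow> f (p, \<xi>) = g (p, \<xi>)" "\<And>P. P \<notin> carrier_of N \<Longrightarrow> f P = g P"
  shows "f = g"
proof
  fix P
  show "f P = g P" using assms by (cases P; cases "P \<in> carrier_of N") (auto simp: N_carrier normal_total_def)
qed

lemma vert_MD:
  assumes a: "a \<in> WS k"
  shows "vert A C a \<in> N.fa.MD k"
proof (rule N.fa.MD_I)
  fix Fs assume n: "\<not> (length Fs = k \<and> set Fs \<subseteq> SN)"
  show "vert A C a Fs = 0"
  proof (rule vert_eqI)
    fix p \<xi> assume p: "p \<in> C" "\<xi> \<in> NS p"
    have "a p (map (vd p \<xi>) Fs) = 0" if "set Fs \<subseteq> SN" using n that by (intro WS_outside[OF a]) simp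
    then show "vert A C a Fs (p, \<xi>) = 0 (p, \<xi>)" by (auto simp: vert_def)
  qed (simp add: vert_outside)
next
  fix Fs
  show "vert A C a Fs \<in> SN"
  proof (rule N.smooth_functionsI)
    fix P assume P: "P \<in> carrier_of N"
    then obtain p \<xi> where p: "P = (p, \<xi>)" "p \<in> C" "\<xi> \<in> NS p" by (auto simp: N_carrier normal_total_def)
    show "smooth_near N P (vert A C a Fs)"
    proof (cases "set Fs \<subseteq> SN")
      case True
      obtain U \<phi> where U: "slice U \<phi>" "p \<in> U" using slice_exists p by blast
      have PU: "(p, \<xi>) \<in> NU U" using U p by simp
      show ?thesis unfolding p(1)
      proof (rule N.smooth_near_cong[OF N.mopen_chart[OF N_mchart[OF U(1)]] PU _ vert_smooth_near[OF a p(2,3) True, of "[]"]])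
        fix Q assume "Q \<in> NU U"
        then show "a (fst Q) (map (\<lambda>G \<eta>. G (fst Q, \<eta>)) [] @ map (vd (fst Q) (snd Q)) Fs) = vert A C a Fs Q"
          using vert_apply[OF True, of "fst Q" "snd Q" a] by auto
      qed simp
    next
      case False
      then have "vert A C a Fs = (\<lambda>Q. 0)" by (intro ext vert_outside) simp
      with N.smooth_near_const[OF P] show ?thesis by simp
    qed
  qed (simp add: vert_outside)
next
  fix us f g c ws assume s: "set us \<union> {f, g} \<union> set ws \<subseteq> SN"
  then have f: "f \<in> SN" and g: "g \<in> SN" by auto
  have s': "set (us @ h # ws) \<subseteq> SN" if "h \<in> SN" for h using s that by auto
  note ap = vert_apply[OF s']
  show "vert A C a (us @ (f + c *\<^sub>R g) # ws) = vert A C a (us @ f # ws) + c *\<^sub>R vert A C a (us @ g # ws) \<and>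
    vert A C a (us @ (f * g) # ws) = f * vert A C a (us @ g # ws) + g * vert A C a (us @ f # ws)"
  proof (intro conjI vert_eqI)
    fix p \<xi> assume p: "p \<in> C" "\<xi> \<in> NS p"
    note fn = SN_near[OF f p] and gn = SN_near[OF g p]
    note nd = vd_ND[OF p fn] vd_ND[OF p gn]
    show "vert A C a (us @ (f + c *\<^sub>R g) # ws) (p, \<xi>) = (vert A C a (us @ f # ws) + c *\<^sub>R vert A C a (us @ g # ws)) (p, \<xi>)"
      unfolding plus_fun_apply scaleR_fun_apply ap[OF N.fa.add_S[OF f N.fa.scale_S[OF g]] p] ap[OF f p] ap[OF g p]
        map_append list.map(2) vd_linear(1)[OF p fn gn] WS_linear[OF a nd] real_scaleR_def by (rule refl)
    have n1: "f (p, \<xi>) *\<^sub>R vd p \<xi> g \<in> ND p" using ND_add_scale[OF ND_zero nd(2), of "f (p, \<xi>)"] by simp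
    show "vert A C a (us @ (f * g) # ws) (p, \<xi>) = (f * vert A C a (us @ g # ws) + g * vert A C a (us @ f # ws)) (p, \<xi>)"
      unfolding plus_fun_apply times_fun_apply ap[OF N.fa.mult_S[OF f g] p] ap[OF f p] ap[OF g p]
        map_append list.map(2) vd_linear(2)[OF p fn gn] WS_linear[OF a n1 nd(1)] WS_scale_arg[OF a nd(2)] by (rule refl)
  qed (simp_all add: vert_outside scaleR_fun_apply)
next
  fix us f g ws
  show "vert A C a (us @ f # g # ws) = - vert A C a (us @ g # f # ws)"
  proof (rule vert_eqI)
    fix p \<xi>
    show "vert A C a (us @ f # g # ws) (p, \<xi>) = (- vert A C a (us @ g # f # ws)) (p, \<xi>)"
      using WS_alt[OF a, of p "map (vd p \<xi>) us" "vd p \<xi> f" "vd p \<xi> g" "map (vd p \<xi>) ws"] by (auto simp: vert_def)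
  qed (simp add: vert_outside)
qed

lemma vert_linear: "vert A C (a + c *\<^sub>R b) = vert A C a + c *\<^sub>R vert A C b"
  by (intro ext) (auto simp: vert_def scaleR_fun_apply)

lemma Proj_linear: "Proj A C (X + c *\<^sub>R Y) = Proj A C X + c *\<^sub>R Proj A C Y"
  by (intro ext) (auto simp: Proj_def scaleR_fun_apply)

lemma Proj_vert:
  assumes a: "a \<in> WS k"
  shows "Proj A C (vert A C a) = a"
proof (intro ext)
  fix p ls
  show "Proj A C (vert A C a) p ls = a p ls"
  proof (cases "p \<in> C \<and> set ls \<subseteq> ND p")
    case True
    then obtain Fs where Fs: "set Fs \<subseteq> Z0" "ls = map (vd p (zs p)) Fs" using ND_list_extension by blast
    have "set Fs \<subseteq> SN" using Fs(1) Z0_D(1) by blast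
    then show ?thesis
      using Proj_eq[OF vert_MD[OF a] _ Fs(1), of p] vert_apply[of Fs p "zs p" a] zs_in[of p] True Fs(2) by simp
  next
    case False
    with Proj_outside[OF False] WS_outside[OF a, of p ls] show ?thesis by auto
  qed
qed

text \<open>On such functions a vertical lift gives a result that is constant along the fibres,
  which a second vertical lift annihilates.\<close>

definition fibrewise_affine :: "('a normal \<Rightarrow> real) set"
  where "fibrewise_affine = {F \<in> SN. \<forall>p\<in>C. \<forall>\<xi>\<in>NS p. \<forall>\<eta>\<in>NS p. vd p \<xi> F = vd p \<eta> F}"

text \<open>The linear part of \<open>F\<close> in the bundle chart, cut off along the base, has the
  required differential at the given point.\<close>

lemma affine_representative:
  assumes F: "F \<in> SN" and p: "p \<in> C" "\<xi> \<in> NS p"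
  shows "\<exists>G\<in>fibrewise_affine. \<forall>v\<in>tangent_space N (p, \<xi>). v F = v G"
proof -
  obtain U \<phi> where U: "slice U \<phi>" "p \<in> U" using slice_exists p by blast
  note U = U p(1)
  have P: "(p, \<xi>) \<in> NU U" using U p by simp
  obtain \<beta> W where W: "mopen A W" "p \<in> W" "W \<subseteq> U" "\<forall>q\<in>W. \<beta> (fst (\<phi> q)) = (1 :: real)"
    and s: "\<And>G. smooth_on UNIV G \<Longrightarrow> (\<lambda>P. if P \<in> NU U then \<beta> (fst (NC \<phi> P)) * G (NC \<phi> P) else 0) \<in> SN"
    using cutoff[OF U] by blast
  let ?f = "F \<circ> iv (NU U) (NC \<phi>)"
  define g where "g = (\<Sum>e\<in>onb. fd ?f (NC \<phi> (p, \<xi>)) e *\<^sub>R e)"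
  define G where "G = (\<lambda>P. if P \<in> NU U then \<beta> (fst (NC \<phi> P)) * (NC \<phi> P \<bullet> g) else 0)"
  have GS: "G \<in> SN" unfolding G_def by (rule s) (intro smooth_on_inner smooth_on_ident smooth_on_const open_UNIV)
  have G: "G (q, nv U \<phi> q y) = \<beta> (fst (\<phi> q)) * ((fst (\<phi> q), y) \<bullet> g)" if "q \<in> U" "q \<in> C" for q y
    using normal_chart_nv[OF U(1) that] nv_in[OF U(1) that] that by (simp add: G_def)
  have "G \<in> fibrewise_affine" unfolding fibrewise_affine_def
  proof (intro CollectI conjI ballI GS)
    fix q \<zeta> \<zeta>' assume q: "q \<in> C" "\<zeta> \<in> NS q" "\<zeta>' \<in> NS q"
    show "vd q \<zeta> G = vd q \<zeta>' G"
    proof (cases "q \<in> U")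
      case True
      note Uq = U(1) True q(1)
      have "vd q \<zeta> G (nv U \<phi> q y) = \<beta> (fst (\<phi> q)) * (y \<bullet> snd g)" if z: "\<zeta> \<in> NS q" for \<zeta> y
      proof -
        obtain z where z: "\<zeta> = nv U \<phi> q z" using nvC[OF Uq z] by blast
        have "vd q \<zeta> G (nv U \<phi> q y) = deriv (\<lambda>t. \<beta> (fst (\<phi> q)) * ((fst (\<phi> q), z + t *\<^sub>R y) \<bullet> g)) 0"
          by (simp add: z vertical_derivative_def nv_in[OF Uq] normal_scale_nv[OF Uq] normal_add_nv[OF Uq] G[OF True q(1)])
        also have "\<dots> = \<beta> (fst (\<phi> q)) * (y \<bullet> snd g)"
          by (rule DERIV_imp_deriv) (auto intro!: derivative_eq_intros simp: inner_prod_def inner_add_left)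
        finally show ?thesis .
      qed
      then have "vd q \<zeta> G (nv U \<phi> q y) = vd q \<zeta>' G (nv U \<phi> q y)" for y using q by simp
      then show ?thesis
        by (rule ND_eqI[OF Uq vd_ND[OF q(1,2) SN_near[OF GS q(1,2)]] vd_ND[OF q(1,3) SN_near[OF GS q(1,3)]]])
    next
      case False
      then have z: "G (q, \<eta>) = 0" for \<eta> by (simp add: G_def)
      show ?thesis unfolding vertical_derivative_def z ..
    qed
  qed
  moreover have "v F = v G" if v: "v \<in> tangent_space N (p, \<xi>)" for v
  proof -
    obtain \<zeta> where \<zeta>: "v = Ntv U \<phi> (p, \<xi>) \<zeta>" by (rule N.tangent_tvecE[OF v N_mchart[OF U(1)] P])
    have PW: "(p, \<xi>) \<in> NU W" using W p by simp
    have "v G = v (\<lambda>Q. NC \<phi> Q \<bullet> g)"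
    proof (rule N.tangent_local[OF v mopen_N[OF W(1)] PW])
      fix Q assume Q: "Q \<in> NU W"
      then have QU: "Q \<in> NU U" using W by auto
      from NU_memE[OF U(1) QU] obtain q z where q: "Q = (q, nv U \<phi> q z)" "q \<in> U" "q \<in> C" "NC \<phi> Q = (fst (\<phi> q), z)" .
      show "G Q = NC \<phi> Q \<bullet> g" using QU q Q W(4) by (simp add: G_def)
    qed
    also have "\<dots> = \<zeta> \<bullet> g" unfolding \<zeta> by (rule N.tvec_coord[OF N_mchart[OF U(1)] P])
    also have "\<dots> = fd ?f (NC \<phi> (p, \<xi>)) \<zeta>"
      using linear_onb[OF fd_linear[OF N.smooth_near_differentiable[OF N_mchart[OF U(1)] P SN_near[OF F p]]], of \<zeta>]
      by (simp add: g_def inner_sum_right mult.commute)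
    also have "\<dots> = v F" using SN_near[OF F p] by (simp add: \<zeta> N.tvec_def)
    finally show ?thesis ..
  qed
  ultimately show ?thesis by blast
qed

abbreviation "same_diff P \<equiv> list_all2 (\<lambda>f g. f \<in> SN \<and> g \<in> SN \<and> (\<forall>v\<in>tangent_space N P. v f = v g))"

lemma affine_list_representative:
  assumes "p \<in> C" "\<xi> \<in> NS p" "set Fs \<subseteq> SN"
  shows "\<exists>Gs. set Gs \<subseteq> fibrewise_affine \<and>
    same_diff (p, \<xi>) Fs Gs"
  using assms(3)
proof (induction Fs)
  case (Cons F Fs)
  then have F: "F \<in> SN" and Fs: "set Fs \<subseteq> SN" by simp_all
  obtain Gs where Gs: "set Gs \<subseteq> fibrewise_affine"
    "same_diff (p, \<xi>) Fs Gs"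
    using Cons.IH[OF Fs] by (elim exE conjE)
  obtain G where G: "G \<in> fibrewise_affine" "\<forall>v\<in>tangent_space N (p, \<xi>). v F = v G"
    using affine_representative[OF F assms(1,2)] by (elim bexE)
  have "G \<in> SN" using G(1) unfolding fibrewise_affine_def by (elim CollectE conjE)
  show ?case by (rule exI[of _ "G # Gs"], simp only: list.simps insert_subset list_all2_Cons)
       (intro conjI G Gs F \<open>G \<in> SN\<close>)
qed simp

lemma vert_vert_affine:
  assumes a: "a \<in> WS k" and b: "b \<in> WS l" and Fs: "set Fs \<subseteq> fibrewise_affine" "set Gs \<subseteq> fibrewise_affine"
  shows "vert A C a (vert A C b Fs # Gs) = 0"
proof (rule vert_eqI)
  fix p \<xi> assume p: "p \<in> C" "\<xi> \<in> NS p"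
  have S: "set Fs \<subseteq> SN" "set Gs \<subseteq> SN" using Fs by (auto simp: fibrewise_affine_def)
  have H: "vert A C b Fs \<in> SN" by (rule N.fa.MD_in_S[OF vert_MD[OF b]])
  have const: "vert A C b Fs (p, \<eta>) = vert A C b Fs (p, \<xi>)" if \<eta>: "\<eta> \<in> NS p" for \<eta>
  proof -
    have "map (vd p \<eta>) Fs = map (vd p \<xi>) Fs" using Fs(1) p \<eta> by (auto simp: fibrewise_affine_def)
    then show ?thesis unfolding vert_apply[OF S(1) p(1) \<eta>] vert_apply[OF S(1) p] by (rule arg_cong)
  qed
  have "vd p \<xi> (vert A C b Fs) = 0"
  proof
    fix \<eta>
    show "vd p \<xi> (vert A C b Fs) \<eta> = 0 \<eta>"
    proof (cases "\<eta> \<in> NS p")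
      case True
      have "vert A C b Fs (p, normal_add \<xi> (normal_scale A C p t \<eta>)) = vert A C b Fs (p, \<xi>)" for t
        by (rule const[OF fibre_add_scale[OF p True]])
      then show ?thesis by (simp add: vertical_derivative_def)
    qed (simp add: vd_outside)
  qed
  then show "vert A C a (vert A C b Fs # Gs) (p, \<xi>) = 0 (p, \<xi>)"
    using vert_apply[of "vert A C b Fs # Gs" p \<xi> a] H S p WS_zero_arg[OF a, of p "[]"] by simp
qed (simp add: vert_outside)

text \<open>At each point the arguments may be replaced by fibrewise affine functions with the same
  differentials, for which every summand of the bracket vanishes.\<close>

lemma vert_abelian:
  assumes a: "a \<in> WS k" and b: "b \<in> WS l"
  shows "schouten (vert A C a) (vert A C b) = 0"
proof
  fix Fs
  have M: "schouten (vert A C a) (vert A C b) \<in> N.fa.MD (k + l - 1)"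
    unfolding schouten_eq_bracket by (rule N.fa.bracket_MD[OF vert_MD[OF a] vert_MD[OF b]])
  have aff: "schouten (vert A C a) (vert A C b) Gs = 0" if Gs: "set Gs \<subseteq> fibrewise_affine" for Gs
  proof -
    have sub: "set (nths Gs I) \<subseteq> fibrewise_affine" for I using Gs set_nths_subset by (metis order_trans)
    show ?thesis
      unfolding schouten_def Let_def vert_vert_affine[OF a b sub sub] vert_vert_affine[OF b a sub sub] by simp
  qed
  show "schouten (vert A C a) (vert A C b) Fs = 0 Fs"
  proof (cases "set Fs \<subseteq> SN")
    case True
    show ?thesis
    proof (rule vert_eqI)
      fix p \<xi> assume p: "p \<in> C" "\<xi> \<in> NS p"
      obtain Gs where Gs: "set Gs \<subseteq> fibrewise_affine"
        "same_diff (p, \<xi>) Fs Gs"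
        using affine_list_representative[OF p True] by blast
      from N.MD_determined_list[OF M totalI[OF p] Gs(2), of "[]"]
      show "schouten (vert A C a) (vert A C b) Fs (p, \<xi>) = (0 Fs) (p, \<xi>)" using aff[OF Gs(1)] by simp
    next
      fix P assume "P \<notin> carrier_of N"
      then show "schouten (vert A C a) (vert A C b) Fs P = (0 Fs) P"
        using N.smooth_functionsD(2)[OF N.fa.MD_in_S[OF M]] by simp
    qed
  next
    case False
    with N.fa.MD_outside[OF M] show ?thesis by simp
  qed
qed

end

section \<open>The algebra\<close>

definition extended :: "(nat \<Rightarrow> 'b set) \<Rightarrow> int \<Rightarrow> 'b::zero set"
  where "extended G d = (if d \<ge> 0 then G (nat d) else {0})"

text \<open>The absolute value keeps the parity of a negative degree, where the element is 0; so
  signs can be computed with natural numbers throughout.\<close>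

lemma extendedE:
  assumes "x \<in> extended G p" "\<And>k. 0 \<in> G k"
  obtains k where "x \<in> G k" "even p \<longleftrightarrow> even k" "p = int k \<or> x = 0"
  using that[of "nat \<bar>p\<bar>"] assms by (cases "p \<ge> 0") (auto simp: extended_def even_nat_iff)

lemma extended_int: "x \<in> G k \<Longrightarrow> x \<in> extended G (int k)"
  by (simp add: extended_def)

lemma subspace_extended: "(\<And>k. subspace (G k)) \<Longrightarrow> subspace (extended G p)"
  by (simp add: extended_def)

context smooth_submanifold
begin

lemma fibre_polynomial_outside: "f \<in> FP p \<Longrightarrow> \<eta> \<notin> NS p \<Longrightarrow> f \<eta> = 0"
  by (induction rule: fibre_polynomials.induct) (auto simp: normal_dual_def)

lemma fibre_polynomial_scale:
  assumes f: "f \<in> FP p"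
  shows "c *\<^sub>R f \<in> FP p"
proof -
  have "c *\<^sub>R f = (\<lambda>\<eta>. if \<eta> \<in> NS p then c else 0) * f"
  proof
    show "(c *\<^sub>R f) \<eta> = ((\<lambda>\<eta>. if \<eta> \<in> NS p then c else 0) * f) \<eta>" for \<eta>
      using fibre_polynomial_outside[OF f] by (simp add: scaleR_fun_apply)
  qed
  with fibre_polynomials.mult[OF fibre_polynomials.const f] show ?thesis by simp
qed

lemma polynomial_functions_fp: "polynomial_functions SN (FPF)"
proof
  have 0: "0 \<in> FPF"
  proof -
    have "(\<lambda>\<eta>. if \<eta> \<in> NS p then 0 else 0) \<in> FP p" for p by (rule fibre_polynomials.const)
    then show ?thesis by (simp add: fp_functions_def zero_fun_def[symmetric])
  qed
  have fpI: "h \<in> FPF" if "h \<in> SN" "\<And>p. p \<in> C \<Longrightarrow> (\<lambda>\<eta>. h (p, \<eta>)) \<in> FP p" for h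
    unfolding fp_functions_def by (intro CollectI conjI ballI that)
  have fpD: "h \<in> SN" "p \<in> C \<Longrightarrow> (\<lambda>\<eta>. h (p, \<eta>)) \<in> FP p" if "h \<in> FPF" for h p
    using that by (simp_all add: fp_functions_def)
  show "FPF \<subseteq> SN" by (auto simp: fp_functions_def)
  show "subspace (FPF)"
  proof (rule subspaceI)
    fix f g assume f: "f \<in> FPF" and g: "g \<in> FPF"
    have e: "(\<lambda>\<eta>. (f + g) (p, \<eta>)) = (\<lambda>\<eta>. f (p, \<eta>)) + (\<lambda>\<eta>. g (p, \<eta>))" for p by (simp add: plus_fun_def)
    show "f + g \<in> FPF"
      by (rule fpI[OF N.fa.add_S[OF fpD(1)[OF f] fpD(1)[OF g]]], unfold e) (intro fibre_polynomials.add fpD(2)[OF f] fpD(2)[OF g])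
  next
    fix c f assume f: "f \<in> FPF"
    have e: "(\<lambda>\<eta>. (c *\<^sub>R f) (p, \<eta>)) = c *\<^sub>R (\<lambda>\<eta>. f (p, \<eta>))" for p by (simp add: scaleR_fun_def)
    show "c *\<^sub>R f \<in> FPF"
      by (rule fpI[OF N.fa.scale_S[OF fpD(1)[OF f]]], unfold e) (intro fibre_polynomial_scale fpD(2)[OF f])
  qed (rule 0)
  fix f g assume f: "f \<in> FPF" and g: "g \<in> FPF"
  have e: "(\<lambda>\<eta>. (f * g) (p, \<eta>)) = (\<lambda>\<eta>. f (p, \<eta>)) * (\<lambda>\<eta>. g (p, \<eta>))" for p by (simp add: times_fun_def)
  show "f * g \<in> FPF"
    by (rule fpI[OF N.fa.mult_S[OF fpD(1)[OF f] fpD(1)[OF g]]], unfold e) (intro fibre_polynomials.mult fpD(2)[OF f] fpD(2)[OF g])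
qed

lemma subspace_chi_fp: "subspace (chi_fp k A C)"
  unfolding chi_fp_eq_chi[OF polynomial_functions_fp]
  by (rule polynomial_functions.subspace_chi[OF polynomial_functions_fp])

lemma chi_fp_MD: "X \<in> chi_fp k A C \<Longrightarrow> X \<in> N.fa.MD k"
  unfolding chi_fp_eq_chi[OF polynomial_functions_fp]
  by (rule polynomial_functions.chi_MD[OF polynomial_functions_fp])

lemma schouten_chi_fp: "X \<in> chi_fp k A C \<Longrightarrow> Y \<in> chi_fp l A C \<Longrightarrow> schouten X Y \<in> chi_fp (k + l - 1) A C"
  unfolding chi_fp_eq_chi[OF polynomial_functions_fp] schouten_eq_bracket
  by (rule polynomial_functions.bracket_chi[OF polynomial_functions_fp])

abbreviation "MV \<equiv> extended (\<lambda>k. N.fa.MD k)"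
abbreviation "CH \<equiv> extended (\<lambda>k. chi_fp k A C)"
abbreviation "WSZ \<equiv> extended (\<lambda>k. WS k)"

text \<open>Reading the degree off the number of arguments makes the grading operator linear on
  inhomogeneous elements.\<close>

definition parity_sign :: "'a normal mvf \<Rightarrow> 'a normal mvf"
  where "parity_sign X fs = (- 1) ^ length fs *\<^sub>R X fs"

lemmas zero_WS = subspace_0[OF subspace_WS]

lemma bracket_extended:
  assumes G: "\<And>k. G k \<subseteq> N.fa.MD k" "\<And>k. 0 \<in> G k" "\<And>X Y k l. X \<in> G k \<Longrightarrow> Y \<in> G l \<Longrightarrow> bracket X Y \<in> G (k + l - 1)"
    and X: "X \<in> extended G p" and Y: "Y \<in> extended G q"
  shows "bracket X Y \<in> extended G (p + q - 1)"
proof -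
  obtain k where k: "X \<in> G k" "p = int k \<or> X = 0" by (rule extendedE[OF X G(2)])
  obtain l where l: "Y \<in> G l" "q = int l \<or> Y = 0" by (rule extendedE[OF Y G(2)])
  have M: "X \<in> N.fa.MD k" "Y \<in> N.fa.MD l" using k l G(1) by blast+
  show ?thesis
  \<comment> \<open>For two functions the degree p + q - 1 is -1 and its space is zero, whereas k +
    l - 1 is truncated to 0; there the bracket has to vanish.\<close>
  proof (cases "p = int k \<and> q = int l \<and> k + l > 0")
    case True
    then have "p + q - 1 = int (k + l - 1)" by linarith
    with extended_int[of "bracket X Y" G "k + l - 1"] G(3)[OF k(1) l(1)] show ?thesis by (simp only:)
  next
    case False
    then have "X = 0 \<or> Y = 0 \<or> k = 0 \<and> l = 0" using k(2) l(2) by auto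
    then have "bracket X Y = 0"
      using N.fa.bracket_zeroM[OF M(1)] N.fa.bracket_zeroM[OF M(2)] N.fa.bracket_0_0[of X Y] M
      by (elim disjE conjE) (simp_all only:)
    then show ?thesis by (simp add: extended_def G(2))
  qed
qed

lemma MV_slot_linear: "X \<in> span (\<Union>p. MV p) \<Longrightarrow> X \<in> N.fa.slot_linear"
proof -
  have "(\<Union>p. MV p) \<subseteq> (\<Union>k. N.fa.MD k)" by (auto simp: extended_def split: if_splits intro: N.fa.MD_0)
  then have "span (\<Union>p. MV p) \<subseteq> N.fa.slot_linear" using span_mono N.fa.span_MD_slot_linear by blast
  then show "X \<in> span (\<Union>p. MV p) \<Longrightarrow> X \<in> N.fa.slot_linear" by (rule subsetD)
qed

lemma higher_derived_brackets_normal: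
  "higher_derived_brackets MV CH schouten parity_sign WSZ (vert A C) (Proj A C)"
proof
  show "subspace (MV p)" "subspace (CH p)" "subspace (WSZ p)" for p
    by (rule subspace_extended N.fa.subspace_MD subspace_chi_fp subspace_WS)+
  show "CH p \<subseteq> MV p" for p using chi_fp_MD by (auto simp: extended_def)
  show "schouten (X + c *\<^sub>R Y) Z = schouten X Z + c *\<^sub>R schouten Y Z"
    "schouten Z (X + c *\<^sub>R Y) = schouten Z X + c *\<^sub>R schouten Z Y"
    if "X \<in> span (\<Union>p. MV p)" "Y \<in> span (\<Union>p. MV p)" "Z \<in> span (\<Union>p. MV p)" for X Y Z c
    unfolding schouten_eq_bracket
    by (rule N.fa.bracket_linear1[OF that[THEN MV_slot_linear]] N.fa.bracket_linear2[OF that[THEN MV_slot_linear]])+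
next
  have sign: "par ((p + 1) * (q + 1)) = (- 1) ^ ((k + 1) * (l + 1))"
    if "even p \<longleftrightarrow> even k" "even q \<longleftrightarrow> even l" for p q and k l :: nat
    using that by (cases "even k"; cases "even l") (simp_all add: par_def minus_one_power_iff)
  fix X Y p q assume X': "X \<in> MV p" and Y': "Y \<in> MV q"
  obtain k where X: "X \<in> N.fa.MD k" "even p \<longleftrightarrow> even k" by (rule extendedE[OF X' N.fa.MD_0])
  obtain l where Y: "Y \<in> N.fa.MD l" "even q \<longleftrightarrow> even l" by (rule extendedE[OF Y' N.fa.MD_0])
  show "schouten X Y \<in> MV (p + q - 1)" unfolding schouten_eq_bracket
    by (rule bracket_extended[OF order_refl N.fa.MD_0 N.fa.bracket_MD X' Y'])
  show "schouten X Y = - (par ((p + 1) * (q + 1)) *\<^sub>R schouten Y X)"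
    unfolding schouten_eq_bracket sign[OF X(2) Y(2)] by (rule N.fa.bracket_antisym[OF X(1) Y(1)])
  show "Proj A C (schouten X Y) = 0" if "Proj A C X = 0" "Proj A C Y = 0" by (rule Proj_kernel[OF X(1) Y(1) that])
  fix Z r assume "Z \<in> MV r"
  then obtain m where Z: "Z \<in> N.fa.MD m" by (rule extendedE[OF _ N.fa.MD_0])
  show "schouten X (schouten Y Z) = schouten (schouten X Y) Z + par ((p + 1) * (q + 1)) *\<^sub>R schouten Y (schouten X Z)"
    unfolding schouten_eq_bracket sign[OF X(2) Y(2)] by (rule N.fa.bracket_jacobi[OF X(1) Y(1) Z])
next
  fix X Y p q assume X: "X \<in> CH p" and Y: "Y \<in> CH q"
  show "schouten X Y \<in> CH (p + q - 1)" unfolding schouten_eq_bracket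
    by (rule bracket_extended[OF subsetI[OF chi_fp_MD] subspace_0[OF subspace_chi_fp] schouten_chi_fp[unfolded schouten_eq_bracket] X Y])
next
  fix X Y :: "'a normal mvf" and c
  show "parity_sign (X + c *\<^sub>R Y) = parity_sign X + c *\<^sub>R parity_sign Y"
    by (rule ext) (simp add: parity_sign_def scaleR_fun_apply scaleR_add_right scaleR_left_commute)
next
  fix X p assume X': "X \<in> MV p"
  obtain k where X: "X \<in> N.fa.MD k" "p = int k \<or> X = 0" by (rule extendedE[OF X' N.fa.MD_0])
  show "parity_sign X = par p *\<^sub>R X"
  proof
    fix fs
    show "parity_sign X fs = (par p *\<^sub>R X) fs"
    proof (cases "X fs = 0")
      case True
      then show ?thesis by (simp add: parity_sign_def scaleR_fun_apply)
    next
      case False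
      then have "length fs = k" "p = int k" using X N.fa.MD_length[OF X(1)] by auto
      then show ?thesis by (simp add: parity_sign_def scaleR_fun_apply par_def minus_one_power_iff)
    qed
  qed
  show "Proj A C X \<in> WSZ p"
  proof (cases "X = 0")
    case True
    then have "Proj A C X = 0" by (intro ext) (simp add: Proj_def)
    then show ?thesis by (simp add: extended_def zero_WS)
  next
    case False
    with X Proj_WS[OF X(1)] show ?thesis by (auto simp: extended_int)
  qed
next
  fix a p assume a': "a \<in> WSZ p"
  obtain k where a: "a \<in> WS k" "p = int k \<or> a = 0" by (rule extendedE[OF a' zero_WS])
  show "vert A C a \<in> MV p"
  proof (cases "a = 0")
    case True
    then have "vert A C a = 0" by (intro ext) (auto simp: vert_def)
    then show ?thesis by (simp add: extended_def)
  next
    case False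
    with a vert_MD[OF a(1)] extended_int[of _ "\<lambda>k. N.fa.MD k"] show ?thesis by simp
  qed
  show "Proj A C (vert A C a) = a" by (rule Proj_vert[OF a(1)])
  fix b q assume "b \<in> WSZ q"
  then obtain l where b: "b \<in> WS l" by (rule extendedE[OF _ zero_WS])
  show "schouten (vert A C a) (vert A C b) = 0" by (rule vert_abelian[OF a(1) b])
qed (rule vert_linear Proj_linear)+

text \<open>Elements of different degrees live on argument lists of different lengths, so a
  vanishing sum vanishes degree by degree.\<close>

lemma graded_defo_space: "graded_space (defo_space A C)"
  unfolding graded_space_def
proof (intro conjI allI impI)
  fix i
  have "subspace (if i + 2 \<ge> 0 then chi_fp (nat (i + 2)) A C else {0})" using subspace_chi_fp by simp
  moreover have "subspace (if i + 1 \<ge> 0 then WS (nat (i + 1)) else {0})" using subspace_WS by simp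
  ultimately show "subspace (defo_space A C i)" unfolding defo_space_def by (rule subspace_Times)
next
  fix w :: "int \<Rightarrow> 'a normal mvf \<times> 'a wsec" and i
  assume w: "(\<forall>i. w i \<in> defo_space A C i) \<and> finite {i. w i \<noteq> 0} \<and> (\<Sum>i | w i \<noteq> 0. w i) = 0"
  let ?I = "{i. w i \<noteq> 0}"
  have m: "fst (w j) \<in> CH (j + 2)" "snd (w j) \<in> WSZ (j + 1)" for j
    using spec[OF conjunct1[OF w], of j] by (simp_all add: defo_space_def mem_Times_iff extended_def)
  have X: "fst (w j) fs = 0" if "int (length fs) \<noteq> j + 2" for j fs
  proof (cases "j + 2 \<ge> 0")
    case True
    then have "length fs \<noteq> nat (j + 2)" "fst (w j) \<in> N.fa.MD (nat (j + 2))"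
      using that m(1)[of j] chi_fp_MD by (auto simp: extended_def)
    with N.fa.MD_length show ?thesis by blast
  next
    case False
    with m(1)[of j] show ?thesis by (simp add: extended_def)
  qed
  have a: "snd (w j) p ls = 0" if "int (length ls) \<noteq> j + 1" for j p ls
  proof (cases "j + 1 \<ge> 0")
    case True
    then have "length ls \<noteq> nat (j + 1)" "snd (w j) \<in> WS (nat (j + 1))"
      using that m(2)[of j] by (auto simp: extended_def)
    with WS_outside show ?thesis by blast
  next
    case False
    with m(2)[of j] show ?thesis by (simp add: extended_def)
  qed
  have s: "(\<Sum>j\<in>?I. fst (w j)) = 0" "(\<Sum>j\<in>?I. snd (w j)) = 0"
    using arg_cong[OF conjunct2[OF conjunct2[OF w]], of fst] arg_cong[OF conjunct2[OF conjunct2[OF w]], of snd]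
    by (simp_all only: fst_sum snd_sum fst_zero snd_zero)
  have fin: "finite ?I" using w by blast
  have "fst (w i) fs = 0" for fs
  proof (cases "int (length fs) = i + 2")
    case True
    have "(\<Sum>j\<in>?I. fst (w j) fs) = (\<Sum>j\<in>?I. if j = i then fst (w i) fs else 0)"
      by (rule sum.cong) (use X True in auto)
    also have "\<dots> = fst (w i) fs" by (auto simp: sum.delta[OF fin])
    finally show ?thesis using fun_cong[OF s(1), of fs] by (simp only: sum_fun_apply zero_fun_apply)
  qed (rule X)
  moreover have "snd (w i) p ls = 0" for p ls
  proof (cases "int (length ls) = i + 1")
    case True
    have "(\<Sum>j\<in>?I. snd (w j) p ls) = (\<Sum>j\<in>?I. if j = i then snd (w i) p ls else 0)"
      by (rule sum.cong) (use a True in auto)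
    also have "\<dots> = snd (w i) p ls" by (auto simp: sum.delta[OF fin])
    finally show ?thesis using fun_cong[OF fun_cong[OF s(2), of p], of ls] by (simp only: sum_fun_apply zero_fun_apply)
  qed (rule a)
  ultimately show "w i = 0" by (simp add: prod_eq_iff fun_eq_iff)
qed

theorem defo_algebra_exists: "\<exists>m. defo_algebra A C m"
proof -
  interpret L: higher_derived_brackets MV CH schouten parity_sign WSZ "vert A C" "Proj A C"
    by (rule higher_derived_brackets_normal)
  have W: "L.W = defo_space A C" by (rule ext) (simp add: L.W_def defo_space_def extended_def)
  have ch: "X \<in> chi_fp k A C \<Longrightarrow> X \<in> CH (int k)" for X k by (simp add: extended_def)
  have chs: "(\<Union>k. chi_fp k A C) \<subseteq> (\<Union>p. CH p)" using ch by blast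
  have wss: "(\<Union>l. WS l) \<subseteq> (\<Union>p. WSZ p)"
  proof
    fix a assume "a \<in> (\<Union>l. WS l)"
    then obtain l where "a \<in> WS l" by blast
    then have "a \<in> WSZ (int l)" by (simp add: extended_def)
    then show "a \<in> (\<Union>p. WSZ p)" by blast
  qed
  have "defo_algebra A C L.brackets" unfolding defo_algebra_def
  proof (intro conjI allI ballI impI; (elim conjE)?)
    show "Linfty1_algebra (defo_space A C) L.brackets"
      using L.Linfty1_algebra_brackets graded_defo_space unfolding W by blast
    show "L.brackets [(X, 0)] = (0, Proj A C X)" if "X \<in> chi_fp k A C" for k X
      by (rule L.brackets_unary[OF ch[OF that]])
    show "L.brackets [(X, 0), (Y, 0)] = ((- 1) ^ (k + 1) *\<^sub>R schouten X Y, 0)"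
      if "X \<in> chi_fp k A C" "Y \<in> chi_fp l A C" for k l X Y
    proof -
      have "- (par (int k) *\<^sub>R schouten X Y) = (- 1) ^ (k + 1) *\<^sub>R schouten X Y"
        by (simp add: par_def minus_one_power_iff)
      with L.brackets_binary[OF ch[OF that(1)] ch[OF that(2)]] show ?thesis by simp
    qed
    show "L.brackets ((X, 0) # map (\<lambda>a. (0, a)) as) = (0, Proj A C (foldl schouten X (map (vert A C) as)))"
      if "X \<in> chi_fp k A C" "as \<noteq> []" "set as \<subseteq> (\<Union>l. WS l)" for k X as
      by (rule L.brackets_mixed[OF ch[OF that(1)] that(2) order_trans[OF that(3) wss]])
    show "L.brackets (map (\<lambda>X. (X, 0)) Xs @ map (\<lambda>a. (0, a)) as) = 0"
      if "set Xs \<subseteq> (\<Union>k. chi_fp k A C)" "set as \<subseteq> (\<Union>l. WS l)" "Xs \<noteq> [] \<or> as \<noteq> []"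
        "length Xs \<noteq> 1" "\<not> (length Xs = 2 \<and> as = [])" for Xs as
      by (rule L.brackets_others[OF order_trans[OF that(1) chs] order_trans[OF that(2) wss] that(3-)])
  qed
  then show ?thesis by blast
qed

end

section \<open>The Maurer-Cartan series\<close>

lemma tendsto_fun_iff:
  fixes f :: "'i \<Rightarrow> 'x \<Rightarrow> 'y::topological_space"
  shows "(f \<longlongrightarrow> l) F \<longleftrightarrow> (\<forall>x. ((\<lambda>i. f i x) \<longlongrightarrow> l x) F)"
  using limitin_componentwise[of "\<lambda>_. euclidean" UNIV f l F]
  by (simp add: euclidean_product_topology limitin_canonical_iff)

lemma sums_fun_iff:
  fixes f :: "nat \<Rightarrow> 'x \<Rightarrow> 'y::{topological_space, comm_monoid_add}"
  shows "f sums l \<longleftrightarrow> (\<forall>x. (\<lambda>n. f n x) sums l x)"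
  unfolding sums_def tendsto_fun_iff sum_fun_apply ..

lemma sums_prod_iff:
  fixes f :: "nat \<Rightarrow> 'x::{topological_space, comm_monoid_add} \<times> 'y::{topological_space, comm_monoid_add}"
  shows "f sums l \<longleftrightarrow> (\<lambda>n. fst (f n)) sums fst l \<and> (\<lambda>n. snd (f n)) sums snd l"
proof -
  have "(\<lambda>n. \<Sum>i<n. f i) = (\<lambda>n. (\<Sum>i<n. fst (f i), \<Sum>i<n. snd (f i)))"
    by (simp add: prod_eq_iff fst_sum snd_sum fun_eq_iff)
  then show ?thesis
    unfolding sums_def using tendsto_fst[of "\<lambda>n. \<Sum>i<n. f i" l] tendsto_snd[of "\<lambda>n. \<Sum>i<n. f i" l]
      tendsto_Pair[of "\<lambda>n. \<Sum>i<n. fst (f i)" "fst l" sequentially "\<lambda>n. \<Sum>i<n. snd (f i)" "snd l"]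
    by (auto simp: fst_sum snd_sum)
qed

lemma sums_poly_taylor:
  fixes q :: "real poly"
  shows "(\<lambda>n. poly ((pderiv ^^ n) q) 0 / fact n) sums poly q 1"
proof -
  have "poly ((pderiv ^^ n) q) 0 / fact n = coeff q n" for n
    by (simp add: poly_0_coeff_0 coeff_higher_pderiv pochhammer_fact[symmetric])
  moreover have "(\<lambda>n. coeff q n) sums (\<Sum>n\<le>degree q. coeff q n)"
    by (rule sums_finite) (auto simp: coeff_eq_0)
  ultimately show ?thesis by (simp add: poly_altdef)
qed

text \<open>Here \<open>f i j n\<close> stands for the bracket of \<open>i\<close> copies of \<open>x\<close>, \<open>j\<close> copies of \<open>y\<close> and
  \<open>n\<close> copies of \<open>x + y\<close>.\<close>

lemma bracket_power_expansion:
  fixes f :: "nat \<Rightarrow> nat \<Rightarrow> nat \<Rightarrow> 'w::real_vector"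
  assumes rec: "\<And>i j n. f i j (Suc n) = f (Suc i) j n + f i (Suc j) n"
    and 0: "\<And>j. j > 0 \<Longrightarrow> f 0 j 0 = 0" and 1: "\<And>j. f 1 j 0 = b j"
    and 2: "\<And>j. f 2 j 0 = (if j = 0 then c else 0)" and 3: "\<And>i j. i \<ge> 3 \<Longrightarrow> f i j 0 = 0"
  shows "f 0 0 (Suc n) = real (Suc n) *\<^sub>R b n + (if n = 1 then c else 0)"
proof -
  have f3: "f i j n = 0" if "i \<ge> 3" for i j n using that by (induction n arbitrary: i j) (auto simp: rec 3)
  have f2: "f 2 j n = (if j = 0 \<and> n = 0 then c else 0)" for j n
    by (induction n arbitrary: j) (simp_all add: rec 2 f3)
  have f1: "f 1 j n = b (j + n) + (if j = 0 \<and> n = 1 then c else 0)" for j n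
    using f2 by (induction n arbitrary: j) (auto simp: rec 1[unfolded One_nat_def] numeral_2_eq_2)
  have f0: "f 0 j n = real n *\<^sub>R b (j + n - 1)" if "j > 0" for j n using that
  proof (induction n arbitrary: j)
    case (Suc n)
    with f1[of j n] show ?case by (simp add: rec scaleR_add_left)
  qed (simp add: 0)
  show ?thesis using f1[of 0 n] f0[of 1 n] by (simp add: rec scaleR_add_left)
qed

lemma Linfty1_algebraD:
  assumes "Linfty1_algebra W m"
  shows "set us \<union> {x, y} \<union> set ws \<subseteq> total_space W \<Longrightarrow>
      m (us @ (x + c *\<^sub>R y) # ws) = m (us @ x # ws) + c *\<^sub>R m (us @ y # ws)"
    and "set us \<union> set ws \<subseteq> total_space W \<and> v \<in> W i \<and> w \<in> W j \<Longrightarrow>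
      m (us @ v # w # ws) = (if odd (i * j) then - 1 else 1) *\<^sub>R m (us @ w # v # ws)"
proof -
  note * = assms[unfolded Linfty1_algebra_def, THEN conjunct2]
  show "set us \<union> {x, y} \<union> set ws \<subseteq> total_space W \<Longrightarrow>
      m (us @ (x + c *\<^sub>R y) # ws) = m (us @ x # ws) + c *\<^sub>R m (us @ y # ws)"
    by (rule *[THEN conjunct1, THEN spec, THEN spec, THEN spec, THEN spec, THEN spec, THEN mp])
  show "set us \<union> set ws \<subseteq> total_space W \<and> v \<in> W i \<and> w \<in> W j \<Longrightarrow>
      m (us @ v # w # ws) = (if odd (i * j) then - 1 else 1) *\<^sub>R m (us @ w # v # ws)"
    by (rule *[THEN conjunct2, THEN conjunct2, THEN conjunct1,
          THEN spec, THEN spec, THEN spec, THEN spec, THEN spec, THEN spec, THEN mp])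
qed

lemma defo_algebraD:
  assumes "defo_algebra A C m"
  shows "Linfty1_algebra (defo_space A C) m"
    and "\<forall>k. \<forall>X\<in>chi_fp k A C. m [(X, 0)] = (0, Proj A C X)"
    and "\<forall>k l. \<forall>X\<in>chi_fp k A C. \<forall>Y\<in>chi_fp l A C. m [(X, 0), (Y, 0)] = ((- 1) ^ (k + 1) *\<^sub>R schouten X Y, 0)"
    and "\<forall>k. \<forall>X\<in>chi_fp k A C. \<forall>as. as \<noteq> [] \<and> set as \<subseteq> (\<Union>l. wedge_sections l A C) \<longrightarrow>
      m ((X, 0) # map (\<lambda>a. (0, a)) as) = (0, Proj A C (foldl schouten X (map (vert A C) as)))"
    and "\<forall>Xs as. set Xs \<subseteq> (\<Union>k. chi_fp k A C) \<and> set as \<subseteq> (\<Union>l. wedge_sections l A C) \<and>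
       (Xs \<noteq> [] \<or> as \<noteq> []) \<and> length Xs \<noteq> 1 \<and> \<not> (length Xs = 2 \<and> as = []) \<longrightarrow>
       m (map (\<lambda>X. (X, 0)) Xs @ map (\<lambda>a. (0, a)) as) = 0"
  using assms unfolding defo_algebra_def by - (elim conjE, assumption)+

text \<open>It suffices to look at products of two polynomial vector fields, where the value is a 2
  by 2 determinant of polynomial functions.\<close>

lemma (in polynomial_functions) chi_2_F0:
  assumes X: "X \<in> chi 2" and f: "f \<in> F0" "g \<in> F0"
  shows "X [f, g] \<in> F0"
proof -
  have "chi 2 \<subseteq> {X. X [f, g] \<in> F0}" unfolding numeral_2_eq_2 chi.simps
  proof (rule span_minimal)
    show "{wedge Y X |Y X. Y \<in> F1 \<and> X \<in> F1} \<subseteq> {X. X [f, g] \<in> F0}"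
    proof clarify
      fix Y Z assume Y: "Y \<in> F1" and Z: "Z \<in> F1"
      have "wedge Y Z [f, g] = Y [f] * Z [g] - Y [g] * Z [f]"
        using wedge_MD_1_right[of Y 1 Z "[f, g]"] F1_MD[OF Y] F1_MD[OF Z] by (simp add: numeral_2_eq_2)
      moreover have "Y [f] * Z [g] - Y [g] * Z [f] \<in> F0"
        using Y Z f by (intro subspace_diff[OF subspace_F0] mult_F0) (auto simp: F1_def)
      ultimately show "wedge Y Z [f, g] \<in> F0" by simp
    qed
    show "subspace {X. X [f, g] \<in> F0}" by (rule subspaceI)
         (auto simp: scaleR_fun_apply subspace_0[OF subspace_F0] intro: subspace_add[OF subspace_F0] subspace_scale[OF subspace_F0])
  qed
  with X show ?thesis by blast
qed

text \<open>Bracketing with a vector field from the right is minus the Lie derivative; this sign is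
  why the graph of the negative section appears.\<close>

lemma (in function_algebra) bracket_2_1:
  assumes X: "X \<in> MD 2" and V: "V \<in> MD 1" and f: "f \<in> S" "g \<in> S"
  shows "bracket X V [f, g] = X [V [f], g] + X [f, V [g]] - V [X [f, g]]"
proof -
  have "bracket X V [f, g] = X [V [f], g] - X [V [g], f] - V [X [f, g]]"
    using MD_length[OF X] MD_length[OF V] MD_zero_arg0[OF X] MD_zero_arg0[OF V]
    by (simp add: bracket_def unshuffle_sum_Cons algebra_simps)
  then show ?thesis using MD_alt0[OF X, of "V [g]" f "[]"] by simp
qed

section \<open>The Maurer-Cartan equation for a bivector field and a section\<close>

context smooth_submanifold
begin

text \<open>Both \<open>x\<close> and \<open>y\<close> have degree 0, so entries commute without
  signs and x + y can be expanded one entry at a time. Only terms with one \<open>\<pi>\<close>, and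
  the one with two \<open>\<pi>\<close> and no section, survive.\<close>

lemma maurer_cartan_terms:
  assumes m: "defo_algebra A C m" and \<pi>: "\<pi> \<in> chi_fp 2 A C" and a: "a \<in> WS 1"
  shows "m (replicate (Suc n) (\<pi>, a)) =
    real (Suc n) *\<^sub>R (0, Proj A C (foldl schouten \<pi> (replicate n (vert A C a)))) +
    (if n = 1 then (- schouten \<pi> \<pi>, 0) else 0)"
proof -
  define x where "x = (\<pi>, 0 :: 'a wsec)"
  define y where "y = (0 :: 'a normal mvf, a)"
  have x_plus_y: "x + y = (\<pi>, a)" unfolding x_def y_def by (simp only: add_Pair add_0_left add_0_right)
  have L: "Linfty1_algebra (defo_space A C) m" by (rule defo_algebraD(1)[OF m])
  have x: "x \<in> defo_space A C 0" and y: "y \<in> defo_space A C 0"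
    using \<pi> a subspace_0[OF subspace_WS] subspace_0[OF subspace_chi_fp] by (simp_all add: defo_space_def x_def y_def)
  have xy: "x + y \<in> defo_space A C 0" unfolding x_plus_y using \<pi> a by (simp add: defo_space_def)
  have tot: "v \<in> total_space (defo_space A C)" if "v \<in> defo_space A C 0" for v
    using that unfolding total_space_def by (intro span_base) blast
  have add: "m (us @ (x + y) # ws) = m (us @ x # ws) + m (us @ y # ws)"
    if "set us \<subseteq> defo_space A C 0" "set ws \<subseteq> defo_space A C 0" for us ws
  proof -
    have "set us \<union> {x, y} \<union> set ws \<subseteq> total_space (defo_space A C)" using that tot x y by blast
    then have "m (us @ (x + 1 *\<^sub>R y) # ws) = m (us @ x # ws) + 1 *\<^sub>R m (us @ y # ws)"
      by (rule Linfty1_algebraD(1)[OF L])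
    then show ?thesis by (simp only: scaleR_one)
  qed
  have swap: "m (us @ v # w # ws) = m (us @ w # v # ws)"
    if "set us \<subseteq> defo_space A C 0" "set ws \<subseteq> defo_space A C 0" "v \<in> defo_space A C 0" "w \<in> defo_space A C 0" for us v w ws
  proof -
    have "set us \<union> set ws \<subseteq> total_space (defo_space A C)" using that tot by blast
    then have "m (us @ v # w # ws) = (if odd (0 * 0 :: int) then - 1 else 1) *\<^sub>R m (us @ w # v # ws)"
      by (intro Linfty1_algebraD(2)[OF L] conjI that(3,4))
    then show ?thesis by (simp only: mult_zero_left even_zero if_False scaleR_one not_True_eq_False)
  qed
  have move: "m (us @ replicate j y @ x # ws) = m (us @ x # replicate j y @ ws)"
    if "set us \<subseteq> defo_space A C 0" "set ws \<subseteq> defo_space A C 0" for us ws j using that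
  proof (induction j arbitrary: us)
    case (Suc j)
    have "m (us @ replicate (Suc j) y @ x # ws) = m ((us @ [y]) @ replicate j y @ x # ws)" by simp
    also have "\<dots> = m ((us @ [y]) @ x # replicate j y @ ws)" by (rule Suc.IH) (use Suc.prems y in auto)
    also have "\<dots> = m (us @ y # x # replicate j y @ ws)" by simp
    also have "\<dots> = m (us @ x # y # replicate j y @ ws)" by (rule swap) (use Suc.prems x y in auto)
    finally show ?case by simp
  qed simp
  define f where "f = (\<lambda>i j n. m (replicate i x @ replicate j y @ replicate n (x + y)))"
  have rep: "set (replicate k v) \<subseteq> defo_space A C 0" if "v \<in> defo_space A C 0" for k v using that by auto
  have van: "m (replicate i x @ replicate j y) = 0" if "i \<noteq> 1" "\<not> (i = 2 \<and> j = 0)" "i + j > 0" for i j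
  proof -
    have "m (map (\<lambda>X. (X, 0)) (replicate i \<pi>) @ map (\<lambda>a. (0, a)) (replicate j a)) = 0"
      by (rule defo_algebraD(5)[OF m, THEN spec, THEN spec, THEN mp]) (use \<pi> a that in \<open>auto simp: set_replicate_conv_if\<close>)
    then show ?thesis by (simp only: map_replicate x_def y_def)
  qed
  have "f 0 0 (Suc n) = real (Suc n) *\<^sub>R (0, Proj A C (foldl schouten \<pi> (replicate n (vert A C a)))) +
      (if n = 1 then (- schouten \<pi> \<pi>, 0) else 0)"
  proof (rule bracket_power_expansion[where f = f and n = n and c = "(- schouten \<pi> \<pi>, 0)"
        and b = "\<lambda>n. (0, Proj A C (foldl schouten \<pi> (replicate n (vert A C a))))"])
    fix i j n
    have "f i j (Suc n) = m ((replicate i x @ replicate j y) @ (x + y) # replicate n (x + y))" by (simp add: f_def)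
    also have "\<dots> = m ((replicate i x @ replicate j y) @ x # replicate n (x + y)) +
        m ((replicate i x @ replicate j y) @ y # replicate n (x + y))"
      by (rule add) (use rep[OF x] rep[OF y] rep[OF xy] in auto)
    finally have "f i j (Suc n) = m ((replicate i x @ replicate j y) @ x # replicate n (x + y)) +
        m ((replicate i x @ replicate j y) @ y # replicate n (x + y))" .
    moreover have "m ((replicate i x @ replicate j y) @ x # replicate n (x + y)) = f (Suc i) j n"
      using move[OF rep[OF x] rep[OF xy], of i j n] by (simp add: f_def replicate_append_same[symmetric])
    moreover have "m ((replicate i x @ replicate j y) @ y # replicate n (x + y)) = f i (Suc j) n"
      by (simp add: f_def replicate_app_Cons_same)
    ultimately show "f i j (Suc n) = f (Suc i) j n + f i (Suc j) n" by (simp only:)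
  next
    show "f 0 j 0 = 0" if "j > 0" for j using van[of 0 j] that by (simp add: f_def)
    show "f 1 j 0 = (0, Proj A C (foldl schouten \<pi> (replicate j (vert A C a))))" for j
    proof (cases "j = 0")
      case True
      have "m [(\<pi>, 0)] = (0, Proj A C \<pi>)" by (rule defo_algebraD(2)[OF m, THEN spec, THEN bspec, OF \<pi>])
      then have "m [x] = (0, Proj A C \<pi>)" unfolding x_def .
      with True show ?thesis by (simp add: f_def)
    next
      case False
      then have "m ((\<pi>, 0) # map (\<lambda>a. (0, a)) (replicate j a)) = (0, Proj A C (foldl schouten \<pi> (map (vert A C) (replicate j a))))"
        using a by (intro defo_algebraD(4)[OF m, THEN spec, THEN bspec, OF \<pi>, THEN spec, THEN mp]) (auto simp: set_replicate_conv_if)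
      then show ?thesis unfolding map_replicate x_def[symmetric] y_def[symmetric] by (simp add: f_def)
    qed
    show "f 2 j 0 = (if j = 0 then (- schouten \<pi> \<pi>, 0) else 0)" for j
    proof (cases "j = 0")
      case True
      have "m [(\<pi>, 0), (\<pi>, 0)] = ((- 1) ^ (2 + 1) *\<^sub>R schouten \<pi> \<pi>, 0)" by (rule defo_algebraD(3)[OF m, THEN spec, THEN spec, THEN bspec, OF \<pi>, THEN bspec, OF \<pi>])
      then show ?thesis unfolding x_def[symmetric] using True by (simp add: f_def numeral_2_eq_2)
    next
      case False
      with van[of 2 j] show ?thesis by (simp add: f_def)
    qed
    show "f i j 0 = 0" if "i \<ge> 3" for i j using van[of i j] that by (simp add: f_def)
  qed
  then show ?thesis by (simp only: f_def x_plus_y replicate_0 append_Nil)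
qed

text \<open>The factor n + 1 turns 1 / (n + 1)! into 1 / n!. The extra term sits at n = 1, where 1 /
  2! makes it - [\<pi>, \<pi>] / 2, and it is the only contribution to the first component.\<close>

lemma maurer_cartan_iff:
  assumes m: "defo_algebra A C m" and \<pi>: "\<pi> \<in> chi_fp 2 A C" and a: "a \<in> WS 1"
  shows "maurer_cartan (defo_space A C) m (\<pi>, a) \<longleftrightarrow> schouten \<pi> \<pi> = 0 \<and>
    (\<forall>p ls. (\<lambda>n. Proj A C (foldl schouten \<pi> (replicate n (vert A C a))) p ls / fact n) sums 0)"
proof -
  let ?P = "\<lambda>n. Proj A C (foldl schouten \<pi> (replicate n (vert A C a)))"
  have d: "(\<pi>, a) \<in> defo_space A C 0" using \<pi> a by (simp add: defo_space_def)
  define t where "t = (\<lambda>n. (1 / fact (Suc n)) *\<^sub>R m (replicate (Suc n) (\<pi>, a)))"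
  have t1: "fst (t n) = (if n = 1 then - ((1 / 2) *\<^sub>R schouten \<pi> \<pi>) else 0)" for n
    unfolding t_def maurer_cartan_terms[OF m \<pi> a] by (simp add: numeral_2_eq_2)
  have t2: "snd (t n) p ls = ?P n p ls / fact n" for n p ls
  proof -
    have "snd (t n) = (1 / fact (Suc n)) *\<^sub>R (real (Suc n) *\<^sub>R ?P n)"
      unfolding t_def maurer_cartan_terms[OF m \<pi> a] by simp
    then show ?thesis by (simp add: scaleR_fun_apply del: of_nat_Suc)
  qed
  have "(\<lambda>n. fst (t n)) sums - ((1 / 2) *\<^sub>R schouten \<pi> \<pi>)"
  proof -
    have "(\<lambda>n. (\<lambda>fs P. if n = 1 then - (schouten \<pi> \<pi> fs P / 2) else 0)) sums (\<lambda>fs P. - (schouten \<pi> \<pi> fs P / 2))"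
      unfolding sums_fun_iff using sums_single[of 1 "\<lambda>_. _ :: real"] by auto
    moreover have "(\<lambda>fs P. if n = 1 then - (schouten \<pi> \<pi> fs P / 2) else 0) = fst (t n)" for n
      by (intro ext) (simp add: t1 scaleR_fun_apply)
    moreover have "(\<lambda>fs P. - (schouten \<pi> \<pi> fs P / 2)) = - ((1 / 2) *\<^sub>R schouten \<pi> \<pi>)"
      by (intro ext) (simp add: scaleR_fun_apply)
    ultimately show ?thesis by (simp only:)
  qed
  note S = this
  have "(\<lambda>n. fst (t n)) sums 0 \<longleftrightarrow> schouten \<pi> \<pi> = 0"
  proof
    assume z: "(\<lambda>n. fst (t n)) sums 0"
    show "schouten \<pi> \<pi> = 0"
    proof (rule ext, rule ext)
      fix fs P
      have "(\<lambda>n. fst (t n) fs P) sums (- ((1 / 2) *\<^sub>R schouten \<pi> \<pi>)) fs P" "(\<lambda>n. fst (t n) fs P) sums 0 fs P"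
        by (rule sums_fun_iff[THEN iffD1, THEN spec, OF sums_fun_iff[THEN iffD1, THEN spec]], rule S)
           (rule sums_fun_iff[THEN iffD1, THEN spec, OF sums_fun_iff[THEN iffD1, THEN spec]], rule z)
      then have "(- ((1 / 2) *\<^sub>R schouten \<pi> \<pi>)) fs P = 0 fs P" by (rule sums_unique2)
      then show "schouten \<pi> \<pi> fs P = 0 fs P" by (simp add: scaleR_fun_apply)
    qed
  next
    assume "schouten \<pi> \<pi> = 0"
    then show "(\<lambda>n. fst (t n)) sums 0" using S by (simp only: scaleR_zero_right minus_zero)
  qed
  then show ?thesis unfolding maurer_cartan_def t_def[symmetric] sums_prod_iff[of t] using d
    by (simp add: sums_fun_iff[of "\<lambda>n. snd (t n)"] sums_fun_iff[of "\<lambda>n. snd (t n) _"] t2)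
qed

lemma fibre_polynomial_line:
  assumes p: "p \<in> C" "\<eta> \<in> NS p" and f: "f \<in> FP p"
  shows "\<exists>q. \<forall>t. f (normal_scale A C p t \<eta>) = poly q t"
proof -
  obtain U \<phi> where U: "slice U \<phi>" "p \<in> U" using slice_exists p by blast
  note U = U p(1)
  obtain y where y: "\<eta> = nv U \<phi> p y" using nvC[OF U p(2)] by blast
  have sc: "normal_scale A C p t \<eta> = nv U \<phi> p (t *\<^sub>R y)" for t unfolding y by (rule normal_scale_nv[OF U])
  from f show ?thesis
  proof (induction rule: fibre_polynomials.induct)
    case (const c)
    show ?case by (rule exI[of _ "[:c:]"]) (simp add: sc nv_in[OF U])
  next
    case (linear l)
    have "l (normal_scale A C p t \<eta>) = poly [:0, l \<eta>:] t" for t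
      unfolding sc unfolding y ND_coord[OF U linear, of "t *\<^sub>R y"] ND_coord[OF U linear, of y] by simp
    then show ?case by blast
  next
    case (add f g)
    then obtain q r where "\<forall>t. f (normal_scale A C p t \<eta>) = poly q t" "\<forall>t. g (normal_scale A C p t \<eta>) = poly r t" by (elim exE)
    then show ?case by (intro exI[of _ "q + r"]) simp
  next
    case (mult f g)
    then obtain q r where "\<forall>t. f (normal_scale A C p t \<eta>) = poly q t" "\<forall>t. g (normal_scale A C p t \<eta>) = poly r t" by (elim exE)
    then show ?case by (intro exI[of _ "q * r"]) simp
  qed
qed

lemma fibrewise_linear_fp: "F \<in> FL \<Longrightarrow> F \<in> FPF"
  unfolding fp_functions_def fibrewise_linear_def
  by (intro CollectI conjI ballI; elim CollectE conjE) (assumption, rule fibre_polynomials.linear, erule bspec)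

end

section \<open>The vertical vector field of a section and the Taylor expansion along the
  fibres\<close>

locale section_of_normal_bundle = smooth_submanifold A C
  for A :: "('a, 'c::finite_dim_inner \<times> 'f::finite_dim_inner) atlas" and C +
  fixes s :: "'a \<Rightarrow> 'a coset"
  assumes normal_section: "normal_section A C s"
begin

lemma s_in: "p \<in> C \<Longrightarrow> s p \<in> NS p"
  using normal_section by (simp add: normal_section_def)

definition sy :: "'a set \<Rightarrow> ('a \<Rightarrow> 'c \<times> 'f) \<Rightarrow> 'c \<Rightarrow> 'f"
  where "sy U \<phi> x = snd (NC \<phi> (iv U \<phi> (x, 0), s (iv U \<phi> (x, 0))))"

lemma s_nv:
  assumes U: "slice U \<phi>" "p \<in> U" "p \<in> C"
  shows "s p = nv U \<phi> p (sy U \<phi> (fst (\<phi> p)))"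
proof -
  obtain y where y: "s p = nv U \<phi> p y" using nvC[OF U s_in[OF U(3)]] by blast
  have "iv U \<phi> (fst (\<phi> p), 0) = p"
    using slice_chart_zero[OF U] iv_simps(1)[OF mchart_inj[OF slice_mchart[OF U(1)]] U(2)] by simp
  then have "sy U \<phi> (fst (\<phi> p)) = y" by (simp add: sy_def y normal_chart_nv[OF U])
  with y show ?thesis by simp
qed

lemma smooth_sy:
  assumes U: "slice U \<phi>"
  shows "smooth_on (dom0 U \<phi>) (sy U \<phi>)"
proof -
  let ?g = "\<lambda>p. (p, s p)"
  have "(U \<inter> C, fst \<circ> \<phi>) \<in> sub_atlas A C" using U by (auto simp: sub_atlas_def)
  moreover note N_chart[OF U]
  moreover have "smooth_map (sub_atlas A C) N ?g" using normal_section by (simp add: normal_section_def)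
  ultimately have "smooth_on ((fst \<circ> \<phi>) ` (U \<inter> C \<inter> ?g -` NU U)) (NC \<phi> \<circ> ?g \<circ> iv (U \<inter> C) (fst \<circ> \<phi>))"
    unfolding smooth_map_def by blast
  moreover have "U \<inter> C \<inter> ?g -` NU U = U \<inter> C" using s_in by auto
  ultimately have 1: "smooth_on (dom0 U \<phi>) (NC \<phi> \<circ> ?g \<circ> iv (U \<inter> C) (fst \<circ> \<phi>))"
    by (simp only: sub_chart_image[OF U order_refl])
  have o: "open (dom0 U \<phi>)" by (rule open_dom0[OF U])
  show ?thesis
  proof (rule smooth_on_cong_imp[OF o smooth_on_linear_compose[OF bounded_linear_snd o 1]])
    fix x assume "x \<in> dom0 U \<phi>"
    then have "x \<in> (fst \<circ> \<phi>) ` (U \<inter> C)" by (simp only: sub_chart_image[OF U order_refl])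
    from sub_iv[OF U this] show "snd ((NC \<phi> \<circ> ?g \<circ> iv (U \<inter> C) (fst \<circ> \<phi>)) x) = sy U \<phi> x"
      by (simp only: o_apply sy_def)
  qed
qed

lemma section_pullback: "F \<in> SN \<Longrightarrow> (\<lambda>p. if p \<in> C then F (p, s p) else 0) \<in> SC"
  by (rule pullback_smooth, assumption, rule exI, rule conjI, erule smooth_sy, intro ballI s_nv) auto

abbreviation "w1 \<equiv> wedge1 A C s"

lemma w1_WS: "w1 \<in> WS 1"
  unfolding wedge_sections_def
proof (intro CollectI conjI allI impI ballI; (elim conjE)?)
  show "w1 p ls = 0" if "\<not> (p \<in> C \<and> length ls = 1 \<and> set ls \<subseteq> ND p)" for p ls
    unfolding wedge1_def using that by (simp only: if_False)
  show "w1 p (us @ l # l' # ws) = - w1 p (us @ l' # l # ws)" for p us l l' ws by (simp add: wedge1_def)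
  show "w1 p (us @ (l + c *\<^sub>R l') # ws) = w1 p (us @ l # ws) + c * w1 p (us @ l' # ws)"
    if p: "p \<in> C" and len: "length us + length ws + 1 = 1" and nd: "set us \<union> {l, l'} \<union> set ws \<subseteq> ND p" for p us l l' c ws
  proof -
    have "us = []" "ws = []" using len by auto
    moreover have "l \<in> ND p" "l' \<in> ND p" "l + c *\<^sub>R l' \<in> ND p" using nd ND_add_scale by auto
    ultimately show ?thesis unfolding wedge1_def using p by (simp add: scaleR_fun_apply del: plus_fun_def)
  qed
  fix Fs assume "length Fs = 1" and Fs: "set Fs \<subseteq> FL"
  then obtain F where F: "Fs = [F]" by (auto simp: length_Suc_conv)
  then have Fl: "F \<in> FL" using Fs by simp
  have "w1 p (map (\<lambda>F \<eta>. F (p, \<eta>)) Fs) = (if p \<in> C then F (p, s p) else 0)" for p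
    using fibrewise_linearD(2)[OF Fl, of p] by (simp add: wedge1_def F)
  then show "(\<lambda>p. w1 p (map (\<lambda>F \<eta>. F (p, \<eta>)) Fs)) \<in> SC"
    using section_pullback[OF fibrewise_linearD(1)[OF Fl]] by (simp only:)
qed

abbreviation "V \<equiv> vert A C w1"

lemma V_MD: "V \<in> N.fa.MD 1"
  by (rule vert_MD[OF w1_WS])

lemma V_SN: "V [F] \<in> SN"
  by (rule N.fa.MD_in_S[OF V_MD])

lemma V_apply:
  assumes "F \<in> SN" "p \<in> C" "\<xi> \<in> NS p"
  shows "V [F] (p, \<xi>) = vd p \<xi> F (s p)"
  using vert_apply[of "[F]" p \<xi> w1] assms vd_ND[OF assms(2,3) SN_near[OF assms]] by (simp add: wedge1_def)

lemma V_fibrewise_linear: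
  "F \<in> FL \<Longrightarrow> p \<in> C \<Longrightarrow> \<xi> \<in> NS p \<Longrightarrow> V [F] (p, \<xi>) = F (p, s p)"
  using V_apply[OF fibrewise_linearD(1)] vd_fibrewise_linear by simp

lemma V_fp: "F \<in> FL \<Longrightarrow> V [F] \<in> FPF"
proof -
  assume F: "F \<in> FL"
  have "(\<lambda>\<eta>. V [F] (p, \<eta>)) \<in> FP p" if p: "p \<in> C" for p
  proof -
    have "V [F] (p, \<eta>) = (if \<eta> \<in> NS p then F (p, s p) else 0)" for \<eta>
      using V_fibrewise_linear[OF F p] vert_outside[of "[F]" "(p, \<eta>)" w1] by (auto simp: N_carrier normal_total_def)
    then show ?thesis using fibre_polynomials.const[of A C p "F (p, s p)"] by (simp only:)
  qed
  then show ?thesis unfolding fp_functions_def by (intro CollectI conjI ballI V_SN)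
qed

text \<open>\<open>V [F]\<close> is constant along the fibres, so it has no vertical derivative;
  this closes the recursion in \<open>taylor_series\<close>.\<close>

lemma V_V: "F \<in> FL \<Longrightarrow> V [V [F]] = 0"
proof (rule vert_eqI)
  fix p \<xi> assume F: "F \<in> FL" and p: "p \<in> C" "\<xi> \<in> NS p"
  have "vd p \<xi> (V [F]) (s p) = deriv (\<lambda>t :: real. F (p, s p)) 0"
    using V_fibrewise_linear[OF F p(1) fibre_add_scale[OF p s_in[OF p(1)]]] s_in[OF p(1)] by (simp add: vertical_derivative_def)
  then show "V [V [F]] (p, \<xi>) = 0 (p, \<xi>)" using V_apply[OF V_SN p] by simp
qed (simp add: vert_outside)

lemma line_in: "p \<in> C \<Longrightarrow> normal_scale A C p t (s p) \<in> NS p"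
proof -
  assume p: "p \<in> C"
  obtain U \<phi> where U: "slice U \<phi>" "p \<in> U" using slice_exists p by blast
  show ?thesis unfolding s_nv[OF U p] normal_scale_nv[OF U p] by (rule nv_in[OF U p])
qed

lemma line_zero: "p \<in> C \<Longrightarrow> normal_scale A C p 0 (s p) = zs p"
proof -
  assume p: "p \<in> C"
  obtain U \<phi> where U: "slice U \<phi>" "p \<in> U" using slice_exists p by blast
  show ?thesis unfolding s_nv[OF U p] normal_scale_nv[OF U p] normal_zero_nv[OF U p] by simp
qed

text \<open>The line t \<mapsto> t s(p) in the fibre is an integral curve of
  \<open>V\<close>.\<close>

lemma line_derivative:
  assumes h: "h \<in> SN" and p: "p \<in> C"
  shows "((\<lambda>t. h (p, normal_scale A C p t (s p))) has_real_derivative V [h] (p, normal_scale A C p t (s p))) (at t)"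
proof -
  obtain U \<phi> where U: "slice U \<phi>" "p \<in> U" using slice_exists p by blast
  note U = U p
  define y where "y = sy U \<phi> (fst (\<phi> p))"
  have sp: "s p = nv U \<phi> p y" unfolding y_def by (rule s_nv[OF U])
  have n: "smooth_near N (p, nv U \<phi> p z) h" for z by (rule SN_near[OF h p nv_in[OF U]])
  have sc: "normal_scale A C p t (s p) = nv U \<phi> p (t *\<^sub>R y)" for t unfolding sp by (rule normal_scale_nv[OF U])
  have "V [h] (p, normal_scale A C p t (s p)) = Ntv U \<phi> (p, nv U \<phi> p (t *\<^sub>R y)) (0, y) h"
    unfolding V_apply[OF h p line_in[OF p]] unfolding sc unfolding sp vd_eq[OF U n] ..
  then show ?thesis using fibre_derivative[OF U n, where z = 0 and t = t and y = y] unfolding sc by (simp only: add_0_left)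
qed

definition T :: "'a normal mvf \<Rightarrow> nat \<Rightarrow> 'a normal mvf"
  where "T \<pi> n = foldl schouten \<pi> (replicate n V)"

lemma T_Suc: "T \<pi> (Suc n) = schouten (T \<pi> n) V"
proof -
  have "replicate (Suc n) V = replicate n V @ [V]" by (simp only: replicate_append_same replicate_Suc)
  then show ?thesis unfolding T_def by (simp only: foldl_append foldl_Cons foldl_Nil)
qed

lemma T_MD: "\<pi> \<in> N.fa.MD 2 \<Longrightarrow> T \<pi> n \<in> N.fa.MD 2"
proof (induction n)
  case (Suc n)
  then show ?case unfolding T_Suc schouten_eq_bracket using N.fa.bracket_MD[OF Suc.IH[OF Suc.prems] V_MD] by simp
qed (simp add: T_def)

text \<open>With \<open>F' = V F\<close> and \<open>G' = V G\<close>, which are constant along the fibres, the derivative of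
  \<open>T\<^sub>n [F + t F', G + t G']\<close> along the curve \<open>-t s p\<close> is the same expression with \<open>T\<^sub>n\<^sub>+\<^sub>1\<close>. So the
  series is the Taylor series of a polynomial in \<open>t\<close>.\<close>

lemma taylor_series:
  assumes \<pi>: "\<pi> \<in> chi_fp 2 A C" and F: "F \<in> FL" and G: "G \<in> FL" and p: "p \<in> C"
  shows "(\<lambda>n. Proj A C (T \<pi> n) p [\<lambda>\<eta>. F (p, \<eta>), \<lambda>\<eta>. G (p, \<eta>)] / fact n) sums
    \<pi> [F + V [F], G + V [G]] (p, normal_scale A C p (- 1) (s p))"
proof -
  define F' where "F' = V [F]"
  define G' where "G' = V [G]"
  note FS = fibrewise_linearD(1)[OF F] and GS = fibrewise_linearD(1)[OF G]
  have F'S: "F' \<in> SN" and G'S: "G' \<in> SN" unfolding F'_def G'_def by (rule V_SN)+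
  have VV: "V [F'] = 0" "V [G'] = 0" unfolding F'_def G'_def by (rule V_V[OF F] V_V[OF G])+
  note \<pi>M = chi_fp_MD[OF \<pi>] and TM = T_MD[OF chi_fp_MD[OF \<pi>]]
  have br: "T \<pi> (Suc n) [f, g] = T \<pi> n [V [f], g] + T \<pi> n [f, V [g]] - V [T \<pi> n [f, g]]" if "f \<in> SN" "g \<in> SN" for n f g
    unfolding T_Suc schouten_eq_bracket by (rule N.fa.bracket_2_1[OF TM V_MD that])
  have z: "T \<pi> n [0, g] = 0" "T \<pi> n [g, 0] = 0" for n g
    using N.fa.MD_zero_arg[OF TM, of n "[]" "[g]"] N.fa.MD_zero_arg[OF TM, of n "[g]" "[]"] by simp_all
  have TS: "T \<pi> n fs \<in> SN" for n fs by (rule N.fa.MD_in_S[OF TM])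
  let ?a = "\<lambda>n. T \<pi> n [F, G]" and ?b = "\<lambda>n. T \<pi> n [F', G]" and ?b' = "\<lambda>n. T \<pi> n [F, G']" and ?c = "\<lambda>n. T \<pi> n [F', G']"
  \<comment> \<open>Four families suffice, since \<open>V\<close> sends F to F', G to G', and both
    F' and G' to 0.\<close>
  have rec: "?a (Suc n) = ?b n + ?b' n - V [?a n]" "?b (Suc n) = ?c n - V [?b n]"
      "?b' (Suc n) = ?c n - V [?b' n]" "?c (Suc n) = - V [?c n]" for n
    using br[OF FS GS, of n] br[OF F'S GS, of n] br[OF FS G'S, of n] br[OF F'S G'S, of n]
    by (simp_all only: VV z F'_def[symmetric] G'_def[symmetric] add_0_left add_0_right diff_0)
  define P where "P = (\<lambda>t. (p, normal_scale A C p (- t) (s p)))"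
  \<comment> \<open>The curve runs backwards along \<open>V\<close>, and the resulting minus sign is
    the one in front of the last term of \<open>bracket_2_1\<close>.\<close>
  have D: "((\<lambda>t. h (P t)) has_real_derivative - V [h] (P t)) (at t)" if "h \<in> SN" for h t
  proof -
    have m: "((\<lambda>t. - t) has_real_derivative - 1) (at t)" by (auto intro!: derivative_eq_intros)
    have "((\<lambda>t. h (p, normal_scale A C p (- t) (s p))) has_real_derivative
        V [h] (p, normal_scale A C p (- t) (s p)) * - 1) (at t)"
      by (rule DERIV_chain2[where f = "\<lambda>t. h (p, normal_scale A C p t (s p))" and g = "\<lambda>t. - t", OF line_derivative[OF that p] m])
    then show ?thesis unfolding P_def by (simp only: mult_minus_right mult_1_right)
  qed
  \<comment> \<open>The value of \<open>T \<pi> n\<close> on \<open>F + t F'\<close> and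
    \<open>G + t G'\<close>, expanded by bilinearity.\<close>
  define R where "R = (\<lambda>n t. ?a n (P t) + t * (?b n (P t) + ?b' n (P t)) + t\<^sup>2 * ?c n (P t))"
  have R': "(R n has_real_derivative R (Suc n) t) (at t)" for n t unfolding R_def rec
    by (rule derivative_eq_intros D[OF TS] refl)+ (simp add: algebra_simps power2_eq_square)
  interpret pf: polynomial_functions SN "FPF" by (rule polynomial_functions_fp)
  have poly: "\<exists>q. \<forall>t. h (P t) = poly q t" if "h \<in> FPF" for h
  proof -
    have "(\<lambda>\<eta>. h (p, \<eta>)) \<in> FP p" using that p by (simp add: fp_functions_def)
    from fibre_polynomial_line[OF p s_in[OF p] this] obtain q where "\<forall>t. h (p, normal_scale A C p t (s p)) = poly q t" by (elim exE)
    then show ?thesis by (intro exI[of _ "pcompose q [:0, - 1:]"]) (simp add: P_def poly_pcompose)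
  qed
  have \<pi>2: "\<pi> \<in> pf.chi 2" using \<pi> unfolding chi_fp_eq_chi[OF polynomial_functions_fp] .
  note fp = fibrewise_linear_fp[OF F] fibrewise_linear_fp[OF G] V_fp[OF F, folded F'_def] V_fp[OF G, folded G'_def]
  obtain qa where qa: "\<forall>t. ?a 0 (P t) = poly qa t" using poly[OF pf.chi_2_F0[OF \<pi>2 fp(1,2)]] by (auto simp: T_def)
  obtain qb where qb: "\<forall>t. ?b 0 (P t) = poly qb t" using poly[OF pf.chi_2_F0[OF \<pi>2 fp(3,2)]] by (auto simp: T_def)
  obtain qb' where qb': "\<forall>t. ?b' 0 (P t) = poly qb' t" using poly[OF pf.chi_2_F0[OF \<pi>2 fp(1,4)]] by (auto simp: T_def)
  obtain qc where qc: "\<forall>t. ?c 0 (P t) = poly qc t" using poly[OF pf.chi_2_F0[OF \<pi>2 fp(3,4)]] by (auto simp: T_def)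
  define r where "r = qa + [:0, 1:] * (qb + qb') + [:0, 0, 1:] * qc"
  have R: "R n t = poly ((pderiv ^^ n) r) t" for n t
  proof (induction n arbitrary: t)
    case 0
    show ?case by (simp add: R_def r_def qa qb qb' qc power2_eq_square algebra_simps)
  next
    case (Suc n)
    have "R n = poly ((pderiv ^^ n) r)" by (rule ext) (rule Suc.IH)
    then show ?case using DERIV_unique[OF R'[of n t]] poly_DERIV[of "(pderiv ^^ n) r" t] by simp
  qed
  have "R n 0 = Proj A C (T \<pi> n) p [\<lambda>\<eta>. F (p, \<eta>), \<lambda>\<eta>. G (p, \<eta>)]" for n
  proof -
    have "set [F, G] \<subseteq> Z0" using Z0_fibrewise_linear F G by simp
    from Proj_eq[OF TM[of n] p this] show ?thesis
      unfolding list.map vd_fibrewise_linear[OF F p zs_in[OF p]] vd_fibrewise_linear[OF G p zs_in[OF p]]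
      by (simp add: R_def P_def line_zero[OF p])
  qed
  moreover have "R 0 1 = \<pi> [F + F', G + G'] (P 1)"
  proof -
    have "\<pi> [F + F', G + G'] = \<pi> [F, G] + \<pi> [F', G] + (\<pi> [F, G'] + \<pi> [F', G'])"
      using N.fa.MD_linear[OF \<pi>M FS F'S, of "[]" 1 "[G + G']"] N.fa.MD_linear[OF \<pi>M GS G'S, of "[F]" 1 "[]"]
        N.fa.MD_linear[OF \<pi>M GS G'S, of "[F']" 1 "[]"] by (simp only: append_Nil append_Cons scaleR_one add_ac)
    then show ?thesis by (simp add: R_def T_def)
  qed
  moreover have "R 0 1 = poly r 1" using R[of 0 1] by simp
  ultimately show ?thesis
    using sums_poly_taylor[of r] unfolding R[symmetric] F'_def[symmetric] G'_def[symmetric] by (simp add: P_def)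
qed

end

section \<open>The graph\<close>

text \<open>Compatibility is checked with the original chart only; \<open>compatible_via\<close>
  transports it to the charts of the atlas.\<close>

lemma (in pre_manifold) mchart_compose:
  assumes U: "mchart U \<phi>" and \<psi>: "smooth_on (\<phi> ` U) \<psi>" and o: "open (\<psi> ` \<phi> ` U)"
    and \<rho>: "smooth_on (\<psi> ` \<phi> ` U) \<rho>" and inv: "\<And>z. z \<in> \<phi> ` U \<Longrightarrow> \<rho> (\<psi> z) = z"
  shows "mchart U (\<psi> \<circ> \<phi>)"
proof -
  note inj = mchart_inj[OF U]
  have inj': "inj_on (\<psi> \<circ> \<phi>) U" by (rule comp_inj_on[OF inj inj_on_inverseI[of _ \<rho>]]) (rule inv)
  have im: "(\<psi> \<circ> \<phi>) ` U = \<psi> ` \<phi> ` U" by (simp add: image_comp)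
  have "smooth_on (\<phi> ` U) ((\<psi> \<circ> \<phi>) \<circ> iv U \<phi>)"
    by (rule smooth_on_cong_imp[OF mchart_open[OF U] \<psi>]) (simp add: iv_simps[OF inj])
  moreover have "smooth_on (\<psi> ` \<phi> ` U) (\<phi> \<circ> iv U (\<psi> \<circ> \<phi>))"
  proof (rule smooth_on_cong_imp[OF o \<rho>])
    fix z assume "z \<in> \<psi> ` \<phi> ` U"
    then obtain q where q: "q \<in> U" "z = (\<psi> \<circ> \<phi>) q" by auto
    then show "\<rho> z = (\<phi> \<circ> iv U (\<psi> \<circ> \<phi>)) z" using iv_simps(1)[OF inj' q(1)] inv[of "\<phi> q"] by simp
  qed
  ultimately have c: "compatible (U, \<psi> \<circ> \<phi>) (U, \<phi>)"
    using o mchart_open[OF U] im by (simp add: compatible_def)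
  have "compatible (U, \<psi> \<circ> \<phi>) b" if b: "b \<in> A" for b
  proof -
    obtain V \<theta> where V: "b = (V, \<theta>)" by (cases b)
    show ?thesis unfolding V
    proof (rule compatible_via[OF inj'])
      show "inj_on \<theta> V" using charts b V by blast
      fix p assume "p \<in> U \<inter> V"
      then show "\<exists>W \<kappa>. p \<in> W \<and> inj_on \<kappa> W \<and> compatible (U, \<psi> \<circ> \<phi>) (W, \<kappa>) \<and> compatible (V, \<theta>) (W, \<kappa> :: 'a \<Rightarrow> 'e)"
        using c compatible_sym[OF mchart_compat[OF U b]] inj unfolding V by blast
    qed
  qed
  with inj' o im mchart_carrier[OF U] show ?thesis by (simp add: maximal_atlas_def)
qed

context section_of_normal_bundle
begin

abbreviation "\<Gamma> \<equiv> graph_neg A C s"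

text \<open>Fibrewise translation by the section, which moves the graph of its negative to the zero
  section and so turns bundle charts into slice charts of the graph.\<close>

definition shear :: "'a set \<Rightarrow> ('a \<Rightarrow> 'c \<times> 'f) \<Rightarrow> 'c \<times> 'f \<Rightarrow> 'c \<times> 'f"
  where "shear U \<phi> z = (fst z, snd z + sy U \<phi> (fst z))"

lemma shear_mchart:
  assumes U: "slice U \<phi>"
  shows "N.mchart (NU U) (shear U \<phi> \<circ> NC \<phi>)"
proof -
  let ?D = "cyl U \<phi>" and ?T = "dom0 U \<phi>"
  let ?\<rho> = "\<lambda>z. (fst z, snd z - sy U \<phi> (fst z))"
  have oT: "open ?T" by (rule open_dom0[OF U])
  have oD: "open ?D" by (rule open_cyl[OF U])
  have im: "NC \<phi> ` NU U = ?D" by (rule NC_image[OF U order_refl])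
  have sh: "shear U \<phi> ` ?D = ?D"
  proof (intro set_eqI iffI)
    fix z assume z: "z \<in> ?D"
    have "z = shear U \<phi> (?\<rho> z)" by (simp add: shear_def)
    moreover have "?\<rho> z \<in> ?D" using z by auto
    ultimately show "z \<in> shear U \<phi> ` ?D" by (rule image_eqI)
  qed (auto simp: shear_def)
  have sD: "smooth_on ?D (\<lambda>z. sy U \<phi> (fst z))"
    by (rule smooth_on_compose[OF oD oT _ smooth_on_fst smooth_sy[OF U]]) auto
  show ?thesis
  proof (rule N.mchart_compose[OF N_mchart[OF U], where \<rho> = ?\<rho>]; (unfold im sh)?)
    show "smooth_on ?D (shear U \<phi>)" unfolding shear_def[abs_def]
      by (intro smooth_on_Pair smooth_on_add smooth_on_fst smooth_on_snd sD oD)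
    show "smooth_on ?D ?\<rho>" by (intro smooth_on_Pair smooth_on_diff smooth_on_fst smooth_on_snd sD oD)
    show "?\<rho> (shear U \<phi> z) = z" for z by (simp add: shear_def)
  qed (rule oD)
qed

lemma shear_nv:
  assumes "slice U \<phi>" "q \<in> U" "q \<in> C"
  shows "(shear U \<phi> \<circ> NC \<phi>) (q, nv U \<phi> q y) = (fst (\<phi> q), y + sy U \<phi> (fst (\<phi> q)))"
  by (simp add: shear_def normal_chart_nv[OF assms])

lemma graph_slice:
  assumes U: "slice U \<phi>"
  shows "(NU U, shear U \<phi> \<circ> NC \<phi>) \<in> slice_charts N \<Gamma>"
proof -
  have "Q \<in> \<Gamma> \<longleftrightarrow> snd ((shear U \<phi> \<circ> NC \<phi>) Q) = 0" if Q: "Q \<in> NU U" for Q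
  proof -
    from NU_memE[OF U Q] obtain q y where q: "Q = (q, nv U \<phi> q y)" "q \<in> U" "q \<in> C" "NC \<phi> Q = (fst (\<phi> q), y)" .
    note Uq = U q(2,3)
    have "Q \<in> \<Gamma> \<longleftrightarrow> nv U \<phi> q y = normal_scale A C q (- 1) (s q)"
      using q by (auto simp: graph_neg_def)
    also have "\<dots> \<longleftrightarrow> y = - sy U \<phi> (fst (\<phi> q))"
      unfolding s_nv[OF Uq] normal_scale_nv[OF Uq] nv_inject[OF Uq] by simp
    finally show ?thesis unfolding q(1) shear_nv[OF Uq] by (simp add: eq_neg_iff_add_eq_0)
  qed
  with shear_mchart[OF U] show ?thesis by (auto simp: slice_charts_def)
qed

lemma graph_submanifold: "submanifold N \<Gamma>"
proof (unfold_locales)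
  show "embedded_submanifold N \<Gamma>" unfolding embedded_submanifold_def
  proof
    fix Q assume "Q \<in> \<Gamma>"
    then obtain p where p: "p \<in> C" "Q = (p, normal_scale A C p (- 1) (s p))" by (auto simp: graph_neg_def)
    obtain U \<phi> where U: "slice U \<phi>" "p \<in> U" using slice_exists p(1) by blast
    have "Q \<in> NU U" using p U line_in[OF p(1)] by simp
    then show "Q \<in> carrier_of (slice_charts N \<Gamma>)" by (rule in_carrierI[OF graph_slice[OF U(1)]])
  qed
qed

text \<open>For a dual frame \<open>B\<close>, the functions \<open>B w + V [B w]\<close> are the
  normal coordinates of the sheared chart near \<open>P\<close>, so \<open>coisotropic_at\<close>
  applies to them. General \<open>F\<close> and \<open>G\<close> are then compared with members of
  the frame.\<close>

lemma coisotropic_at_graph_point: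
  assumes \<pi>: "\<pi> \<in> chi_fp 2 A C" and p: "p \<in> C" and P: "P = (p, normal_scale A C p (- 1) (s p))"
  shows "sharp N \<pi> P ` annihilator N \<Gamma> P \<subseteq> tangent_sub N \<Gamma> P \<longleftrightarrow>
    (\<forall>F\<in>FL. \<forall>G\<in>FL. \<pi> [F + V [F], G + V [G]] P = 0)"
proof -
  obtain U \<phi> where U: "slice U \<phi>" "p \<in> U" using slice_exists p by blast
  note U = U p
  from dual_frame[OF U] obtain B W where W: "mopen A W" "p \<in> W" "W \<subseteq> U" and B: "\<forall>w. B w \<in> FL"
    and BW: "\<forall>w q y. q \<in> W \<inter> C \<longrightarrow> B w (q, nv U \<phi> q y) = y \<bullet> w"
    by (elim exE conjE) (erule meta_allE, erule meta_allE, erule meta_impE, assumption)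
  have B': "B w \<in> FL" for w using B ..
  have PU: "P \<in> NU U" "P \<in> NU W" using P U W line_in[OF p] by auto
  have P\<Gamma>: "P \<in> \<Gamma>" using P p by (auto simp: graph_neg_def)
  have iff: "sharp N \<pi> P ` annihilator N \<Gamma> P \<subseteq> tangent_sub N \<Gamma> P \<longleftrightarrow>
      (\<forall>w w'. \<pi> [B w + V [B w], B w' + V [B w']] P = 0)"
  proof (rule submanifold.coisotropic_at[OF graph_submanifold N.bump_manifold_axioms graph_slice[OF U(1)] PU(1) P\<Gamma> chi_fp_MD[OF \<pi>]])
    show "B w + V [B w] \<in> SN" for w by (rule N.fa.add_S[OF fibrewise_linearD(1)[OF B'] V_SN])
    show "\<exists>W. mopen N W \<and> P \<in> W \<and> (\<forall>Q\<in>W. (B w + V [B w]) Q = snd ((shear U \<phi> \<circ> NC \<phi>) Q) \<bullet> w)" for w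
    proof (intro exI[of _ "NU W"] conjI ballI mopen_N W(1) PU(2))
      fix Q assume Q: "Q \<in> NU W"
      then have QU: "Q \<in> NU U" using W by auto
      from NU_memE[OF U(1) QU] obtain q y where q: "Q = (q, nv U \<phi> q y)" "q \<in> U" "q \<in> C" "NC \<phi> Q = (fst (\<phi> q), y)" .
      note Uq = U(1) q(2,3)
      have qW: "q \<in> W \<inter> C" using Q q by auto
      have "V [B w] Q = B w (q, s q)" unfolding q(1) by (rule V_fibrewise_linear[OF B' q(3) nv_in[OF Uq]])
      also have "\<dots> = sy U \<phi> (fst (\<phi> q)) \<bullet> w" unfolding s_nv[OF Uq] using BW qW by blast
      finally have "V [B w] Q = sy U \<phi> (fst (\<phi> q)) \<bullet> w" .
      moreover have "B w Q = y \<bullet> w" unfolding q(1) using BW qW by blast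
      ultimately show "(B w + V [B w]) Q = snd ((shear U \<phi> \<circ> NC \<phi>) Q) \<bullet> w"
        unfolding plus_fun_apply q(1) shear_nv[OF Uq] by (simp only: snd_conv inner_add_left)
    qed
  qed
  have "\<exists>w. (\<lambda>\<eta>. F (p, \<eta>)) = (\<lambda>\<eta>. B w (p, \<eta>))" if F: "F \<in> FL" for F
  proof -
    note l = fibrewise_linearD(2)[OF F p]
    let ?w = "\<Sum>e\<in>onb. F (p, nv U \<phi> p e) *\<^sub>R e"
    have "F (p, nv U \<phi> p y) = B ?w (p, nv U \<phi> p y)" for y using ND_coord[OF U l, of y] BW W(2) p by simp
    then have "(\<lambda>\<eta>. F (p, \<eta>)) = (\<lambda>\<eta>. B ?w (p, \<eta>))"
      by (rule ND_eqI[OF U l fibrewise_linearD(2)[OF B' p]])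
    then show ?thesis by (rule exI)
  qed
  note frame = this
  have "\<pi> [F + V [F], G + V [G]] P = 0"
    if F: "F \<in> FL" and G: "G \<in> FL"
      and 0: "\<forall>w w'. \<pi> [B w + V [B w], B w' + V [B w']] P = 0" for F G
  proof -
    obtain w where w: "(\<lambda>\<eta>. F (p, \<eta>)) = (\<lambda>\<eta>. B w (p, \<eta>))" using frame[OF F] by (elim exE)
    obtain w' where w': "(\<lambda>\<eta>. G (p, \<eta>)) = (\<lambda>\<eta>. B w' (p, \<eta>))" using frame[OF G] by (elim exE)
    \<comment> \<open>Both values are sums of the same Taylor series, which sees \<open>F\<close>
      and \<open>G\<close> only through their restrictions to the fibre over
      \<open>p\<close>.\<close>
    have "\<pi> [F + V [F], G + V [G]] P = \<pi> [B w + V [B w], B w' + V [B w']] P"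
      using taylor_series[OF \<pi> F G p, folded P, unfolded w w'] taylor_series[OF \<pi> B' B' p, folded P, of w w']
      by (rule sums_unique2)
    with 0 show ?thesis by simp
  qed
  then show ?thesis unfolding iff using B' by blast
qed

lemma maurer_cartan_iff_poisson_coisotropic:
  assumes m: "defo_algebra A C m" and \<pi>: "\<pi> \<in> chi_fp 2 A C"
  shows "poisson N \<pi> \<and> coisotropic_submanifold N \<pi> \<Gamma> \<longleftrightarrow> maurer_cartan (defo_space A C) m (\<pi>, w1)"
proof -
  let ?P = "\<lambda>p. (p, normal_scale A C p (- 1) (s p))"
  let ?lin = "\<lambda>p. \<forall>F\<in>FL. \<forall>G\<in>FL. \<pi> [F + V [F], G + V [G]] (?P p) = 0"
  note \<pi>M = chi_fp_MD[OF \<pi>]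
  have "poisson N \<pi> \<longleftrightarrow> schouten \<pi> \<pi> = 0" using \<pi>M by (simp add: poisson_def multivector_fields_eq)
  moreover have "coisotropic_submanifold N \<pi> \<Gamma> \<longleftrightarrow> (\<forall>p\<in>C. ?lin p)"
    unfolding coisotropic_submanifold_def
    using submanifold.embedded[OF graph_submanifold] coisotropic_at_graph_point[OF \<pi> _ refl]
    by (simp add: graph_neg_def)
  moreover have "(\<forall>p ls. (\<lambda>n. Proj A C (T \<pi> n) p ls / fact n) sums 0) \<longleftrightarrow> (\<forall>p\<in>C. ?lin p)"
  proof (intro iffI ballI allI)
    fix p F G assume z: "\<forall>p ls. (\<lambda>n. Proj A C (T \<pi> n) p ls / fact n) sums 0" and p: "p \<in> C"
      and F: "F \<in> FL" and G: "G \<in> FL"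
    show "\<pi> [F + V [F], G + V [G]] (?P p) = 0"
      by (rule sums_unique2[OF taylor_series[OF \<pi> F G p] z[THEN spec, THEN spec]])
  next
    fix p ls assume z: "\<forall>p\<in>C. ?lin p"
    show "(\<lambda>n. Proj A C (T \<pi> n) p ls / fact n) sums 0"
    \<comment> \<open>Every pair of covectors is realized by fibrewise linear functions, while any
      other argument list gives zero because the projections are sections of degree 2.\<close>
    proof (cases "p \<in> C \<and> length ls = 2 \<and> set ls \<subseteq> ND p")
      case True
      then obtain l l' where ls: "ls = [l, l']" by (auto simp: numeral_2_eq_2 length_Suc_conv)
      have p: "p \<in> C" and l: "l \<in> ND p" "l' \<in> ND p" using True ls by auto
      obtain F where F: "F \<in> FL" "(\<lambda>\<eta>. F (p, \<eta>)) = l" using fibrewise_linear_extension[OF p l(1)] by (elim bexE)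
      obtain G where G: "G \<in> FL" "(\<lambda>\<eta>. G (p, \<eta>)) = l'" using fibrewise_linear_extension[OF p l(2)] by (elim bexE)
      have "\<pi> [F + V [F], G + V [G]] (?P p) = 0" using z p F(1) G(1) by blast
      with taylor_series[OF \<pi> F(1) G(1) p] show ?thesis unfolding ls F(2) G(2) by simp
    next
      case False
      then have "Proj A C (T \<pi> n) p ls = 0" for n by (rule WS_outside[OF Proj_WS[OF T_MD[OF \<pi>M]]])
      then show ?thesis by (simp add: sums_zero)
    qed
  qed
  ultimately show ?thesis unfolding maurer_cartan_iff[OF m \<pi> w1_WS] T_def by blast
qed

end

theorem corollary2p3:
  fixes A :: "('m, 'c::finite_dim_inner \<times> 'f::finite_dim_inner) atlas"
    and C :: "'m set"
    and \<psi> :: "'m normal \<Rightarrow> 'm"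
  assumes "smooth_manifold A"
    and "embedded_submanifold A C"
    and "tubular_embedding A C \<psi>"
  shows "(\<exists>m. defo_algebra A C m) \<and>
    (\<forall>m. defo_algebra A C m \<longrightarrow>
      (\<forall>\<pi> s. \<pi> \<in> chi_fp 2 A C \<and> normal_section A C s \<longrightarrow>
        (poisson (normal_atlas A C) \<pi> \<and>
         coisotropic_submanifold (normal_atlas A C) \<pi> (graph_neg A C s)
         \<longleftrightarrow> maurer_cartan (defo_space A C) m (\<pi>, wedge1 A C s))))"
proof -
  interpret smooth_submanifold A C by (rule smooth_submanifold.intro[OF assms(1,2)])
  show ?thesis
  proof (intro conjI allI impI defo_algebra_exists; elim conjE)
    fix m \<pi> s
    assume m: "defo_algebra A C m" and \<pi>: "\<pi> \<in> chi_fp 2 A C" and s: "normal_section A C s"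
    interpret section_of_normal_bundle A C s
      by (rule section_of_normal_bundle.intro[OF smooth_submanifold_axioms section_of_normal_bundle_axioms.intro[OF s]])
    show "poisson N \<pi> \<and> coisotropic_submanifold N \<pi> (graph_neg A C s) \<longleftrightarrow>
        maurer_cartan (defo_space A C) m (\<pi>, wedge1 A C s)"
      by (rule maurer_cartan_iff_poisson_coisotropic[OF m \<pi>])
  qed
qed

end
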